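(* Let $\Omega_T=(0,T)\times\mathbb R^n$, let $A^1,\dots,A^n,B\in M_m(\mathcal G_{L^\infty}(\Omega_T))$ with all $A^j$ Hermitian. Assume (i'') $G\in\mathcal G_{L^2}(\mathbb R^n)^m$ and $F\in\mathcal G_{L^2}(\Omega_T)^m$; (ii'') all $\partial_{x_i}A^j$ ($1\le i,j\le n$) as well as the Hermitian part $\frac12(B+B^* )$ of $B$ are of $L^{1,\infty}$-log-type. Then there exists a unique solution $U\in\mathcal G_{L^2}(\Omega_T)^m$ to the initial value problem $$\partial_tU+\sum_{j=1}^nA^j\partial_{x_j}U+BU=F\ \text{ on }\Omega_T,\qquad U(0,x)=G(x).$$
   Context: Colombeau generalized functions: for a locally convex space $E$ with seminorms $(p_j)_{j\in J}$, $\mathcal M_E$ is the set of nets $(u_\varepsilon)_{\varepsilon\in(0,1]}$ in $E$ with $\forall j\,\exists N:\ p_j(u_\varepsilon)=O(\varepsilon^{-N})$ as $\varepsilon\to0$, $\mathcal N_E$ those with $\forall j\,\forall q:\ p_j(u_\varepsilon)=O(\varepsilon^q)$, and $\mathcal G_E=\mathcal M_E/\mathcal N_E$; componentwise for vectors/matrices. $\mathcal G_{L^2}(\Omega)$ uses $E=H^\infty(\Omega)=\{h\in C^\infty(\overline\Omega):\partial^\alpha h\in L^2(\Omega)\ \forall\alpha\}$ with the $H^k(\Omega)$-norms as seminorms; $\mathcal G_{L^\infty}(\Omega)$ uses $E=\{h\in C^\infty(\overline\Omega):\partial^\alpha h\in L^\infty(\Omega)\ \forall\alpha\}$ with seminorms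 $\max_{|\alpha|\le k}\|\partial^\alpha h\|_{L^\infty(\Omega)}$. A matrix of generalized functions is Hermitian if it has a representative that is Hermitian for all small $\varepsilon$; $B^*$ is the conjugate transpose. For a bounded matrix function $A$ on $\Omega_T$ put $\|A\|_{L^{1,\infty}(\Omega_T)}=\int_0^T\|A(s,\cdot)\|_{L^\infty(\mathbb R^n)}ds$ (pointwise operator norm). $A\in M_m(\mathcal G_{L^\infty}(\Omega_T))$ is of $L^{1,\infty}$-log-type if it has a representative with $\|A_\varepsilon\|_{L^{1,\infty}(\Omega_T)}=O(\log(1/\varepsilon))$ as $\varepsilon\to0$. *)

theory Defs
  imports "HOL-Analysis.Analysis" "HOL-Library.Landau_Symbols"
begin

definition pd :: "'a::euclidean_space set \<Rightarrow> 'a \<Rightarrow> ('a \<Rightarrow> 'b::real_normed_vector) \<Rightarrow> 'a \<Rightarrow> 'b" where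
  "pd S v f = (\<lambda>x. frechet_derivative f (at x within S) v)"

text \<open>Iterated partial derivative along a list of directions (a multi-index, up to order).\<close>
fun ipd :: "'a::euclidean_space set \<Rightarrow> 'a list \<Rightarrow> ('a \<Rightarrow> 'b::real_normed_vector) \<Rightarrow> 'a \<Rightarrow> 'b" where
  "ipd S [] f = f"
| "ipd S (v # vs) f = pd S v (ipd S vs f)"

definition smooth_upto :: "'a::euclidean_space set \<Rightarrow> ('a \<Rightarrow> complex) \<Rightarrow> bool" where
  "smooth_upto S f \<longleftrightarrow>
     (\<forall>vs\<in>lists Basis. \<forall>x\<in>closure S. ipd (closure S) vs f differentiable (at x within closure S))"

definition L2norm :: "'a::euclidean_space set \<Rightarrow> ('a \<Rightarrow> complex) \<Rightarrow> real" where
  "L2norm S g = sqrt (integral\<^sup>L (lebesgue_on S) (\<lambda>x. (norm (g x))\<^sup>2))"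

definition supnorm :: "'a::euclidean_space set \<Rightarrow> ('a \<Rightarrow> complex) \<Rightarrow> real" where
  "supnorm S g = (SUP x\<in>S. norm (g x))"

definition Hinf :: "'a::euclidean_space set \<Rightarrow> ('a \<Rightarrow> complex) \<Rightarrow> bool" where
  "Hinf S f \<longleftrightarrow> smooth_upto S f \<and>
     (\<forall>vs\<in>lists Basis. ipd (closure S) vs f \<in> borel_measurable (lebesgue_on S) \<and>
        integrable (lebesgue_on S) (\<lambda>x. (norm (ipd (closure S) vs f x))\<^sup>2))"

definition Winf :: "'a::euclidean_space set \<Rightarrow> ('a \<Rightarrow> complex) \<Rightarrow> bool" where
  "Winf S f \<longleftrightarrow> smooth_upto S f \<and> (\<forall>vs\<in>lists Basis. bounded (ipd (closure S) vs f ` S))"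

definition mod_L2 :: "'a::euclidean_space set \<Rightarrow> (real \<Rightarrow> 'a \<Rightarrow> complex) \<Rightarrow> bool" where
  "mod_L2 S u \<longleftrightarrow> (\<forall>\<epsilon>\<in>{0<..1}. Hinf S (u \<epsilon>)) \<and>
     (\<forall>vs\<in>lists Basis. \<exists>N::nat.
        (\<lambda>\<epsilon>. L2norm S (ipd (closure S) vs (u \<epsilon>))) \<in> O[at_right 0](\<lambda>\<epsilon>. \<epsilon> powr (- real N)))"

definition neg_L2 :: "'a::euclidean_space set \<Rightarrow> (real \<Rightarrow> 'a \<Rightarrow> complex) \<Rightarrow> bool" where
  "neg_L2 S u \<longleftrightarrow> (\<forall>\<epsilon>\<in>{0<..1}. Hinf S (u \<epsilon>)) \<and>
     (\<forall>vs\<in>lists Basis. \<forall>q::nat.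
        (\<lambda>\<epsilon>. L2norm S (ipd (closure S) vs (u \<epsilon>))) \<in> O[at_right 0](\<lambda>\<epsilon>. \<epsilon> ^ q))"

definition mod_Linf :: "'a::euclidean_space set \<Rightarrow> (real \<Rightarrow> 'a \<Rightarrow> complex) \<Rightarrow> bool" where
  "mod_Linf S u \<longleftrightarrow> (\<forall>\<epsilon>\<in>{0<..1}. Winf S (u \<epsilon>)) \<and>
     (\<forall>vs\<in>lists Basis. \<exists>N::nat.
        (\<lambda>\<epsilon>. supnorm S (ipd (closure S) vs (u \<epsilon>))) \<in> O[at_right 0](\<lambda>\<epsilon>. \<epsilon> powr (- real N)))"

definition neg_Linf :: "'a::euclidean_space set \<Rightarrow> (real \<Rightarrow> 'a \<Rightarrow> complex) \<Rightarrow> bool" where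
  "neg_Linf S u \<longleftrightarrow> (\<forall>\<epsilon>\<in>{0<..1}. Winf S (u \<epsilon>)) \<and>
     (\<forall>vs\<in>lists Basis. \<forall>q::nat.
        (\<lambda>\<epsilon>. supnorm S (ipd (closure S) vs (u \<epsilon>))) \<in> O[at_right 0](\<lambda>\<epsilon>. \<epsilon> ^ q))"

text \<open>A matrix net: \<open>M \<epsilon> k l\<close> is the (k,l) entry of the representative at \<open>\<epsilon>\<close>.\<close>

definition mat_mod_Linf :: "'a::euclidean_space set \<Rightarrow> (real \<Rightarrow> 'm \<Rightarrow> 'm \<Rightarrow> 'a \<Rightarrow> complex) \<Rightarrow> bool" where
  "mat_mod_Linf S M \<longleftrightarrow> (\<forall>k l. mod_Linf S (\<lambda>\<epsilon>. M \<epsilon> k l))"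

definition mat_same_class :: "'a::euclidean_space set \<Rightarrow> (real \<Rightarrow> 'm \<Rightarrow> 'm \<Rightarrow> 'a \<Rightarrow> complex)
     \<Rightarrow> (real \<Rightarrow> 'm \<Rightarrow> 'm \<Rightarrow> 'a \<Rightarrow> complex) \<Rightarrow> bool" where
  "mat_same_class S M M' \<longleftrightarrow> mat_mod_Linf S M \<and> mat_mod_Linf S M' \<and>
     (\<forall>k l. neg_Linf S (\<lambda>\<epsilon> x. M' \<epsilon> k l x - M \<epsilon> k l x))"

definition gen_hermitian :: "'a::euclidean_space set \<Rightarrow> (real \<Rightarrow> 'm \<Rightarrow> 'm \<Rightarrow> 'a \<Rightarrow> complex) \<Rightarrow> bool" where
  "gen_hermitian S M \<longleftrightarrow> (\<exists>M'. mat_same_class S M M' \<and>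
     (\<forall>\<^sub>F \<epsilon> in at_right 0. \<forall>x\<in>S. \<forall>k l. M' \<epsilon> k l x = cnj (M' \<epsilon> l k x)))"

definition mat_opnorm :: "('m::finite \<Rightarrow> 'm \<Rightarrow> complex) \<Rightarrow> real" where
  "mat_opnorm M = onorm (\<lambda>v::complex^'m. \<chi> k. \<Sum>l\<in>UNIV. M k l * v $ l)"

definition Omega :: "real \<Rightarrow> (real \<times> (real^'n)) set" where
  "Omega T = {0<..<T} \<times> UNIV"

definition L1inf_norm :: "real \<Rightarrow> ('m::finite \<Rightarrow> 'm \<Rightarrow> real \<times> (real^'n) \<Rightarrow> complex) \<Rightarrow> real" where
  "L1inf_norm T M = integral\<^sup>L (lebesgue_on {0<..<T})
      (\<lambda>s. SUP x\<in>(UNIV::(real^'n) set). mat_opnorm (\<lambda>k l. M k l (s, x)))"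

definition log_type :: "real \<Rightarrow> (real \<Rightarrow> 'm::finite \<Rightarrow> 'm \<Rightarrow> real \<times> (real^'n) \<Rightarrow> complex) \<Rightarrow> bool" where
  "log_type T M \<longleftrightarrow> (\<exists>M'. mat_same_class (Omega T) M M' \<and>
      (\<lambda>\<epsilon>. L1inf_norm T (M' \<epsilon>)) \<in> O[at_right 0](\<lambda>\<epsilon>. ln (1 / \<epsilon>)))"

definition dt :: "real \<times> (real^'n)" where "dt = (1, 0)"
definition dx :: "'n \<Rightarrow> real \<times> (real^'n)" where "dx j = (0, axis j 1)"

definition solves_ivp ::
  "real \<Rightarrow> ('n::finite \<Rightarrow> real \<Rightarrow> 'm::finite \<Rightarrow> 'm \<Rightarrow> real \<times> (real^'n) \<Rightarrow> complex)
   \<Rightarrow> (real \<Rightarrow> 'm \<Rightarrow> 'm \<Rightarrow> real \<times> (real^'n) \<Rightarrow> complex)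
   \<Rightarrow> (real \<Rightarrow> 'm \<Rightarrow> real \<times> (real^'n) \<Rightarrow> complex)
   \<Rightarrow> (real \<Rightarrow> 'm \<Rightarrow> real^'n \<Rightarrow> complex)
   \<Rightarrow> (real \<Rightarrow> 'm \<Rightarrow> real \<times> (real^'n) \<Rightarrow> complex) \<Rightarrow> bool" where
  "solves_ivp T A B F G U \<longleftrightarrow>
     (\<forall>k. neg_L2 (Omega T) (\<lambda>\<epsilon> x.
         pd (closure (Omega T)) dt (U \<epsilon> k) x
       + (\<Sum>j\<in>UNIV. \<Sum>l\<in>UNIV. A j \<epsilon> k l x * pd (closure (Omega T)) (dx j) (U \<epsilon> l) x)
       + (\<Sum>l\<in>UNIV. B \<epsilon> k l x * U \<epsilon> l x)
       - F \<epsilon> k x)) \<and>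
     (\<forall>k. neg_L2 (UNIV :: (real^'n) set) (\<lambda>\<epsilon> y. U \<epsilon> k (0, y) - G \<epsilon> k y))"

end

theory Submission
  imports Defs
begin

text \<open>For each \<open>\<epsilon>\<close> the spatial derivatives are replaced by centred differences with the tiny step
  \<open>exp (-1 / \<epsilon>)\<close>. The resulting equation is an ordinary differential equation with bounded
  operators, and a sufficiently late Picard iterate solves it up to an error \<open>exp (-1 / \<epsilon>)\<close>; no
  limit has to be taken. The centred difference is skew, so for Hermitian coefficients the energy
  estimate involves only \<open>\<partial>\<^sub>i A\<^sup>j\<close> and \<open>B + B\<^sup>*\<close>, uniformly in the step, and the log-type
  hypothesis turns its Gronwall factor into \<open>exp (C log (1 / \<epsilon>))\<close>, which is moderate. Spatial
  derivatives of order \<open>N\<close> satisfy the same kind of equation with right-hand sides that are moderate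
  by induction on \<open>N\<close>; time derivatives are read off the Picard recursion. Finally, a moderate net
  whose slices are negligible in \<open>L\<^sup>2\<close> has negligible derivatives (interpolation with
  difference quotients), so that both the residual of the approximate solution and the difference of
  two solutions need to be estimated only at order zero.\<close>

section \<open>Calculus on the closed slab\<close>

text \<open>The step must be exponentially small because the consistency error, its square times a
  moderate net, has to beat every power of \<epsilon>. The difference operator then has
  exponentially large norm, but this affects only the number of Picard iterations, which may depend
  on \<epsilon> in any way. In the energy estimate, coefficient bounds that are merely moderate must
  stay out of the exponent. At order \<open>N\<close> this succeeds because a commutator term with
  one derivative on \<open>A\<close> has full order \<open>N\<close> but the log-type factor
  \<open>c\<close>, and one with more derivatives on \<open>A\<close> involves only lower orders,
  bounded before. Hermitian symmetry and the log-type bounds may hold for different representatives;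
  exchanging them costs negligible errors, or an additive constant in \<open>c\<close>. Initial data
  are removed by subtracting their extension constant in time. Bounds are uniform over time slices
  rather than over the slab, since initial values and energies live on slices; a trace inequality
  links the two at the price of one time derivative.\<close>

locale slab =
  fixes T :: real
  assumes T_pos: "T > 0"
begin

abbreviation Z :: "(real \<times> (real^'n::finite)) set" where "Z \<equiv> closure (Omega T)"
abbreviation sm :: "(real \<times> (real^'n::finite) \<Rightarrow> complex) \<Rightarrow> bool" where "sm \<equiv> smooth_upto (Omega T)"

lemma Z_eq: "Z = {0..T} \<times> UNIV"
  using T_pos by (simp add: Omega_def closure_Times)

lemma convex_Z: "convex Z"
  by (auto simp: Z_eq intro!: convex_Times)

lemma Z_shift [simp]: "p + (0, y) \<in> Z \<longleftrightarrow> p \<in> Z"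
  by (cases p) (auto simp: Z_eq)

text \<open>Derivatives within \<open>Z\<close> are unique on the two boundary planes as well: from
  every point of \<open>Z\<close> each coordinate direction has arbitrarily small nonzero multiples
  that stay in \<open>Z\<close>, with a backward time step at \<open>t = T\<close>. Here
  \<open>T > 0\<close> enters.\<close>

lemma pd_eq:
  assumes "p \<in> Z" "(f has_derivative f') (at p within Z)"
  shows "pd Z v f p = f' v"
proof -
  obtain t x where p: "p = (t, x)" "t \<in> {0..T}" using assms(1) by (auto simp: Z_eq)
  have *: "\<exists>d. 0 < \<bar>d\<bar> \<and> \<bar>d\<bar> < e \<and> p + d *\<^sub>R i \<in> Z" if "i \<in> Basis" "0 < e" for i e
  proof -
    from that(1) consider "i = (1, 0)" | u where "i = (0, u)" by (auto simp: Basis_prod_def)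
    then show ?thesis
    proof cases
      case 1
      define d where "d = (if t < T then min (e/2) (T - t) else - min (e/2) T)"
      have "0 < \<bar>d\<bar> \<and> \<bar>d\<bar> < e \<and> p + d *\<^sub>R i \<in> Z"
        using p T_pos that(2) unfolding d_def by (auto simp: Z_eq 1 min_def)
      then show ?thesis by blast
    next
      case 2
      then show ?thesis using p that(2) by (intro exI[of _ "e/2"]) (auto simp: Z_eq)
    qed
  qed
  have "(f has_derivative frechet_derivative f (at p within Z)) (at p within Z)"
    using assms(2) frechet_derivative_works differentiable_def by blast
  then have "frechet_derivative f (at p within Z) = f'"
    by (rule frechet_derivative_unique_within[OF _ assms(2)]) (use * in blast)
  then show ?thesis by (simp add: pd_def)
qed

lemma has_derivative_pd:
  assumes "f differentiable (at p within Z)"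
  shows "(f has_derivative (\<lambda>v. pd Z v f p)) (at p within Z)"
  using assms frechet_derivative_works unfolding pd_def by blast

lemma pd_cong:
  assumes "\<And>q. q \<in> Z \<Longrightarrow> f q = g q" "p \<in> Z"
  shows "pd Z v f p = pd Z v g p"
proof -
  have "(f has_derivative f') (at p within Z) \<longleftrightarrow> (g has_derivative f') (at p within Z)" for f'
    using has_derivative_transform[of p Z f g f'] has_derivative_transform[of p Z g f f'] assms by auto
  then show ?thesis by (simp add: pd_def frechet_derivative_def)
qed

lemma differentiable_cong:
  assumes "\<And>q. q \<in> Z \<Longrightarrow> f q = g q" "p \<in> Z" "f differentiable (at p within Z)"
  shows "g differentiable (at p within Z)"
  using assms has_derivative_transform[of p Z g f] by (auto simp: differentiable_def)

lemma ipd_append: "ipd S (us @ vs) f = ipd S us (ipd S vs f)"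
  by (induction us) auto

lemma ipd_cong:
  assumes "\<And>q. q \<in> Z \<Longrightarrow> f q = g q" "p \<in> Z"
  shows "ipd Z vs f p = ipd Z vs g p"
  using assms(2)
proof (induction vs arbitrary: p)
  case (Cons v vs)
  then show ?case by (auto intro!: pd_cong)
qed (use assms in auto)

text \<open>An invariant closed under one differentiation yields all orders, so no formula for
  higher derivatives is needed. The derivative has to agree with a member of \<open>P\<close> only
  on \<open>Z\<close>, because the value of \<open>pd\<close> is arbitrary outside.\<close>

lemma smooth_coinduct:
  fixes f :: "real \<times> (real^'n::finite) \<Rightarrow> complex"
  assumes "P f"
    and diff: "\<And>f p. P f \<Longrightarrow> p \<in> Z \<Longrightarrow> f differentiable (at p within Z)"
    and step: "\<And>f v. P f \<Longrightarrow> v \<in> Basis \<Longrightarrow> \<exists>g. P g \<and> (\<forall>p\<in>Z. pd Z v f p = g p)"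
  shows "sm f"
proof -
  have *: "\<exists>g. P g \<and> (\<forall>p\<in>Z. ipd Z vs f p = g p)" if "vs \<in> lists Basis" for vs
    using that
  proof (induction vs)
    case Nil
    then show ?case using assms(1) by auto
  next
    case (Cons v vs)
    then obtain g where g: "P g" "\<forall>p\<in>Z. ipd Z vs f p = g p" by auto
    from step[OF g(1), of v] Cons obtain h where h: "P h" "\<forall>p\<in>Z. pd Z v g p = h p" by auto
    have "\<forall>p\<in>Z. pd Z v (ipd Z vs f) p = h p"
      using h(2) pd_cong[of "ipd Z vs f" g] g(2) by auto
    with h(1) show ?case by auto
  qed
  show ?thesis unfolding smooth_upto_def
  proof (intro ballI)
    fix vs :: "(real \<times> (real^'n)) list" and p :: "real \<times> (real^'n)"
    assume "vs \<in> lists Basis" "p \<in> Z"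
    with * obtain g where "P g" "\<forall>p\<in>Z. ipd Z vs f p = g p" by blast
    then show "ipd Z vs f differentiable at p within Z"
      using diff \<open>p \<in> Z\<close> differentiable_cong[of g "ipd Z vs f" p] by auto
  qed
qed

lemma sm_differentiable: "sm f \<Longrightarrow> p \<in> Z \<Longrightarrow> f differentiable (at p within Z)"
  unfolding smooth_upto_def by (metis ipd.simps(1) lists.Nil)

lemma sm_continuous: "sm f \<Longrightarrow> continuous_on Z f"
  using sm_differentiable by (metis continuous_on_eq_continuous_within differentiable_imp_continuous_within)

lemma sm_ipd: "sm f \<Longrightarrow> vs \<in> lists Basis \<Longrightarrow> sm (ipd Z vs f)"
  unfolding smooth_upto_def by (metis append_in_lists_conv ipd_append)

lemma sm_pd: "sm f \<Longrightarrow> v \<in> Basis \<Longrightarrow> sm (pd Z v f)"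
  using sm_ipd[of f "[v]"] by auto

lemma sm_cong:
  fixes f :: "real \<times> (real^'n::finite) \<Rightarrow> complex"
  shows "sm f \<Longrightarrow> (\<And>p. p \<in> Z \<Longrightarrow> f p = g p) \<Longrightarrow> sm g"
proof (rule smooth_coinduct[of "\<lambda>g. \<exists>f. sm f \<and> (\<forall>p\<in>Z. f p = g p)"])
  fix g :: "real \<times> (real^'n) \<Rightarrow> complex" and v :: "real \<times> (real^'n)" assume "\<exists>f. sm f \<and> (\<forall>p\<in>Z. f p = g p)" "v \<in> Basis"
  then obtain f where f: "sm f" "\<forall>p\<in>Z. f p = g p" by blast
  have "\<forall>p\<in>Z. pd Z v g p = pd Z v f p" using pd_cong[of g f] f(2) by simp
  with sm_pd[OF f(1) \<open>v \<in> Basis\<close>]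
  show "\<exists>h. (\<exists>f. sm f \<and> (\<forall>p\<in>Z. f p = h p)) \<and> (\<forall>p\<in>Z. pd Z v g p = h p)" by blast
qed (auto intro: differentiable_cong sm_differentiable)

lemma has_derivative_shift:
  assumes "(f has_derivative f') (at (p + (0,y)) within Z)" "p \<in> Z"
  shows "((\<lambda>q. f (q + (0,y))) has_derivative f') (at p within Z)"
proof -
  have "((\<lambda>q. q + (0,y)) has_derivative (\<lambda>v. v)) (at p within Z)"
    by (auto intro!: derivative_eq_intros)
  moreover have "(f has_derivative f') (at (p + (0,y)) within (\<lambda>q. q + (0,y)) ` Z)"
    using assms by (elim has_derivative_subset) (auto simp: Z_eq)
  ultimately show ?thesis
    using diff_chain_within[of "\<lambda>q. q + (0,y)" "\<lambda>v. v" p Z f f'] by (simp add: o_def)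
qed

lemma pd_add: "f differentiable (at p within Z) \<Longrightarrow> g differentiable (at p within Z) \<Longrightarrow> p \<in> Z \<Longrightarrow>
    pd Z v (\<lambda>q. f q + g q) p = pd Z v f p + pd Z v g p"
  by (rule pd_eq[where f'="\<lambda>v. pd Z v f p + pd Z v g p", THEN trans]) (auto intro!: has_derivative_add has_derivative_pd)

lemma pd_mult:
  fixes f g :: "real \<times> (real^'n::finite) \<Rightarrow> complex"
  shows "f differentiable (at p within Z) \<Longrightarrow> g differentiable (at p within Z) \<Longrightarrow> p \<in> Z \<Longrightarrow>
    pd Z v (\<lambda>q. f q * g q) p = pd Z v f p * g p + f p * pd Z v g p"
  by (rule pd_eq[where f'="\<lambda>v. f p * pd Z v g p + pd Z v f p * g p", THEN trans])
     (auto intro!: has_derivative_mult has_derivative_pd)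

lemma pd_shift: "f differentiable (at (p + (0,y)) within Z) \<Longrightarrow> p \<in> Z \<Longrightarrow>
    pd Z v (\<lambda>q. f (q + (0,y))) p = pd Z v f (p + (0,y))"
  by (rule pd_eq) (auto intro!: has_derivative_shift has_derivative_pd)

lemma pd_const: "p \<in> Z \<Longrightarrow> pd Z v (\<lambda>q. c) p = 0"
  by (rule pd_eq) auto

lemma sm_const: "sm (\<lambda>q. c)"
  by (rule smooth_coinduct[of "\<lambda>f. \<exists>c. f = (\<lambda>q. c)"]) (auto simp: pd_const)

text \<open>Closing the smooth functions under sums, products and shifts simultaneously lets the coinduction
  principle establish smoothness of all these operations at once.\<close>

inductive shift_alg :: "(real \<times> (real^'n::finite) \<Rightarrow> complex) \<Rightarrow> bool" where
  base: "sm f \<Longrightarrow> shift_alg f"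
| add: "shift_alg f \<Longrightarrow> shift_alg g \<Longrightarrow> shift_alg (\<lambda>p. f p + g p)"
| mult: "shift_alg f \<Longrightarrow> shift_alg g \<Longrightarrow> shift_alg (\<lambda>p. f p * g p)"
| shift: "shift_alg f \<Longrightarrow> shift_alg (\<lambda>p. f (p + (0,y)))"

lemma shift_alg_diff: "shift_alg f \<Longrightarrow> p \<in> Z \<Longrightarrow> f differentiable (at p within Z)"
proof (induction arbitrary: p rule: shift_alg.induct)
  case (shift f y)
  have "(f has_derivative (\<lambda>v. pd Z v f (p + (0,y)))) (at (p + (0,y)) within Z)"
    by (intro has_derivative_pd shift.IH) (use shift.prems in auto)
  from has_derivative_shift[OF this] show ?case using shift.prems differentiableI by blast
qed (auto intro: sm_differentiable)

lemma shift_alg_pd: "shift_alg f \<Longrightarrow> v \<in> Basis \<Longrightarrow> \<exists>g. shift_alg g \<and> (\<forall>p\<in>Z. pd Z v f p = g p)"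
proof (induction rule: shift_alg.induct)
  case (base f)
  then show ?case using shift_alg.base sm_pd by blast
next
  case (add f g)
  obtain f' where "shift_alg f'" "\<forall>p\<in>Z. pd Z v f p = f' p" using add by blast
  moreover obtain g' where "shift_alg g'" "\<forall>p\<in>Z. pd Z v g p = g' p" using add by blast
  moreover from calculation this have "shift_alg (\<lambda>p. f' p + g' p)" by (intro shift_alg.add)
  moreover have "\<forall>p\<in>Z. pd Z v (\<lambda>p. f p + g p) p = pd Z v f p + pd Z v g p"
    using pd_add shift_alg_diff add by blast
  ultimately show ?case by force
next
  case (mult f g)
  obtain f' where "shift_alg f'" "\<forall>p\<in>Z. pd Z v f p = f' p" using mult by blast
  moreover obtain g' where "shift_alg g'" "\<forall>p\<in>Z. pd Z v g p = g' p" using mult by blast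
  moreover from calculation have "shift_alg (\<lambda>p. f' p * g p + f p * g' p)"
    using mult by (intro shift_alg.add shift_alg.mult)
  moreover have "\<forall>p\<in>Z. pd Z v (\<lambda>p. f p * g p) p = pd Z v f p * g p + f p * pd Z v g p"
    using pd_mult shift_alg_diff mult by blast
  ultimately show ?case by force
next
  case (shift f y)
  then obtain f' where *: "shift_alg f'" "\<forall>p\<in>Z. pd Z v f p = f' p" by blast
  then show ?case using shift_alg.shift[OF *(1), of y] shift by (force simp: pd_shift shift_alg_diff)
qed

lemma shift_alg_sm: "shift_alg f \<Longrightarrow> sm f"
  by (rule smooth_coinduct[of shift_alg]) (auto intro: shift_alg_diff shift_alg_pd)

lemma sm_add: "sm f \<Longrightarrow> sm g \<Longrightarrow> sm (\<lambda>p. f p + g p)"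
  and sm_mult: "sm f \<Longrightarrow> sm g \<Longrightarrow> sm (\<lambda>p. f p * g p)"
  and sm_shift: "sm f \<Longrightarrow> sm (\<lambda>p. f (p + (0,y)))"
  by (rule shift_alg_sm, intro shift_alg.add shift_alg.mult shift_alg.shift shift_alg.base, assumption+)+

lemma sm_cmult: "sm f \<Longrightarrow> sm (\<lambda>p. c * f p)"
  by (intro sm_mult sm_const)

lemma sm_uminus: "sm f \<Longrightarrow> sm (\<lambda>p. - f p)"
  using sm_cmult[of f "-1"] by simp

lemma sm_diff: "sm f \<Longrightarrow> sm g \<Longrightarrow> sm (\<lambda>p. f p - g p)"
  using sm_add[OF _ sm_uminus, of f g] by simp

lemma sm_sum: "(\<And>i. i \<in> S \<Longrightarrow> sm (f i)) \<Longrightarrow> sm (\<lambda>p. \<Sum>i\<in>S. f i p)"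
  by (induction S rule: infinite_finite_induct) (auto intro: sm_const sm_add)

lemma ipd_add: "sm f \<Longrightarrow> sm g \<Longrightarrow> vs \<in> lists Basis \<Longrightarrow> p \<in> Z \<Longrightarrow>
    ipd Z vs (\<lambda>q. f q + g q) p = ipd Z vs f p + ipd Z vs g p"
proof (induction vs arbitrary: p)
  case (Cons v vs)
  then have "pd Z v (ipd Z vs (\<lambda>q. f q + g q)) p = pd Z v (\<lambda>q. ipd Z vs f q + ipd Z vs g q) p"
    by (intro pd_cong) auto
  with Cons show ?case by (simp add: pd_add sm_differentiable sm_ipd)
qed auto

lemma ipd_const: "vs \<in> lists Basis \<Longrightarrow> vs \<noteq> [] \<Longrightarrow> p \<in> Z \<Longrightarrow> ipd Z vs (\<lambda>q. c) p = 0"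
proof (induction vs arbitrary: p)
  case (Cons v vs)
  show ?case
  proof (cases "vs = []")
    case False
    with Cons have "pd Z v (ipd Z vs (\<lambda>q. c)) p = pd Z v (\<lambda>q. 0) p"
      by (intro pd_cong) auto
    then show ?thesis using Cons by (simp add: pd_const)
  qed (use Cons in \<open>auto simp: pd_const\<close>)
qed auto

lemma ipd_zero: "vs \<in> lists Basis \<Longrightarrow> p \<in> Z \<Longrightarrow> ipd Z vs (\<lambda>q. 0) p = 0"
  using ipd_const[of vs p 0] by (cases "vs = []") auto

lemma ipd_cmult: "sm f \<Longrightarrow> vs \<in> lists Basis \<Longrightarrow> p \<in> Z \<Longrightarrow> ipd Z vs (\<lambda>q. c * f q) p = c * ipd Z vs f p"
proof (induction vs arbitrary: p)
  case (Cons v vs)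
  then have "pd Z v (ipd Z vs (\<lambda>q. c * f q)) p = pd Z v (\<lambda>q. c * ipd Z vs f q) p"
    by (intro pd_cong) auto
  with Cons show ?case by (simp add: pd_mult sm_differentiable sm_ipd sm_const pd_const)
qed auto

lemma ipd_uminus: "sm f \<Longrightarrow> vs \<in> lists Basis \<Longrightarrow> p \<in> Z \<Longrightarrow> ipd Z vs (\<lambda>q. - f q) p = - ipd Z vs f p"
  using ipd_cmult[of f vs p "-1"] by simp

lemma ipd_diff: "sm f \<Longrightarrow> sm g \<Longrightarrow> vs \<in> lists Basis \<Longrightarrow> p \<in> Z \<Longrightarrow>
    ipd Z vs (\<lambda>q. f q - g q) p = ipd Z vs f p - ipd Z vs g p"
  using ipd_add[of f "\<lambda>q. - g q" vs p] by (simp add: ipd_uminus sm_uminus)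

lemma ipd_sum: "(\<And>i. i \<in> S \<Longrightarrow> sm (f i)) \<Longrightarrow> vs \<in> lists Basis \<Longrightarrow> p \<in> Z \<Longrightarrow>
    ipd Z vs (\<lambda>q. \<Sum>i\<in>S. f i q) p = (\<Sum>i\<in>S. ipd Z vs (f i) p)"
  by (induction S rule: infinite_finite_induct) (auto simp: ipd_zero ipd_add sm_sum)

lemma ipd_shift: "sm f \<Longrightarrow> vs \<in> lists Basis \<Longrightarrow> p \<in> Z \<Longrightarrow>
    ipd Z vs (\<lambda>q. f (q + (0,y))) p = ipd Z vs f (p + (0,y))"
proof (induction vs arbitrary: p)
  case (Cons v vs)
  then have "pd Z v (ipd Z vs (\<lambda>q. f (q + (0,y)))) p = pd Z v (\<lambda>q. ipd Z vs f (q + (0,y))) p"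
    by (intro pd_cong) auto
  with Cons show ?case by (simp add: pd_shift sm_differentiable sm_ipd)
qed auto

end

text \<open>The ways to distribute the derivatives \<open>vs\<close> over the two factors of a product, except the one in
  which the first factor is not differentiated.\<close>

fun psplits :: "'a list \<Rightarrow> ('a list \<times> 'a list) list" where
  "psplits [] = []"
| "psplits (v # vs) = ([v], vs) # map (\<lambda>(p, q). (v # p, q)) (psplits vs) @ map (\<lambda>(p, q). (p, v # q)) (psplits vs)"

text \<open>A nonempty first part makes the second strictly shorter than \<open>vs\<close>, which is
  the gain in the commutator estimates. Counting one direction \<open>d\<close> is used with
  \<open>dt\<close> to keep track of time derivatives.\<close>

lemma psplits_props:
  "(p, q) \<in> set (psplits vs) \<Longrightarrow> p \<noteq> [] \<and> length p + length q = length vs \<and> set p \<subseteq> set vs \<and> set q \<subseteq> set vs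
     \<and> count_list p d + count_list q d = count_list vs d"
proof (induction vs arbitrary: p q)
  case (Cons v vs)
  from Cons.prems consider "p = [v]" "q = vs"
    | p' where "p = v # p'" "(p', q) \<in> set (psplits vs)"
    | q' where "q = v # q'" "(p, q') \<in> set (psplits vs)" by auto
  then show ?case
  proof cases
    case 2
    with Cons.IH[OF 2(2)] show ?thesis by auto
  next
    case 3
    with Cons.IH[OF 3(2)] show ?thesis by auto
  qed auto
qed auto

lemma length_psplits: "length (psplits vs) \<le> 2 ^ length vs"
proof -
  have "length (psplits vs) + 1 = 2 ^ length vs" by (induction vs) auto
  then show ?thesis by simp
qed

context slab begin

text \<open>Leibniz rule. The term without derivative on \<open>f\<close> stands apart because for
  an operator coefficient \<open>f\<close> it is the operator acting on the differentiated unknown;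
  the remaining sum is the commutator.\<close>

lemma ipd_mult:
  assumes "sm f" "sm g"
  shows "vs \<in> lists Basis \<Longrightarrow> p \<in> Z \<Longrightarrow> ipd Z vs (\<lambda>q. f q * g q) p
    = f p * ipd Z vs g p + (\<Sum>(a, b)\<leftarrow>psplits vs. ipd Z a f p * ipd Z b g p)"
proof (induction vs arbitrary: p)
  case (Cons v vs)
  let ?S = "\<lambda>L q. \<Sum>(a, b)\<leftarrow>L. ipd Z a f q * ipd Z b g q"
  have vs: "vs \<in> lists Basis" "v \<in> Basis" using Cons.prems by auto
  \<comment> \<open>Stated for an arbitrary list of pairs: differentiating the sum is an induction
    over its terms, in which \<open>psplits vs\<close> would not keep its shape.\<close>
  have *: "sm (?S L) \<and> pd Z v (?S L) p
     = ?S (map (\<lambda>(a, b). (v # a, b)) L) p + ?S (map (\<lambda>(a, b). (a, v # b)) L) p"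
    if "\<forall>(a,b)\<in>set L. a \<in> lists Basis \<and> b \<in> lists Basis" for L
    using that
  proof (induction L)
    case (Cons ab L)
    obtain a b where ab: "ab = (a, b)" by (cases ab)
    have s: "sm (ipd Z a f)" "sm (ipd Z b g)" "sm (?S L)" using Cons ab assms by (auto intro: sm_ipd)
    then have "pd Z v (\<lambda>q. ipd Z a f q * ipd Z b g q + ?S L q) p
      = pd Z v (ipd Z a f) p * ipd Z b g p + ipd Z a f p * pd Z v (ipd Z b g) p + pd Z v (?S L) p"
      using \<open>p \<in> Z\<close> by (simp add: pd_add pd_mult sm_mult sm_differentiable)
    then show ?case using Cons s by (simp add: ab sm_add sm_mult)
  qed (use \<open>p \<in> Z\<close> in \<open>auto simp: sm_const pd_const\<close>)
  have **: "\<forall>(a,b)\<in>set (psplits vs). a \<in> lists Basis \<and> b \<in> lists Basis"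
    using psplits_props vs by (fastforce simp: in_lists_conv_set)
  have "ipd Z (v # vs) (\<lambda>q. f q * g q) p = pd Z v (\<lambda>q. f q * ipd Z vs g q + ?S (psplits vs) q) p"
    using Cons vs by (auto intro!: pd_cong)
  also have "\<dots> = pd Z v f p * ipd Z vs g p + f p * ipd Z (v # vs) g p + pd Z v (?S (psplits vs)) p"
    using *[OF **] assms vs \<open>p \<in> Z\<close> by (simp add: pd_add pd_mult sm_mult sm_differentiable sm_ipd)
  finally show ?case using *[OF **] by simp
qed auto

text \<open>\<open>J f (t, x)\<close> is the integral of \<open>f (s, x)\<close> over \<open>s\<close> from \<open>0\<close> to \<open>t\<close>, rescaled to a fixed interval so
  that differentiation under the integral sign applies.\<close>

definition J :: "(real \<times> (real^'n::finite) \<Rightarrow> complex) \<Rightarrow> real \<times> (real^'n) \<Rightarrow> complex" where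
  "J f = (\<lambda>(t, x). integral {0..1} (\<lambda>\<sigma>. complex_of_real t * f (t * \<sigma>, x)))"

lemma Z_scale: "(t, x) \<in> Z \<Longrightarrow> \<sigma> \<in> {0..1} \<Longrightarrow> (t * \<sigma>, x) \<in> Z"
  using mult_left_le[of \<sigma> t] by (auto simp: Z_eq)

lemma scale_continuous:
  fixes f :: "real \<times> (real^'n::finite) \<Rightarrow> complex"
  assumes "continuous_on Z f"
  shows "continuous_on (Z \<times> {0..1}) (\<lambda>(p, \<sigma>). f (fst p * \<sigma>, snd p))"
proof -
  have "continuous_on (Z \<times> {0..1}) (f \<circ> (\<lambda>(p, \<sigma>). (fst p * \<sigma>, snd p)))"
    using assms by (intro continuous_on_compose)
      (auto intro!: continuous_intros Z_scale elim!: continuous_on_subset simp: split_beta)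
  then show ?thesis by (simp add: o_def split_beta)
qed

lemma scale_continuous_slice:
  assumes "continuous_on Z f" "(t, x) \<in> Z"
  shows "continuous_on {0..1} (\<lambda>\<sigma>. f (t * \<sigma>, x))"
proof -
  have "continuous_on {0..1} (f \<circ> (\<lambda>\<sigma>. (t * \<sigma>, x)))"
    using assms by (intro continuous_on_compose)
      (auto intro!: continuous_intros Z_scale elim!: continuous_on_subset)
  then show ?thesis by (simp add: o_def)
qed

lemma J_eq:
  assumes "continuous_on Z f" "(t, x) \<in> Z"
  shows "J f (t, x) = integral {0..t} (\<lambda>s. f (s, x))"
proof (cases "t = 0")
  case False
  then have t: "t > 0" using assms(2) by (auto simp: Z_eq)
  have c: "continuous_on {0..t} (\<lambda>s. f (s, x))"
    by (rule continuous_on_compose2[OF assms(1)]) (use assms(2) in \<open>auto simp: Z_eq intro!: continuous_intros\<close>)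
  have "((\<lambda>\<sigma>. t *\<^sub>R f (t * \<sigma>, x)) has_integral integral {t * 0..t * 1} (\<lambda>s. f (s, x))) {0..1}"
    by (rule has_integral_substitution[where c=0 and d=t])
      (use t c in \<open>auto intro!: derivative_eq_intros mult_left_le\<close>)
  then have "((\<lambda>\<sigma>. complex_of_real t * f (t * \<sigma>, x)) has_integral integral {0..t} (\<lambda>s. f (s, x))) {0..1}"
    by (simp add: scaleR_conv_of_real)
  from integral_unique[OF this] show ?thesis by (simp only: J_def prod.case)
qed (simp add: J_def)

text \<open>Differentiation under the integral on the fixed interval. The derivative is an integral
  of bounded linear maps, which requires the derivative of the integrand to be jointly continuous as
  such a map. Only the values in space directions are recorded; the time direction follows later
  from the fundamental theorem of calculus.\<close>

lemma J_derivative: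
  fixes f :: "real \<times> (real^'n::finite) \<Rightarrow> complex"
  assumes "sm f" and p: "p \<in> Z"
  obtains D where "(J f has_derivative D) (at p within Z)"
    "\<And>u. D (0, u) = J (pd Z (0, u) f) p"
proof -
  define g where "g = (\<lambda>p \<sigma>. complex_of_real (fst p) * f (fst p * \<sigma>, snd p))"
  define G where "G = (\<lambda>p \<sigma> v. complex_of_real (fst v) * f (fst p * \<sigma>, snd p) +
     complex_of_real (fst p) * pd Z (fst v * \<sigma>, snd v) f (fst p * \<sigma>, snd p))"
  have g: "((\<lambda>p. g p \<sigma>) has_derivative G p \<sigma>) (at p within Z)" if "p \<in> Z" "\<sigma> \<in> {0..1}" for p \<sigma>
  proof -
    have q: "(fst p * \<sigma>, snd p) \<in> Z" using that Z_scale[of "fst p" "snd p"] by simp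
    have "(f has_derivative (\<lambda>v. pd Z v f (fst p * \<sigma>, snd p))) (at (fst p * \<sigma>, snd p) within (\<lambda>p. (fst p * \<sigma>, snd p)) ` Z)"
      by (rule has_derivative_subset[OF has_derivative_pd[OF sm_differentiable[OF assms(1) q]]])
        (use that in \<open>auto intro!: Z_scale\<close>)
    moreover have "((\<lambda>p. (fst p * \<sigma>, snd p)) has_derivative (\<lambda>v. (fst v * \<sigma>, snd v))) (at p within Z)"
      by (auto intro!: derivative_eq_intros)
    ultimately have "((\<lambda>p. f (fst p * \<sigma>, snd p)) has_derivative (\<lambda>v. pd Z (fst v * \<sigma>, snd v) f (fst p * \<sigma>, snd p))) (at p within Z)"
      using diff_chain_within[of "\<lambda>p. (fst p * \<sigma>, snd p)" "\<lambda>v. (fst v * \<sigma>, snd v)" p Z f "\<lambda>v. pd Z v f (fst p * \<sigma>, snd p)"] by (simp add: o_def)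
    then show ?thesis unfolding g_def G_def
      by (auto intro!: derivative_eq_intros)
  qed
  have bl: "bounded_linear (G p \<sigma>)" if "p \<in> Z" "\<sigma> \<in> {0..1}" for p \<sigma>
    using has_derivative_bounded_linear[OF g[OF that]] .
  define B where "B = (\<lambda>p \<sigma>. Blinfun (G p \<sigma>))"
  have B: "blinfun_apply (B p \<sigma>) = G p \<sigma>" if "p \<in> Z" "\<sigma> \<in> {0..1}" for p \<sigma>
    using bl[OF that] unfolding B_def by (simp add: bounded_linear_Blinfun_apply)
  have cB: "continuous_on (Z \<times> {0..1}) (\<lambda>(p, \<sigma>). B p \<sigma>)"
  proof (rule continuous_on_blinfun_componentwise)
    fix b :: "real \<times> (real^'n)" assume b: "b \<in> Basis"
    consider "b = (1, 0)" | u where "b = (0, u)" using b by (auto simp: Basis_prod_def)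
    then have "continuous_on (Z \<times> {0..1}) (\<lambda>(p, \<sigma>). G p \<sigma> b)"
    proof cases
      case 1
      \<comment> \<open>Continuity is known only for derivatives in basis directions, so linearity
        pulls the factor \<sigma> out of the direction \<open>(\<sigma>, 0)\<close>.\<close>
      have *: "pd Z (\<sigma>, 0) f q = \<sigma> * pd Z (1, 0) f q" if "q \<in> Z" for \<sigma> q
        using linear_scale[OF has_derivative_linear[OF has_derivative_pd[OF sm_differentiable[OF assms(1) that]]], of \<sigma> "(1,0)"]
        by (simp add: scaleR_conv_of_real)
      have "continuous_on (Z \<times> {0..1}) (\<lambda>(p, \<sigma>). f (fst p * \<sigma>, snd p) +
           complex_of_real (fst p) * (complex_of_real \<sigma> * pd Z (1, 0) f (fst p * \<sigma>, snd p)))"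
        using scale_continuous[OF sm_continuous[OF assms(1)]]
          scale_continuous[OF sm_continuous[OF sm_pd[OF assms(1) b]]] unfolding 1
        by (auto simp: split_beta intro!: continuous_intros)
      then show ?thesis
      proof (rule continuous_on_eq)
        fix z :: "(real \<times> (real^'n)) \<times> real" assume "z \<in> Z \<times> {0..1}"
        then have "(fst (fst z) * snd z, snd (fst z)) \<in> Z" by (auto intro!: Z_scale)
        from *[OF this, of "snd z"] show "(case z of (p, \<sigma>) \<Rightarrow> f (fst p * \<sigma>, snd p) +
           complex_of_real (fst p) * (complex_of_real \<sigma> * pd Z (1, 0) f (fst p * \<sigma>, snd p))) = (case z of (p, \<sigma>) \<Rightarrow> G p \<sigma> b)"
          by (simp add: G_def 1 split_beta)
      qed
    next
      case 2
      have "continuous_on (Z \<times> {0..1}) (\<lambda>(p, \<sigma>). complex_of_real (fst p) * (pd Z b f (fst p * \<sigma>, snd p)))"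
        using scale_continuous[OF sm_continuous[OF sm_pd[OF assms(1) b]]]
        by (auto simp: split_beta intro!: continuous_intros)
      then show ?thesis
        by (rule continuous_on_eq) (auto simp: G_def 2 split_beta)
    qed
    then show "continuous_on (Z \<times> {0..1}) (\<lambda>x. blinfun_apply (case x of (p, \<sigma>) \<Rightarrow> B p \<sigma>) b)"
      by (rule continuous_on_eq) (auto simp: B split_beta)
  qed
  have gi: "g p integrable_on cbox 0 1" if "p \<in> Z" for p
  proof -
    have "continuous_on {0..1} (g p)"
      using scale_continuous_slice[OF sm_continuous[OF assms(1)], of "fst p" "snd p"] that
      unfolding g_def by (auto intro!: continuous_intros)
    then show ?thesis by (simp add: integrable_continuous_interval)
  qed
  have D: "((\<lambda>p. integral (cbox 0 1) (g p)) has_derivative integral (cbox 0 1) (B p)) (at p within Z)"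
    by (rule leibniz_rule) (use g B gi cB p in \<open>auto simp: convex_Z\<close>)
  have Bi: "B p integrable_on {0..1}"
  proof -
    have "continuous_on {0..1} ((\<lambda>(p, \<sigma>). B p \<sigma>) \<circ> (\<lambda>\<sigma>. (p, \<sigma>)))"
      by (intro continuous_on_compose continuous_intros continuous_on_subset[OF cB]) (use p in auto)
    then show ?thesis by (simp add: o_def integrable_continuous_interval)
  qed
  show thesis
  proof (rule that)
    show "(J f has_derivative blinfun_apply (integral {0..1} (B p))) (at p within Z)"
      using D by (simp only: J_def g_def case_prod_unfold cbox_interval)
    fix u
    have "blinfun_apply (integral {0..1} (B p)) (0, u) = integral {0..1} (\<lambda>\<sigma>. B p \<sigma> (0, u))"
      by (rule blinfun_apply_integral[OF Bi])
    also have "\<dots> = J (pd Z (0, u) f) p"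
      unfolding J_def split_beta by (rule integral_cong) (simp add: B[OF p] G_def)
    finally show "blinfun_apply (integral {0..1} (B p)) (0, u) = J (pd Z (0, u) f) p" .
  qed
qed

lemma J_differentiable: "sm f \<Longrightarrow> p \<in> Z \<Longrightarrow> J f differentiable (at p within Z)"
  using J_derivative differentiableI by metis

lemma pd_J_space: "sm f \<Longrightarrow> p \<in> Z \<Longrightarrow> pd Z (0, u) (J f) p = J (pd Z (0, u) f) p"
  by (rule J_derivative[of f p]) (auto simp: pd_eq)

lemma has_vector_derivative_slice:
  assumes "(f has_derivative f') (at (t, x) within Z)"
  shows "((\<lambda>s. f (s, x)) has_vector_derivative f' (1, 0)) (at t within {0..T})"
proof -
  have "((\<lambda>s. (s, x)) has_vector_derivative (1, 0)) (at t within {0..T})"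
    by (auto intro!: derivative_eq_intros)
  moreover have "(f has_derivative f') (at (t, x) within (\<lambda>s. (s, x)) ` {0..T})"
    using assms by (elim has_derivative_subset) (auto simp: Z_eq)
  ultimately show ?thesis
    using vector_derivative_diff_chain_within[of "\<lambda>s. (s, x)" "(1, 0)" t "{0..T}" f f'] by (simp add: o_def)
qed

lemma pd_dt_slice:
  assumes "sm f" "t \<in> {0..T}"
  shows "((\<lambda>s. f (s, x)) has_vector_derivative pd Z (1, 0) f (t, x)) (at t within {0..T})"
  by (rule has_vector_derivative_slice, rule has_derivative_pd, rule sm_differentiable) (use assms in \<open>auto simp: Z_eq\<close>)

text \<open>The fundamental theorem and the chain rule along a time line both give a derivative
  within \<open>{0..T}\<close> of the same function of one variable, and on a nondegenerate interval
  such derivatives are unique.\<close>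

lemma pd_J_time:
  assumes "sm f" "p \<in> Z"
  shows "pd Z (1, 0) (J f) p = f p"
proof -
  obtain t x where p: "p = (t, x)" "t \<in> {0..T}" using assms(2) by (auto simp: Z_eq)
  have c: "continuous_on {0..T} (\<lambda>s. f (s, x))"
    by (rule continuous_on_compose2[OF sm_continuous[OF assms(1)]]) (auto simp: Z_eq intro!: continuous_intros)
  have "((\<lambda>u. integral {0..u} (\<lambda>s. f (s, x))) has_vector_derivative f (t, x)) (at t within {0..T})"
    by (rule integral_has_vector_derivative[OF c p(2)])
  then have "((\<lambda>u. J f (u, x)) has_vector_derivative f (t, x)) (at t within {0..T})"
    by (rule has_vector_derivative_transform[OF p(2), rotated])
      (auto intro!: J_eq sm_continuous assms simp: Z_eq)
  moreover have "((\<lambda>u. J f (u, x)) has_vector_derivative pd Z (1, 0) (J f) (t, x)) (at t within {0..T})"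
    by (rule has_vector_derivative_slice, rule has_derivative_pd, rule J_differentiable) (use assms p in auto)
  ultimately show ?thesis
    using vector_derivative_unique_within_closed_interval[of 0 T t] p T_pos by fastforce
qed

text \<open>The invariant contains \<open>J f\<close> together with all smooth functions: a space
  derivative passes under the integral and keeps the form \<open>J f\<close>, a time derivative
  removes \<open>J\<close> and lands among the smooth functions.\<close>

lemma sm_J:
  fixes f :: "real \<times> (real^'n::finite) \<Rightarrow> complex"
  shows "sm f \<Longrightarrow> sm (J f)"
proof (rule smooth_coinduct[of "\<lambda>h. sm h \<or> (\<exists>f. sm f \<and> h = J f)"])
  fix f :: "real \<times> (real^'n) \<Rightarrow> complex" and p :: "real \<times> (real^'n)" assume "sm f \<or> (\<exists>g. sm g \<and> f = J g)" "p \<in> Z"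
  then show "f differentiable at p within Z" by (auto intro: sm_differentiable J_differentiable)
next
  fix f :: "real \<times> (real^'n) \<Rightarrow> complex" and v :: "real \<times> (real^'n)" assume *: "sm f \<or> (\<exists>g. sm g \<and> f = J g)" "v \<in> Basis"
  show "\<exists>g. (sm g \<or> (\<exists>f. sm f \<and> g = J f)) \<and> (\<forall>p\<in>Z. pd Z v f p = g p)"
  proof (cases "sm f")
    case True
    then show ?thesis using *(2) sm_pd by blast
  next
    case False
    then obtain g where g: "sm g" "f = J g" using * by auto
    consider "v = (1, 0)" | u where "v = (0, u)" using *(2) by (auto simp: Basis_prod_def)
    then show ?thesis
    proof cases
      case 1
      then show ?thesis using g pd_J_time by (intro exI[of _ g]) auto
    next
      case 2
      then show ?thesis using g pd_J_space sm_pd[OF g(1) *(2)] by (intro exI[of _ "J (pd Z v g)"]) auto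
    qed
  qed
qed auto

lemma Basis_slab: "(Basis :: (real \<times> (real^'n::finite)) set) = insert dt (range dx)"
  by (auto simp: Basis_prod_def dt_def dx_def Basis_vec_def)

lemma dt_Basis [simp]: "dt \<in> Basis" and dx_Basis [simp]: "dx j \<in> Basis"
  by (auto simp: Basis_slab)

lemma space_lists [simp]: "vs \<in> lists (range dx) \<Longrightarrow> vs \<in> lists Basis"
  by (auto simp: Basis_slab in_lists_conv_set)

lemma pd_J_dt: "sm f \<Longrightarrow> p \<in> Z \<Longrightarrow> pd Z dt (J f) p = f p"
  by (simp add: dt_def pd_J_time)

lemma ipd_J_space:
  assumes "sm f"
  shows "vs \<in> lists (range dx) \<Longrightarrow> p \<in> Z \<Longrightarrow> ipd Z vs (J f) p = J (ipd Z vs f) p"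
proof (induction vs arbitrary: p)
  case (Cons v vs)
  then have "pd Z v (ipd Z vs (J f)) p = pd Z v (J (ipd Z vs f)) p"
    by (intro pd_cong) auto
  moreover obtain j where "v = dx j" using Cons.prems by auto
  moreover have "sm (ipd Z vs f)" using Cons.prems assms by (auto intro!: sm_ipd)
  ultimately show ?case using Cons.prems by (simp add: dx_def pd_J_space)
qed auto

lemma dt_slice:
  "sm f \<Longrightarrow> t \<in> {0..T} \<Longrightarrow> ((\<lambda>s. f (s, x)) has_vector_derivative pd Z dt f (t, x)) (at t within {0..T})"
  unfolding dt_def by (rule pd_dt_slice)

lemma dx_slice:
  assumes "sm f" "t \<in> {0..T}"
  shows "((\<lambda>r. f (t, x + r *\<^sub>R axis j 1)) has_vector_derivative pd Z (dx j) f (t, x + r *\<^sub>R axis j 1)) (at r within S)"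
proof -
  let ?g = "\<lambda>r. (t, x + r *\<^sub>R axis j 1)"
  have z: "?g r \<in> Z" for r using assms by (auto simp: Z_eq)
  have "(?g has_vector_derivative dx j) (at r within S)"
    by (auto intro!: derivative_eq_intros simp: dx_def)
  moreover have "(f has_derivative (\<lambda>v. pd Z v f (?g r))) (at (?g r) within ?g ` S)"
    by (rule has_derivative_subset[OF has_derivative_pd[OF sm_differentiable[OF assms(1) z]]]) (use z in auto)
  ultimately show ?thesis
    using vector_derivative_diff_chain_within[of ?g "dx j" r S f] by (simp add: o_def)
qed

end

section \<open>Square-integrable slices\<close>

text \<open>Squared L2 norm with extended values, so that an upper bound on it can prove square
  integrability instead of presupposing it.\<close>

definition nsq :: "('a::euclidean_space \<Rightarrow> complex) \<Rightarrow> ennreal" where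
  "nsq w = (\<integral>\<^sup>+x. ennreal ((cmod (w x))\<^sup>2) \<partial>lborel)"

lemma nsq_add:
  assumes [measurable]: "v \<in> borel_measurable borel" "w \<in> borel_measurable borel"
  shows "nsq (\<lambda>x. v x + w x) \<le> 2 * nsq v + 2 * nsq w"
proof -
  have "(cmod (a + b))\<^sup>2 \<le> 2 * (cmod a)\<^sup>2 + 2 * (cmod b)\<^sup>2" for a b
  proof -
    have "(cmod (a + b))\<^sup>2 \<le> (cmod a + cmod b)\<^sup>2" by (intro power_mono norm_triangle_ineq) auto
    also have "\<dots> \<le> 2 * (cmod a)\<^sup>2 + 2 * (cmod b)\<^sup>2"
      using zero_le_power2[of "cmod a - cmod b"] by (simp add: power2_sum power2_diff)
    finally show ?thesis .
  qed
  then have "nsq (\<lambda>x. v x + w x) \<le> (\<integral>\<^sup>+x. ennreal (2 * (cmod (v x))\<^sup>2 + 2 * (cmod (w x))\<^sup>2) \<partial>lborel)"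
    unfolding nsq_def by (intro nn_integral_mono ennreal_leI) auto
  also have "\<dots> = 2 * nsq v + 2 * nsq w"
    unfolding nsq_def by (subst ennreal_plus, simp, simp, subst nn_integral_add)
      (auto simp: ennreal_mult nn_integral_cmult)
  finally show ?thesis .
qed

lemma nsq_mult_le:
  assumes [measurable]: "w \<in> borel_measurable borel" and "\<And>x. cmod (a x) \<le> M"
  shows "nsq (\<lambda>x. a x * w x) \<le> ennreal (M\<^sup>2) * nsq w"
proof -
  have "nsq (\<lambda>x. a x * w x) \<le> (\<integral>\<^sup>+x. ennreal (M\<^sup>2 * (cmod (w x))\<^sup>2) \<partial>lborel)"
    unfolding nsq_def using assms(2)
    by (intro nn_integral_mono ennreal_leI) (auto simp: norm_mult power_mult_distrib intro!: mult_right_mono power_mono)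
  also have "\<dots> = ennreal (M\<^sup>2) * nsq w"
    unfolding nsq_def by (auto simp: ennreal_mult nn_integral_cmult)
  finally show ?thesis .
qed

lemma nsq_shift:
  assumes [measurable]: "w \<in> borel_measurable borel"
  shows "nsq (\<lambda>x. w (x + y)) = nsq w"
proof -
  have "nsq w = (\<integral>\<^sup>+x. ennreal ((cmod (w x))\<^sup>2) \<partial>distr lborel borel ((+) y))"
    by (simp add: nsq_def lborel_distr_plus)
  also have "\<dots> = nsq (\<lambda>x. w (x + y))"
    by (subst nn_integral_distr) (auto simp: nsq_def add.commute)
  finally show ?thesis by simp
qed

text \<open>Jensen's inequality on the unit interval: the variance of \<open>cmod (g s)\<close>
  about its mean \<open>m\<close> is nonnegative.\<close>

lemma integral_norm_square_le:
  fixes g :: "real \<Rightarrow> complex"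
  assumes g: "continuous_on {0..1} g"
  shows "(cmod (integral {0..1} g))\<^sup>2 \<le> integral {0..1} (\<lambda>s. (cmod (g s))\<^sup>2)"
proof -
  define m where "m = integral {0..1} (\<lambda>s. cmod (g s))"
  have i: "(\<lambda>s. (cmod (g s))\<^sup>2) integrable_on {0..1}" "(\<lambda>s. cmod (g s)) integrable_on {0..1}"
    "g integrable_on {0..1}"
    using g by (auto intro!: integrable_continuous_interval continuous_intros)
  have "cmod (integral {0..1} g) \<le> m"
    unfolding m_def by (rule integral_norm_bound_integral) (use i in auto)
  then have "(cmod (integral {0..1} g))\<^sup>2 \<le> m\<^sup>2" by (intro power_mono) auto
  moreover have "0 \<le> integral {0..1} (\<lambda>s. (cmod (g s) - m)\<^sup>2)"
    using g by (intro integral_nonneg integrable_continuous_interval continuous_intros) auto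
  moreover have "integral {0..1} (\<lambda>s. (cmod (g s) - m)\<^sup>2) = integral {0..1} (\<lambda>s. (cmod (g s))\<^sup>2) + m\<^sup>2 - 2 * m * m"
  proof -
    have "((\<lambda>s. (cmod (g s))\<^sup>2 + m\<^sup>2 - 2 * m * cmod (g s)) has_integral
       integral {0..1} (\<lambda>s. (cmod (g s))\<^sup>2) + m\<^sup>2 - 2 * m * m) {0..1}"
      unfolding m_def
      using i has_integral_const_real[of "(integral {0..1} (\<lambda>s. cmod (g s)))\<^sup>2" 0 1]
      by (intro has_integral_diff has_integral_add has_integral_mult_right integrable_integral) auto
    from integral_unique[OF this] show ?thesis by (simp add: power2_diff algebra_simps)
  qed
  ultimately show ?thesis by (simp add: power2_eq_square)
qed

lemma nn_integral_Icc:
  fixes g :: "real \<Rightarrow> real"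
  assumes "continuous_on {a..b} g" "\<And>s. s \<in> {a..b} \<Longrightarrow> 0 \<le> g s"
  shows "(\<integral>\<^sup>+s. ennreal (g s) * indicator {a..b} s \<partial>lborel) = ennreal (integral {a..b} g)"
  by (rule nn_integral_has_integral_lebesgue')
     (use assms in \<open>auto intro!: integrable_integral integrable_continuous_interval\<close>)

text \<open>Jensen pointwise in \<open>x\<close>, then Tonelli. The increments, remainders and time
  integrals below are written as averages over the unit interval so that this one lemma bounds
  them.\<close>

lemma nsq_average:
  fixes \<phi> :: "real \<Rightarrow> 'a::euclidean_space \<Rightarrow> complex"
  assumes c: "continuous_on ({0..1} \<times> UNIV) (\<lambda>(s, x). \<phi> s x)"
    and k: "continuous_on {0..1} k" "\<And>s. s \<in> {0..1} \<Longrightarrow> 0 \<le> k s" "\<And>s. s \<in> {0..1} \<Longrightarrow> nsq (\<phi> s) \<le> ennreal (k s)"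
  shows "nsq (\<lambda>x. integral {0..1} (\<lambda>s. \<phi> s x)) \<le> ennreal (integral {0..1} k)"
proof -
  have cs: "continuous_on {0..1} (\<lambda>s. \<phi> s x)" for x
  proof -
    have "continuous_on {0..1} ((\<lambda>(s, x). \<phi> s x) \<circ> (\<lambda>s. (s, x)))"
      by (intro continuous_on_compose continuous_intros continuous_on_subset[OF c]) auto
    then show ?thesis by (simp add: o_def)
  qed
  \<comment> \<open>\<phi> is continuous only for \<open>s\<close> in the unit interval; cutting it
    off there gives the joint measurability needed to interchange the integrals.\<close>
  have "(\<lambda>z. indicator ({0..1} \<times> UNIV) z *\<^sub>R (\<lambda>(s, x). \<phi> s x) z) \<in> borel_measurable borel"
    by (intro borel_measurable_continuous_on_indicator c) (auto intro!: borel_closed closed_Times)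
  then have "(\<lambda>z. ennreal ((cmod (indicator ({0..1} \<times> UNIV) z *\<^sub>R (\<lambda>(s, x). \<phi> s x) z))\<^sup>2)) \<in> borel_measurable borel"
    by measurable
  moreover have "(\<lambda>z. ennreal ((cmod (indicator ({0..1} \<times> UNIV) z *\<^sub>R (\<lambda>(s, x). \<phi> s x) z))\<^sup>2)) =
     (\<lambda>(s, x). ennreal ((cmod (\<phi> s x))\<^sup>2) * indicator {0..1} s)"
    by (auto simp: indicator_def)
  ultimately have m: "(\<lambda>(s, x). ennreal ((cmod (\<phi> s x))\<^sup>2) * indicator {0..1} s) \<in> borel_measurable (lborel \<Otimes>\<^sub>M (lborel :: 'a measure))"
    by (simp only: lborel_prod measurable_lborel2)
  have "nsq (\<lambda>x. integral {0..1} (\<lambda>s. \<phi> s x)) \<le> (\<integral>\<^sup>+x. ennreal (integral {0..1} (\<lambda>s. (cmod (\<phi> s x))\<^sup>2)) \<partial>lborel)"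
    unfolding nsq_def by (intro nn_integral_mono ennreal_leI integral_norm_square_le cs)
  also have "\<dots> = (\<integral>\<^sup>+x. \<integral>\<^sup>+s. ennreal ((cmod (\<phi> s x))\<^sup>2) * indicator {0..1} s \<partial>lborel \<partial>lborel)"
    using cs by (subst nn_integral_Icc) (auto intro!: continuous_intros)
  also have "\<dots> = (\<integral>\<^sup>+s. \<integral>\<^sup>+x. ennreal ((cmod (\<phi> s x))\<^sup>2) * indicator {0..1} s \<partial>lborel \<partial>lborel)"
    using m by (rule lborel_pair.Fubini')
  also have "\<dots> \<le> (\<integral>\<^sup>+s. ennreal (k s) * indicator {0..1} s \<partial>lborel)"
  proof (intro nn_integral_mono)
    fix s :: real
    show "(\<integral>\<^sup>+x. ennreal ((cmod (\<phi> s x))\<^sup>2) * indicator {0..1} s \<partial>lborel) \<le> ennreal (k s) * indicator {0..1} s"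
      using k(3)[of s] by (cases "s \<in> {0..1}") (auto simp: nsq_def)
  qed
  also have "\<dots> = ennreal (integral {0..1} k)"
    using k by (intro nn_integral_Icc) auto
  finally show ?thesis .
qed

context slab begin

text \<open>Bounds the squared norm of one slice. Admissible time, continuity and
  \<open>0 \<le> K\<close> are bundled in, so that measurability of the slice and the arithmetic of
  bounds need no further hypotheses.\<close>

definition slice_le :: "real \<Rightarrow> (real \<times> (real^'n::finite) \<Rightarrow> complex) \<Rightarrow> real \<Rightarrow> bool" where
  "slice_le t f K \<longleftrightarrow> t \<in> {0..T} \<and> continuous_on Z f \<and> 0 \<le> K \<and> nsq (\<lambda>x. f (t, x)) \<le> ennreal K"

lemma continuous_slice: "continuous_on Z f \<Longrightarrow> t \<in> {0..T} \<Longrightarrow> continuous_on UNIV (\<lambda>x. f (t, x))"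
  by (rule continuous_on_compose2[of Z f]) (auto simp: Z_eq intro!: continuous_intros)

lemma measurable_slice: "continuous_on Z f \<Longrightarrow> t \<in> {0..T} \<Longrightarrow> (\<lambda>x. f (t, x)) \<in> borel_measurable borel"
  by (intro borel_measurable_continuous_onI continuous_slice)

lemma slice_le_mono: "slice_le t f K \<Longrightarrow> K \<le> L \<Longrightarrow> slice_le t f L"
  unfolding slice_le_def by (auto intro: order_trans ennreal_leI)

lemma slice_le_cong: "slice_le t f K \<Longrightarrow> (\<And>p. p \<in> Z \<Longrightarrow> f p = g p) \<Longrightarrow> slice_le t g K"
proof -
  assume *: "slice_le t f K" "\<And>p. p \<in> Z \<Longrightarrow> f p = g p"
  then have "t \<in> {0..T}" by (simp add: slice_le_def)
  then have "(\<lambda>x. f (t, x)) = (\<lambda>x. g (t, x))" using *(2) by (auto simp: Z_eq)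
  moreover have "continuous_on Z g" using * by (metis slice_le_def continuous_on_cong)
  ultimately show ?thesis using *(1) by (simp add: slice_le_def)
qed

lemma slice_le_zero: "t \<in> {0..T} \<Longrightarrow> 0 \<le> K \<Longrightarrow> slice_le t (\<lambda>p. 0) K"
  by (simp add: slice_le_def nsq_def)

lemma slice_le_add:
  assumes "slice_le t f K" "slice_le t g L"
  shows "slice_le t (\<lambda>p. f p + g p) (2 * K + 2 * L)"
proof -
  have "nsq (\<lambda>x. f (t, x) + g (t, x)) \<le> 2 * nsq (\<lambda>x. f (t, x)) + 2 * nsq (\<lambda>x. g (t, x))"
    using assms by (intro nsq_add measurable_slice) (auto simp: slice_le_def)
  also have "\<dots> \<le> 2 * ennreal K + 2 * ennreal L"
    using assms by (intro add_mono mult_left_mono) (auto simp: slice_le_def)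
  also have "\<dots> = ennreal (2 * K + 2 * L)"
    using assms by (simp add: slice_le_def ennreal_mult)
  finally show ?thesis using assms by (auto simp: slice_le_def intro!: continuous_intros)
qed

lemma slice_le_mult:
  assumes "slice_le t f K" "continuous_on Z a" "\<And>p. p \<in> Z \<Longrightarrow> cmod (a p) \<le> M"
  shows "slice_le t (\<lambda>p. a p * f p) (M\<^sup>2 * K)"
proof -
  have "nsq (\<lambda>x. a (t, x) * f (t, x)) \<le> ennreal (M\<^sup>2) * nsq (\<lambda>x. f (t, x))"
    using assms by (intro nsq_mult_le measurable_slice) (auto simp: slice_le_def Z_eq)
  also have "\<dots> \<le> ennreal (M\<^sup>2) * ennreal K"
    using assms by (intro mult_left_mono) (auto simp: slice_le_def)
  also have "\<dots> = ennreal (M\<^sup>2 * K)"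
    using assms by (simp add: slice_le_def ennreal_mult)
  finally show ?thesis using assms by (auto simp: slice_le_def intro!: continuous_intros)
qed

lemma slice_le_cmult: "slice_le t f K \<Longrightarrow> slice_le t (\<lambda>p. c * f p) ((cmod c)\<^sup>2 * K)"
  by (rule slice_le_mult) auto

lemma slice_le_uminus: "slice_le t f K \<Longrightarrow> slice_le t (\<lambda>p. - f p) K"
  using slice_le_cmult[of t f K "-1"] by simp

lemma slice_le_diff: "slice_le t f K \<Longrightarrow> slice_le t g L \<Longrightarrow> slice_le t (\<lambda>p. f p - g p) (2 * K + 2 * L)"
  using slice_le_add[OF _ slice_le_uminus, of t f K g L] by simp

lemma slice_le_shift:
  assumes "slice_le t f K"
  shows "slice_le t (\<lambda>p. f (p + (0, y))) K"
proof -
  have "nsq (\<lambda>x. f (t, x + y)) = nsq (\<lambda>x. f (t, x))"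
    using assms by (intro nsq_shift[of "\<lambda>x. f (t, x)"] measurable_slice) (auto simp: slice_le_def)
  moreover have "continuous_on Z (\<lambda>p. f (p + (0, y)))"
    by (rule continuous_on_compose2[of Z f]) (use assms in \<open>auto simp only: slice_le_def Z_shift intro!: continuous_intros\<close>)
  ultimately show ?thesis using assms by (simp add: slice_le_def)
qed

text \<open>Each addition doubles the bounds, whence the power of 2. Such factors depend only on the
  number of terms and not on \<epsilon>, so no sharper inequality is sought.\<close>

lemma slice_le_sum:
  assumes "finite S" "t \<in> {0..T}" "\<And>i. i \<in> S \<Longrightarrow> slice_le t (f i) (K i)"
  shows "slice_le t (\<lambda>p. \<Sum>i\<in>S. f i p) (2 ^ card S * (\<Sum>i\<in>S. K i))"
  using assms(1,3)
proof (induction S rule: finite_induct)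
  case empty
  then show ?case using assms(2) by (simp add: slice_le_zero)
next
  case (insert i S)
  have K: "0 \<le> K i" "0 \<le> (\<Sum>i\<in>S. K i)" using insert by (auto simp: slice_le_def intro!: sum_nonneg)
  have "slice_le t (\<lambda>p. f i p + (\<Sum>i\<in>S. f i p)) (2 * K i + 2 * (2 ^ card S * (\<Sum>i\<in>S. K i)))"
    using insert by (intro slice_le_add) auto
  moreover have "2 * K i + 2 * (2 ^ card S * (\<Sum>i\<in>S. K i)) \<le> 2 ^ card (insert i S) * (\<Sum>i\<in>insert i S. K i)"
    using insert K mult_right_mono[of 1 "2 ^ card S" "K i"] by (simp add: algebra_simps)
  ultimately show ?case using insert by (auto intro: slice_le_mono)
qed

lemma slice_le_sum_list:
  assumes "t \<in> {0..T}" "0 \<le> K" "\<And>f. f \<in> set fs \<Longrightarrow> slice_le t f K"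
  shows "slice_le t (\<lambda>p. \<Sum>f\<leftarrow>fs. f p) (4 ^ length fs * K)"
  using assms(3)
proof (induction fs)
  case Nil
  then show ?case using assms by (simp add: slice_le_zero)
next
  case (Cons f fs)
  have "slice_le t (\<lambda>p. f p + (\<Sum>f\<leftarrow>fs. f p)) (2 * K + 2 * (4 ^ length fs * K))"
    using Cons by (intro slice_le_add) auto
  moreover have "2 * K + 2 * (4 ^ length fs * K) \<le> 4 ^ length (f # fs) * K"
    using assms(2) mult_right_mono[of 1 "4 ^ length fs" K] by (simp add: mult.commute)
  ultimately show ?case by (auto intro: slice_le_mono)
qed

lemma slice_le_average:
  fixes \<phi> :: "real \<Rightarrow> real^'n::finite \<Rightarrow> complex"
  assumes t: "t \<in> {0..T}" and g: "continuous_on Z g" "\<And>x. g (t, x) = integral {0..1} (\<lambda>s. \<phi> s x)"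
    and c: "continuous_on ({0..1} \<times> UNIV) (\<lambda>(s, x). \<phi> s x)"
    and k: "\<And>s. s \<in> {0..1} \<Longrightarrow> nsq (\<phi> s) \<le> ennreal K" "0 \<le> K"
  shows "slice_le t g K"
  using nsq_average[OF c, of "\<lambda>_. K"] k t g by (simp add: slice_le_def)

text \<open>For squared norms weighted by \<open>exp (\<mu> * t)\<close>, integration in time gains
  the factor \<open>T / \<mu>\<close>. A large \<mu> thus makes the Picard map contract on the whole
  interval at once.\<close>

lemma slice_le_J:
  assumes f: "sm f" and K: "\<And>s. s \<in> {0..T} \<Longrightarrow> slice_le s f (M * exp (\<mu> * s))" and "\<mu> > 0" "t \<in> {0..T}"
  shows "slice_le t (J f) (T * M / \<mu> * exp (\<mu> * t))"
proof -
  have M: "0 \<le> M" using K[of 0] T_pos by (auto simp: slice_le_def)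
  let ?\<phi> = "\<lambda>s x. complex_of_real t * f (t * s, x)"
  have ts: "t * s \<in> {0..T}" if "s \<in> {0..1}" for s
    using that assms(4) mult_left_le[of s t] by auto
  have c: "continuous_on ({0..1} \<times> UNIV) (\<lambda>(s, x). f (t * s, x))"
    unfolding split_beta by (intro continuous_on_compose2[OF sm_continuous[OF f]])
      (use ts in \<open>auto intro!: continuous_intros simp: Z_eq\<close>)
  have "nsq (\<lambda>x. integral {0..1} (\<lambda>s. ?\<phi> s x)) \<le> ennreal (integral {0..1} (\<lambda>s. t\<^sup>2 * (M * exp (\<mu> * (t * s)))))"
  proof (rule nsq_average)
    fix s :: real assume s: "s \<in> {0..1}"
    have "nsq (?\<phi> s) \<le> ennreal (t\<^sup>2) * nsq (\<lambda>x. f (t * s, x))"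
      using ts[OF s] assms(4) by (intro nsq_mult_le measurable_slice sm_continuous[OF f]) auto
    also have "\<dots> \<le> ennreal (t\<^sup>2) * ennreal (M * exp (\<mu> * (t * s)))"
      using K[OF ts[OF s]] by (intro mult_left_mono) (auto simp: slice_le_def)
    also have "\<dots> = ennreal (t\<^sup>2 * (M * exp (\<mu> * (t * s))))"
      using M by (simp add: ennreal_mult)
    finally show "nsq (?\<phi> s) \<le> ennreal (t\<^sup>2 * (M * exp (\<mu> * (t * s))))" .
  next
    show "continuous_on ({0..1} \<times> UNIV) (\<lambda>(s, x). ?\<phi> s x)"
      using c by (auto simp: split_beta intro!: continuous_intros)
  qed (use M in \<open>auto intro!: continuous_intros\<close>)
  also have "integral {0..1} (\<lambda>s. t\<^sup>2 * (M * exp (\<mu> * (t * s)))) \<le> T * M / \<mu> * exp (\<mu> * t)"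
  proof (cases "t = 0")
    case False
    then have t: "t > 0" using assms by auto
    have "((\<lambda>s. t\<^sup>2 * (M * exp (\<mu> * (t * s)))) has_integral t * M / \<mu> * exp (\<mu> * (t * 1)) - t * M / \<mu> * exp (\<mu> * (t * 0))) {0..1}"
      using t \<open>\<mu> > 0\<close> by (intro fundamental_theorem_of_calculus)
        (auto intro!: derivative_eq_intros simp: has_real_derivative_iff_has_vector_derivative[symmetric] power2_eq_square)
    then have "integral {0..1} (\<lambda>s. t\<^sup>2 * (M * exp (\<mu> * (t * s)))) = t * M / \<mu> * (exp (\<mu> * t) - 1)"
      by (subst integral_unique) (simp_all add: right_diff_distrib)
    also have "\<dots> \<le> t * M / \<mu> * exp (\<mu> * t)"
      using t M \<open>\<mu> > 0\<close> by (intro mult_left_mono) auto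
    also have "\<dots> \<le> T * M / \<mu> * exp (\<mu> * t)"
      using assms M by (intro mult_right_mono divide_right_mono) auto
    finally show ?thesis .
  qed (use M T_pos \<open>\<mu> > 0\<close> in auto)
  finally show ?thesis
    using assms M T_pos sm_continuous[OF sm_J[OF f]] by (auto simp: slice_le_def J_def ennreal_leI)
qed

section \<open>Difference quotients and interpolation inequalities\<close>

definition D :: "real \<Rightarrow> 'n \<Rightarrow> (real \<times> (real^'n::finite) \<Rightarrow> complex) \<Rightarrow> real \<times> (real^'n) \<Rightarrow> complex" where
  "D h j f = (\<lambda>p. complex_of_real (1 / (2 * h)) * (f (p + (0, h *\<^sub>R axis j 1)) - f (p + (0, - (h *\<^sub>R axis j 1)))))"

lemma sm_D: "sm f \<Longrightarrow> sm (D h j f)"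
  unfolding D_def by (intro sm_cmult sm_diff sm_shift)

lemma ipd_D: "sm f \<Longrightarrow> vs \<in> lists Basis \<Longrightarrow> p \<in> Z \<Longrightarrow> ipd Z vs (D h j f) p = D h j (ipd Z vs f) p"
  unfolding D_def by (simp only: ipd_cmult ipd_diff sm_diff sm_shift ipd_shift)

text \<open>Mean value theorem in L2: the increment is the average of \<open>r\<close> times the
  derivative along the segment, and translations preserve the norm.\<close>

lemma slice_le_increment:
  assumes f: "sm f" and K: "slice_le t (pd Z (dx j) f) K"
  shows "slice_le t (\<lambda>p. f (p + (0, r *\<^sub>R axis j 1)) - f p) (r\<^sup>2 * K)"
proof -
  have t: "t \<in> {0..T}" "0 \<le> K" using K by (auto simp: slice_le_def)
  let ?d = "pd Z (dx j) f"
  have cd: "continuous_on Z ?d" by (intro sm_continuous sm_pd f dx_Basis)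
  have "continuous_on ({0..1} \<times> UNIV) (\<lambda>(s, x). ?d (t, x + (s * r) *\<^sub>R axis j 1))"
    unfolding split_beta by (intro continuous_on_compose2[OF cd] continuous_intros) (use t in \<open>auto simp: Z_eq\<close>)
  then have c: "continuous_on ({0..1} \<times> UNIV) (\<lambda>(s, x). complex_of_real r * ?d (t, x + (s * r) *\<^sub>R axis j 1))"
    by (auto simp: split_beta intro!: continuous_intros)
  show ?thesis
  proof (rule slice_le_average[OF t(1) _ _ c])
    show "continuous_on Z (\<lambda>p. f (p + (0, r *\<^sub>R axis j 1)) - f p)"
      using f by (intro sm_continuous sm_diff sm_shift)
    fix x
    have "((\<lambda>s. f (t, x + (s * r) *\<^sub>R axis j 1)) has_vector_derivative r *\<^sub>R ?d (t, x + (s * r) *\<^sub>R axis j 1)) (at s within {0..1})" for s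
    proof -
      have "((\<lambda>s. s * r) has_vector_derivative r) (at s within {0..1})"
        by (auto intro!: derivative_eq_intros simp: has_real_derivative_iff_has_vector_derivative[symmetric])
      from vector_diff_chain_within[OF this dx_slice[OF f t(1)]] show ?thesis by (simp add: o_def)
    qed
    then have "((\<lambda>s. r *\<^sub>R ?d (t, x + (s * r) *\<^sub>R axis j 1)) has_integral
       f (t, x + (1 * r) *\<^sub>R axis j 1) - f (t, x + (0 * r) *\<^sub>R axis j 1)) {0..1}"
      by (intro fundamental_theorem_of_calculus) auto
    from integral_unique[OF this]
    show "f ((t, x) + (0, r *\<^sub>R axis j 1)) - f (t, x) = integral {0..1} (\<lambda>s. complex_of_real r * ?d (t, x + (s * r) *\<^sub>R axis j 1))"
      unfolding scaleR_conv_of_real[symmetric, where 'a=complex] by (simp add: scaleR_conv_of_real[symmetric, where 'a=complex])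
  next
    fix s :: real
    have "slice_le t (\<lambda>p. complex_of_real r * ?d (p + (0, (s * r) *\<^sub>R axis j 1))) ((cmod (complex_of_real r))\<^sup>2 * K)"
      by (intro slice_le_cmult slice_le_shift K)
    then show "nsq (\<lambda>x. complex_of_real r * ?d (t, x + (s * r) *\<^sub>R axis j 1)) \<le> ennreal (r\<^sup>2 * K)"
      by (simp add: slice_le_def)
  qed (use t in auto)
qed

text \<open>The centred difference is a forward difference of step \<open>2 * h\<close>, translated
  by \<open>- h\<close>. This bound is free of \<open>h\<close> and keeps the energy estimate
  uniform in the step.\<close>

lemma slice_le_D:
  assumes f: "sm f" and K: "slice_le t (pd Z (dx j) f) K" and h: "h > 0"
  shows "slice_le t (D h j f) K"
proof -
  have "slice_le t (\<lambda>p. complex_of_real (1 / (2 * h)) * (\<lambda>p. f (p + (0, (2 * h) *\<^sub>R axis j 1)) - f p) (p + (0, - (h *\<^sub>R axis j 1))))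
     ((cmod (complex_of_real (1 / (2 * h))))\<^sup>2 * ((2 * h)\<^sup>2 * K))"
    by (intro slice_le_cmult slice_le_shift slice_le_increment f K)
  moreover have "(cmod (complex_of_real (1 / (2 * h))))\<^sup>2 * ((2 * h)\<^sup>2 * K) = K"
    unfolding norm_of_real power2_abs using h by (simp add: field_simps)
  moreover have "p + (0, - (h *\<^sub>R axis j 1)) + (0, (2 * h) *\<^sub>R axis j 1) = p + (0, h *\<^sub>R axis j 1)" for p :: "real \<times> (real^'a)"
    unfolding mult_2 scaleR_add_left by (cases p) simp
  ultimately show ?thesis unfolding D_def by (simp only: add.assoc)
qed

text \<open>At fixed step the difference is a bounded operator on L2, which is what makes the
  semi-discrete equation an ordinary differential equation. The bound explodes as \<open>h\<close>
  tends to 0; it serves the Picard iteration and the interpolation inequality.\<close>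

lemma slice_le_D_const:
  assumes K: "slice_le t f K" and h: "h > 0"
  shows "slice_le t (D h j f) (K / h\<^sup>2)"
proof -
  have "slice_le t (D h j f) ((cmod (complex_of_real (1 / (2 * h))))\<^sup>2 * (2 * K + 2 * K))"
    unfolding D_def by (intro slice_le_cmult slice_le_diff slice_le_shift K)
  then show ?thesis unfolding norm_of_real power2_abs using h by (simp add: field_simps power2_eq_square)
qed

text \<open>Consistency: \<open>D h j f\<close> is the average of the derivative over the segment
  from \<open>- h\<close> to \<open>h\<close>, parameterised by \<open>r\<close>, so the error is an
  average of increments of that derivative.\<close>

lemma slice_le_D_diff:
  assumes f: "sm f" and K: "slice_le t (pd Z (dx j) (pd Z (dx j) f)) K" and h: "h > 0"
  shows "slice_le t (\<lambda>p. D h j f p - pd Z (dx j) f p) (h\<^sup>2 * K)"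
proof -
  have t: "t \<in> {0..T}" "0 \<le> K" using K by (auto simp: slice_le_def)
  let ?d = "pd Z (dx j) f"
  have smd: "sm ?d" by (intro sm_pd f dx_Basis)
  note cd = sm_continuous[OF smd]
  define r where "r = (\<lambda>s. h * (2 * s - 1))"
  have c: "continuous_on ({0..1} \<times> UNIV) (\<lambda>(s, x). ?d (t, x + r s *\<^sub>R axis j 1) - ?d (t, x))"
    unfolding split_beta r_def
    by (intro continuous_on_diff continuous_on_compose2[OF cd] continuous_intros) (use t in \<open>auto simp: Z_eq\<close>)
  show ?thesis
  proof (rule slice_le_average[OF t(1) _ _ c])
    show "continuous_on Z (\<lambda>p. D h j f p - ?d p)"
      using f smd by (intro sm_continuous sm_diff sm_D)
    fix x
    have "((\<lambda>s. f (t, x + r s *\<^sub>R axis j 1)) has_vector_derivative (2 * h) *\<^sub>R ?d (t, x + r s *\<^sub>R axis j 1)) (at s within {0..1})" for s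
    proof -
      have "(r has_vector_derivative 2 * h) (at s within {0..1})" unfolding r_def
        by (auto intro!: derivative_eq_intros simp: has_real_derivative_iff_has_vector_derivative[symmetric])
      from vector_diff_chain_within[OF this dx_slice[OF f t(1)]] show ?thesis by (simp add: o_def)
    qed
    then have "((\<lambda>s. (2 * h) *\<^sub>R ?d (t, x + r s *\<^sub>R axis j 1)) has_integral
       f (t, x + r 1 *\<^sub>R axis j 1) - f (t, x + r 0 *\<^sub>R axis j 1)) {0..1}"
      by (intro fundamental_theorem_of_calculus) auto
    from has_integral_cmul[OF this, of "1 / (2 * h)"]
    have "((\<lambda>s. ?d (t, x + r s *\<^sub>R axis j 1)) has_integral
       (1 / (2 * h)) *\<^sub>R (f (t, x + h *\<^sub>R axis j 1) - f (t, x + (- h) *\<^sub>R axis j 1))) {0..1}"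
      using h by (simp add: r_def)
    then have "((\<lambda>s. ?d (t, x + r s *\<^sub>R axis j 1)) has_integral D h j f (t, x)) {0..1}"
      by (simp add: D_def scaleR_conv_of_real)
    from has_integral_diff[OF this has_integral_const_real[of "?d (t, x)" 0 1]]
    show "D h j f (t, x) - ?d (t, x) = integral {0..1} (\<lambda>s. ?d (t, x + r s *\<^sub>R axis j 1) - ?d (t, x))"
      by (simp add: integral_unique)
  next
    fix s :: real assume s: "s \<in> {0..1}"
    have "\<bar>r s\<bar> \<le> h"
      using s h mult_left_le[of "\<bar>2 * s - 1\<bar>" h] by (simp add: r_def abs_mult abs_le_iff)
    then have "(r s)\<^sup>2 \<le> h\<^sup>2"
      using h by (simp add: abs_le_square_iff[symmetric])
    then have "slice_le t (\<lambda>p. ?d (p + (0, r s *\<^sub>R axis j 1)) - ?d p) (h\<^sup>2 * K)"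
      by (intro slice_le_mono[OF slice_le_increment[OF smd K]] mult_right_mono t)
    then show "nsq (\<lambda>x. ?d (t, x + r s *\<^sub>R axis j 1) - ?d (t, x)) \<le> ennreal (h\<^sup>2 * K)"
      by (simp add: slice_le_def)
  qed (use t in auto)
qed

lemma slice_le_time_increment:
  assumes f: "sm f" and K: "\<And>u. u \<in> {0..T} \<Longrightarrow> slice_le u (pd Z dt f) K" and st: "s \<in> {0..T}" "t \<in> {0..T}"
  shows "nsq (\<lambda>x. f (s, x) - f (t, x)) \<le> ennreal ((s - t)\<^sup>2 * K)"
proof -
  let ?d = "pd Z dt f"
  define r where "r = (\<lambda>\<sigma>. t + \<sigma> * (s - t))"
  have r: "r \<sigma> \<in> {0..T}" if "\<sigma> \<in> {0..1}" for \<sigma>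
  proof -
    have "r \<sigma> = (1 - \<sigma>) * t + \<sigma> * s" by (simp add: r_def algebra_simps)
    then show ?thesis using convexD[OF convex_real_interval(5), of t 0 T s "1 - \<sigma>" \<sigma>] that st by simp
  qed
  have K0: "0 \<le> K" using K[OF st(1)] by (simp add: slice_le_def)
  have cd: "continuous_on Z ?d" by (intro sm_continuous sm_pd f dt_Basis)
  have "continuous_on ({0..1} \<times> UNIV) (\<lambda>(\<sigma>, x). ?d (r \<sigma>, x))"
    unfolding split_beta by (intro continuous_on_compose2[OF cd])
      (use r in \<open>auto simp: Z_eq r_def intro!: continuous_intros\<close>)
  then have c: "continuous_on ({0..1} \<times> UNIV) (\<lambda>(\<sigma>, x). complex_of_real (s - t) * ?d (r \<sigma>, x))"
    by (auto simp: split_beta intro!: continuous_intros)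
  have "nsq (\<lambda>x. integral {0..1} (\<lambda>\<sigma>. complex_of_real (s - t) * ?d (r \<sigma>, x))) \<le> ennreal (integral {0..1} (\<lambda>_::real. (s - t)\<^sup>2 * K))"
  proof (rule nsq_average)
    show "continuous_on ({0..1} \<times> UNIV) (\<lambda>(\<sigma>, x). complex_of_real (s - t) * ?d (r \<sigma>, x))" by (rule c)
    fix \<sigma> :: real assume "\<sigma> \<in> {0..1}"
    from slice_le_cmult[OF K[OF r[OF this]], of "complex_of_real (s - t)"]
    show "nsq (\<lambda>x. complex_of_real (s - t) * ?d (r \<sigma>, x)) \<le> ennreal ((s - t)\<^sup>2 * K)"
      unfolding slice_le_def norm_of_real power2_abs by simp
  qed (use K0 in auto)
  moreover have "f (s, x) - f (t, x) = integral {0..1} (\<lambda>\<sigma>. complex_of_real (s - t) * ?d (r \<sigma>, x))" for x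
  proof -
    have "((\<lambda>\<sigma>. f (r \<sigma>, x)) has_vector_derivative (s - t) *\<^sub>R ?d (r \<sigma>, x)) (at \<sigma> within {0..1})"
      if "\<sigma> \<in> {0..1}" for \<sigma>
    proof -
      have "(r has_vector_derivative s - t) (at \<sigma> within {0..1})" unfolding r_def
        by (auto intro!: derivative_eq_intros simp: has_real_derivative_iff_has_vector_derivative[symmetric])
      moreover have "((\<lambda>u. f (u, x)) has_vector_derivative ?d (r \<sigma>, x)) (at (r \<sigma>) within r ` {0..1})"
        by (rule has_vector_derivative_within_subset[OF dt_slice[OF f r[OF that]]]) (use r in auto)
      ultimately show ?thesis using vector_diff_chain_within by (fastforce simp: o_def)
    qed
    then have "((\<lambda>\<sigma>. (s - t) *\<^sub>R ?d (r \<sigma>, x)) has_integral f (r 1, x) - f (r 0, x)) {0..1}"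
      by (intro fundamental_theorem_of_calculus) auto
    from integral_unique[OF this] show ?thesis
      unfolding scaleR_conv_of_real[symmetric, where 'a=complex] by (simp add: r_def)
  qed
  ultimately show ?thesis by simp
qed

text \<open>Interpolation: the time derivative is a difference quotient minus an averaged increment
  of itself over the step. The quotient costs a multiple of \<open>K0 / h\<^sup>2\<close>, the
  increment a multiple of \<open>h\<^sup>2 * K2\<close>.\<close>

lemma slice_le_time_derivative:
  assumes f: "sm f" and K0: "\<And>t. t \<in> {0..T} \<Longrightarrow> slice_le t f K0"
    and K2: "\<And>t. t \<in> {0..T} \<Longrightarrow> slice_le t (pd Z dt (pd Z dt f)) K2"
    and h: "0 < h" "2 * h \<le> T" and t: "t \<in> {0..T}"
  shows "slice_le t (pd Z dt f) (8 * K0 / h\<^sup>2 + 2 * h\<^sup>2 * K2)"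
proof -
  let ?d = "pd Z dt f"
  have smd: "sm ?d" by (intro sm_pd f dt_Basis)
  note cd = sm_continuous[OF smd]
  \<comment> \<open>The step goes forward in the first half of the time interval and backward in the
    second; \<open>2 * h \<le> T\<close> keeps it inside.\<close>
  obtain k where k: "\<bar>k\<bar> = h" "t + k \<in> {0..T}"
  proof (cases "t \<le> T / 2")
    case True
    then show ?thesis using h t by (intro that[of h]) auto
  next
    case False
    then show ?thesis using h t by (intro that[of "-h"]) auto
  qed
  define r where "r = (\<lambda>\<sigma>. t + \<sigma> * k)"
  have r: "r \<sigma> \<in> {0..T}" if "\<sigma> \<in> {0..1}" for \<sigma>
  proof -
    have "r \<sigma> = (1 - \<sigma>) * t + \<sigma> * (t + k)" by (simp add: r_def algebra_simps)
    then show ?thesis using convexD[OF convex_real_interval(5), of t 0 T "t + k" "1 - \<sigma>" \<sigma>] that t k by simp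
  qed
  have nonneg: "0 \<le> K0" "0 \<le> K2" using K0[OF t] K2[OF t] by (auto simp: slice_le_def)
  have ck: "continuous_on ({0..1} \<times> UNIV) (\<lambda>(\<sigma>, x). ?d (r \<sigma>, x) - ?d (t, x))"
    unfolding split_beta by (intro continuous_on_diff continuous_on_compose2[OF cd])
      (use r t in \<open>auto simp: Z_eq r_def intro!: continuous_intros\<close>)
  define R where "R = (\<lambda>x. integral {0..1} (\<lambda>\<sigma>. ?d (r \<sigma>, x) - ?d (t, x)))"
  have R: "nsq R \<le> ennreal (integral {0..1} (\<lambda>_::real. h\<^sup>2 * K2))"
    unfolding R_def
  proof (rule nsq_average)
    show "continuous_on ({0..1} \<times> UNIV) (\<lambda>(\<sigma>, x). ?d (r \<sigma>, x) - ?d (t, x))" by (rule ck)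
    fix \<sigma> :: real assume \<sigma>: "\<sigma> \<in> {0..1}"
    have "(r \<sigma> - t)\<^sup>2 = \<sigma>\<^sup>2 * h\<^sup>2" using k by (simp add: r_def power_mult_distrib flip: power2_abs[of k])
    then have "(r \<sigma> - t)\<^sup>2 \<le> h\<^sup>2" using \<sigma> by (simp add: mult_left_le_one_le power_le_one)
    then have "ennreal ((r \<sigma> - t)\<^sup>2 * K2) \<le> ennreal (h\<^sup>2 * K2)"
      using nonneg by (intro ennreal_leI mult_right_mono)
    moreover have "nsq (\<lambda>x. ?d (r \<sigma>, x) - ?d (t, x)) \<le> ennreal ((r \<sigma> - t)\<^sup>2 * K2)"
      by (rule slice_le_time_increment[OF smd K2 r[OF \<sigma>] t])
    ultimately show "nsq (\<lambda>x. ?d (r \<sigma>, x) - ?d (t, x)) \<le> ennreal (h\<^sup>2 * K2)" by simp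
  qed (use nonneg in auto)
  have eq: "?d (t, x) = complex_of_real (1 / k) * (f (t + k, x) - f (t, x)) + (- 1) * R x" for x
  proof -
    have "((\<lambda>\<sigma>. f (r \<sigma>, x)) has_vector_derivative k *\<^sub>R ?d (r \<sigma>, x)) (at \<sigma> within {0..1})"
      if "\<sigma> \<in> {0..1}" for \<sigma>
    proof -
      have "(r has_vector_derivative k) (at \<sigma> within {0..1})" unfolding r_def
        by (auto intro!: derivative_eq_intros simp: has_real_derivative_iff_has_vector_derivative[symmetric])
      moreover have "((\<lambda>u. f (u, x)) has_vector_derivative ?d (r \<sigma>, x)) (at (r \<sigma>) within r ` {0..1})"
        by (rule has_vector_derivative_within_subset[OF dt_slice[OF f r[OF that]]]) (use r in auto)
      ultimately show ?thesis using vector_diff_chain_within by (fastforce simp: o_def)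
    qed
    then have "((\<lambda>\<sigma>. k *\<^sub>R ?d (r \<sigma>, x)) has_integral f (r 1, x) - f (r 0, x)) {0..1}"
      by (intro fundamental_theorem_of_calculus) auto
    from has_integral_cmul[OF this, of "1 / k"]
    have "((\<lambda>\<sigma>. ?d (r \<sigma>, x)) has_integral (1 / k) *\<^sub>R (f (t + k, x) - f (t, x))) {0..1}"
      using k h by (simp add: r_def split: if_splits)
    from has_integral_diff[OF this has_integral_const_real[of "?d (t, x)" 0 1]]
    have "R x = (1 / k) *\<^sub>R (f (t + k, x) - f (t, x)) - ?d (t, x)"
      by (simp add: R_def integral_unique)
    then show ?thesis by (simp add: scaleR_conv_of_real)
  qed
  have m: "(\<lambda>x. f (t + k, x)) \<in> borel_measurable borel" "(\<lambda>x. f (t, x)) \<in> borel_measurable borel"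
    "(\<lambda>x. ?d (t, x)) \<in> borel_measurable borel"
    using measurable_slice[OF sm_continuous[OF f]] measurable_slice[OF cd] k t by auto
  have "R = (\<lambda>x. complex_of_real (1 / k) * (f (t + k, x) - f (t, x)) - ?d (t, x))"
    using eq by auto
  then have mR[measurable]: "R \<in> borel_measurable borel" using m by simp
  have inc: "nsq (\<lambda>x. f (t + k, x) + (- 1) * f (t, x)) \<le> 2 * ennreal K0 + 2 * (ennreal (1\<^sup>2) * ennreal K0)"
  proof -
    have "nsq (\<lambda>x. f (t + k, x) + (- 1) * f (t, x)) \<le> 2 * nsq (\<lambda>x. f (t + k, x)) + 2 * nsq (\<lambda>x. (- 1) * f (t, x))"
      using m by (intro nsq_add) auto
    also have "\<dots> \<le> 2 * ennreal K0 + 2 * (ennreal (1\<^sup>2) * ennreal K0)"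
      using m K0[OF t] K0[OF k(2)]
      by (intro add_mono mult_left_mono order_trans[OF nsq_mult_le[where M=1]]) (auto simp: slice_le_def)
    finally show ?thesis .
  qed
  have "nsq (\<lambda>x. ?d (t, x)) \<le> 2 * nsq (\<lambda>x. complex_of_real (1 / k) * (f (t + k, x) - f (t, x))) + 2 * nsq (\<lambda>x. (- 1) * R x)"
    unfolding eq using m by (intro nsq_add) auto
  also have "\<dots> \<le> 2 * (ennreal ((1 / h)\<^sup>2) * nsq (\<lambda>x. f (t + k, x) + (- 1) * f (t, x))) + 2 * (ennreal (1\<^sup>2) * nsq R)"
    using m k h by (intro add_mono mult_left_mono order_trans[OF nsq_mult_le[where M="1/h"]] nsq_mult_le) (auto simp: norm_divide)
  also have "\<dots> \<le> 2 * (ennreal ((1 / h)\<^sup>2) * (2 * ennreal K0 + 2 * (ennreal (1\<^sup>2) * ennreal K0))) + 2 * (ennreal (1\<^sup>2) * ennreal (h\<^sup>2 * K2))"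
    using R inc by (intro add_mono mult_left_mono) auto
  also have "2 * (ennreal ((1 / h)\<^sup>2) * (2 * ennreal K0 + 2 * (ennreal (1\<^sup>2) * ennreal K0))) + 2 * (ennreal (1\<^sup>2) * ennreal (h\<^sup>2 * K2))
     = ennreal (2 * ((1 / h)\<^sup>2 * (2 * K0 + 2 * (1\<^sup>2 * K0))) + 2 * (1\<^sup>2 * (h\<^sup>2 * K2)))"
  proof -
    have "2 * (ennreal a * (2 * ennreal b + 2 * (ennreal c * ennreal b))) + 2 * (ennreal c * ennreal d)
      = ennreal (2 * (a * (2 * b + 2 * (c * b))) + 2 * (c * d))" if "0 \<le> a" "0 \<le> b" "0 \<le> c" "0 \<le> d" for a b c d
      using that by (simp add: ennreal_mult ennreal_plus)
    note * = this
    show ?thesis by (rule *) (use nonneg in auto)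
  qed
  finally have "nsq (\<lambda>x. ?d (t, x)) \<le> ennreal (8 * K0 / h\<^sup>2 + 2 * h\<^sup>2 * K2)"
    by (simp add: power_divide algebra_simps)
  then show ?thesis using t cd nonneg by (simp add: slice_le_def)
qed

text \<open>The same interpolation in space, where both shifted points always stay in
  \<open>Z\<close> and the centred difference can replace the one-sided quotient.\<close>

lemma slice_le_space_derivative:
  assumes f: "sm f" and K0: "slice_le t f K0" and K2: "slice_le t (pd Z (dx j) (pd Z (dx j) f)) K2" and h: "0 < h"
  shows "slice_le t (pd Z (dx j) f) (2 * (K0 / h\<^sup>2) + 2 * (h\<^sup>2 * K2))"
  using slice_le_diff[OF slice_le_D_const[OF K0 h, of j] slice_le_D_diff[OF f K2 h]] by simp

end

section \<open>Energy estimate\<close>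

lemma integral_shift:
  fixes f :: "'a::euclidean_space \<Rightarrow> real"
  assumes "integrable lborel f"
  shows "integrable lborel (\<lambda>x. f (x + y))" "(\<integral>x. f (x + y) \<partial>lborel) = (\<integral>x. f x \<partial>lborel)"
proof -
  have m[measurable]: "f \<in> borel_measurable borel" using assms by auto
  have "integrable (distr lborel borel ((+) y)) f" using assms by (simp add: lborel_distr_plus)
  then show "integrable lborel (\<lambda>x. f (x + y))"
    by (subst (asm) integrable_distr_eq) (auto simp: add.commute)
  have "(\<integral>x. f x \<partial>distr lborel borel ((+) y)) = (\<integral>x. f (y + x) \<partial>lborel)"
    by (subst integral_distr) auto
  then show "(\<integral>x. f (x + y) \<partial>lborel) = (\<integral>x. f x \<partial>lborel)"
    by (simp add: lborel_distr_plus add.commute)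
qed

definition sqi :: "('a::euclidean_space \<Rightarrow> complex) \<Rightarrow> bool" where
  "sqi w \<longleftrightarrow> continuous_on UNIV w \<and> nsq w < \<infinity>"

definition isq :: "('a::euclidean_space \<Rightarrow> complex) \<Rightarrow> real" where
  "isq w = (\<integral>x. (cmod (w x))\<^sup>2 \<partial>lborel)"

lemma isq_nonneg [simp]: "0 \<le> isq w"
  by (simp add: isq_def)

lemma sqi_measurable: "sqi w \<Longrightarrow> w \<in> borel_measurable borel"
  by (simp add: sqi_def borel_measurable_continuous_onI)

lemma sqi_integrable: "sqi w \<Longrightarrow> integrable lborel (\<lambda>x. (cmod (w x))\<^sup>2)"
  using sqi_measurable[of w] by (intro integrableI_bounded) (auto simp: sqi_def nsq_def)

lemma nsq_eq_isq: "sqi w \<Longrightarrow> nsq w = ennreal (isq w)"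
  unfolding nsq_def isq_def by (intro nn_integral_eq_integral sqi_integrable) auto

lemma isq_le: "sqi w \<Longrightarrow> nsq w \<le> ennreal K \<Longrightarrow> 0 \<le> K \<Longrightarrow> isq w \<le> K"
  by (simp add: nsq_eq_isq)

lemma sqi_shift: "sqi w \<Longrightarrow> sqi (\<lambda>x. w (x + y))"
  using sqi_measurable[of w] by (auto simp: sqi_def nsq_shift intro!: continuous_intros elim!: continuous_on_compose2)

lemma isq_shift: "sqi w \<Longrightarrow> isq (\<lambda>x. w (x + y)) = isq w"
  unfolding isq_def using integral_shift(2)[OF sqi_integrable, of w y] by simp

lemma inner_mult_le:
  fixes w u a :: complex
  assumes "cmod a \<le> \<gamma>"
  shows "\<bar>w \<bullet> (a * u)\<bar> \<le> \<gamma> / 2 * ((cmod w)\<^sup>2 + (cmod u)\<^sup>2)"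
proof -
  have "\<bar>w \<bullet> (a * u)\<bar> \<le> cmod w * cmod (a * u)" by (rule Cauchy_Schwarz_ineq2)
  also have "\<dots> \<le> \<gamma> * (cmod w * cmod u)"
    using assms by (simp add: norm_mult mult_right_mono mult.left_commute)
  also have "\<dots> \<le> \<gamma> * (((cmod w)\<^sup>2 + (cmod u)\<^sup>2) / 2)"
    using zero_le_power2[of "cmod w - cmod u"] order_trans[OF norm_ge_zero assms]
    by (intro mult_left_mono) (auto simp: power2_diff)
  finally show ?thesis by simp
qed

lemma inner_integrable:
  assumes w: "sqi w" and u: "sqi u" and a: "continuous_on UNIV a" "\<And>x. cmod (a x) \<le> \<gamma>"
  shows "integrable lborel (\<lambda>x. w x \<bullet> (a x * u x))"
proof (rule Bochner_Integration.integrable_bound)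
  show "integrable lborel (\<lambda>x. \<gamma> / 2 * ((cmod (w x))\<^sup>2 + (cmod (u x))\<^sup>2))"
    by (intro integrable_mult_right Bochner_Integration.integrable_add sqi_integrable w u)
  have [measurable]: "a \<in> borel_measurable borel" by (intro borel_measurable_continuous_onI a)
  show "(\<lambda>x. w x \<bullet> (a x * u x)) \<in> borel_measurable lborel"
    using sqi_measurable[OF w] sqi_measurable[OF u] by simp
  show "AE x in lborel. norm (w x \<bullet> (a x * u x)) \<le> norm (\<gamma> / 2 * ((cmod (w x))\<^sup>2 + (cmod (u x))\<^sup>2))"
    using inner_mult_le[OF a(2)] by (auto intro!: AE_I2 order_trans[OF _ abs_ge_self])
qed

lemma inner_integral_le:
  assumes w: "sqi w" and u: "sqi u" and a: "continuous_on UNIV a" "\<And>x. cmod (a x) \<le> \<gamma>"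
  shows "\<bar>\<integral>x. w x \<bullet> (a x * u x) \<partial>lborel\<bar> \<le> \<gamma> / 2 * (isq w + isq u)"
proof -
  have "\<bar>\<integral>x. w x \<bullet> (a x * u x) \<partial>lborel\<bar> \<le> (\<integral>x. \<bar>w x \<bullet> (a x * u x)\<bar> \<partial>lborel)"
    using integral_norm_bound[of lborel "\<lambda>x. w x \<bullet> (a x * u x)"] by simp
  also have "\<dots> \<le> (\<integral>x. \<gamma> / 2 * ((cmod (w x))\<^sup>2 + (cmod (u x))\<^sup>2) \<partial>lborel)"
    by (intro integral_mono inner_mult_le a integrable_abs inner_integrable[OF assms] integrable_mult_right
        Bochner_Integration.integrable_add sqi_integrable w u)
  also have "\<dots> = \<gamma> / 2 * (isq w + isq u)"
    unfolding isq_def by (simp add: sqi_integrable w u)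
  finally show ?thesis .
qed

text \<open>Summation by parts: the centred difference is skew, so only the increments of the
  Hermitian coefficient survive.\<close>

lemma centred_difference_estimate:
  fixes w :: "'m::finite \<Rightarrow> 'a::euclidean_space \<Rightarrow> complex" and a :: "'m \<Rightarrow> 'm \<Rightarrow> 'a \<Rightarrow> complex"
  assumes w: "\<And>k. sqi (w k)" and a: "\<And>k l. continuous_on UNIV (a k l)" "\<And>k l x. cmod (a k l x) \<le> M"
    and herm: "\<And>k l x. a k l x = cnj (a l k x)"
    and lip: "\<And>k l x. cmod (a k l x - a k l (x + y)) \<le> \<gamma> * h" and h: "h > 0"
  shows "\<bar>\<Sum>k\<in>UNIV. \<Sum>l\<in>UNIV. \<integral>x. w k x \<bullet> (a k l x * (complex_of_real (1 / (2 * h)) * (w l (x + y) - w l (x - y)))) \<partial>lborel\<bar>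
     \<le> \<gamma> / 2 * real CARD('m) * (\<Sum>k\<in>UNIV. isq (w k))"
proof -
  \<comment> \<open>Forward term, backward term, and forward term with translated coefficient.
    Translating \<open>Q k l\<close> by \<open>y\<close> and using Hermitian symmetry turns it into
    \<open>R l k\<close>, so that \<open>P - Q\<close> sums to \<open>P - R\<close>, where only an
    increment of the coefficient survives. That increment, at most \<open>\<gamma> * h\<close>,
    compensates the factor \<open>1 / (2 * h)\<close>.\<close>
  define P where "P = (\<lambda>k l x. w k x \<bullet> (a k l x * w l (x + y)))"
  define Q where "Q = (\<lambda>k l x. w k x \<bullet> (a k l x * w l (x - y)))"
  define R where "R = (\<lambda>k l x. w k x \<bullet> (a k l (x + y) * w l (x + y)))"
  have ay: "continuous_on UNIV (\<lambda>x. a k l (x + y))" for k l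
    by (rule continuous_on_compose2[OF a(1)]) (auto intro!: continuous_intros)
  have wm: "sqi (\<lambda>x. w l (x - y))" for l using sqi_shift[OF w, of l "-y"] by simp
  have iP: "integrable lborel (P k l)" for k l unfolding P_def by (rule inner_integrable[OF w sqi_shift[OF w] a])
  have iQ: "integrable lborel (Q k l)" for k l unfolding Q_def by (rule inner_integrable[OF w wm a])
  have iR: "integrable lborel (R k l)" for k l unfolding R_def by (rule inner_integrable[OF w sqi_shift[OF w] ay a(2)])
  \<comment> \<open>The inner product on the complex numbers is the real one, the real part of
    \<open>cnj u * v\<close>; the adjoint of multiplication by \<open>b\<close> is multiplication by
    \<open>cnj b\<close>.\<close>
  have sw: "u \<bullet> (b * v) = v \<bullet> (cnj b * u)" for u v b :: complex
    by (simp add: inner_complex_def algebra_simps)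
  have "(\<integral>x. Q k l x \<partial>lborel) = (\<integral>x. R l k x \<partial>lborel)" for k l
  proof -
    have "Q k l x = R l k (x + - y)" for x
      unfolding Q_def R_def using sw[of "w k x" "a k l x" "w l (x - y)"] herm[of l k x] by simp
    then have "(\<integral>x. Q k l x \<partial>lborel) = (\<integral>x. R l k (x + - y) \<partial>lborel)" by presburger
    then show ?thesis using integral_shift(2)[OF iR] by metis
  qed
  then have QR: "(\<Sum>k\<in>UNIV. \<Sum>l\<in>UNIV. \<integral>x. Q k l x \<partial>lborel) = (\<Sum>k\<in>UNIV. \<Sum>l\<in>UNIV. \<integral>x. R k l x \<partial>lborel)"
    by (subst sum.swap) simp
  have PR: "(\<integral>x. w k x \<bullet> ((a k l x - a k l (x + y)) * w l (x + y)) \<partial>lborel) = (\<integral>x. P k l x \<partial>lborel) - (\<integral>x. R k l x \<partial>lborel)" for k l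
    unfolding Bochner_Integration.integral_diff[OF iP iR, symmetric]
    by (simp add: P_def R_def inner_diff_right left_diff_distrib)
  have "(\<integral>x. w k x \<bullet> (a k l x * (complex_of_real (1 / (2 * h)) * (w l (x + y) - w l (x - y)))) \<partial>lborel)
    = 1 / (2 * h) * ((\<integral>x. P k l x \<partial>lborel) - (\<integral>x. Q k l x \<partial>lborel))" for k l
  proof -
    have "w k x \<bullet> (a k l x * (complex_of_real (1 / (2 * h)) * (w l (x + y) - w l (x - y)))) = 1 / (2 * h) * (P k l x - Q k l x)" for x
    proof -
      have "a k l x * (complex_of_real (1 / (2 * h)) * (w l (x + y) - w l (x - y)))
         = (1 / (2 * h)) *\<^sub>R (a k l x * w l (x + y) - a k l x * w l (x - y))"
        by (simp add: scaleR_conv_of_real algebra_simps)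
      then show ?thesis by (simp only: inner_scaleR_right inner_diff_right P_def Q_def)
    qed
    then show ?thesis using iP iQ by simp
  qed
  then have "(\<Sum>k\<in>UNIV. \<Sum>l\<in>UNIV. \<integral>x. w k x \<bullet> (a k l x * (complex_of_real (1 / (2 * h)) * (w l (x + y) - w l (x - y)))) \<partial>lborel)
    = 1 / (2 * h) * ((\<Sum>k\<in>UNIV. \<Sum>l\<in>UNIV. \<integral>x. P k l x \<partial>lborel) - (\<Sum>k\<in>UNIV. \<Sum>l\<in>UNIV. \<integral>x. Q k l x \<partial>lborel))"
    by (simp only: sum_distrib_left[symmetric] sum_subtractf)
  also have "\<dots> = 1 / (2 * h) * (\<Sum>k\<in>UNIV. \<Sum>l\<in>UNIV. \<integral>x. w k x \<bullet> ((a k l x - a k l (x + y)) * w l (x + y)) \<partial>lborel)"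
    by (simp only: QR PR sum_subtractf)
  finally have eq: "(\<Sum>k\<in>UNIV. \<Sum>l\<in>UNIV. \<integral>x. w k x \<bullet> (a k l x * (complex_of_real (1 / (2 * h)) * (w l (x + y) - w l (x - y)))) \<partial>lborel) = \<dots>" .
  have "\<bar>\<Sum>k\<in>UNIV. \<Sum>l\<in>UNIV. \<integral>x. w k x \<bullet> ((a k l x - a k l (x + y)) * w l (x + y)) \<partial>lborel\<bar>
     \<le> (\<Sum>k\<in>UNIV. \<Sum>l\<in>UNIV. \<gamma> * h / 2 * (isq (w k) + isq (w l)))"
  proof (intro order_trans[OF sum_abs] sum_mono)
    fix k l
    have "\<bar>\<integral>x. w k x \<bullet> ((a k l x - a k l (x + y)) * w l (x + y)) \<partial>lborel\<bar> \<le> \<gamma> * h / 2 * (isq (w k) + isq (\<lambda>x. w l (x + y)))"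
      by (rule inner_integral_le[OF w sqi_shift[OF w] continuous_on_diff[OF a(1) ay] lip])
    then show "\<bar>\<integral>x. w k x \<bullet> ((a k l x - a k l (x + y)) * w l (x + y)) \<partial>lborel\<bar> \<le> \<gamma> * h / 2 * (isq (w k) + isq (w l))"
      by (simp add: isq_shift w)
  qed
  also have "\<dots> = \<gamma> * h * real CARD('m) * (\<Sum>k\<in>UNIV. isq (w k))"
    unfolding sum_distrib_left[symmetric] sum.distrib sum_constant by (simp add: algebra_simps)
  finally show ?thesis unfolding eq abs_mult using h by (simp add: field_simps)
qed

context slab begin

lemma slice_le_sqi: "slice_le t f K \<Longrightarrow> sqi (\<lambda>x. f (t, x))"
  by (auto simp: slice_le_def sqi_def continuous_slice ennreal_less_top intro: le_less_trans)

lemma slice_le_isq: "slice_le t f K \<Longrightarrow> isq (\<lambda>x. f (t, x)) \<le> K"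
  using isq_le[OF slice_le_sqi, of t f K K] by (simp add: slice_le_def)

lemma isq_slice_le: "slice_le t f K \<Longrightarrow> isq (\<lambda>x. f (t, x)) \<le> L \<Longrightarrow> slice_le t f L"
  using nsq_eq_isq[OF slice_le_sqi, of t f K] order_trans[OF isq_nonneg, of _ L]
  by (auto simp: slice_le_def intro: ennreal_leI)

text \<open>Gronwall in integrated form. For fixed \<open>x\<close> the energy density with an
  integrating factor is differentiated in time alone; the fundamental theorem is then integrated
  over \<open>x\<close>, and interchanging the integrals avoids differentiating an L2 norm. The
  hypothesis \<open>ineq\<close> concerns interior times, because the symmetry of the coefficients
  is available only there.\<close>

lemma energy_estimate:
  fixes w :: "'i \<Rightarrow> real \<times> (real^'n::finite) \<Rightarrow> complex"
  assumes fin: "finite I" and w: "\<And>i. i \<in> I \<Longrightarrow> sm (w i)"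
    and Kw: "\<And>i t. i \<in> I \<Longrightarrow> t \<in> {0..T} \<Longrightarrow> slice_le t (w i) K"
    and Kd: "\<And>i t. i \<in> I \<Longrightarrow> t \<in> {0..T} \<Longrightarrow> slice_le t (pd Z dt (w i)) K"
    and c: "continuous_on {0..T} c" "\<And>s. s \<in> {0..T} \<Longrightarrow> 0 \<le> c s" and r: "0 \<le> r"
    and ineq: "\<And>s. s \<in> {0<..<T} \<Longrightarrow> 2 * (\<Sum>i\<in>I. \<integral>x. w i (s, x) \<bullet> pd Z dt (w i) (s, x) \<partial>lborel)
        \<le> c s * (\<Sum>i\<in>I. isq (\<lambda>x. w i (s, x))) + r"
    and t: "t \<in> {0..T}"
  shows "(\<Sum>i\<in>I. isq (\<lambda>x. w i (t, x))) \<le> exp (integral {0..T} c) * ((\<Sum>i\<in>I. isq (\<lambda>x. w i (0, x))) + T * r)"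
proof -
  define C where "C = (\<lambda>s. integral {0..s} c)"
  define wd where "wd = (\<lambda>i. pd Z dt (w i))"
  define e where "e = (\<lambda>s x. \<Sum>i\<in>I. (cmod (w i (s, x)))\<^sup>2)"
  \<comment> \<open>Time derivative of \<open>exp (- C s) * e s x\<close>, the energy density with
    the integrating factor belonging to \<open>c\<close>.\<close>
  define \<psi> where "\<psi> = (\<lambda>s x. exp (- C s) * (2 * (\<Sum>i\<in>I. w i (s, x) \<bullet> wd i (s, x)) - c s * e s x))"
  have smwd: "sm (wd i)" if "i \<in> I" for i unfolding wd_def by (intro sm_pd w that dt_Basis)
  have si: "sqi (\<lambda>x. w i (s, x))" "sqi (\<lambda>x. wd i (s, x))" if "i \<in> I" "s \<in> {0..T}" for i s
    using Kw[OF that] Kd[OF that] slice_le_sqi by (auto simp: wd_def)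
  have Cd: "(C has_vector_derivative c s) (at s within {0..T})" if "s \<in> {0..T}" for s
    unfolding C_def by (rule integral_has_vector_derivative[OF c(1) that])
  then have Cc: "continuous_on {0..T} C"
    by (metis continuous_on_eq_continuous_within has_vector_derivative_continuous)
  have C0: "C 0 = 0" by (simp add: C_def)
  have Cn: "0 \<le> C s" if "s \<in> {0..T}" for s
    unfolding C_def using c that by (intro integral_nonneg integrable_continuous_interval) (auto elim: continuous_on_subset)
  have CT: "C s \<le> integral {0..T} c" if "s \<in> {0..T}" for s
    unfolding C_def using c that
    by (intro integral_subset_le integrable_continuous_interval) (auto elim: continuous_on_subset)
  have FTC: "((\<lambda>s. \<psi> s x) has_integral exp (- C t) * e t x - e 0 x) {0..t}" for x
  proof -
    have "((\<lambda>s. exp (- C s) * e s x) has_vector_derivative \<psi> s x) (at s within {0..t})" if "s \<in> {0..t}" for s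
    proof -
      have s: "s \<in> {0..T}" "{0..t} \<subseteq> {0..T}" using that t by auto
      have d: "((\<lambda>s. w i (s, x)) has_derivative (\<lambda>h. h *\<^sub>R wd i (s, x))) (at s within {0..t})" if "i \<in> I" for i
        using has_vector_derivative_within_subset[OF dt_slice[OF w[OF that] s(1)] s(2)]
        by (simp add: has_vector_derivative_def wd_def)
      have "((\<lambda>s. e s x) has_derivative (\<lambda>h. \<Sum>i\<in>I. w i (s, x) \<bullet> (h *\<^sub>R wd i (s, x)) + (h *\<^sub>R wd i (s, x)) \<bullet> w i (s, x))) (at s within {0..t})"
        unfolding e_def power2_norm_eq_inner by (intro has_derivative_sum has_derivative_inner d)
      moreover have "(\<lambda>h. \<Sum>i\<in>I. w i (s, x) \<bullet> (h *\<^sub>R wd i (s, x)) + (h *\<^sub>R wd i (s, x)) \<bullet> w i (s, x))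
         = (\<lambda>h. h *\<^sub>R (2 * (\<Sum>i\<in>I. w i (s, x) \<bullet> wd i (s, x))))"
        by (auto simp: inner_commute sum_distrib_left algebra_simps)
      ultimately have ed: "((\<lambda>s. e s x) has_vector_derivative 2 * (\<Sum>i\<in>I. w i (s, x) \<bullet> wd i (s, x))) (at s within {0..t})"
        by (simp add: has_vector_derivative_def)
      have "(C has_real_derivative c s) (at s within {0..t})"
        using has_vector_derivative_within_subset[OF Cd[OF s(1)] s(2)]
        by (simp add: has_real_derivative_iff_has_vector_derivative)
      then show ?thesis using ed unfolding \<psi>_def has_real_derivative_iff_has_vector_derivative[symmetric]
        by (auto intro!: derivative_eq_intros simp: algebra_simps)
    qed
    from fundamental_theorem_of_calculus[OF _ this] t show ?thesis by (simp add: C0)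
  qed
  have cw: "continuous_on ({0..t} \<times> UNIV) (w i)" "continuous_on ({0..t} \<times> UNIV) (wd i)" if "i \<in> I" for i
    using sm_continuous[OF w[OF that]] sm_continuous[OF smwd[OF that]] t by (auto simp: Z_eq elim!: continuous_on_subset)
  have fstc: "continuous_on ({0..t} \<times> (UNIV :: (real^'n) set)) (\<lambda>z. g (fst z))" if "continuous_on {0..T} g" for g :: "real \<Rightarrow> real"
    by (rule continuous_on_compose2[OF that]) (use t in \<open>auto intro!: continuous_intros\<close>)
  have c\<psi>: "continuous_on ({0..t} \<times> UNIV) (\<lambda>(s, x). \<psi> s x)"
    unfolding \<psi>_def e_def split_beta prod.collapse
    by (intro continuous_intros fstc cw c Cc; assumption)
  obtain cm where cm: "\<And>s. s \<in> {0..T} \<Longrightarrow> c s \<le> cm" "0 \<le> cm"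
  proof -
    obtain s0 where "s0 \<in> {0..T}" "\<And>s. s \<in> {0..T} \<Longrightarrow> c s \<le> c s0"
      using continuous_attains_sup[of "{0..T}" c] c T_pos by auto
    then show ?thesis using c(2) by (intro that[of "c s0"]) auto
  qed
  let ?g = "\<lambda>(s, x). indicator {0..t} s *\<^sub>R \<psi> s x"
  have g: "?g = (\<lambda>z. indicator ({0..t} \<times> UNIV) z *\<^sub>R (\<lambda>(s, x). \<psi> s x) z)"
    by (auto simp: indicator_def)
  have m: "?g \<in> borel_measurable (lborel \<Otimes>\<^sub>M lborel)"
    unfolding g lborel_prod measurable_lborel2
    by (intro borel_measurable_continuous_on_indicator c\<psi>) (auto intro!: borel_closed closed_Times)
  have psib: "\<bar>\<psi> s x\<bar> \<le> (\<Sum>i\<in>I. (cm + 1) * (cmod (w i (s, x)))\<^sup>2 + (cmod (wd i (s, x)))\<^sup>2)" if "s \<in> {0..t}" for s x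
  proof -
    have s: "s \<in> {0..T}" using that t by auto
    have "\<bar>\<psi> s x\<bar> \<le> \<bar>2 * (\<Sum>i\<in>I. w i (s, x) \<bullet> wd i (s, x)) - c s * e s x\<bar>"
      unfolding \<psi>_def abs_mult using Cn[OF s] by (auto intro!: mult_left_le_one_le)
    also have "\<dots> \<le> 2 * (\<Sum>i\<in>I. \<bar>w i (s, x) \<bullet> wd i (s, x)\<bar>) + c s * e s x"
      using c(2)[OF s] by (intro order_trans[OF abs_triangle_ineq4] add_mono)
        (auto simp: abs_mult e_def sum_nonneg)
    also have "\<dots> \<le> 2 * (\<Sum>i\<in>I. 1 / 2 * ((cmod (w i (s, x)))\<^sup>2 + (cmod (wd i (s, x)))\<^sup>2)) + cm * e s x"
      using cm(1)[OF s] inner_mult_le[of 1 1]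
      by (intro add_mono mult_left_mono mult_right_mono sum_mono) (auto simp: e_def sum_nonneg)
    also have "\<dots> = (\<Sum>i\<in>I. (cm + 1) * (cmod (w i (s, x)))\<^sup>2 + (cmod (wd i (s, x)))\<^sup>2)"
      by (simp add: e_def sum_distrib_left sum.distrib algebra_simps)
    finally show ?thesis .
  qed
  have si': "integrable lborel (\<lambda>x. \<Sum>i\<in>I. (cm + 1) * (cmod (w i (s, x)))\<^sup>2 + (cmod (wd i (s, x)))\<^sup>2)"
    if "s \<in> {0..T}" for s
    by (intro Bochner_Integration.integrable_sum Bochner_Integration.integrable_add integrable_mult_right sqi_integrable si that)
  \<comment> \<open>Fubini needs integrability on the strip up to \<open>t\<close>: \<psi> is
    dominated by the squares of \<open>w\<close> and \<open>wd\<close>, whose slices are bounded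
    uniformly in time.\<close>
  have int: "integrable (lborel \<Otimes>\<^sub>M lborel) ?g"
  proof (rule integrableI_bounded[OF m])
    define KK where "KK = (\<Sum>i\<in>I. (cm + 1) * K + K)"
    have "(\<integral>\<^sup>+z. ennreal (norm (?g z)) \<partial>(lborel \<Otimes>\<^sub>M lborel)) = (\<integral>\<^sup>+s. \<integral>\<^sup>+x. ennreal (norm (?g (s, x))) \<partial>lborel \<partial>lborel)"
      by (rule lborel.nn_integral_fst[symmetric]) (use m in measurable)
    also have "\<dots> \<le> (\<integral>\<^sup>+s. ennreal KK * indicator {0..t} s \<partial>lborel)"
    proof (intro nn_integral_mono)
      fix s :: real
      show "(\<integral>\<^sup>+x. ennreal (norm (?g (s, x))) \<partial>lborel) \<le> ennreal KK * indicator {0..t} s"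
      proof (cases "s \<in> {0..t}")
        case True
        then have s: "s \<in> {0..T}" using t by auto
        have "(\<integral>\<^sup>+x. ennreal (norm (?g (s, x))) \<partial>lborel) \<le>
          (\<integral>\<^sup>+x. ennreal (\<Sum>i\<in>I. (cm + 1) * (cmod (w i (s, x)))\<^sup>2 + (cmod (wd i (s, x)))\<^sup>2) \<partial>lborel)"
          using psib[OF True] True by (intro nn_integral_mono ennreal_leI) auto
        also have "\<dots> = ennreal (\<integral>x. (\<Sum>i\<in>I. (cm + 1) * (cmod (w i (s, x)))\<^sup>2 + (cmod (wd i (s, x)))\<^sup>2) \<partial>lborel)"
          using cm by (intro nn_integral_eq_integral si' s) (auto intro!: AE_I2 sum_nonneg)
        also have "(\<integral>x. (\<Sum>i\<in>I. (cm + 1) * (cmod (w i (s, x)))\<^sup>2 + (cmod (wd i (s, x)))\<^sup>2) \<partial>lborel)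
          = (\<Sum>i\<in>I. (cm + 1) * isq (\<lambda>x. w i (s, x)) + isq (\<lambda>x. wd i (s, x)))"
          unfolding isq_def using si s by (simp add: sqi_integrable)
        also have "\<dots> \<le> KK"
          unfolding KK_def using slice_le_isq[OF Kw[OF _ s]] slice_le_isq[OF Kd[OF _ s]] cm
          by (intro sum_mono add_mono mult_left_mono) (auto simp: wd_def)
        finally show ?thesis using True by (simp add: ennreal_leI)
      qed auto
    qed
    also have "\<dots> < \<infinity>" using t by (simp add: nn_integral_cmult ennreal_mult_less_top)
    finally show "(\<integral>\<^sup>+z. ennreal (norm (?g z)) \<partial>(lborel \<Otimes>\<^sub>M lborel)) < \<infinity>" .
  qed
  have "(\<integral>x. (\<integral>s. indicator {0..t} s *\<^sub>R \<psi> s x \<partial>lborel) \<partial>lborel) = (\<integral>s. (\<integral>x. indicator {0..t} s *\<^sub>R \<psi> s x \<partial>lborel) \<partial>lborel)"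
    by (rule lborel_pair.Fubini_integral[OF int])
  moreover have "(\<integral>s. indicator {0..t} s *\<^sub>R \<psi> s x \<partial>lborel) = exp (- C t) * e t x - e 0 x" for x
  proof -
    have "continuous_on {0..t} (\<lambda>s. \<psi> s x)"
    proof -
      have "continuous_on {0..t} (\<lambda>s. (s, x))" by (intro continuous_intros)
      from continuous_on_compose2[OF c\<psi> this] show ?thesis by auto
    qed
    then have "set_integrable lborel {0..t} (\<lambda>s. \<psi> s x)"
      by (intro borel_integrable_atLeastAtMost')
    from set_borel_integral_eq_integral(2)[OF this] FTC[of x] show ?thesis
      by (simp add: set_lebesgue_integral_def integral_unique)
  qed
  moreover have "(\<integral>x. exp (- C t) * e t x - e 0 x \<partial>lborel) = exp (- C t) * (\<Sum>i\<in>I. isq (\<lambda>x. w i (t, x))) - (\<Sum>i\<in>I. isq (\<lambda>x. w i (0, x)))"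
    unfolding e_def isq_def using si t T_pos by (simp add: sqi_integrable)
  moreover have "(\<integral>s. (\<integral>x. indicator {0..t} s *\<^sub>R \<psi> s x \<partial>lborel) \<partial>lborel) \<le> (\<integral>s. indicator {0..t} s *\<^sub>R r \<partial>lborel)"
  proof (rule integral_mono_AE)
    show "integrable lborel (\<lambda>s. \<integral>x. indicator {0..t} s *\<^sub>R \<psi> s x \<partial>lborel)"
      using lborel_pair.integrable_fst'[OF int] by simp
    show "integrable lborel (\<lambda>s. indicator {0..t} s *\<^sub>R r)"
      using t by (intro integrable_scaleR_left integrable_real_indicator) auto
    \<comment> \<open>The two endpoint times form a null set, so interior times suffice.\<close>
    have *: "(\<integral>x. indicator {0..t} s *\<^sub>R \<psi> s x \<partial>lborel) \<le> indicator {0..t} s *\<^sub>R r" if "s \<noteq> 0" "s \<noteq> T" for s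
    proof (cases "s \<in> {0..t}")
      case True
      then have s: "s \<in> {0<..<T}" "s \<in> {0..T}" using that t by auto
      have "(\<integral>x. \<psi> s x \<partial>lborel) = exp (- C s) * (2 * (\<Sum>i\<in>I. \<integral>x. w i (s, x) \<bullet> wd i (s, x) \<partial>lborel) - c s * (\<Sum>i\<in>I. isq (\<lambda>x. w i (s, x))))"
      proof -
        have "integrable lborel (\<lambda>x. w i (s, x) \<bullet> wd i (s, x))" if "i \<in> I" for i
          using inner_integrable[OF si(1)[OF that s(2)] si(2)[OF that s(2)], of "\<lambda>_. 1" 1] by simp
        moreover have "integrable lborel (\<lambda>x. (cmod (w i (s, x)))\<^sup>2)" if "i \<in> I" for i
          by (rule sqi_integrable[OF si(1)[OF that s(2)]])
        ultimately show ?thesis unfolding \<psi>_def e_def isq_def by simp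
      qed
      also have "\<dots> \<le> exp (- C s) * r"
        using ineq[OF s(1)] by (intro mult_left_mono) (auto simp: wd_def)
      also have "\<dots> \<le> r" using Cn[OF s(2)] r by (auto intro!: mult_left_le_one_le)
      finally show ?thesis using True by simp
    qed auto
    have "AE s in lborel. s \<noteq> (0::real)" "AE s in lborel. s \<noteq> T"
      by (auto intro: AE_lborel_singleton)
    then show "AE s in lborel. (\<integral>x. indicator {0..t} s *\<^sub>R \<psi> s x \<partial>lborel) \<le> indicator {0..t} s *\<^sub>R r"
      by eventually_elim (rule *)
  qed
  moreover have "(\<integral>s. indicator {0..t} s *\<^sub>R r \<partial>lborel) = t * r" using t by simp
  ultimately have "exp (- C t) * (\<Sum>i\<in>I. isq (\<lambda>x. w i (t, x))) \<le> (\<Sum>i\<in>I. isq (\<lambda>x. w i (0, x))) + t * r"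
    using t by simp
  then have "exp (C t) * (exp (- C t) * (\<Sum>i\<in>I. isq (\<lambda>x. w i (t, x)))) \<le> exp (C t) * ((\<Sum>i\<in>I. isq (\<lambda>x. w i (0, x))) + t * r)"
    by (intro mult_left_mono) auto
  also have "\<dots> \<le> exp (integral {0..T} c) * ((\<Sum>i\<in>I. isq (\<lambda>x. w i (0, x))) + T * r)"
    using CT[OF t] t r by (intro mult_mono add_mono mult_right_mono) (auto intro!: add_nonneg_nonneg sum_nonneg)
  finally show ?thesis by (simp add: mult.assoc[symmetric] exp_add[symmetric])
qed

end

section \<open>Energy estimate for derivatives of order \<open>N\<close>\<close>

text \<open>There are \<open>m * n ^ N\<close> components of order \<open>N\<close> and at most
  \<open>2 ^ N\<close> commutator terms per product. The summands come in turn from the source term,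
  the principal part, the zeroth-order part, the sums of data over all components, and the
  commutators with \<open>A\<close> and with \<open>B\<close>. Only counting enters, hence
  independence of \<epsilon>, of the step and of the coefficients.\<close>

definition order_const :: "nat \<Rightarrow> nat \<Rightarrow> nat \<Rightarrow> real" where
  "order_const n m N = real (1 + n * m + m + m * n ^ N + 2 * ((m * n ^ N) * (n * m * 2 ^ N)) + (m * n ^ N) * (m * 2 ^ N))"

context slab begin

definition semi_op :: "real \<Rightarrow> ('n::finite \<Rightarrow> 'm::finite \<Rightarrow> 'm \<Rightarrow> real \<times> (real^'n) \<Rightarrow> complex) \<Rightarrow>
    ('m \<Rightarrow> 'm \<Rightarrow> real \<times> (real^'n) \<Rightarrow> complex) \<Rightarrow> ('m \<Rightarrow> real \<times> (real^'n) \<Rightarrow> complex) \<Rightarrow> 'm \<Rightarrow> real \<times> (real^'n) \<Rightarrow> complex" where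
  "semi_op h A B U k = (\<lambda>p. (\<Sum>j\<in>UNIV. \<Sum>l\<in>UNIV. A j k l p * D h j (U l) p) + (\<Sum>l\<in>UNIV. B k l p * U l p))"

lemma range_dx_Basis [intro]: "v \<in> range dx \<Longrightarrow> v \<in> Basis"
  by auto

lemma sm_semi_op:
  assumes "\<And>j k l. sm (A j k l)" "\<And>k l. sm (B k l)" "\<And>l. sm (U l)"
  shows "sm (semi_op h A B U k)"
  unfolding semi_op_def by (intro sm_add sm_sum sm_mult sm_D assms)

lemma psplits_Basis:
  assumes "vs \<in> lists S" "(a, b) \<in> set (psplits vs)"
  shows "a \<in> lists S" "b \<in> lists S"
  using assms psplits_props[OF assms(2)] by (auto simp: in_lists_conv_set)

lemma ipd_mult_D:
  assumes "sm f" "sm g" "vs \<in> lists Basis" "p \<in> Z"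
  shows "ipd Z vs (\<lambda>q. f q * D h j g q) p
    = f p * D h j (ipd Z vs g) p + (\<Sum>(a, b)\<leftarrow>psplits vs. ipd Z a f p * D h j (ipd Z b g) p)"
proof -
  have "map (\<lambda>(a, b). ipd Z a f p * ipd Z b (D h j g) p) (psplits vs) = map (\<lambda>(a, b). ipd Z a f p * D h j (ipd Z b g) p) (psplits vs)"
    using psplits_Basis[OF assms(3)] assms by (auto simp: ipd_D)
  from arg_cong[OF this, of sum_list] show ?thesis using assms by (simp only: ipd_mult sm_D ipd_D)
qed

text \<open>Principal part and its commutator, zeroth-order part and its commutator. The energy
  estimate treats these four sums separately, as \<open>f1\<close> to \<open>f4\<close>.\<close>

lemma ipd_semi_op:
  assumes "\<And>j k l. sm (A j k l)" "\<And>k l. sm (B k l)" "\<And>l. sm (U l)" "vs \<in> lists Basis" "p \<in> Z"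
  shows "ipd Z vs (semi_op h A B U k) p =
    (\<Sum>j\<in>UNIV. \<Sum>l\<in>UNIV. A j k l p * D h j (ipd Z vs (U l)) p) +
    (\<Sum>j\<in>UNIV. \<Sum>l\<in>UNIV. \<Sum>(a, b)\<leftarrow>psplits vs. ipd Z a (A j k l) p * D h j (ipd Z b (U l)) p) +
    ((\<Sum>l\<in>UNIV. B k l p * ipd Z vs (U l) p) +
    (\<Sum>l\<in>UNIV. \<Sum>(a, b)\<leftarrow>psplits vs. ipd Z a (B k l) p * ipd Z b (U l) p))"
proof -
  have "ipd Z vs (semi_op h A B U k) p = (\<Sum>j\<in>UNIV. \<Sum>l\<in>UNIV. ipd Z vs (\<lambda>q. A j k l q * D h j (U l) q) p)
      + (\<Sum>l\<in>UNIV. ipd Z vs (\<lambda>q. B k l q * U l q) p)"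
    unfolding semi_op_def using assms by (simp add: ipd_add ipd_sum sm_sum sm_mult sm_D)
  then show ?thesis
    unfolding ipd_mult_D[OF assms(1,3,4,5)] ipd_mult[OF assms(2,3,4,5)] by (simp only: sum.distrib)
qed

definition slice_L2 :: "real \<Rightarrow> (real \<times> (real^'n::finite) \<Rightarrow> complex) \<Rightarrow> bool" where
  "slice_L2 t f \<longleftrightarrow> (\<exists>K. slice_le t f K)"

definition slice_inner :: "real \<Rightarrow> (real \<times> (real^'n::finite) \<Rightarrow> complex) \<Rightarrow> (real \<times> (real^'n) \<Rightarrow> complex) \<Rightarrow> real" where
  "slice_inner t f g = (\<integral>x. f (t, x) \<bullet> g (t, x) \<partial>lborel)"

abbreviation slice_norm2 :: "real \<Rightarrow> (real \<times> (real^'n::finite) \<Rightarrow> complex) \<Rightarrow> real" where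
  "slice_norm2 t f \<equiv> isq (\<lambda>x. f (t, x))"

lemma slice_L2_sqi: "slice_L2 t f \<Longrightarrow> sqi (\<lambda>x. f (t, x))"
  unfolding slice_L2_def using slice_le_sqi by blast

lemma slice_L2_t: "slice_L2 t f \<Longrightarrow> t \<in> {0..T}"
  by (auto simp: slice_L2_def slice_le_def)

lemma slice_L2_add: "slice_L2 t f \<Longrightarrow> slice_L2 t g \<Longrightarrow> slice_L2 t (\<lambda>p. f p + g p)"
  and slice_L2_diff: "slice_L2 t f \<Longrightarrow> slice_L2 t g \<Longrightarrow> slice_L2 t (\<lambda>p. f p - g p)"
  unfolding slice_L2_def using slice_le_add slice_le_diff by blast+

lemma slice_L2_mult: "slice_L2 t f \<Longrightarrow> continuous_on Z a \<Longrightarrow> (\<And>p. p \<in> Z \<Longrightarrow> cmod (a p) \<le> M) \<Longrightarrow> slice_L2 t (\<lambda>p. a p * f p)"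
  unfolding slice_L2_def using slice_le_mult by blast

lemma slice_L2_sum: "t \<in> {0..T} \<Longrightarrow> (\<And>i. i \<in> S \<Longrightarrow> slice_L2 t (f i)) \<Longrightarrow> slice_L2 t (\<lambda>p. \<Sum>i\<in>S. f i p)"
proof (induction S rule: infinite_finite_induct)
  case (insert i S)
  then show ?case by (simp add: slice_L2_add)
qed (auto simp: slice_L2_def intro!: exI[of _ 0] slice_le_zero)

lemma slice_L2_sum_list: "t \<in> {0..T} \<Longrightarrow> (\<And>i. i \<in> set S \<Longrightarrow> slice_L2 t (f i)) \<Longrightarrow> slice_L2 t (\<lambda>p. \<Sum>i\<leftarrow>S. f i p)"
proof (induction S)
  case (Cons i S)
  then show ?case by (simp add: slice_L2_add)
qed (auto simp: slice_L2_def intro!: exI[of _ 0] slice_le_zero)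

lemma slice_L2_D: "slice_L2 t f \<Longrightarrow> h > 0 \<Longrightarrow> slice_L2 t (D h j f)"
  unfolding slice_L2_def using slice_le_D_const by blast

lemma slice_inner_integrable: "slice_L2 t f \<Longrightarrow> slice_L2 t g \<Longrightarrow> integrable lborel (\<lambda>x. f (t, x) \<bullet> g (t, x))"
  using inner_integrable[OF slice_L2_sqi slice_L2_sqi, of t f t g "\<lambda>_. 1" 1] by simp

lemma slice_inner_add: "slice_L2 t f \<Longrightarrow> slice_L2 t g \<Longrightarrow> slice_L2 t g' \<Longrightarrow> slice_inner t f (\<lambda>p. g p + g' p) = slice_inner t f g + slice_inner t f g'"
  unfolding slice_inner_def inner_add_right by (intro Bochner_Integration.integral_add slice_inner_integrable)

lemma slice_inner_diff: "slice_L2 t f \<Longrightarrow> slice_L2 t g \<Longrightarrow> slice_L2 t g' \<Longrightarrow> slice_inner t f (\<lambda>p. g p - g' p) = slice_inner t f g - slice_inner t f g'"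
  unfolding slice_inner_def inner_diff_right by (intro Bochner_Integration.integral_diff slice_inner_integrable)

lemma slice_inner_sum: "slice_L2 t f \<Longrightarrow> (\<And>i. i \<in> S \<Longrightarrow> slice_L2 t (g i)) \<Longrightarrow> slice_inner t f (\<lambda>p. \<Sum>i\<in>S. g i p) = (\<Sum>i\<in>S. slice_inner t f (g i))"
proof (induction S rule: infinite_finite_induct)
  case (insert i S)
  then have "slice_L2 t (\<lambda>p. \<Sum>i\<in>S. g i p)" using slice_L2_t by (intro slice_L2_sum) auto
  with insert show ?case by (simp add: slice_inner_add)
qed (auto simp: slice_inner_def)

lemma slice_inner_sum_list: "slice_L2 t f \<Longrightarrow> (\<And>i. i \<in> set S \<Longrightarrow> slice_L2 t (g i)) \<Longrightarrow> slice_inner t f (\<lambda>p. \<Sum>i\<leftarrow>S. g i p) = (\<Sum>i\<leftarrow>S. slice_inner t f (g i))"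
proof (induction S)
  case (Cons i S)
  then have "slice_L2 t (\<lambda>p. \<Sum>i\<leftarrow>S. g i p)" using slice_L2_t by (intro slice_L2_sum_list) auto
  with Cons show ?case by (simp add: slice_inner_add)
qed (auto simp: slice_inner_def)

lemma slice_inner_le: "slice_L2 t f \<Longrightarrow> slice_L2 t g \<Longrightarrow> 2 * \<bar>slice_inner t f g\<bar> \<le> slice_norm2 t f + slice_norm2 t g"
  unfolding slice_inner_def using inner_integral_le[OF slice_L2_sqi slice_L2_sqi, of t f t g "\<lambda>_. 1" 1] by simp

lemma slice_inner_sum_bound:
  assumes "finite S" "slice_L2 t f" "\<And>i. i \<in> S \<Longrightarrow> slice_L2 t (g i)" "\<And>i. i \<in> S \<Longrightarrow> 2 * \<bar>slice_inner t f (g i)\<bar> \<le> X"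
  shows "2 * \<bar>slice_inner t f (\<lambda>p. \<Sum>i\<in>S. g i p)\<bar> \<le> real (card S) * X"
proof -
  have "2 * \<bar>slice_inner t f (\<lambda>p. \<Sum>i\<in>S. g i p)\<bar> \<le> (\<Sum>i\<in>S. 2 * \<bar>slice_inner t f (g i)\<bar>)"
    using slice_inner_sum[of t f S g] assms(2,3) sum_abs[of "\<lambda>i. slice_inner t f (g i)" S] by (simp add: sum_distrib_left[symmetric])
  also have "\<dots> \<le> real (card S) * X" using assms(4) by (rule sum_bounded_above)
  finally show ?thesis .
qed

lemma slice_inner_sum_list_bound:
  assumes "slice_L2 t f" "\<And>i. i \<in> set S \<Longrightarrow> slice_L2 t (g i)" "\<And>i. i \<in> set S \<Longrightarrow> 2 * \<bar>slice_inner t f (g i)\<bar> \<le> X"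
    and "real (length S) \<le> P" "0 \<le> X"
  shows "2 * \<bar>slice_inner t f (\<lambda>p. \<Sum>i\<leftarrow>S. g i p)\<bar> \<le> P * X"
proof -
  have "2 * \<bar>\<Sum>i\<leftarrow>S. slice_inner t f (g i)\<bar> \<le> real (length S) * X"
    using assms(3)
  proof (induction S)
    case (Cons i S)
    then have "2 * \<bar>\<Sum>i\<leftarrow>S. slice_inner t f (g i)\<bar> \<le> real (length S) * X" "2 * \<bar>slice_inner t f (g i)\<bar> \<le> X" by auto
    then show ?case
      using abs_triangle_ineq[of "slice_inner t f (g i)" "\<Sum>i\<leftarrow>S. slice_inner t f (g i)"] by (simp add: algebra_simps)
  qed auto
  also have "\<dots> \<le> P * X" using assms by (intro mult_right_mono) auto
  finally show ?thesis using slice_inner_sum_list[of t f S g] assms(1,2) by simp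
qed

lemma slice_inner_mult_le:
  assumes "slice_L2 t f" "slice_L2 t g" "continuous_on Z a" "\<And>x. cmod (a (t, x)) \<le> \<gamma>"
  shows "2 * \<bar>slice_inner t f (\<lambda>p. a p * g p)\<bar> \<le> \<gamma> * (slice_norm2 t f + slice_norm2 t g)"
  unfolding slice_inner_def
  using inner_integral_le[OF slice_L2_sqi slice_L2_sqi, OF assms(1,2) continuous_slice[OF assms(3) slice_L2_t[OF assms(1)]] assms(4)] by simp

lemma slice_inner_cong: "t \<in> {0..T} \<Longrightarrow> (\<And>p. p \<in> Z \<Longrightarrow> g p = g' p) \<Longrightarrow> slice_inner t f g = slice_inner t f g'"
  by (simp add: slice_inner_def Z_eq)

lemma slice_le_slice_norm2: "slice_le t f K \<Longrightarrow> slice_norm2 t f \<le> K"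
  by (rule slice_le_isq)

lemma slice_norm2_D_le:
  assumes "sm f" "slice_L2 t (pd Z (dx j) f)" "h > 0"
  shows "slice_norm2 t (D h j f) \<le> slice_norm2 t (pd Z (dx j) f)"
proof -
  obtain K where "slice_le t (pd Z (dx j) f) K" using assms(2) by (auto simp: slice_L2_def)
  from isq_slice_le[OF this order_refl] show ?thesis by (intro slice_le_slice_norm2 slice_le_D assms)
qed

lemma slice_norm2_mult_le:
  assumes "slice_L2 t f" "continuous_on Z a" "\<And>p. p \<in> Z \<Longrightarrow> cmod (a p) \<le> M"
  shows "slice_norm2 t (\<lambda>p. a p * f p) \<le> M\<^sup>2 * slice_norm2 t f"
proof -
  obtain K where "slice_le t f K" using assms(1) by (auto simp: slice_L2_def)
  from isq_slice_le[OF this order_refl] show ?thesis by (intro slice_le_slice_norm2 slice_le_mult assms)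
qed

lemma vector_increment_le:
  fixes f :: "real \<Rightarrow> 'b::real_normed_vector"
  assumes "a \<le> b" "continuous_on {a..b} f"
    and "\<And>x. x \<in> {a<..<b} \<Longrightarrow> (f has_vector_derivative f' x) (at x)"
    and "\<And>x. x \<in> {a<..<b} \<Longrightarrow> norm (f' x) \<le> \<gamma>"
  shows "norm (f b - f a) \<le> \<gamma> * (b - a)"
proof (cases "a = b")
  case False
  have "norm (f b - f a) \<le> \<gamma> * b - \<gamma> * a"
    by (rule differentiable_bound_general[of a b f "\<lambda>x. \<gamma> * x" f' "\<lambda>_. \<gamma>"])
      (use assms False in \<open>auto intro!: continuous_intros derivative_eq_intros
        simp: has_real_derivative_iff_has_vector_derivative[symmetric]\<close>)
  then show ?thesis by (simp add: algebra_simps)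
qed auto

lemma space_increment_le:
  assumes f: "sm f" and t: "t \<in> {0..T}" and b: "\<And>x. cmod (pd Z (dx j) f (t, x)) \<le> \<gamma>" and h: "h > 0"
  shows "cmod (f (t, x) - f (t, x + h *\<^sub>R axis j 1)) \<le> \<gamma> * h"
proof -
  have d: "((\<lambda>r. f (t, x + r *\<^sub>R axis j 1)) has_vector_derivative pd Z (dx j) f (t, x + r *\<^sub>R axis j 1)) (at r)" for r
    by (rule dx_slice[OF f t])
  have "cmod (f (t, x + h *\<^sub>R axis j 1) - f (t, x + 0 *\<^sub>R axis j 1)) \<le> \<gamma> * (h - 0)"
    by (rule vector_increment_le[OF _ _ d b])
      (use h d in \<open>auto intro!: continuous_at_imp_continuous_on has_vector_derivative_continuous\<close>)
  then show ?thesis by (simp add: norm_minus_commute)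
qed

text \<open>All space derivatives of order \<open>N\<close> are estimated together, since the
  commutator with one derivative on \<open>A\<close> couples them. The exponent contains
  \<open>c\<close> but not \<open>M\<close>: next to unknowns of order \<open>N\<close> the
  coefficients enter only through the skewness of the centred difference, through \<open>B\<close>
  plus its adjoint, and through single derivatives of \<open>A\<close>. Wherever \<open>M\<close>
  occurs it multiplies the lower-order bound \<open>Y\<close>. The bound \<open>K\<close> secures
  the integrability on which the energy identity rests.\<close>

lemma order_estimate:
  fixes A :: "'n::finite \<Rightarrow> 'm::finite \<Rightarrow> 'm \<Rightarrow> real \<times> (real^'n) \<Rightarrow> complex"
  assumes smA: "\<And>j k l. sm (A j k l)" and smB: "\<And>k l. sm (B k l)" and smU: "\<And>l. sm (U l)"
    and h: "h > 0"
    and herm: "\<And>j k l s x. s \<in> {0<..<T} \<Longrightarrow> A j k l (s, x) = cnj (A j l k (s, x))"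
    and cA: "\<And>i j k l s x. s \<in> {0<..<T} \<Longrightarrow> cmod (pd Z (dx i) (A j k l) (s, x)) \<le> c s"
    and cB: "\<And>k l s x. s \<in> {0<..<T} \<Longrightarrow> cmod (B k l (s, x) + cnj (B l k (s, x))) \<le> c s"
    and c: "continuous_on {0..T} c" "\<And>s. s \<in> {0..T} \<Longrightarrow> 0 \<le> c s"
    and MA: "\<And>vs j k l p. vs \<in> lists (range dx) \<Longrightarrow> length vs \<le> N \<Longrightarrow> p \<in> Z \<Longrightarrow> cmod (ipd Z vs (A j k l) p) \<le> M"
    and MB: "\<And>vs k l p. vs \<in> lists (range dx) \<Longrightarrow> length vs \<le> N \<Longrightarrow> p \<in> Z \<Longrightarrow> cmod (ipd Z vs (B k l) p) \<le> M"
    and eq: "\<And>vs l p. vs \<in> lists (range dx) \<Longrightarrow> length vs = N \<Longrightarrow> p \<in> Z \<Longrightarrow>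
       pd Z dt (ipd Z vs (U l)) p = ipd Z vs (H l) p - ipd Z vs (semi_op h A B U l) p"
    and KU: "\<And>vs l t. vs \<in> lists Basis \<Longrightarrow> length vs \<le> Suc N \<Longrightarrow> t \<in> {0..T} \<Longrightarrow> slice_le t (ipd Z vs (U l)) K"
    and init: "\<And>vs l. vs \<in> lists (range dx) \<Longrightarrow> length vs = N \<Longrightarrow> slice_le 0 (ipd Z vs (U l)) I0"
    and hH: "\<And>vs l t. vs \<in> lists (range dx) \<Longrightarrow> length vs = N \<Longrightarrow> t \<in> {0..T} \<Longrightarrow> slice_le t (ipd Z vs (H l)) L"
    and low: "\<And>vs l t. vs \<in> lists (range dx) \<Longrightarrow> length vs < N \<Longrightarrow> t \<in> {0..T} \<Longrightarrow> slice_le t (ipd Z vs (U l)) Y"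
    and nonneg: "0 \<le> I0" "0 \<le> L" "0 \<le> Y"
    and vs: "vs \<in> lists (range dx)" "length vs = N" and t: "t \<in> {0..T}"
  defines "C \<equiv> order_const CARD('n) CARD('m) N"
  shows "slice_le t (ipd Z vs (U l)) (exp (C * (T + integral {0..T} c)) * (C * I0 + T * (C * (L + M\<^sup>2 * Y))))"
proof -
  define LL where "LL = {vs. vs \<in> lists (range (dx :: 'n \<Rightarrow> real \<times> (real^'n))) \<and> length vs = N}"
  define I where "I = (UNIV :: 'm set) \<times> LL"
  define w where "w = (\<lambda>(l, vs). ipd Z vs (U l))"
  define n m P q where "n = real CARD('n)" and "m = real CARD('m)" and "P = (2::real) ^ N" and "q = m * n ^ N"
  have LL: "finite LL" "card LL = CARD('n) ^ N"
  proof -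
    have "inj (dx :: 'n \<Rightarrow> real \<times> (real^'n))" by (auto simp: inj_def dx_def axis_eq_axis)
    then have "card (range (dx :: 'n \<Rightarrow> real \<times> (real^'n))) = CARD('n)" by (simp add: card_image)
    moreover have "LL = {vs. set vs \<subseteq> range dx \<and> length vs = N}" by (auto simp: LL_def in_lists_conv_set)
    ultimately show "finite LL" "card LL = CARD('n) ^ N"
      using finite_lists_length_eq[of "range dx" N] card_lists_length_eq[of "range (dx :: 'n \<Rightarrow> real \<times> (real^'n))" N] by auto
  qed
  have finI: "finite I" and cI: "real (card I) = q"
    using LL by (auto simp: I_def card_cartesian_product q_def m_def n_def)
  have pos: "1 \<le> n" "1 \<le> m" "1 \<le> P" "0 \<le> q" by (auto simp: n_def m_def P_def q_def Suc_le_eq)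
  have C: "C = 1 + n * m + m + q + 2 * (q * (n * m * P)) + q * (m * P)"
    by (simp add: C_def order_const_def n_def m_def P_def q_def)
  have C0: "0 \<le> C" and qC: "q \<le> C" using pos by (auto simp: C)
  have "(\<Sum>i\<in>I. isq (\<lambda>x. w i (t, x))) \<le> exp (integral {0..T} (\<lambda>s. C * (1 + c s))) * ((\<Sum>i\<in>I. isq (\<lambda>x. w i (0, x))) + T * (C * (L + M\<^sup>2 * Y)))"
  proof (rule energy_estimate[OF finI])
    show "sm (w i)" if "i \<in> I" for i
      using that by (auto simp: w_def I_def LL_def intro!: sm_ipd smU)
    show "slice_le t (w i) K" if "i \<in> I" "t \<in> {0..T}" for i t
      using that by (auto simp: w_def I_def LL_def intro!: KU)
    show "slice_le t (pd Z dt (w i)) K" if i: "i \<in> I" and tt: "t \<in> {0..T}" for i t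
    proof -
      obtain l vs where i: "i = (l, vs)" "vs \<in> lists (range dx)" "length vs = N"
        using i unfolding I_def LL_def by blast
      have "slice_le t (ipd Z (dt # vs) (U l)) K"
        by (rule KU) (use i tt space_lists[OF i(2)] in \<open>auto simp del: in_lists_conv_set\<close>)
      then show ?thesis by (simp add: w_def i)
    qed
    show "continuous_on {0..T} (\<lambda>s. C * (1 + c s))" by (intro continuous_intros c)
    show "0 \<le> C * (1 + c s)" if "s \<in> {0..T}" for s using C0 c(2)[OF that] by simp
    show "0 \<le> C * (L + M\<^sup>2 * Y)" using C0 nonneg by simp
    show "t \<in> {0..T}" by (rule t)
    fix s assume s: "s \<in> {0<..<T}"
    then have s': "s \<in> {0..T}" by auto
    define E where "E = (\<Sum>i\<in>I. slice_norm2 s (w i))"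
    have cs: "0 \<le> c s" using c(2)[OF s'] .
    have wE: "slice_norm2 s (ipd Z vs (U l)) \<le> E" if "vs \<in> LL" for vs l
      using member_le_sum[OF _ _ finI, of "(l, vs)" "\<lambda>i. slice_norm2 s (w i)"] that by (simp add: E_def I_def w_def)
    have E0: "0 \<le> E" by (simp add: E_def sum_nonneg)
    have wsq: "slice_L2 s (ipd Z vs (U l))" if "vs \<in> lists Basis" "length vs \<le> Suc N" for vs l
      using KU[OF that s'] by (auto simp: slice_L2_def)
    have cont: "continuous_on Z (ipd Z a (A j k l))" "continuous_on Z (ipd Z a (B k l))" if "a \<in> lists (range dx)" for a j k l
      using that by (auto intro!: sm_continuous sm_ipd smA smB)
    have MA0: "cmod (A j k l p) \<le> M" "cmod (B k l p) \<le> M" if "p \<in> Z" for j k l p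
      using MA[of "[]" p j k l] MB[of "[]" p k l] that by auto
    have contA: "continuous_on Z (A j k l)" and contB: "continuous_on Z (B k l)" for j k l
      by (intro sm_continuous smA smB)+
    \<comment> \<open>Young's inequality bounds twice the inner product with a commutator term of
      lower order by the energy plus \<open>M\<^sup>2 * Y\<close>.\<close>
    define X where "X = E + M\<^sup>2 * Y"
    have X0: "0 \<le> X" using E0 nonneg by (simp add: X_def)
    define f1 where "f1 = (\<lambda>k vs p. \<Sum>j\<in>UNIV. \<Sum>l\<in>UNIV. A j k l p * D h j (ipd Z vs (U l)) p)"
    define f2 where "f2 = (\<lambda>k vs p. \<Sum>j\<in>UNIV. \<Sum>l\<in>UNIV. \<Sum>ab\<leftarrow>psplits vs. ipd Z (fst ab) (A j k l) p * D h j (ipd Z (snd ab) (U l)) p)"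
    define f3 where "f3 = (\<lambda>k vs p. \<Sum>l\<in>UNIV. B k l p * ipd Z vs (U l) p)"
    define f4 where "f4 = (\<lambda>k vs p. \<Sum>l\<in>UNIV. \<Sum>ab\<leftarrow>psplits vs. ipd Z (fst ab) (B k l) p * ipd Z (snd ab) (U l) p)"
    have spl: "fst ab \<in> lists (range dx) \<and> snd ab \<in> lists (range dx) \<and> fst ab \<noteq> [] \<and> length (fst ab) + length (snd ab) = N"
      if "vs \<in> LL" "ab \<in> set (psplits vs)" for vs ab
      using psplits_Basis[of vs "range dx" "fst ab" "snd ab"] psplits_props[of "fst ab" "snd ab" vs] that by (auto simp: LL_def)
    have t1: "slice_L2 s (\<lambda>p. A j k l p * D h j (ipd Z vs (U l)) p)" if "vs \<in> LL" for j k l vs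
      using that by (intro slice_L2_mult[OF _ contA MA0(1)] slice_L2_D wsq h) (auto simp: LL_def)
    have t3: "slice_L2 s (\<lambda>p. B k l p * ipd Z vs (U l) p)" if "vs \<in> LL" for k l vs
      using that by (intro slice_L2_mult[OF _ contB MA0(2)] wsq) (auto simp: LL_def)
    have t2: "slice_L2 s (\<lambda>p. ipd Z (fst ab) (A j k l) p * D h j (ipd Z (snd ab) (U l)) p)" if "vs \<in> LL" "ab \<in> set (psplits vs)" for j k l vs ab
      using spl[OF that] by (intro slice_L2_mult[OF _ cont(1) MA] slice_L2_D wsq h) auto
    have t4: "slice_L2 s (\<lambda>p. ipd Z (fst ab) (B k l) p * ipd Z (snd ab) (U l) p)" if "vs \<in> LL" "ab \<in> set (psplits vs)" for k l vs ab
      using spl[OF that] by (intro slice_L2_mult[OF _ cont(2) MB] wsq) auto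
    have sqf: "slice_L2 s (f1 k vs)" "slice_L2 s (f2 k vs)" "slice_L2 s (f3 k vs)" "slice_L2 s (f4 k vs)" if "vs \<in> LL" for k vs
      unfolding f1_def f2_def f3_def f4_def using that s'
      by (auto intro!: slice_L2_sum slice_L2_sum_list t1 t2 t3 t4)
    have dec: "slice_inner s (w (k, vs)) (pd Z dt (w (k, vs))) = slice_inner s (w (k, vs)) (ipd Z vs (H k))
        - slice_inner s (w (k, vs)) (f1 k vs) - slice_inner s (w (k, vs)) (f2 k vs) - slice_inner s (w (k, vs)) (f3 k vs) - slice_inner s (w (k, vs)) (f4 k vs)"
      if "vs \<in> LL" for k vs
    proof -
      have v: "vs \<in> lists (range dx)" "vs \<in> lists Basis" "length vs = N" using that by (auto simp: LL_def)
      have "slice_inner s (w (k, vs)) (pd Z dt (w (k, vs))) = slice_inner s (w (k, vs)) (\<lambda>p. ipd Z vs (H k) p - ((f1 k vs p + f2 k vs p) + (f3 k vs p + f4 k vs p)))"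
        by (rule slice_inner_cong[OF s'])
          (simp add: w_def eq[OF v(1,3)] ipd_semi_op[OF smA smB smU v(2)] f1_def f2_def f3_def f4_def case_prod_unfold)
      moreover have "slice_L2 s (w (k, vs))" using wsq[OF v(2)] v(3) by (simp add: w_def)
      moreover have "slice_L2 s (ipd Z vs (H k))" using hH[OF v(1,3) s'] by (auto simp: slice_L2_def)
      ultimately show ?thesis using sqf[OF that, of k] by (simp add: slice_inner_diff slice_inner_add slice_L2_add)
    qed
    have wk: "slice_L2 s (w (k, vs))" if "vs \<in> LL" for k vs using that by (auto simp: w_def LL_def intro!: wsq)
    have b0: "2 * \<bar>slice_inner s (w (k, vs)) (ipd Z vs (H k))\<bar> \<le> slice_norm2 s (w (k, vs)) + L" if "vs \<in> LL" for k vs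
    proof -
      have "slice_le s (ipd Z vs (H k)) L" using that s' by (auto simp: LL_def intro!: hH)
      then show ?thesis using slice_inner_le[OF wk[OF that], of "ipd Z vs (H k)" k] slice_le_slice_norm2 by (fastforce simp: slice_L2_def)
    qed
    have lenP: "real (length (psplits vs)) \<le> P" if "vs \<in> LL" for vs
      using length_psplits[of vs] that of_nat_mono[of _ "2 ^ N", where 'a=real] by (fastforce simp: P_def LL_def)
    have b4: "2 * \<bar>slice_inner s (w (k, vs)) (f4 k vs)\<bar> \<le> m * (P * X)" if "vs \<in> LL" for k vs
    proof -
      have "2 * \<bar>slice_inner s (w (k, vs)) (\<lambda>p. ipd Z (fst ab) (B k l) p * ipd Z (snd ab) (U l) p)\<bar> \<le> X"
        if ab: "ab \<in> set (psplits vs)" for l ab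
      proof -
        note sp = spl[OF \<open>vs \<in> LL\<close> ab]
        have "2 * \<bar>slice_inner s (w (k, vs)) (\<lambda>p. ipd Z (fst ab) (B k l) p * ipd Z (snd ab) (U l) p)\<bar>
          \<le> slice_norm2 s (w (k, vs)) + slice_norm2 s (\<lambda>p. ipd Z (fst ab) (B k l) p * ipd Z (snd ab) (U l) p)"
          by (intro slice_inner_le wk t4[OF \<open>vs \<in> LL\<close> ab] \<open>vs \<in> LL\<close>)
        moreover have "slice_norm2 s (w (k, vs)) \<le> E" using wE[OF \<open>vs \<in> LL\<close>] by (simp add: w_def)
        moreover have "slice_norm2 s (\<lambda>p. ipd Z (fst ab) (B k l) p * ipd Z (snd ab) (U l) p) \<le> M\<^sup>2 * slice_norm2 s (ipd Z (snd ab) (U l))"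
          using sp by (intro slice_norm2_mult_le wsq cont MB) auto
        moreover have "M\<^sup>2 * slice_norm2 s (ipd Z (snd ab) (U l)) \<le> M\<^sup>2 * Y"
          using sp by (intro mult_left_mono slice_le_slice_norm2 low s') auto
        ultimately show ?thesis by (simp add: X_def)
      qed
      then have "2 * \<bar>slice_inner s (w (k, vs)) (\<lambda>p. \<Sum>ab\<leftarrow>psplits vs. ipd Z (fst ab) (B k l) p * ipd Z (snd ab) (U l) p)\<bar> \<le> P * X" for l
        by (intro slice_inner_sum_list_bound wk t4[OF that] that lenP X0)
      then show ?thesis unfolding f4_def m_def
        by (intro slice_inner_sum_bound wk slice_L2_sum_list t4[OF that] that s') auto
    qed
    have b2: "2 * \<bar>slice_inner s (w (k, vs)) (f2 k vs)\<bar> \<le> n * (m * (P * (2 * c s * E + X)))" if "vs \<in> LL" for k vs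
    proof -
      have X1: "0 \<le> 2 * c s * E + X" using cs E0 X0 by simp
      have "2 * \<bar>slice_inner s (w (k, vs)) (\<lambda>p. ipd Z (fst ab) (A j k l) p * D h j (ipd Z (snd ab) (U l)) p)\<bar> \<le> 2 * c s * E + X"
        if ab: "ab \<in> set (psplits vs)" for j l ab
      proof -
        note sp = spl[OF \<open>vs \<in> LL\<close> ab]
        have smb: "sm (ipd Z (snd ab) (U l))" using sp by (intro sm_ipd smU) auto
        have slice_le: "slice_L2 s (pd Z (dx j) (ipd Z (snd ab) (U l)))"
          using wsq[of "dx j # snd ab" l] sp by auto
        have wE': "slice_norm2 s (w (k, vs)) \<le> E" using wE[OF \<open>vs \<in> LL\<close>] by (simp add: w_def)
        have Db: "slice_norm2 s (D h j (ipd Z (snd ab) (U l))) \<le> slice_norm2 s (ipd Z (dx j # snd ab) (U l))"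
          using slice_norm2_D_le[OF smb slice_le h] by simp
        show ?thesis
        \<comment> \<open>One derivative on \<open>A\<close>: the other factor, with its difference,
          has full order \<open>N\<close>, and only the coefficient bound \<open>c s\<close> may
          accompany it. More derivatives on \<open>A\<close>: the other factor has order below
          \<open>N\<close>, and the moderate bound \<open>M\<close> is admissible.\<close>
        proof (cases "length (fst ab) = 1")
          case True
          then obtain v where v: "fst ab = [v]" by (auto simp: length_Suc_conv)
          then obtain i where i: "v = dx i" using sp by auto
          have "dx j # snd ab \<in> LL" using sp True by (auto simp: LL_def)
          then have Db': "slice_norm2 s (D h j (ipd Z (snd ab) (U l))) \<le> E" using Db wE order_trans by blast
          have "2 * \<bar>slice_inner s (w (k, vs)) (\<lambda>p. ipd Z (fst ab) (A j k l) p * D h j (ipd Z (snd ab) (U l)) p)\<bar>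
            \<le> c s * (slice_norm2 s (w (k, vs)) + slice_norm2 s (D h j (ipd Z (snd ab) (U l))))"
            using sp s by (intro slice_inner_mult_le wk \<open>vs \<in> LL\<close> slice_L2_D wsq h cont) (auto simp: v i intro!: cA)
          also have "\<dots> \<le> c s * (E + E)" using Db' wE' cs by (intro mult_left_mono add_mono)
          finally show ?thesis using X0 by simp
        next
          case False
          then have l2: "length (snd ab) + 2 \<le> N" using sp by (cases "fst ab"; cases "tl (fst ab)") auto
          have "2 * \<bar>slice_inner s (w (k, vs)) (\<lambda>p. ipd Z (fst ab) (A j k l) p * D h j (ipd Z (snd ab) (U l)) p)\<bar>
            \<le> slice_norm2 s (w (k, vs)) + slice_norm2 s (\<lambda>p. ipd Z (fst ab) (A j k l) p * D h j (ipd Z (snd ab) (U l)) p)"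
            by (intro slice_inner_le wk t2[OF \<open>vs \<in> LL\<close> ab] \<open>vs \<in> LL\<close>)
          moreover have "slice_norm2 s (\<lambda>p. ipd Z (fst ab) (A j k l) p * D h j (ipd Z (snd ab) (U l)) p) \<le> M\<^sup>2 * slice_norm2 s (D h j (ipd Z (snd ab) (U l)))"
            using sp by (intro slice_norm2_mult_le slice_L2_D wsq cont MA h) auto
          moreover have "slice_norm2 s (ipd Z (dx j # snd ab) (U l)) \<le> Y"
            using sp l2 by (intro slice_le_slice_norm2 low s') auto
          then have "M\<^sup>2 * slice_norm2 s (D h j (ipd Z (snd ab) (U l))) \<le> M\<^sup>2 * Y"
            using Db by (intro mult_left_mono) auto
          moreover have "0 \<le> c s * E" using cs E0 by simp
          ultimately show ?thesis using wE' unfolding X_def by linarith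
        qed
      qed
      then have "2 * \<bar>slice_inner s (w (k, vs)) (\<lambda>p. \<Sum>ab\<leftarrow>psplits vs. ipd Z (fst ab) (A j k l) p * D h j (ipd Z (snd ab) (U l)) p)\<bar>
          \<le> P * (2 * c s * E + X)" for j l
        by (intro slice_inner_sum_list_bound wk t2[OF that] that lenP X1)
      then have "2 * \<bar>slice_inner s (w (k, vs)) (\<lambda>p. \<Sum>l\<in>UNIV. \<Sum>ab\<leftarrow>psplits vs. ipd Z (fst ab) (A j k l) p * D h j (ipd Z (snd ab) (U l)) p)\<bar>
          \<le> m * (P * (2 * c s * E + X))" for j
        unfolding m_def by (intro slice_inner_sum_bound wk slice_L2_sum_list t2[OF that] that s') auto
      then show ?thesis unfolding f2_def n_def
        by (intro slice_inner_sum_bound wk slice_L2_sum slice_L2_sum_list t2[OF that] that s') auto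
    qed
    \<comment> \<open>The sum over \<open>k\<close> stays inside the absolute value, because
      skewness cancels between the entries \<open>(k, l)\<close> and \<open>(l, k)\<close>, not
      within a single entry.\<close>
    have b1: "2 * \<bar>\<Sum>k\<in>UNIV. slice_inner s (w (k, vs)) (f1 k vs)\<bar> \<le> n * (c s * m * (\<Sum>k\<in>UNIV. slice_norm2 s (w (k, vs))))" if "vs \<in> LL" for vs
    proof -
      have "(\<Sum>k\<in>UNIV. slice_inner s (w (k, vs)) (f1 k vs)) = (\<Sum>k\<in>UNIV. \<Sum>j\<in>UNIV. \<Sum>l\<in>UNIV. slice_inner s (w (k, vs)) (\<lambda>p. A j k l p * D h j (w (l, vs)) p))"
      proof (rule sum.cong[OF refl])
        fix k
        have "slice_inner s (w (k, vs)) (f1 k vs) = (\<Sum>j\<in>UNIV. slice_inner s (w (k, vs)) (\<lambda>p. \<Sum>l\<in>UNIV. A j k l p * D h j (ipd Z vs (U l)) p))"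
          unfolding f1_def by (rule slice_inner_sum[OF wk[OF that]]) (intro slice_L2_sum t1 that s')
        also have "\<dots> = (\<Sum>j\<in>UNIV. \<Sum>l\<in>UNIV. slice_inner s (w (k, vs)) (\<lambda>p. A j k l p * D h j (ipd Z vs (U l)) p))"
          by (intro sum.cong refl slice_inner_sum wk t1 that)
        finally show "slice_inner s (w (k, vs)) (f1 k vs) = (\<Sum>j\<in>UNIV. \<Sum>l\<in>UNIV. slice_inner s (w (k, vs)) (\<lambda>p. A j k l p * D h j (w (l, vs)) p))"
          by (simp add: w_def)
      qed
      also have "\<dots> = (\<Sum>j\<in>UNIV. \<Sum>k\<in>UNIV. \<Sum>l\<in>UNIV. slice_inner s (w (k, vs)) (\<lambda>p. A j k l p * D h j (w (l, vs)) p))"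
        by (rule sum.swap)
      finally have "2 * \<bar>\<Sum>k\<in>UNIV. slice_inner s (w (k, vs)) (f1 k vs)\<bar> \<le> 2 * (\<Sum>j\<in>UNIV. \<bar>\<Sum>k\<in>UNIV. \<Sum>l\<in>UNIV. slice_inner s (w (k, vs)) (\<lambda>p. A j k l p * D h j (w (l, vs)) p)\<bar>)"
        by (simp add: sum_abs)
      also have "\<dots> \<le> 2 * (\<Sum>j\<in>(UNIV::'n set). c s / 2 * m * (\<Sum>k\<in>UNIV. slice_norm2 s (w (k, vs))))"
      proof (intro mult_left_mono sum_mono)
        fix j :: 'n
        have "\<bar>\<Sum>k\<in>UNIV. \<Sum>l\<in>UNIV. \<integral>x. w (k, vs) (s, x) \<bullet> (A j k l (s, x) * (complex_of_real (1 / (2 * h)) *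
            (w (l, vs) (s, x + h *\<^sub>R axis j 1) - w (l, vs) (s, x - h *\<^sub>R axis j 1)))) \<partial>lborel\<bar>
          \<le> c s / 2 * real CARD('m) * (\<Sum>k\<in>UNIV. slice_norm2 s (w (k, vs)))"
        proof (rule centred_difference_estimate[OF _ _ _ _ _ h])
          show "sqi (\<lambda>x. w (k, vs) (s, x))" for k using wk[OF that] by (rule slice_L2_sqi)
          show "continuous_on UNIV (\<lambda>x. A j k l (s, x))" for k l by (rule continuous_slice[OF contA s'])
          show "cmod (A j k l (s, x)) \<le> M" for k l x using s' by (intro MA0) (auto simp: Z_eq)
          show "A j k l (s, x) = cnj (A j l k (s, x))" for k l x by (rule herm[OF s])
          show "cmod (A j k l (s, x) - A j k l (s, x + h *\<^sub>R axis j 1)) \<le> c s * h" for k l x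
            by (rule space_increment_le[OF smA s' cA[OF s] h])
        qed
        then show "\<bar>\<Sum>k\<in>UNIV. \<Sum>l\<in>UNIV. slice_inner s (w (k, vs)) (\<lambda>p. A j k l p * D h j (w (l, vs)) p)\<bar> \<le> c s / 2 * m * (\<Sum>k\<in>UNIV. slice_norm2 s (w (k, vs)))"
          by (simp add: slice_inner_def D_def m_def)
      qed auto
      also have "\<dots> = n * (c s * m * (\<Sum>k\<in>UNIV. slice_norm2 s (w (k, vs))))" by (simp add: n_def)
      finally show ?thesis .
    qed
    \<comment> \<open>Averaging the sum with its transpose, in which \<open>B\<close> becomes its
      adjoint, leaves only the Hermitian part of \<open>B\<close>; the skew part does not contribute
      to the energy.\<close>
    have b3: "2 * \<bar>\<Sum>k\<in>UNIV. slice_inner s (w (k, vs)) (f3 k vs)\<bar> \<le> c s * m * (\<Sum>k\<in>UNIV. slice_norm2 s (w (k, vs)))" if "vs \<in> LL" for vs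
    proof -
      have i3: "integrable lborel (\<lambda>x. w (k, vs) (s, x) \<bullet> (B k l (s, x) * w (l, vs) (s, x)))" for k l
        using slice_inner_integrable[OF wk[OF that] t3[OF that], of k k l] by (simp add: w_def)
      have "continuous_on Z (\<lambda>p. cnj (B l k p))" for k l by (intro continuous_intros contB)
      then have i3': "integrable lborel (\<lambda>x. w (k, vs) (s, x) \<bullet> (cnj (B l k (s, x)) * w (l, vs) (s, x)))" for k l
        using slice_inner_integrable[OF wk[OF that] slice_L2_mult[OF wk[OF that], of "\<lambda>p. cnj (B l k p)" M], of k l] MA0 by simp
      have sw: "(\<integral>x. w (k, vs) (s, x) \<bullet> (B k l (s, x) * w (l, vs) (s, x)) \<partial>lborel) = (\<integral>x. w (l, vs) (s, x) \<bullet> (cnj (B k l (s, x)) * w (k, vs) (s, x)) \<partial>lborel)" for k l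
        by (intro Bochner_Integration.integral_cong refl) (simp add: inner_complex_def algebra_simps)
      have e1: "(\<Sum>k\<in>UNIV. slice_inner s (w (k, vs)) (f3 k vs)) = (\<Sum>k\<in>UNIV. \<Sum>l\<in>UNIV. \<integral>x. w (k, vs) (s, x) \<bullet> (B k l (s, x) * w (l, vs) (s, x)) \<partial>lborel)"
      proof (rule sum.cong[OF refl])
        fix k
        have "slice_inner s (w (k, vs)) (f3 k vs) = (\<Sum>l\<in>UNIV. slice_inner s (w (k, vs)) (\<lambda>p. B k l p * ipd Z vs (U l) p))"
          unfolding f3_def by (intro slice_inner_sum wk t3 that)
        then show "slice_inner s (w (k, vs)) (f3 k vs) = (\<Sum>l\<in>UNIV. \<integral>x. w (k, vs) (s, x) \<bullet> (B k l (s, x) * w (l, vs) (s, x)) \<partial>lborel)"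
          by (simp add: slice_inner_def w_def)
      qed
      also have "\<dots> = (\<Sum>k\<in>UNIV. \<Sum>l\<in>UNIV. \<integral>x. w (k, vs) (s, x) \<bullet> (cnj (B l k (s, x)) * w (l, vs) (s, x)) \<partial>lborel)"
        by (subst sw, rule sum.swap)
      finally have e2: "(\<Sum>k\<in>UNIV. slice_inner s (w (k, vs)) (f3 k vs)) = \<dots>" .
      have "2 * (\<Sum>k\<in>UNIV. slice_inner s (w (k, vs)) (f3 k vs)) = (\<Sum>k\<in>UNIV. \<Sum>l\<in>UNIV. \<integral>x. w (k, vs) (s, x) \<bullet> ((B k l (s, x) + cnj (B l k (s, x))) * w (l, vs) (s, x)) \<partial>lborel)"
      proof -
        have "(\<integral>x. w (k, vs) (s, x) \<bullet> ((B k l (s, x) + cnj (B l k (s, x))) * w (l, vs) (s, x)) \<partial>lborel)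
          = (\<integral>x. w (k, vs) (s, x) \<bullet> (B k l (s, x) * w (l, vs) (s, x)) \<partial>lborel) + (\<integral>x. w (k, vs) (s, x) \<bullet> (cnj (B l k (s, x)) * w (l, vs) (s, x)) \<partial>lborel)" for k l
          unfolding distrib_right inner_add_right by (intro Bochner_Integration.integral_add i3 i3')
        then show ?thesis using e1 e2 by (simp only: sum.distrib)
      qed
      then have "2 * \<bar>\<Sum>k\<in>UNIV. slice_inner s (w (k, vs)) (f3 k vs)\<bar> = \<bar>\<Sum>k\<in>UNIV. \<Sum>l\<in>UNIV. \<integral>x. w (k, vs) (s, x) \<bullet> ((B k l (s, x) + cnj (B l k (s, x))) * w (l, vs) (s, x)) \<partial>lborel\<bar>"
        by linarith
      also have "\<dots> \<le> (\<Sum>k\<in>UNIV. \<Sum>l\<in>UNIV. c s / 2 * (slice_norm2 s (w (k, vs)) + slice_norm2 s (w (l, vs))))"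
      proof (intro order_trans[OF sum_abs] sum_mono)
        fix k l
        have "continuous_on Z (\<lambda>p. B k l p + cnj (B l k p))" by (intro continuous_intros contB)
        from inner_integral_le[OF slice_L2_sqi[OF wk[OF that]] slice_L2_sqi[OF wk[OF that]] continuous_slice[OF this s'] cB[OF s]]
        show "\<bar>\<integral>x. w (k, vs) (s, x) \<bullet> ((B k l (s, x) + cnj (B l k (s, x))) * w (l, vs) (s, x)) \<partial>lborel\<bar> \<le> c s / 2 * (slice_norm2 s (w (k, vs)) + slice_norm2 s (w (l, vs)))" .
      qed
      also have "\<dots> = c s * m * (\<Sum>k\<in>UNIV. slice_norm2 s (w (k, vs)))"
        unfolding sum_distrib_left[symmetric] sum.distrib sum_constant m_def by (simp add: algebra_simps)
      finally show ?thesis .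
    qed
    have Isum: "(\<Sum>i\<in>I. g i) = (\<Sum>vs\<in>LL. \<Sum>k\<in>UNIV. g (k, vs))" for g :: "'m \<times> (real \<times> (real^'n)) list \<Rightarrow> real"
      unfolding I_def by (subst sum.swap) (simp add: sum.cartesian_product)
    have E_eq: "E = (\<Sum>vs\<in>LL. \<Sum>k\<in>UNIV. slice_norm2 s (w (k, vs)))" unfolding E_def by (rule Isum)
    have "2 * (\<Sum>i\<in>I. slice_inner s (w i) (pd Z dt (w i))) = (\<Sum>vs\<in>LL. (\<Sum>k\<in>UNIV. 2 * slice_inner s (w (k, vs)) (ipd Z vs (H k)) - 2 * slice_inner s (w (k, vs)) (f2 k vs) - 2 * slice_inner s (w (k, vs)) (f4 k vs))
       - 2 * (\<Sum>k\<in>UNIV. slice_inner s (w (k, vs)) (f1 k vs)) - 2 * (\<Sum>k\<in>UNIV. slice_inner s (w (k, vs)) (f3 k vs)))"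
      unfolding Isum sum_distrib_left[of 2 _ LL] using dec
      by (intro sum.cong refl) (simp add: sum_subtractf sum_distrib_left)
    also have "\<dots> \<le> (\<Sum>vs\<in>LL. (\<Sum>k\<in>UNIV. slice_norm2 s (w (k, vs)) + L + n * (m * (P * (2 * c s * E + X))) + m * (P * X))
       + n * (c s * m * (\<Sum>k\<in>UNIV. slice_norm2 s (w (k, vs)))) + c s * m * (\<Sum>k\<in>UNIV. slice_norm2 s (w (k, vs))))"
    proof (intro sum_mono)
      fix vs assume v: "vs \<in> LL"
      have "(\<Sum>k\<in>UNIV. 2 * slice_inner s (w (k, vs)) (ipd Z vs (H k)) - 2 * slice_inner s (w (k, vs)) (f2 k vs) - 2 * slice_inner s (w (k, vs)) (f4 k vs))
        \<le> (\<Sum>k\<in>UNIV. slice_norm2 s (w (k, vs)) + L + n * (m * (P * (2 * c s * E + X))) + m * (P * X))"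
      proof (rule sum_mono)
        fix k
        show "2 * slice_inner s (w (k, vs)) (ipd Z vs (H k)) - 2 * slice_inner s (w (k, vs)) (f2 k vs) - 2 * slice_inner s (w (k, vs)) (f4 k vs)
          \<le> slice_norm2 s (w (k, vs)) + L + n * (m * (P * (2 * c s * E + X))) + m * (P * X)"
          using b0[OF v, of k] b2[OF v, of k] b4[OF v, of k] by linarith
      qed
      then show "(\<Sum>k\<in>UNIV. 2 * slice_inner s (w (k, vs)) (ipd Z vs (H k)) - 2 * slice_inner s (w (k, vs)) (f2 k vs) - 2 * slice_inner s (w (k, vs)) (f4 k vs))
       - 2 * (\<Sum>k\<in>UNIV. slice_inner s (w (k, vs)) (f1 k vs)) - 2 * (\<Sum>k\<in>UNIV. slice_inner s (w (k, vs)) (f3 k vs))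
       \<le> (\<Sum>k\<in>UNIV. slice_norm2 s (w (k, vs)) + L + n * (m * (P * (2 * c s * E + X))) + m * (P * X))
       + n * (c s * m * (\<Sum>k\<in>UNIV. slice_norm2 s (w (k, vs)))) + c s * m * (\<Sum>k\<in>UNIV. slice_norm2 s (w (k, vs)))"
        using b1[OF v] b3[OF v] by linarith
    qed
    also have "\<dots> = E + q * (L + n * (m * (P * (2 * c s * E + X))) + m * (P * X)) + n * (c s * m * E) + c s * m * E"
    proof -
      define R where "R = L + n * (m * (P * (2 * c s * E + X))) + m * (P * X)"
      have "real (card LL) * (m * R) = q * R" by (simp add: LL q_def n_def)
      moreover have "(\<Sum>vs\<in>LL. (\<Sum>k\<in>UNIV. slice_norm2 s (w (k, vs)) + R) + n * (c s * m * (\<Sum>k\<in>UNIV. slice_norm2 s (w (k, vs)))) + c s * m * (\<Sum>k\<in>UNIV. slice_norm2 s (w (k, vs))))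
        = E + real (card LL) * (m * R) + n * (c s * m * E) + c s * m * E"
        unfolding sum.distrib sum_distrib_left[symmetric] sum_constant E_eq[symmetric] by (simp add: m_def)
      ultimately show ?thesis by (simp add: R_def add.assoc)
    qed
    also have "\<dots> = (1 + q * (n * m * P) + q * (m * P) + (n * m + m + 2 * (q * (n * m * P))) * c s) * E
        + q * L + (q * (n * m * P) + q * (m * P)) * (M\<^sup>2 * Y)"
      by (simp add: X_def algebra_simps)
    also have "\<dots> \<le> (C + C * c s) * E + C * L + C * (M\<^sup>2 * Y)"
    proof -
      have p: "0 \<le> q * (n * m * P)" "0 \<le> q * (m * P)" "0 \<le> n * m" "0 \<le> m" using pos by auto
      have "1 + q * (n * m * P) + q * (m * P) \<le> C" "n * m + m + 2 * (q * (n * m * P)) \<le> C" "q * (n * m * P) + q * (m * P) \<le> C"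
        using p pos(4) unfolding C by linarith+
      then show ?thesis using cs E0 nonneg qC
        by (intro add_mono mult_right_mono) auto
    qed
    finally show "2 * (\<Sum>i\<in>I. \<integral>x. w i (s, x) \<bullet> pd Z dt (w i) (s, x) \<partial>lborel)
        \<le> C * (1 + c s) * (\<Sum>i\<in>I. isq (\<lambda>x. w i (s, x))) + C * (L + M\<^sup>2 * Y)"
      by (simp add: slice_inner_def E_def algebra_simps)
  qed
  also have "integral {0..T} (\<lambda>s. C * (1 + c s)) = C * (T + integral {0..T} c)"
  proof -
    have "((\<lambda>s. C * (1 + c s)) has_integral C * (T + integral {0..T} c)) {0..T}"
      using T_pos has_integral_const_real[of "1::real" 0 T] c(1)
      by (intro has_integral_mult_right has_integral_add integrable_integral integrable_continuous_interval) auto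
    then show ?thesis by (rule integral_unique)
  qed
  also have "(\<Sum>i\<in>I. isq (\<lambda>x. w i (0, x))) \<le> C * I0"
  proof -
    have "(\<Sum>i\<in>I. isq (\<lambda>x. w i (0, x))) \<le> real (card I) * I0"
      by (rule sum_bounded_above) (auto simp: I_def LL_def w_def intro!: slice_le_slice_norm2 init)
    also have "\<dots> \<le> C * I0" using qC nonneg by (auto simp: cI intro: mult_right_mono)
    finally show ?thesis .
  qed
  finally have main: "(\<Sum>i\<in>I. isq (\<lambda>x. w i (t, x))) \<le> exp (C * (T + integral {0..T} c)) * (C * I0 + T * (C * (L + M\<^sup>2 * Y)))"
    by simp
  have "slice_le t (ipd Z vs (U l)) K" using vs by (intro KU t) auto
  moreover have "slice_norm2 t (ipd Z vs (U l)) \<le> (\<Sum>i\<in>I. isq (\<lambda>x. w i (t, x)))"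
    using member_le_sum[OF _ _ finI, of "(l, vs)" "\<lambda>i. slice_norm2 t (w i)"] vs by (simp add: I_def LL_def w_def)
  ultimately show ?thesis using main by (blast intro: isq_slice_le order_trans)
qed

end

section \<open>Traces, and extension from the initial plane\<close>

lemma nn_integral_L2norm:
  assumes "integrable (lebesgue_on S) (\<lambda>x. (cmod (f x))\<^sup>2)"
  shows "(\<integral>\<^sup>+x. ennreal ((cmod (f x))\<^sup>2) \<partial>lebesgue_on S) = ennreal ((L2norm S f)\<^sup>2)"
  using nn_integral_eq_integral[OF assms] by (simp add: L2norm_def)

lemma nsq_UNIV:
  fixes g :: "'a::euclidean_space \<Rightarrow> complex"
  assumes "integrable (lebesgue_on UNIV) (\<lambda>x. (cmod (g x))\<^sup>2)"
  shows "nsq g = ennreal ((L2norm UNIV g)\<^sup>2)"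
  using nn_integral_L2norm[OF assms] by (simp add: nsq_def nn_integral_completion lebesgue_on_UNIV_eq)

context slab begin

text \<open>Tonelli on the open slab; passing to the closed time interval changes only a null
  set.\<close>

lemma nn_integral_slab:
  fixes f :: "real \<times> (real^'n::finite) \<Rightarrow> complex"
  assumes f: "continuous_on Z f"
  shows "(\<integral>\<^sup>+p. ennreal ((cmod (f p))\<^sup>2) \<partial>lebesgue_on (Omega T)) = (\<integral>\<^sup>+t. nsq (\<lambda>x. f (t, x)) * indicator {0..T} t \<partial>lborel)"
proof -
  let ?O = "Omega T :: (real \<times> (real^'n)) set"
  have O: "open ?O" by (simp add: Omega_def open_Times)
  have fO: "continuous_on ?O f" using f closure_subset by (rule continuous_on_subset)
  have "(\<lambda>z. indicator ?O z *\<^sub>R f z) \<in> borel_measurable borel"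
    using O fO by (intro borel_measurable_continuous_on_indicator) auto
  then have "(\<lambda>z. ennreal ((cmod (indicator ?O z *\<^sub>R f z))\<^sup>2)) \<in> borel_measurable borel"
    by measurable
  also have "(\<lambda>z. ennreal ((cmod (indicator ?O z *\<^sub>R f z))\<^sup>2)) = (\<lambda>p. ennreal ((cmod (f p))\<^sup>2) * indicator ?O p)"
    by (auto simp: indicator_def)
  finally have m: "(\<lambda>p. ennreal ((cmod (f p))\<^sup>2) * indicator ?O p) \<in> borel_measurable (lborel \<Otimes>\<^sub>M lborel)"
    by (simp only: lborel_prod measurable_lborel2)
  have "(\<integral>\<^sup>+p. ennreal ((cmod (f p))\<^sup>2) \<partial>lebesgue_on ?O) = (\<integral>\<^sup>+p. ennreal ((cmod (f p))\<^sup>2) * indicator ?O p \<partial>lebesgue)"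
    using O by (intro nn_integral_restrict_space) auto
  also have "\<dots> = (\<integral>\<^sup>+p. ennreal ((cmod (f p))\<^sup>2) * indicator ?O p \<partial>(lborel \<Otimes>\<^sub>M lborel))"
    by (simp add: nn_integral_completion lborel_prod)
  also have "\<dots> = (\<integral>\<^sup>+t. \<integral>\<^sup>+x. ennreal ((cmod (f (t, x)))\<^sup>2) * indicator ?O (t, x) \<partial>lborel \<partial>lborel)"
    by (rule lborel.nn_integral_fst[symmetric, OF m])
  also have "\<dots> = (\<integral>\<^sup>+t. nsq (\<lambda>x. f (t, x)) * indicator {0<..<T} t \<partial>lborel)"
    by (intro nn_integral_cong) (auto simp: Omega_def indicator_def nsq_def)
  also have "\<dots> = (\<integral>\<^sup>+t. nsq (\<lambda>x. f (t, x)) * indicator {0..T} t \<partial>lborel)"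
  proof (rule nn_integral_cong_AE)
    have "AE s in lborel. s \<noteq> (0::real)" "AE s in lborel. s \<noteq> T" by (auto intro: AE_lborel_singleton)
    then show "AE t in lborel. nsq (\<lambda>x. f (t, x)) * indicator {0<..<T} t = nsq (\<lambda>x. f (t, x)) * indicator {0..T} t"
      by eventually_elim (auto simp: indicator_def)
  qed
  finally show ?thesis .
qed

text \<open>Uniform slice bounds return to norms over the slab by integrating in time, the way back
  from the trace estimate.\<close>

lemma slice_le_integrable:
  fixes f :: "real \<times> (real^'n::finite) \<Rightarrow> complex"
  assumes K: "\<And>t. t \<in> {0..T} \<Longrightarrow> slice_le t f K"
  shows "f \<in> borel_measurable (lebesgue_on (Omega T))"
    "integrable (lebesgue_on (Omega T)) (\<lambda>p. (cmod (f p))\<^sup>2)"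
    "(L2norm (Omega T) f)\<^sup>2 \<le> T * K"
proof -
  let ?O = "Omega T :: (real \<times> (real^'n)) set"
  have f: "continuous_on Z f" and K0: "0 \<le> K" using K[of 0] T_pos by (auto simp: slice_le_def)
  have "open ?O" by (simp add: Omega_def open_Times)
  then show m: "f \<in> borel_measurable (lebesgue_on ?O)"
    by (intro continuous_imp_measurable_on_sets_lebesgue continuous_on_subset[OF f closure_subset]) auto
  have "(\<integral>\<^sup>+p. ennreal ((cmod (f p))\<^sup>2) \<partial>lebesgue_on ?O) \<le> (\<integral>\<^sup>+t. ennreal K * indicator {0..T} t \<partial>lborel)"
    unfolding nn_integral_slab[OF f]
  proof (intro nn_integral_mono)
    fix t :: real show "nsq (\<lambda>x. f (t, x)) * indicator {0..T} t \<le> ennreal K * indicator {0..T} t"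
      using K[of t] by (cases "t \<in> {0..T}") (auto simp: slice_le_def)
  qed
  also have "\<dots> = ennreal (T * K)"
    using T_pos K0 by (simp add: nn_integral_cmult ennreal_mult mult.commute)
  finally have le: "(\<integral>\<^sup>+p. ennreal ((cmod (f p))\<^sup>2) \<partial>lebesgue_on ?O) \<le> ennreal (T * K)" .
  show int: "integrable (lebesgue_on ?O) (\<lambda>p. (cmod (f p))\<^sup>2)"
  proof (rule integrableI_bounded)
    show "(\<lambda>p. (cmod (f p))\<^sup>2) \<in> borel_measurable (lebesgue_on ?O)" using m by measurable
    show "(\<integral>\<^sup>+p. ennreal (norm ((cmod (f p))\<^sup>2)) \<partial>lebesgue_on ?O) < \<infinity>"
      using le_less_trans[OF le ennreal_less_top] by simp
  qed
  show "(L2norm ?O f)\<^sup>2 \<le> T * K"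
    using le unfolding nn_integral_L2norm[OF int] using T_pos K0 by (subst (asm) ennreal_le_iff) auto
qed

text \<open>One-dimensional Sobolev inequality in time for fixed \<open>x\<close>: the squared
  modulus at \<open>t\<close> is at most that at \<open>s\<close> plus \<open>Q\<close>, which
  dominates its variation, and averaging over \<open>s\<close> gives a bound by integrals.
  Integration over \<open>x\<close> then bounds a slice by norms over the slab, at the price of one
  time derivative.\<close>

lemma trace_estimate:
  fixes f :: "real \<times> (real^'n::finite) \<Rightarrow> complex"
  assumes f: "sm f" and i0: "integrable (lebesgue_on (Omega T)) (\<lambda>p. (cmod (f p))\<^sup>2)"
    and i1: "integrable (lebesgue_on (Omega T)) (\<lambda>p. (cmod (pd Z dt f p))\<^sup>2)"
    and t: "t \<in> {0..T}"
  shows "slice_le t f ((1 / T + 1) * (L2norm (Omega T) f)\<^sup>2 + (L2norm (Omega T) (pd Z dt f))\<^sup>2)"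
proof -
  let ?d = "pd Z dt f"
  have smd: "sm ?d" by (intro sm_pd f dt_Basis)
  have cf: "continuous_on Z f" and cd: "continuous_on Z ?d" using f smd sm_continuous by auto
  have slice: "continuous_on {0..T} (\<lambda>s. g (s, x))" if "continuous_on Z g" for g :: "real \<times> (real^'n) \<Rightarrow> complex" and x
    by (rule continuous_on_compose2[OF that]) (auto simp: Z_eq intro!: continuous_intros)
  define w where "w = (\<lambda>s x. (1 / T + 1) * (cmod (f (s, x)))\<^sup>2 + (cmod (?d (s, x)))\<^sup>2)"
  have w0: "0 \<le> w s x" for s x using T_pos by (simp add: w_def)
  have cw: "continuous_on {0..T} (\<lambda>s. w s x)" for x
    unfolding w_def by (intro continuous_intros slice cf cd)
  have pw: "(cmod (f (t, x)))\<^sup>2 \<le> integral {0..T} (\<lambda>s. w s x)" for x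
  proof -
    let ?\<phi> = "\<lambda>s. (cmod (f (s, x)))\<^sup>2" and ?\<psi> = "\<lambda>s. (cmod (f (s, x)))\<^sup>2 + (cmod (?d (s, x)))\<^sup>2"
    have c\<phi>: "continuous_on {0..T} ?\<phi>" and c\<psi>: "continuous_on {0..T} ?\<psi>" by (intro continuous_intros slice cf cd)+
    have c2: "continuous_on {0..T} (\<lambda>s. 2 * (f (s, x) \<bullet> ?d (s, x)))" by (intro continuous_intros slice cf cd)
    define Q where "Q = integral {0..T} ?\<psi>"
    have "?\<phi> t \<le> ?\<phi> s + Q" if s: "s \<in> {0..T}" for s
    proof -
      have *: "\<bar>?\<phi> b - ?\<phi> a\<bar> \<le> Q" if ab: "a \<le> b" "{a..b} \<subseteq> {0..T}" for a b
      proof -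
        have "(?\<phi> has_vector_derivative 2 * (f (u, x) \<bullet> ?d (u, x))) (at u within {a..b})" if "u \<in> {a..b}" for u
        proof -
          have "((\<lambda>s. f (s, x)) has_derivative (\<lambda>h. h *\<^sub>R ?d (u, x))) (at u within {a..b})"
            using has_vector_derivative_within_subset[OF dt_slice[OF f] ab(2)] that ab by (auto simp: has_vector_derivative_def)
          from has_derivative_inner[OF this this]
          show ?thesis unfolding has_vector_derivative_def power2_norm_eq_inner
            by (simp add: inner_commute algebra_simps)
        qed
        from fundamental_theorem_of_calculus[OF ab(1) this]
        have i: "((\<lambda>s. 2 * (f (s, x) \<bullet> ?d (s, x))) has_integral ?\<phi> b - ?\<phi> a) {a..b}" .
        have "\<bar>?\<phi> b - ?\<phi> a\<bar> \<le> integral {a..b} ?\<psi>"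
          unfolding integral_unique[OF i, symmetric] real_norm_def[symmetric]
        proof (rule integral_norm_bound_integral)
          show "(\<lambda>s. 2 * (f (s, x) \<bullet> ?d (s, x))) integrable_on {a..b}" using i by blast
          show "?\<psi> integrable_on {a..b}"
            by (intro integrable_continuous_interval continuous_on_subset[OF c\<psi> ab(2)])
          show "norm (2 * (f (s, x) \<bullet> ?d (s, x))) \<le> ?\<psi> s" for s
            using inner_mult_le[of 1 1 "f (s, x)" "?d (s, x)"] by simp
        qed
        also have "\<dots> \<le> Q" unfolding Q_def
          by (intro integral_subset_le integrable_continuous_interval continuous_on_subset[OF c\<psi>]) (use ab in auto)
        finally show ?thesis .
      qed
      show ?thesis
      proof (cases "s \<le> t")
        case True
        then have "\<bar>?\<phi> t - ?\<phi> s\<bar> \<le> Q" using s t by (intro *) auto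
        then show ?thesis by linarith
      next
        case False
        then have "\<bar>?\<phi> s - ?\<phi> t\<bar> \<le> Q" using s t by (intro *) auto
        then show ?thesis by linarith
      qed
    qed
    then have "integral {0..T} (\<lambda>s. ?\<phi> t) \<le> integral {0..T} (\<lambda>s. ?\<phi> s + Q)"
      by (intro integral_le integrable_continuous_interval continuous_intros c\<phi>) auto
    also have "\<dots> = integral {0..T} ?\<phi> + T * Q"
      using T_pos by (subst Henstock_Kurzweil_Integration.integral_add) (auto intro!: integrable_continuous_interval c\<phi>)
    finally have "T * ?\<phi> t \<le> integral {0..T} ?\<phi> + T * Q" using T_pos by simp
    then have "?\<phi> t \<le> 1 / T * integral {0..T} ?\<phi> + Q"
      using T_pos by (simp add: field_simps)
    also have "\<dots> = integral {0..T} (\<lambda>s. 1 / T * ?\<phi> s + ?\<psi> s)"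
      unfolding Q_def
      by (rule sym, rule integral_unique, intro has_integral_add has_integral_mult_right integrable_integral
          integrable_continuous_interval c\<phi> c\<psi>)
    also have "\<dots> = integral {0..T} (\<lambda>s. w s x)"
      by (simp add: w_def algebra_simps)
    finally show ?thesis .
  qed
  have mg: "(\<lambda>(s, x). ennreal ((cmod (g (s, x)))\<^sup>2) * indicator {0..T} s) \<in> borel_measurable (lborel \<Otimes>\<^sub>M lborel)"
    if "continuous_on Z g" for g :: "real \<times> (real^'n) \<Rightarrow> complex"
  proof -
    have "(\<lambda>z. indicator Z z *\<^sub>R g z) \<in> borel_measurable borel"
      by (intro borel_measurable_continuous_on_indicator that) (auto intro!: borel_closed)
    then have "(\<lambda>z. ennreal ((cmod (indicator Z z *\<^sub>R g z))\<^sup>2)) \<in> borel_measurable borel"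
      by measurable
    also have "(\<lambda>z. ennreal ((cmod (indicator Z z *\<^sub>R g z))\<^sup>2)) = (\<lambda>(s, x). ennreal ((cmod (g (s, x)))\<^sup>2) * indicator {0..T} s)"
      by (auto simp: indicator_def Z_eq)
    finally show ?thesis by (simp only: lborel_prod measurable_lborel2)
  qed
  have ms: "(\<lambda>s. ennreal ((cmod (g (s, x)))\<^sup>2) * indicator {0..T} s) \<in> borel_measurable lborel"
    if "continuous_on Z g" for g :: "real \<times> (real^'n) \<Rightarrow> complex" and x
    using measurable_compose[OF measurable_Pair2'[of x lborel lborel] mg[OF that]] by simp
  have swap: "(\<integral>\<^sup>+x. \<integral>\<^sup>+s. ennreal ((cmod (g (s, x)))\<^sup>2) * indicator {0..T} s \<partial>lborel \<partial>lborel) = ennreal ((L2norm (Omega T) g)\<^sup>2)"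
    if "continuous_on Z g" "integrable (lebesgue_on (Omega T)) (\<lambda>p. (cmod (g p))\<^sup>2)" for g :: "real \<times> (real^'n) \<Rightarrow> complex"
  proof -
    have "(\<integral>\<^sup>+x. \<integral>\<^sup>+s. ennreal ((cmod (g (s, x)))\<^sup>2) * indicator {0..T} s \<partial>lborel \<partial>lborel)
       = (\<integral>\<^sup>+s. \<integral>\<^sup>+x. ennreal ((cmod (g (s, x)))\<^sup>2) * indicator {0..T} s \<partial>lborel \<partial>lborel)"
      by (rule lborel_pair.Fubini'[OF mg[OF that(1)]])
    also have "\<dots> = (\<integral>\<^sup>+s. nsq (\<lambda>x. g (s, x)) * indicator {0..T} s \<partial>lborel)"
      by (intro nn_integral_cong) (auto simp: nsq_def indicator_def)
    also have "\<dots> = ennreal ((L2norm (Omega T) g)\<^sup>2)"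
      unfolding nn_integral_slab[OF that(1), symmetric] by (rule nn_integral_L2norm[OF that(2)])
    finally show ?thesis .
  qed
  have "nsq (\<lambda>x. f (t, x)) \<le> (\<integral>\<^sup>+x. \<integral>\<^sup>+s. ennreal (w s x) * indicator {0..T} s \<partial>lborel \<partial>lborel)"
    unfolding nsq_def using pw w0 cw by (intro nn_integral_mono) (simp add: nn_integral_Icc ennreal_leI)
  also have "\<dots> = (\<integral>\<^sup>+x. ennreal (1 / T + 1) * (\<integral>\<^sup>+s. ennreal ((cmod (f (s, x)))\<^sup>2) * indicator {0..T} s \<partial>lborel)
      + (\<integral>\<^sup>+s. ennreal ((cmod (?d (s, x)))\<^sup>2) * indicator {0..T} s \<partial>lborel) \<partial>lborel)"
  proof (intro nn_integral_cong)
    fix x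
    have "(\<integral>\<^sup>+s. ennreal (w s x) * indicator {0..T} s \<partial>lborel) = (\<integral>\<^sup>+s. ennreal (1 / T + 1) * (ennreal ((cmod (f (s, x)))\<^sup>2) * indicator {0..T} s)
      + ennreal ((cmod (?d (s, x)))\<^sup>2) * indicator {0..T} s \<partial>lborel)"
    proof (intro nn_integral_cong)
      fix s
      have "ennreal (w s x) = ennreal (1 / T + 1) * ennreal ((cmod (f (s, x)))\<^sup>2) + ennreal ((cmod (?d (s, x)))\<^sup>2)"
        unfolding w_def using T_pos by (subst ennreal_plus) (auto simp: ennreal_mult)
      then show "ennreal (w s x) * indicator {0..T} s = ennreal (1 / T + 1) * (ennreal ((cmod (f (s, x)))\<^sup>2) * indicator {0..T} s)
      + ennreal ((cmod (?d (s, x)))\<^sup>2) * indicator {0..T} s"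
        by (simp add: indicator_def)
    qed
    also have "\<dots> = ennreal (1 / T + 1) * (\<integral>\<^sup>+s. ennreal ((cmod (f (s, x)))\<^sup>2) * indicator {0..T} s \<partial>lborel)
      + (\<integral>\<^sup>+s. ennreal ((cmod (?d (s, x)))\<^sup>2) * indicator {0..T} s \<partial>lborel)"
      using ms[OF cf] ms[OF cd] by (subst nn_integral_add) (auto simp: nn_integral_cmult)
    finally show "(\<integral>\<^sup>+s. ennreal (w s x) * indicator {0..T} s \<partial>lborel) = \<dots>" .
  qed
  also have "\<dots> = ennreal (1 / T + 1) * ennreal ((L2norm (Omega T) f)\<^sup>2) + ennreal ((L2norm (Omega T) ?d)\<^sup>2)"
  proof -
    have *: "(\<lambda>x. \<integral>\<^sup>+s. ennreal ((cmod (g (s, x)))\<^sup>2) * indicator {0..T} s \<partial>lborel) \<in> borel_measurable lborel"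
      if "continuous_on Z g" for g :: "real \<times> (real^'n) \<Rightarrow> complex"
      using lborel.borel_measurable_nn_integral[of "\<lambda>x s. ennreal ((cmod (g (s, x)))\<^sup>2) * indicator {0..T} s" lborel]
        measurable_pair_swap[OF mg[OF that]] by (simp add: case_prod_unfold)
    show ?thesis using *[OF cf] *[OF cd]
      by (subst nn_integral_add) (auto simp: nn_integral_cmult swap[OF cf i0] swap[OF cd i1])
  qed
  also have "\<dots> = ennreal ((1 / T + 1) * (L2norm (Omega T) f)\<^sup>2 + (L2norm (Omega T) ?d)\<^sup>2)"
    using T_pos by (subst ennreal_plus) (auto simp: ennreal_mult)
  finally show ?thesis using t T_pos by (simp add: slice_le_def cf)
qed

text \<open>Extension constant in time. Subtracting it from the unknown reduces the initial value
  problem to zero initial data, which the integral operator \<open>J\<close> builds in.\<close>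

definition ext :: "(real^'n::finite \<Rightarrow> complex) \<Rightarrow> real \<times> (real^'n) \<Rightarrow> complex" where
  "ext g = (\<lambda>p. g (snd p))"

lemma smooth_UNIV_differentiable:
  fixes g :: "'a::euclidean_space \<Rightarrow> complex"
  assumes "smooth_upto UNIV g" "vs \<in> lists Basis"
  shows "(ipd UNIV vs g has_derivative (\<lambda>v. pd UNIV v (ipd UNIV vs g) x)) (at x)"
proof -
  have "ipd UNIV vs g differentiable (at x)"
    using assms unfolding smooth_upto_def closure_UNIV by blast
  from iffD1[OF frechet_derivative_works this] show ?thesis unfolding pd_def .
qed

lemma ext_has_derivative:
  assumes "smooth_upto UNIV g" "vs \<in> lists Basis"
  shows "(ext (ipd UNIV vs g) has_derivative (\<lambda>v. pd UNIV (snd v) (ipd UNIV vs g) (snd p))) (at p within Z)"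
proof -
  have "(snd has_derivative snd) (at p within Z)" by (auto intro!: derivative_eq_intros)
  from has_derivative_in_compose[OF this has_derivative_subset[OF smooth_UNIV_differentiable[OF assms] subset_UNIV]]
  show ?thesis by (simp add: ext_def)
qed

lemma pd_ext:
  assumes "smooth_upto UNIV g" "vs \<in> lists Basis" "p \<in> Z"
  shows "pd Z (dx j) (ext (ipd UNIV vs g)) p = ext (ipd UNIV (axis j 1 # vs) g) p" "pd Z dt (ext (ipd UNIV vs g)) p = 0"
proof -
  show "pd Z (dx j) (ext (ipd UNIV vs g)) p = ext (ipd UNIV (axis j 1 # vs) g) p"
    using pd_eq[OF assms(3) ext_has_derivative[OF assms(1,2)], of "dx j"] by (simp add: dx_def ext_def)
  have "pd UNIV 0 (ipd UNIV vs g) (snd p) = 0"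
    using linear_0[OF has_derivative_linear[OF smooth_UNIV_differentiable[OF assms(1,2), of "snd p"]]] .
  then show "pd Z dt (ext (ipd UNIV vs g)) p = 0"
    using pd_eq[OF assms(3) ext_has_derivative[OF assms(1,2)], of dt] by (simp add: dt_def)
qed

text \<open>The zero function belongs to the invariant because it is the time derivative of every
  extension.\<close>

lemma sm_ext:
  fixes g :: "real^'n::finite \<Rightarrow> complex"
  assumes g: "smooth_upto UNIV g"
  shows "sm (ext g)"
proof (rule smooth_coinduct[of "\<lambda>f. f = (\<lambda>_. 0) \<or> (\<exists>vs\<in>lists Basis. f = ext (ipd UNIV vs g))"])
  have "ext g = ext (ipd UNIV [] g)" "[] \<in> lists Basis" by auto
  then show "ext g = (\<lambda>_. 0) \<or> (\<exists>vs\<in>lists Basis. ext g = ext (ipd UNIV vs g))" by blast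
next
  fix f :: "real \<times> (real^'n) \<Rightarrow> complex" and p
  assume "f = (\<lambda>_. 0) \<or> (\<exists>vs\<in>lists Basis. f = ext (ipd UNIV vs g))"
  then show "f differentiable (at p within Z)"
  proof
    assume "\<exists>vs\<in>lists Basis. f = ext (ipd UNIV vs g)"
    then obtain vs where "vs \<in> lists Basis" "f = ext (ipd UNIV vs g)" by blast
    then show ?thesis using differentiableI[OF ext_has_derivative[OF g]] by blast
  qed auto
next
  fix f :: "real \<times> (real^'n) \<Rightarrow> complex" and v :: "real \<times> (real^'n)"
  assume f: "f = (\<lambda>_. 0) \<or> (\<exists>vs\<in>lists Basis. f = ext (ipd UNIV vs g))" and v: "v \<in> Basis"
  show "\<exists>h. (h = (\<lambda>_. 0) \<or> (\<exists>vs\<in>lists Basis. h = ext (ipd UNIV vs g))) \<and> (\<forall>p\<in>Z. pd Z v f p = h p)"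
  proof (cases "f = (\<lambda>_. 0)")
    case True
    then show ?thesis by (intro exI[of _ "\<lambda>_. 0"]) (simp add: pd_const)
  next
    case False
    then obtain vs where vs: "vs \<in> lists Basis" "f = ext (ipd UNIV vs g)" using f by blast
    consider "v = dt" | j where "v = dx j" using v by (auto simp: Basis_slab)
    then show ?thesis
    proof cases
      case 1
      then show ?thesis using vs pd_ext(2)[OF g vs(1)] by (intro exI[of _ "\<lambda>_. 0"]) simp
    next
      case 2
      have "axis j 1 # vs \<in> lists Basis" using vs by (auto simp: axis_in_Basis_iff)
      then show ?thesis using 2 vs pd_ext(1)[OF g vs(1)] by blast
    qed
  qed
qed

lemma ipd_ext:
  fixes g :: "real^'n::finite \<Rightarrow> complex"
  assumes g: "smooth_upto UNIV g" and "vs \<in> lists Basis" "p \<in> Z"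
  shows "ipd Z vs (ext g) p = (if vs \<in> lists (range dx) then ext (ipd UNIV (map snd vs) g) p else 0)"
  using assms(2,3)
proof (induction vs arbitrary: p rule: list.induct)
  case (Cons v vs)
  have vs: "vs \<in> lists Basis" and v: "v \<in> Basis" using Cons.prems(1) by (simp_all only: Cons_in_lists_iff)
  show ?case
  proof (cases "vs \<in> lists (range dx)")
    case True
    have e: "pd Z v (ipd Z vs (ext g)) p = pd Z v (ext (ipd UNIV (map snd vs) g)) p"
      using Cons True vs by (intro pd_cong) auto
    have m: "map snd vs \<in> lists Basis"
    proof -
      have "snd u \<in> Basis" if "u \<in> range dx" for u :: "real \<times> (real^'n)"
        using that by (auto simp: dx_def axis_in_Basis_iff)
      then show ?thesis using True unfolding in_lists_conv_set by simp
    qed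
    consider "v = dt" | j where "v = dx j" using v by (auto simp: Basis_slab)
    then show ?thesis
    proof cases
      case 1
      have "dt \<notin> range (dx :: 'n \<Rightarrow> real \<times> (real^'n))" by (simp add: dt_def dx_def image_iff)
      then have "v # vs \<notin> lists (range dx)" unfolding 1 Cons_in_lists_iff by (rule contrapos_nn) (rule conjunct1)
      then show ?thesis using 1 e pd_ext(2)[OF g m Cons.prems(2)] by (simp only: ipd.simps if_False)
    next
      case 2
      then have "v # vs \<in> lists (range dx)" using True unfolding Cons_in_lists_iff by simp
      moreover have "pd Z v (ext (ipd UNIV (map snd vs) g)) p = ext (ipd UNIV (map snd (v # vs)) g) p"
        using pd_ext(1)[OF g m Cons.prems(2), of j] unfolding 2 list.map by (simp only: dx_def snd_conv)
      ultimately show ?thesis using e by (simp only: ipd.simps if_True)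
    qed
  next
    case False
    have "pd Z v (ipd Z vs (ext g)) p = pd Z v (\<lambda>_. 0) p"
      using Cons False vs by (intro pd_cong) auto
    moreover have "v # vs \<notin> lists (range dx)" using False unfolding Cons_in_lists_iff by (rule contrapos_nn) (rule conjunct2)
    ultimately show ?thesis using Cons.prems(2) by (simp only: ipd.simps pd_const if_False)
  qed
qed (auto simp: ext_def)

end

section \<open>Moderate and negligible nets\<close>

text \<open>No constant stands in front of the power: an O-constant is absorbed by one further power
  of \<epsilon>, here and for \<open>negligible\<close>. This keeps sums and products of bounds
  elementary.\<close>

definition moderate :: "(real \<Rightarrow> real) \<Rightarrow> bool" where
  "moderate K \<longleftrightarrow> (\<exists>N::nat. \<forall>\<^sub>F \<epsilon> in at_right 0. \<bar>K \<epsilon>\<bar> \<le> (1 / \<epsilon>) ^ N)"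

definition negligible :: "(real \<Rightarrow> real) \<Rightarrow> bool" where
  "negligible K \<longleftrightarrow> (\<forall>q::nat. \<forall>\<^sub>F \<epsilon> in at_right 0. \<bar>K \<epsilon>\<bar> \<le> \<epsilon> ^ q)"

lemma eventually_small: "0 < r \<Longrightarrow> \<forall>\<^sub>F \<epsilon> in at_right (0::real). 0 < \<epsilon> \<and> \<epsilon> < r"
  by (auto simp: eventually_at_right[of 0 r] intro: exI[of _ r])

lemma moderate_mono:
  assumes "moderate L" "\<forall>\<^sub>F \<epsilon> in at_right 0. \<bar>K \<epsilon>\<bar> \<le> \<bar>L \<epsilon>\<bar>"
  shows "moderate K"
proof -
  obtain N where "\<forall>\<^sub>F \<epsilon> in at_right 0. \<bar>L \<epsilon>\<bar> \<le> (1 / \<epsilon>) ^ N" using assms by (auto simp: moderate_def)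
  with assms(2) have "\<forall>\<^sub>F \<epsilon> in at_right 0. \<bar>K \<epsilon>\<bar> \<le> (1 / \<epsilon>) ^ N" by eventually_elim linarith
  then show ?thesis by (auto simp: moderate_def)
qed

lemma moderate_cong: "moderate L \<Longrightarrow> \<forall>\<^sub>F \<epsilon> in at_right 0. K \<epsilon> = L \<epsilon> \<Longrightarrow> moderate K"
  by (erule moderate_mono, erule eventually_mono) simp

lemma moderate_power: "moderate (\<lambda>\<epsilon>. (1 / \<epsilon>) ^ N)"
  unfolding moderate_def using eventually_small[of 1]
  by (intro exI[of _ N]) (auto elim!: eventually_mono)

lemma moderate_const: "moderate (\<lambda>_. c)"
proof -
  have "\<forall>\<^sub>F \<epsilon> in at_right 0. \<bar>c\<bar> \<le> (1 / \<epsilon>) ^ 1"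
  proof -
    have "\<forall>\<^sub>F \<epsilon> in at_right 0. 0 < \<epsilon> \<and> \<epsilon> < 1 / (\<bar>c\<bar> + 1)" by (rule eventually_small) simp
    then show ?thesis
    proof eventually_elim
      case (elim \<epsilon>)
      then have "\<epsilon> * (\<bar>c\<bar> + 1) < 1" by (simp add: pos_less_divide_eq)
      then have "\<bar>c\<bar> * \<epsilon> \<le> 1" using elim by (simp add: algebra_simps)
      then show ?case using elim by (simp add: pos_le_divide_eq)
    qed
  qed
  then show ?thesis unfolding moderate_def by blast
qed

lemma moderate_add:
  assumes "moderate K" "moderate L"
  shows "moderate (\<lambda>\<epsilon>. K \<epsilon> + L \<epsilon>)"
proof -
  obtain N M where "\<forall>\<^sub>F \<epsilon> in at_right 0. \<bar>K \<epsilon>\<bar> \<le> (1 / \<epsilon>) ^ N" "\<forall>\<^sub>F \<epsilon> in at_right 0. \<bar>L \<epsilon>\<bar> \<le> (1 / \<epsilon>) ^ M"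
    using assms by (auto simp: moderate_def)
  moreover have "\<forall>\<^sub>F \<epsilon> in at_right 0. 0 < \<epsilon> \<and> \<epsilon> < (1/2::real)" by (rule eventually_small) simp
  ultimately have "\<forall>\<^sub>F \<epsilon> in at_right 0. \<bar>K \<epsilon> + L \<epsilon>\<bar> \<le> (1 / \<epsilon>) ^ (Suc (N + M))"
  proof eventually_elim
    case (elim \<epsilon>)
    then have e: "1 \<le> 1 / \<epsilon>" "2 \<le> 1 / \<epsilon>" by (auto simp: field_simps)
    have "\<bar>K \<epsilon> + L \<epsilon>\<bar> \<le> (1 / \<epsilon>) ^ N + (1 / \<epsilon>) ^ M" using elim by linarith
    also have "\<dots> \<le> (1 / \<epsilon>) ^ (N + M) + (1 / \<epsilon>) ^ (N + M)"
      using e by (intro add_mono power_increasing) auto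
    also have "\<dots> \<le> (1 / \<epsilon>) ^ (Suc (N + M))"
    proof -
      have "0 \<le> (1 / \<epsilon>) ^ (N + M)" using elim by simp
      from mult_right_mono[OF e(2) this] show ?thesis by simp
    qed
    finally show ?case .
  qed
  then show ?thesis unfolding moderate_def by blast
qed

lemma moderate_mult:
  assumes "moderate K" "moderate L"
  shows "moderate (\<lambda>\<epsilon>. K \<epsilon> * L \<epsilon>)"
proof -
  obtain N M where "\<forall>\<^sub>F \<epsilon> in at_right 0. \<bar>K \<epsilon>\<bar> \<le> (1 / \<epsilon>) ^ N" "\<forall>\<^sub>F \<epsilon> in at_right 0. \<bar>L \<epsilon>\<bar> \<le> (1 / \<epsilon>) ^ M"
    using assms by (auto simp: moderate_def)
  then have "\<forall>\<^sub>F \<epsilon> in at_right 0. \<bar>K \<epsilon> * L \<epsilon>\<bar> \<le> (1 / \<epsilon>) ^ (N + M)"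
    by eventually_elim (auto simp: abs_mult power_add intro!: mult_mono)
  then show ?thesis unfolding moderate_def by blast
qed

lemma negligible_moderate: "negligible K \<Longrightarrow> moderate K"
  unfolding negligible_def moderate_def by (intro exI[of _ 0]) (auto dest: spec[of _ 0])

lemma negligible_mono:
  assumes "negligible L" "\<forall>\<^sub>F \<epsilon> in at_right 0. \<bar>K \<epsilon>\<bar> \<le> \<bar>L \<epsilon>\<bar>"
  shows "negligible K"
  unfolding negligible_def
proof
  fix q
  have "\<forall>\<^sub>F \<epsilon> in at_right 0. \<bar>L \<epsilon>\<bar> \<le> \<epsilon> ^ q" using assms(1) by (simp add: negligible_def)
  with assms(2) show "\<forall>\<^sub>F \<epsilon> in at_right 0. \<bar>K \<epsilon>\<bar> \<le> \<epsilon> ^ q" by eventually_elim linarith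
qed

lemma negligible_mult:
  assumes "moderate K" "negligible L"
  shows "negligible (\<lambda>\<epsilon>. K \<epsilon> * L \<epsilon>)"
  unfolding negligible_def
proof
  fix q
  obtain N where "\<forall>\<^sub>F \<epsilon> in at_right 0. \<bar>K \<epsilon>\<bar> \<le> (1 / \<epsilon>) ^ N" using assms by (auto simp: moderate_def)
  moreover have "\<forall>\<^sub>F \<epsilon> in at_right 0. \<bar>L \<epsilon>\<bar> \<le> \<epsilon> ^ (N + q)" using assms(2) by (simp add: negligible_def)
  ultimately show "\<forall>\<^sub>F \<epsilon> in at_right 0. \<bar>K \<epsilon> * L \<epsilon>\<bar> \<le> \<epsilon> ^ q"
    using eventually_small[of 1, simplified]
  proof eventually_elim
    case (elim \<epsilon>)
    have "\<bar>K \<epsilon> * L \<epsilon>\<bar> \<le> (1 / \<epsilon>) ^ N * \<epsilon> ^ (N + q)" unfolding abs_mult using elim by (intro mult_mono) auto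
    also have "\<dots> = \<epsilon> ^ q" using elim by (simp add: power_add power_divide)
    finally show ?case .
  qed
qed

lemma negligible_add:
  assumes "negligible K" "negligible L"
  shows "negligible (\<lambda>\<epsilon>. K \<epsilon> + L \<epsilon>)"
  unfolding negligible_def
proof
  fix q
  have "\<forall>\<^sub>F \<epsilon> in at_right 0. \<bar>K \<epsilon>\<bar> \<le> \<epsilon> ^ Suc q" "\<forall>\<^sub>F \<epsilon> in at_right 0. \<bar>L \<epsilon>\<bar> \<le> \<epsilon> ^ Suc q"
    using assms unfolding negligible_def by blast+
  then show "\<forall>\<^sub>F \<epsilon> in at_right 0. \<bar>K \<epsilon> + L \<epsilon>\<bar> \<le> \<epsilon> ^ q"
    using eventually_small[of "1/2", simplified]
  proof eventually_elim
    case (elim \<epsilon>)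
    have "\<bar>K \<epsilon> + L \<epsilon>\<bar> \<le> 2 * \<epsilon> ^ Suc q" using elim by linarith
    also have "\<dots> = (2 * \<epsilon>) * \<epsilon> ^ q" by simp
    also have "\<dots> \<le> 1 * \<epsilon> ^ q" using elim by (intro mult_right_mono) auto
    finally show ?case by simp
  qed
qed

text \<open>With \<open>x = 1 / \<epsilon>\<close> this is the decay of \<open>x ^ q / exp x\<close>
  at infinity.\<close>

lemma negligible_exp: "negligible (\<lambda>\<epsilon>. exp (- 1 / \<epsilon>))"
  unfolding negligible_def
proof
  fix q :: nat
  have "((\<lambda>x::real. x ^ q / exp x) \<longlongrightarrow> 0) at_top" by (rule tendsto_power_div_exp_0)
  then have "\<forall>\<^sub>F x in at_top. x ^ q / exp x < (1::real)" by (rule order_tendstoD(2)) simp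
  then have "\<forall>\<^sub>F \<epsilon> in at_right 0. (inverse \<epsilon>) ^ q / exp (inverse \<epsilon>) < (1::real)"
    using filterlim_inverse_at_top_right by (auto simp: filterlim_iff)
  then show "\<forall>\<^sub>F \<epsilon> in at_right 0. \<bar>exp (- 1 / \<epsilon> :: real)\<bar> \<le> \<epsilon> ^ q"
    using eventually_small[of 1, simplified]
    by eventually_elim (simp add: exp_minus field_simps power_inverse)
qed

lemma negligible_sqrt: "negligible K \<Longrightarrow> (\<And>\<epsilon>. 0 \<le> K \<epsilon>) \<Longrightarrow> negligible (\<lambda>\<epsilon>. sqrt (K \<epsilon>))"
  unfolding negligible_def
proof
  assume nn: "\<And>\<epsilon>. 0 \<le> K \<epsilon>"
  fix q assume "\<forall>q. \<forall>\<^sub>F \<epsilon> in at_right 0. \<bar>K \<epsilon>\<bar> \<le> \<epsilon> ^ q"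
  then have "\<forall>\<^sub>F \<epsilon> in at_right 0. \<bar>K \<epsilon>\<bar> \<le> \<epsilon> ^ (2 * q)" by blast
  then show "\<forall>\<^sub>F \<epsilon> in at_right 0. \<bar>sqrt (K \<epsilon>)\<bar> \<le> \<epsilon> ^ q"
    using eventually_small[of 1, simplified]
  proof eventually_elim
    case (elim \<epsilon>)
    have "K \<epsilon> \<le> (\<epsilon> ^ q)\<^sup>2" using elim by (simp add: power_mult[symmetric] mult.commute)
    then have "sqrt (K \<epsilon>) \<le> \<epsilon> ^ q" using elim by (intro real_le_lsqrt) auto
    then show ?case using nn[of \<epsilon>] by simp
  qed
qed

lemma moderate_exp_ln: "moderate (\<lambda>\<epsilon>. exp (a + b * ln (1 / \<epsilon>)))"
proof -
  have "\<forall>\<^sub>F \<epsilon> in at_right 0. \<bar>exp (a + b * ln (1 / \<epsilon>))\<bar> \<le> \<bar>exp a * (1 / \<epsilon>) ^ nat \<lceil>\<bar>b\<bar>\<rceil>\<bar>"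
    using eventually_small[of 1, simplified]
  proof eventually_elim
    case (elim \<epsilon>)
    have "0 \<le> ln (1 / \<epsilon>)" using elim by (intro ln_ge_zero) (auto simp: field_simps)
    moreover have "b \<le> real (nat \<lceil>\<bar>b\<bar>\<rceil>)" by linarith
    ultimately have "b * ln (1 / \<epsilon>) \<le> real (nat \<lceil>\<bar>b\<bar>\<rceil>) * ln (1 / \<epsilon>)" by (intro mult_right_mono)
    then have "exp (b * ln (1 / \<epsilon>)) \<le> exp (real (nat \<lceil>\<bar>b\<bar>\<rceil>) * ln (1 / \<epsilon>))" by simp
    also have "\<dots> = (1 / \<epsilon>) ^ nat \<lceil>\<bar>b\<bar>\<rceil>" unfolding exp_of_nat_mult using elim by simp
    finally show ?case using elim by (simp add: exp_add)
  qed
  then show ?thesis by (rule moderate_mono[OF moderate_mult[OF moderate_const moderate_power]])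
qed

lemma bigo_moderate: "f \<in> O[at_right 0](\<lambda>\<epsilon>. \<epsilon> powr (- real N)) \<Longrightarrow> moderate f"
proof -
  assume "f \<in> O[at_right 0](\<lambda>\<epsilon>. \<epsilon> powr (- real N))"
  then obtain c where "\<forall>\<^sub>F \<epsilon> in at_right 0. norm (f \<epsilon>) \<le> c * norm (\<epsilon> powr (- real N))"
    by (elim landau_o.bigE)
  then have "\<forall>\<^sub>F \<epsilon> in at_right 0. \<bar>f \<epsilon>\<bar> \<le> \<bar>c * (1 / \<epsilon>) ^ N\<bar>"
    using eventually_small[of 1, simplified]
    by eventually_elim (auto simp: powr_minus powr_realpow power_divide divide_inverse power_inverse intro: order_trans[OF _ abs_ge_self])
  then show ?thesis by (rule moderate_mono[OF moderate_mult[OF moderate_const moderate_power]])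
qed

lemma moderate_bigo: "moderate f \<Longrightarrow> \<exists>N::nat. f \<in> O[at_right 0](\<lambda>\<epsilon>. \<epsilon> powr (- real N))"
proof -
  assume "moderate f"
  then obtain N where "\<forall>\<^sub>F \<epsilon> in at_right 0. \<bar>f \<epsilon>\<bar> \<le> (1 / \<epsilon>) ^ N" by (auto simp: moderate_def)
  then have "\<forall>\<^sub>F \<epsilon> in at_right 0. norm (f \<epsilon>) \<le> 1 * norm (\<epsilon> powr (- real N))"
    using eventually_small[of 1, simplified]
    by eventually_elim (auto simp: powr_minus powr_realpow power_divide divide_inverse power_inverse)
  then show ?thesis by (blast intro: landau_o.bigI[of 1])
qed

lemma bigo_negligible: "(\<And>q::nat. f \<in> O[at_right 0](\<lambda>\<epsilon>. \<epsilon> ^ q)) \<Longrightarrow> negligible f"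
  unfolding negligible_def
proof
  fix q :: nat assume "\<And>q::nat. f \<in> O[at_right 0](\<lambda>\<epsilon>. \<epsilon> ^ q)"
  then obtain c where c: "c > 0" "\<forall>\<^sub>F \<epsilon> in at_right 0. norm (f \<epsilon>) \<le> c * norm (\<epsilon> ^ Suc q)"
    by (metis landau_o.bigE)
  show "\<forall>\<^sub>F \<epsilon> in at_right 0. \<bar>f \<epsilon>\<bar> \<le> \<epsilon> ^ q"
    using c(2) eventually_small[OF divide_pos_pos[OF zero_less_one c(1)]]
  proof eventually_elim
    case (elim \<epsilon>)
    have "\<bar>f \<epsilon>\<bar> \<le> (c * \<epsilon>) * \<epsilon> ^ q" using elim by (simp add: abs_mult)
    also have "\<dots> \<le> 1 * \<epsilon> ^ q" using elim c(1) by (intro mult_right_mono) (auto simp: field_simps)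
    finally show ?case by simp
  qed
qed

lemma negligible_bigo: "negligible f \<Longrightarrow> f \<in> O[at_right 0](\<lambda>\<epsilon>. \<epsilon> ^ q)"
proof -
  assume "negligible f"
  then have "\<forall>\<^sub>F \<epsilon> in at_right 0. \<bar>f \<epsilon>\<bar> \<le> \<epsilon> ^ q" by (simp add: negligible_def)
  then have "\<forall>\<^sub>F \<epsilon> in at_right 0. norm (f \<epsilon>) \<le> 1 * norm (\<epsilon> ^ q)"
    using eventually_small[of 1, simplified] by eventually_elim auto
  then show ?thesis by (rule landau_o.bigI[rotated]) simp
qed

text \<open>Statements about nets are parameterised by a class \<open>P\<close> of admissible bounds: \<open>any_bound\<close> expresses
  mere finiteness for every \<open>\<epsilon>\<close>, \<open>moderate\<close> the growth condition of the Colombeau algebra.\<close>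

definition bound_class :: "((real \<Rightarrow> real) \<Rightarrow> bool) \<Rightarrow> bool" where
  "bound_class P \<longleftrightarrow> (\<forall>c. P (\<lambda>_. c)) \<and> (\<forall>K L. P K \<longrightarrow> P L \<longrightarrow> P (\<lambda>\<epsilon>. K \<epsilon> + L \<epsilon>) \<and> P (\<lambda>\<epsilon>. K \<epsilon> * L \<epsilon>))"

lemma bound_class_add: "bound_class P \<Longrightarrow> P K \<Longrightarrow> P L \<Longrightarrow> P (\<lambda>\<epsilon>. K \<epsilon> + L \<epsilon>)"
  and bound_class_mult: "bound_class P \<Longrightarrow> P K \<Longrightarrow> P L \<Longrightarrow> P (\<lambda>\<epsilon>. K \<epsilon> * L \<epsilon>)"
  and bound_class_const: "bound_class P \<Longrightarrow> P (\<lambda>_. c)"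
  by (simp_all add: bound_class_def)

lemmas bound_class_intros = bound_class_add bound_class_mult bound_class_const

abbreviation any_bound :: "(real \<Rightarrow> real) \<Rightarrow> bool" where "any_bound \<equiv> (\<lambda>_. True)"

lemma bound_class_any_bound [simp]: "bound_class any_bound"
  by (simp add: bound_class_def)

lemma bound_class_moderate [simp]: "bound_class moderate"
  by (simp add: bound_class_def moderate_const moderate_add moderate_mult)

section \<open>Nets of functions on the slab with bounded slices\<close>

context slab begin

text \<open>The bound holds for every \<epsilon> in the unit interval although the growth classes
  look at small \<epsilon> only: a representative must lie in the function space for each
  \<epsilon>, not just eventually.\<close>

definition L2_bdd :: "((real \<Rightarrow> real) \<Rightarrow> bool) \<Rightarrow> (real \<Rightarrow> real \<times> (real^'n::finite) \<Rightarrow> complex) \<Rightarrow> bool" where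
  "L2_bdd P u \<longleftrightarrow> (\<exists>K. P K \<and> (\<forall>\<epsilon>\<in>{0<..1}. \<forall>t\<in>{0..T}. slice_le t (u \<epsilon>) (K \<epsilon>)))"

definition sup_bdd :: "((real \<Rightarrow> real) \<Rightarrow> bool) \<Rightarrow> (real \<Rightarrow> real \<times> (real^'n::finite) \<Rightarrow> complex) \<Rightarrow> bool" where
  "sup_bdd P a \<longleftrightarrow> (\<exists>M. P M \<and> (\<forall>\<epsilon>\<in>{0<..1}. continuous_on Z (a \<epsilon>) \<and> (\<forall>p\<in>Z. cmod (a \<epsilon> p) \<le> M \<epsilon>)))"

lemma L2_bdd_cong: "L2_bdd P u \<Longrightarrow> (\<And>\<epsilon> p. \<epsilon> \<in> {0<..1} \<Longrightarrow> p \<in> Z \<Longrightarrow> u \<epsilon> p = v \<epsilon> p) \<Longrightarrow> L2_bdd P v"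
  unfolding L2_bdd_def by (metis slice_le_cong)

lemma L2_bdd_zero: "bound_class P \<Longrightarrow> L2_bdd P (\<lambda>_ _. 0)"
  unfolding L2_bdd_def bound_class_def by (intro exI[of _ "\<lambda>_. 0"]) (auto intro: slice_le_zero)

lemma L2_bdd_add:
  assumes "bound_class P" "L2_bdd P u" "L2_bdd P v"
  shows "L2_bdd P (\<lambda>\<epsilon> p. u \<epsilon> p + v \<epsilon> p)"
proof -
  obtain K L where KL: "P K" "P L" "\<forall>\<epsilon>\<in>{0<..1}. \<forall>t\<in>{0..T}. slice_le t (u \<epsilon>) (K \<epsilon>)" "\<forall>\<epsilon>\<in>{0<..1}. \<forall>t\<in>{0..T}. slice_le t (v \<epsilon>) (L \<epsilon>)"
    using assms by (auto simp: L2_bdd_def)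
  have "P (\<lambda>\<epsilon>. 2 * K \<epsilon> + 2 * L \<epsilon>)" by (intro bound_class_intros[OF assms(1)] KL)
  then show ?thesis unfolding L2_bdd_def using KL(3,4) by (intro exI[of _ "\<lambda>\<epsilon>. 2 * K \<epsilon> + 2 * L \<epsilon>"]) (auto intro: slice_le_add)
qed

lemma L2_bdd_mult:
  assumes "bound_class P" "sup_bdd P a" "L2_bdd P u"
  shows "L2_bdd P (\<lambda>\<epsilon> p. a \<epsilon> p * u \<epsilon> p)"
proof -
  obtain K M where KM: "P K" "P M" "\<forall>\<epsilon>\<in>{0<..1}. \<forall>t\<in>{0..T}. slice_le t (u \<epsilon>) (K \<epsilon>)"
    "\<forall>\<epsilon>\<in>{0<..1}. continuous_on Z (a \<epsilon>) \<and> (\<forall>p\<in>Z. cmod (a \<epsilon> p) \<le> M \<epsilon>)"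
    using assms by (auto simp: L2_bdd_def sup_bdd_def)
  have "P (\<lambda>\<epsilon>. (M \<epsilon> * M \<epsilon>) * K \<epsilon>)" by (intro bound_class_intros[OF assms(1)] KM)
  then show ?thesis unfolding L2_bdd_def using KM(3,4)
    by (intro exI[of _ "\<lambda>\<epsilon>. (M \<epsilon> * M \<epsilon>) * K \<epsilon>"]) (auto simp: power2_eq_square[symmetric] intro!: slice_le_mult)
qed

lemma L2_bdd_uminus: "L2_bdd P u \<Longrightarrow> L2_bdd P (\<lambda>\<epsilon> p. - u \<epsilon> p)"
  unfolding L2_bdd_def by (metis slice_le_uminus)

lemma L2_bdd_sum_list:
  assumes "bound_class P" "\<And>i. i \<in> set S \<Longrightarrow> L2_bdd P (u i)"
  shows "L2_bdd P (\<lambda>\<epsilon> p. \<Sum>i\<leftarrow>S. u i \<epsilon> p)"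
  using assms(2) by (induction S) (simp_all add: assms(1) L2_bdd_zero L2_bdd_add)

lemma L2_bdd_finite:
  assumes "bound_class P" "finite S" "\<And>i. i \<in> S \<Longrightarrow> L2_bdd P (u i)"
  obtains K where "P K" "\<And>\<epsilon>. 0 \<le> K \<epsilon>" "\<And>i \<epsilon> t. i \<in> S \<Longrightarrow> \<epsilon> \<in> {0<..1} \<Longrightarrow> t \<in> {0..T} \<Longrightarrow> slice_le t (u i \<epsilon>) (K \<epsilon>)"
  using assms(2,3)
proof (induction S arbitrary: thesis rule: finite_induct)
  case empty
  have "P (\<lambda>_. 0)" using assms(1) by (simp add: bound_class_def)
  then show ?case by (rule empty(1)) auto
next
  case (insert i S)
  obtain K where K: "P K" "\<And>\<epsilon>. 0 \<le> K \<epsilon>" "\<And>i \<epsilon> t. i \<in> S \<Longrightarrow> \<epsilon> \<in> {0<..1} \<Longrightarrow> t \<in> {0..T} \<Longrightarrow> slice_le t (u i \<epsilon>) (K \<epsilon>)"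
    by (rule insert.IH) (use insert.prems(2) in auto)
  obtain L where L: "P L" "\<forall>\<epsilon>\<in>{0<..1}. \<forall>t\<in>{0..T}. slice_le t (u i \<epsilon>) (L \<epsilon>)" using insert.prems(2)[of i] by (auto simp: L2_bdd_def)
  \<comment> \<open>A \<open>bound_class\<close> offers sums, products and constants but no maximum;
    \<open>x \<le> x * x + 1\<close> produces a nonnegative common majorant from these
    alone.\<close>
  have P: "P (\<lambda>\<epsilon>. K \<epsilon> + (L \<epsilon> * L \<epsilon> + 1))" by (intro bound_class_intros[OF assms(1)] K L)
  show ?case
  proof (rule insert.prems(1)[OF P])
    show "0 \<le> K \<epsilon> + (L \<epsilon> * L \<epsilon> + 1)" for \<epsilon> using K(2)[of \<epsilon>] zero_le_square[of "L \<epsilon>"] by linarith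
    fix j and \<epsilon> t :: real assume *: "j \<in> insert i S" "\<epsilon> \<in> {0<..1}" "t \<in> {0..T}"
    have "L \<epsilon> \<le> L \<epsilon> * L \<epsilon> + 1" 
    proof -
      have "0 \<le> (L \<epsilon> - 1) * (L \<epsilon> - 1)" "0 \<le> L \<epsilon> * L \<epsilon>" by simp_all
      moreover have "(L \<epsilon> - 1) * (L \<epsilon> - 1) = L \<epsilon> * L \<epsilon> - 2 * L \<epsilon> + 1" by (simp add: algebra_simps)
      ultimately show ?thesis by linarith
    qed
    then have le: "L \<epsilon> \<le> K \<epsilon> + (L \<epsilon> * L \<epsilon> + 1)" "K \<epsilon> \<le> K \<epsilon> + (L \<epsilon> * L \<epsilon> + 1)"
      using K(2)[of \<epsilon>] zero_le_square[of "L \<epsilon>"] by linarith+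
    show "slice_le t (u j \<epsilon>) (K \<epsilon> + (L \<epsilon> * L \<epsilon> + 1))"
    proof (cases "j = i")
      case True
      then have "slice_le t (u j \<epsilon>) (L \<epsilon>)" using * L(2) by simp
      then show ?thesis using le(1) by (rule slice_le_mono)
    next
      case False
      then have "slice_le t (u j \<epsilon>) (K \<epsilon>)" using * K(3) by simp
      then show ?thesis using le(2) by (rule slice_le_mono)
    qed
  qed
qed

lemma sup_bdd_finite:
  assumes "bound_class P" "finite S" "\<And>i. i \<in> S \<Longrightarrow> sup_bdd P (u i)"
  shows "\<exists>M. P M \<and> (\<forall>i\<in>S. \<forall>\<epsilon>\<in>{0<..1}. \<forall>p\<in>Z. cmod (u i \<epsilon> p) \<le> M \<epsilon>)"
  using assms(2,3)
proof (induction S rule: finite_induct)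
  case empty
  have "P (\<lambda>_. 0)" using assms(1) by (simp add: bound_class_def)
  then show ?case by blast
next
  case (insert i S)
  then obtain K where K: "P K" "\<forall>i\<in>S. \<forall>\<epsilon>\<in>{0<..1}. \<forall>p\<in>Z. cmod (u i \<epsilon> p) \<le> K \<epsilon>" by blast
  have "sup_bdd P (u i)" using insert.prems by simp
  then obtain L where L: "P L" "\<forall>\<epsilon>\<in>{0<..1}. \<forall>p\<in>Z. cmod (u i \<epsilon> p) \<le> L \<epsilon>" unfolding sup_bdd_def by blast
  have P: "P (\<lambda>\<epsilon>. (K \<epsilon> * K \<epsilon> + 1) + (L \<epsilon> * L \<epsilon> + 1))" by (intro bound_class_intros[OF assms(1)] K L)
  have slice_L2: "x \<le> x * x + 1 \<and> 0 \<le> x * x + 1" for x :: real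
  proof -
    have "0 \<le> (x - 1) * (x - 1)" "0 \<le> x * x" by simp_all
    moreover have "(x - 1) * (x - 1) = x * x - 2 * x + 1" by (simp add: algebra_simps)
    ultimately show ?thesis by linarith
  qed
  have "cmod (u j \<epsilon> p) \<le> (K \<epsilon> * K \<epsilon> + 1) + (L \<epsilon> * L \<epsilon> + 1)"
    if *: "j \<in> insert i S" "\<epsilon> \<in> {0<..1}" "p \<in> Z" for j \<epsilon> p
  proof (cases "j = i")
    case True
    then have "cmod (u j \<epsilon> p) \<le> L \<epsilon>" using * L(2) by blast
    then show ?thesis using slice_L2[of "L \<epsilon>"] slice_L2[of "K \<epsilon>"] by linarith
  next
    case False
    then have "cmod (u j \<epsilon> p) \<le> K \<epsilon>" using * K(2) by blast
    then show ?thesis using slice_L2[of "L \<epsilon>"] slice_L2[of "K \<epsilon>"] by linarith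
  qed
  with P show ?case by blast
qed

lemma L2_bdd_any_bound: "L2_bdd any_bound u \<longleftrightarrow> (\<forall>\<epsilon>\<in>{0<..1}. \<exists>K. \<forall>t\<in>{0..T}. slice_le t (u \<epsilon>) K)"
  unfolding L2_bdd_def by (auto dest: bchoice)

lemma sup_bdd_any_bound: "sup_bdd any_bound a \<longleftrightarrow> (\<forall>\<epsilon>\<in>{0<..1}. continuous_on Z (a \<epsilon>) \<and> (\<exists>M. \<forall>p\<in>Z. cmod (a \<epsilon> p) \<le> M))"
proof
  assume "sup_bdd any_bound a"
  then show "\<forall>\<epsilon>\<in>{0<..1}. continuous_on Z (a \<epsilon>) \<and> (\<exists>M. \<forall>p\<in>Z. cmod (a \<epsilon> p) \<le> M)"
    unfolding sup_bdd_def by blast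
next
  assume *: "\<forall>\<epsilon>\<in>{0<..1}. continuous_on Z (a \<epsilon>) \<and> (\<exists>M. \<forall>p\<in>Z. cmod (a \<epsilon> p) \<le> M)"
  then have "\<exists>M. \<forall>\<epsilon>\<in>{0<..1}. \<forall>p\<in>Z. cmod (a \<epsilon> p) \<le> M \<epsilon>" by (intro bchoice) blast
  then show "sup_bdd any_bound a" unfolding sup_bdd_def using * by blast
qed

lemma L2_bdd_weaken: "L2_bdd P u \<Longrightarrow> L2_bdd any_bound u" and sup_bdd_weaken: "sup_bdd P u \<Longrightarrow> sup_bdd any_bound u"
  unfolding L2_bdd_def sup_bdd_def by auto

text \<open>A bound for small \<epsilon> is completed by merely finite bounds for the remaining
  \<epsilon>, which the growth condition does not see. Estimates that hold only eventually are
  brought into the form \<open>L2_bdd\<close> this way.\<close>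

lemma L2_bdd_moderate_eventually:
  assumes "L2_bdd any_bound u" "moderate K" "\<forall>\<^sub>F \<epsilon> in at_right 0. \<forall>t\<in>{0..T}. slice_le t (u \<epsilon>) (K \<epsilon>)"
  shows "L2_bdd moderate u"
proof -
  obtain L where L: "\<forall>\<epsilon>\<in>{0<..1}. \<forall>t\<in>{0..T}. slice_le t (u \<epsilon>) (L \<epsilon>)" using assms(1) by (auto simp: L2_bdd_def)
  define K' where "K' = (\<lambda>\<epsilon>. if \<forall>t\<in>{0..T}. slice_le t (u \<epsilon>) (K \<epsilon>) then K \<epsilon> else L \<epsilon>)"
  have "moderate K'" using assms(3) by (intro moderate_cong[OF assms(2)]) (auto simp: K'_def elim!: eventually_mono)
  moreover have "\<forall>\<epsilon>\<in>{0<..1}. \<forall>t\<in>{0..T}. slice_le t (u \<epsilon>) (K' \<epsilon>)" using L by (auto simp: K'_def)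
  ultimately show ?thesis by (auto simp: L2_bdd_def)
qed

text \<open>Here \<open>m\<close> limits the number of time derivatives only: the spatial derivatives are controlled by the energy
  estimate all at once, the time derivatives one after the other.\<close>

definition L2_smooth :: "((real \<Rightarrow> real) \<Rightarrow> bool) \<Rightarrow> nat \<Rightarrow> (real \<Rightarrow> real \<times> (real^'n::finite) \<Rightarrow> complex) \<Rightarrow> bool" where
  "L2_smooth P m u \<longleftrightarrow> (\<forall>\<epsilon>\<in>{0<..1}. sm (u \<epsilon>)) \<and>
     (\<forall>vs\<in>lists Basis. count_list vs dt \<le> m \<longrightarrow> L2_bdd P (\<lambda>\<epsilon>. ipd Z vs (u \<epsilon>)))"

definition sup_smooth :: "((real \<Rightarrow> real) \<Rightarrow> bool) \<Rightarrow> (real \<Rightarrow> real \<times> (real^'n::finite) \<Rightarrow> complex) \<Rightarrow> bool" where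
  "sup_smooth P a \<longleftrightarrow> (\<forall>\<epsilon>\<in>{0<..1}. sm (a \<epsilon>)) \<and> (\<forall>vs\<in>lists Basis. sup_bdd P (\<lambda>\<epsilon>. ipd Z vs (a \<epsilon>)))"

lemma L2_smooth_sm: "L2_smooth P m u \<Longrightarrow> \<epsilon> \<in> {0<..1} \<Longrightarrow> sm (u \<epsilon>)"
  and sup_smooth_sm: "sup_smooth P a \<Longrightarrow> \<epsilon> \<in> {0<..1} \<Longrightarrow> sm (a \<epsilon>)"
  by (auto simp: L2_smooth_def sup_smooth_def)

lemma L2_smooth_L2_bdd: "L2_smooth P m u \<Longrightarrow> vs \<in> lists Basis \<Longrightarrow> count_list vs dt \<le> m \<Longrightarrow> L2_bdd P (\<lambda>\<epsilon>. ipd Z vs (u \<epsilon>))"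
  and sup_smooth_sup_bdd: "sup_smooth P a \<Longrightarrow> vs \<in> lists Basis \<Longrightarrow> sup_bdd P (\<lambda>\<epsilon>. ipd Z vs (a \<epsilon>))"
  unfolding L2_smooth_def sup_smooth_def by blast+

lemma L2_smoothI:
  assumes "\<And>\<epsilon>. \<epsilon> \<in> {0<..1} \<Longrightarrow> sm (u \<epsilon>)"
    and "\<And>vs. vs \<in> lists Basis \<Longrightarrow> count_list vs dt \<le> m \<Longrightarrow> L2_bdd P (\<lambda>\<epsilon>. ipd Z vs (u \<epsilon>))"
  shows "L2_smooth P m u"
  using assms unfolding L2_smooth_def by blast

lemma L2_smooth_cong:
  assumes "L2_smooth P m u" "\<And>\<epsilon> p. \<epsilon> \<in> {0<..1} \<Longrightarrow> p \<in> Z \<Longrightarrow> u \<epsilon> p = v \<epsilon> p"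
  shows "L2_smooth P m v"
proof (rule L2_smoothI)
  fix \<epsilon> :: real assume "\<epsilon> \<in> {0<..1}" then show "sm (v \<epsilon>)" using assms sm_cong[OF L2_smooth_sm] by blast
next
  fix vs :: "(real \<times> (real^'a)) list" assume "vs \<in> lists Basis" "count_list vs dt \<le> m"
  from L2_smooth_L2_bdd[OF assms(1) this] show "L2_bdd P (\<lambda>\<epsilon>. ipd Z vs (v \<epsilon>))"
    by (rule L2_bdd_cong) (use assms(2) in \<open>auto intro!: ipd_cong\<close>)
qed

lemma L2_smooth_weaken: "L2_smooth P m u \<Longrightarrow> L2_smooth any_bound m u" and sup_smooth_weaken: "sup_smooth P a \<Longrightarrow> sup_smooth any_bound a"
  unfolding L2_smooth_def sup_smooth_def by (blast intro: L2_bdd_weaken sup_bdd_weaken)+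

lemma L2_smooth_zero: "bound_class P \<Longrightarrow> L2_smooth P m (\<lambda>_ _. 0)"
  by (rule L2_smoothI) (intro sm_const, erule L2_bdd_cong[OF L2_bdd_zero], rule ipd_zero[symmetric])

lemma L2_smooth_add:
  assumes "bound_class P" "L2_smooth P m u" "L2_smooth P m v"
  shows "L2_smooth P m (\<lambda>\<epsilon> p. u \<epsilon> p + v \<epsilon> p)"
proof (rule L2_smoothI)
  fix vs :: "(real \<times> (real^'a)) list" assume vs: "vs \<in> lists Basis" "count_list vs dt \<le> m"
  show "L2_bdd P (\<lambda>\<epsilon>. ipd Z vs (\<lambda>p. u \<epsilon> p + v \<epsilon> p))"
    by (rule L2_bdd_cong[OF L2_bdd_add[OF assms(1) L2_smooth_L2_bdd[OF assms(2) vs] L2_smooth_L2_bdd[OF assms(3) vs]]])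
      (use assms vs in \<open>simp add: ipd_add L2_smooth_sm\<close>)
qed (intro sm_add L2_smooth_sm[OF assms(2)] L2_smooth_sm[OF assms(3)])

lemma L2_smooth_uminus:
  assumes "L2_smooth P m u"
  shows "L2_smooth P m (\<lambda>\<epsilon> p. - u \<epsilon> p)"
proof (rule L2_smoothI)
  fix vs :: "(real \<times> (real^'a)) list" assume vs: "vs \<in> lists Basis" "count_list vs dt \<le> m"
  show "L2_bdd P (\<lambda>\<epsilon>. ipd Z vs (\<lambda>p. - u \<epsilon> p))"
    by (rule L2_bdd_cong[OF L2_bdd_uminus[OF L2_smooth_L2_bdd[OF assms vs]]]) (use assms vs in \<open>simp add: ipd_uminus L2_smooth_sm\<close>)
qed (intro sm_uminus L2_smooth_sm[OF assms])

lemma L2_smooth_diff: "bound_class P \<Longrightarrow> L2_smooth P m u \<Longrightarrow> L2_smooth P m v \<Longrightarrow> L2_smooth P m (\<lambda>\<epsilon> p. u \<epsilon> p - v \<epsilon> p)"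
  using L2_smooth_add[OF _ _ L2_smooth_uminus, of P m u v] by simp

lemma L2_smooth_sum:
  assumes "bound_class P" "\<And>i. i \<in> S \<Longrightarrow> L2_smooth P m (u i)"
  shows "L2_smooth P m (\<lambda>\<epsilon> p. \<Sum>i\<in>S. u i \<epsilon> p)"
  using assms(2) by (induction S rule: infinite_finite_induct) (simp_all add: assms(1) L2_smooth_zero L2_smooth_add)

text \<open>The Leibniz rule distributes the time derivatives over the factors, so neither receives
  more than \<open>m\<close> of them.\<close>

lemma L2_smooth_mult:
  assumes P: "bound_class P" and a: "sup_smooth P a" and u: "L2_smooth P m u"
  shows "L2_smooth P m (\<lambda>\<epsilon> p. a \<epsilon> p * u \<epsilon> p)"
proof (rule L2_smoothI)
  fix vs :: "(real \<times> (real^'a)) list" assume vs: "vs \<in> lists Basis" "count_list vs dt \<le> m"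
  have "L2_bdd P (\<lambda>\<epsilon> p. ipd Z [] (a \<epsilon>) p * ipd Z vs (u \<epsilon>) p + (\<Sum>ab\<leftarrow>psplits vs. ipd Z (fst ab) (a \<epsilon>) p * ipd Z (snd ab) (u \<epsilon>) p))"
  proof (intro L2_bdd_add L2_bdd_sum_list P L2_bdd_mult[OF P] L2_smooth_L2_bdd[OF u] sup_smooth_sup_bdd[OF a] vs)
    fix ab assume "ab \<in> set (psplits vs)"
    then have ab: "(fst ab, snd ab) \<in> set (psplits vs)" by simp
    show "fst ab \<in> lists Basis" "snd ab \<in> lists Basis" using psplits_Basis[OF vs(1) ab] by auto
    show "count_list (snd ab) dt \<le> m" using psplits_props[OF ab, of dt] vs by simp
  qed auto
  then show "L2_bdd P (\<lambda>\<epsilon>. ipd Z vs (\<lambda>p. a \<epsilon> p * u \<epsilon> p))"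
    by (rule L2_bdd_cong) (use a u vs in \<open>simp add: ipd_mult L2_smooth_sm sup_smooth_sm case_prod_unfold\<close>)
qed (intro sm_mult L2_smooth_sm[OF u] sup_smooth_sm[OF a])

lemma L2_bdd_D:
  assumes "L2_bdd P (\<lambda>\<epsilon>. pd Z (dx j) (u \<epsilon>))" "\<And>\<epsilon>. \<epsilon> \<in> {0<..1} \<Longrightarrow> sm (u \<epsilon>)" "\<And>\<epsilon>. \<epsilon> \<in> {0<..1} \<Longrightarrow> 0 < h \<epsilon>"
  shows "L2_bdd P (\<lambda>\<epsilon>. D (h \<epsilon>) j (u \<epsilon>))"
  using assms(1) unfolding L2_bdd_def by (meson assms(2,3) slice_le_D)

lemma L2_smooth_D:
  assumes "L2_smooth P m u" "\<And>\<epsilon>. \<epsilon> \<in> {0<..1} \<Longrightarrow> 0 < h \<epsilon>"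
  shows "L2_smooth P m (\<lambda>\<epsilon>. D (h \<epsilon>) j (u \<epsilon>))"
proof (rule L2_smoothI)
  fix vs :: "(real \<times> (real^'a)) list" assume vs: "vs \<in> lists Basis" "count_list vs dt \<le> m"
  have "(dx j :: real \<times> (real^'a)) \<noteq> dt" by (auto simp: dx_def dt_def)
  then have "L2_bdd P (\<lambda>\<epsilon>. ipd Z (dx j # vs) (u \<epsilon>))" using vs by (intro L2_smooth_L2_bdd[OF assms(1)]) auto
  then have "L2_bdd P (\<lambda>\<epsilon>. D (h \<epsilon>) j (ipd Z vs (u \<epsilon>)))"
    using assms(2) by (intro L2_bdd_D sm_ipd L2_smooth_sm[OF assms(1)] vs) simp_all
  then show "L2_bdd P (\<lambda>\<epsilon>. ipd Z vs (D (h \<epsilon>) j (u \<epsilon>)))"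
    by (rule L2_bdd_cong) (use assms vs in \<open>simp add: ipd_D L2_smooth_sm\<close>)
qed (intro sm_D L2_smooth_sm[OF assms(1)])

lemma L2_smooth_semi_op:
  assumes "bound_class P" "\<And>j k l. sup_smooth P (\<lambda>\<epsilon>. A j \<epsilon> k l)" "\<And>k l. sup_smooth P (\<lambda>\<epsilon>. B \<epsilon> k l)"
    "\<And>l. L2_smooth P m (\<lambda>\<epsilon>. U \<epsilon> l)" "\<And>\<epsilon>. \<epsilon> \<in> {0<..1} \<Longrightarrow> 0 < h \<epsilon>"
  shows "L2_smooth P m (\<lambda>\<epsilon>. semi_op (h \<epsilon>) (\<lambda>j. A j \<epsilon>) (B \<epsilon>) (U \<epsilon>) k)"
  unfolding semi_op_def by (intro L2_smooth_add L2_smooth_sum L2_smooth_mult L2_smooth_D assms)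

lemma L2_bdd_J:
  assumes "bound_class P" "L2_bdd P u" "\<And>\<epsilon>. \<epsilon> \<in> {0<..1} \<Longrightarrow> sm (u \<epsilon>)"
  shows "L2_bdd P (\<lambda>\<epsilon>. J (u \<epsilon>))"
proof -
  obtain K where K: "P K" "\<forall>\<epsilon>\<in>{0<..1}. \<forall>t\<in>{0..T}. slice_le t (u \<epsilon>) (K \<epsilon>)" using assms(2) by (auto simp: L2_bdd_def)
  have "P (\<lambda>\<epsilon>. (T * exp T) * K \<epsilon>)" by (intro bound_class_intros[OF assms(1)] K)
  moreover have "slice_le t (J (u \<epsilon>)) ((T * exp T) * K \<epsilon>)" if "\<epsilon> \<in> {0<..1}" "t \<in> {0..T}" for \<epsilon> t
  proof -
    have K0: "0 \<le> K \<epsilon>" using K(2) that by (auto simp: slice_le_def)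
    have "slice_le t (J (u \<epsilon>)) (T * K \<epsilon> / 1 * exp (1 * t))"
    proof (rule slice_le_J[OF assms(3)[OF that(1)] _ _ that(2)])
      fix s assume s: "s \<in> {0..T}"
      have "0 \<le> s" using s by simp
      then have "K \<epsilon> * 1 \<le> K \<epsilon> * exp (1 * s)" using K0 by (intro mult_left_mono) auto
      moreover have "slice_le s (u \<epsilon>) (K \<epsilon>)" using K(2) that s by blast
      ultimately show "slice_le s (u \<epsilon>) (K \<epsilon> * exp (1 * s))" by (auto intro: slice_le_mono)
    qed auto
    then show ?thesis
      by (rule slice_le_mono) (use K0 T_pos that in \<open>auto intro!: mult_left_mono simp: mult.commute mult.left_commute\<close>)
  qed
  ultimately show ?thesis unfolding L2_bdd_def by blast
qed

text \<open>The derivatives of a list act from its end, so before the last \<open>dt\<close> only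
  space derivatives act. They commute with \<open>J\<close>, and this \<open>dt\<close> cancels
  it.\<close>

lemma ipd_J_dt:
  assumes "sm f" "ws \<in> lists Basis" "xs \<in> lists (range dx)" "p \<in> Z"
  shows "ipd Z (ws @ dt # xs) (J f) p = ipd Z (ws @ xs) f p"
  unfolding ipd_append
proof (rule ipd_cong)
  fix q :: "real \<times> (real^'a)" assume q: "q \<in> Z"
  have "sm (ipd Z xs f)" using assms by (intro sm_ipd) auto
  moreover have "pd Z dt (ipd Z xs (J f)) q = pd Z dt (J (ipd Z xs f)) q"
    by (rule pd_cong) (use assms q in \<open>auto simp: ipd_J_space simp del: in_lists_conv_set\<close>)
  ultimately show "ipd Z (dt # xs) (J f) q = ipd Z xs f q" using q by (simp add: pd_J_dt)
qed (rule assms)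

text \<open>Gains one time derivative: a list containing \<open>dt\<close> loses one
  \<open>dt\<close> together with \<open>J\<close> and falls back on \<open>f\<close>. Lists without
  \<open>dt\<close> are left to the hypothesis \<open>s\<close>, so that the energy estimate can
  supply their bounds.\<close>

lemma L2_smooth_J:
  assumes f: "L2_smooth P m f" and s: "\<And>vs. vs \<in> lists (range dx) \<Longrightarrow> L2_bdd P (\<lambda>\<epsilon>. ipd Z vs (J (f \<epsilon>)))"
  shows "L2_smooth P (Suc m) (\<lambda>\<epsilon>. J (f \<epsilon>))"
proof (rule L2_smoothI)
  fix vs :: "(real \<times> (real^'a)) list" assume vs: "vs \<in> lists Basis" "count_list vs dt \<le> Suc m"
  show "L2_bdd P (\<lambda>\<epsilon>. ipd Z vs (J (f \<epsilon>)))"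
  proof (cases "dt \<in> set vs")
    case False
    have "v \<in> range dx" if "v \<in> set vs" for v
    proof -
      have "v \<in> Basis" "v \<noteq> dt" using vs(1) that False by auto
      then show ?thesis by (simp add: Basis_slab)
    qed
    then have "vs \<in> lists (range dx)" by (simp only: in_lists_conv_set) blast
    then show ?thesis by (rule s)
  next
    case True
    then obtain ws xs where v: "vs = ws @ dt # xs" "dt \<notin> set xs" using split_list_last by metis
    have "v \<in> range dx" if "v \<in> set xs" for v
    proof -
      have "v \<in> Basis" "v \<noteq> dt" using vs(1) that v by auto
      then show ?thesis by (simp add: Basis_slab)
    qed
    then have w: "ws \<in> lists Basis" "xs \<in> lists (range dx)"
      using vs(1) v by (simp_all only: in_lists_conv_set) auto
    have "L2_bdd P (\<lambda>\<epsilon>. ipd Z (ws @ xs) (f \<epsilon>))"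
      using vs(2) w space_lists[OF w(2)] v by (intro L2_smooth_L2_bdd[OF f]) auto
    then show ?thesis
      by (rule L2_bdd_cong) (use w f in \<open>simp add: v(1) ipd_J_dt L2_smooth_sm del: in_lists_conv_set\<close>)
  qed
qed (intro sm_J L2_smooth_sm[OF f])


lemma L2_bdd_negligible_add:
  assumes "L2_bdd negligible u" "L2_bdd negligible v"
  shows "L2_bdd negligible (\<lambda>\<epsilon> p. u \<epsilon> p + v \<epsilon> p)"
proof -
  obtain K L where KL: "negligible K" "negligible L" "\<forall>\<epsilon>\<in>{0<..1}. \<forall>t\<in>{0..T}. slice_le t (u \<epsilon>) (K \<epsilon>)" "\<forall>\<epsilon>\<in>{0<..1}. \<forall>t\<in>{0..T}. slice_le t (v \<epsilon>) (L \<epsilon>)"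
    using assms by (auto simp: L2_bdd_def)
  have "negligible (\<lambda>\<epsilon>. 2 * K \<epsilon> + 2 * L \<epsilon>)" by (intro negligible_add negligible_mult moderate_const KL)
  then show ?thesis unfolding L2_bdd_def using KL(3,4) by (intro exI[of _ "\<lambda>\<epsilon>. 2 * K \<epsilon> + 2 * L \<epsilon>"]) (auto intro: slice_le_add)
qed

lemma L2_bdd_negligible_diff: "L2_bdd negligible u \<Longrightarrow> L2_bdd negligible v \<Longrightarrow> L2_bdd negligible (\<lambda>\<epsilon> p. u \<epsilon> p - v \<epsilon> p)"
  using L2_bdd_negligible_add[OF _ L2_bdd_uminus, of u v] by simp

lemma negligible_const_0: "negligible (\<lambda>_. 0)"
  unfolding negligible_def using eventually_small[of 1] by (auto elim!: eventually_mono)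

lemma L2_bdd_negligible_sum: "(\<And>i. i \<in> S \<Longrightarrow> L2_bdd negligible (u i)) \<Longrightarrow> L2_bdd negligible (\<lambda>\<epsilon> p. \<Sum>i\<in>S. u i \<epsilon> p)"
proof (induction S rule: infinite_finite_induct)
  case (insert i S)
  then show ?case by (simp add: L2_bdd_negligible_add)
qed (auto simp: L2_bdd_def intro!: exI[of _ "\<lambda>_. 0"] negligible_const_0 slice_le_zero)

lemma L2_bdd_negligible_mult:
  assumes a: "sup_bdd moderate a" and u: "L2_bdd negligible u"
  shows "L2_bdd negligible (\<lambda>\<epsilon> p. a \<epsilon> p * u \<epsilon> p)"
proof -
  obtain K M where KM: "negligible K" "moderate M" "\<forall>\<epsilon>\<in>{0<..1}. \<forall>t\<in>{0..T}. slice_le t (u \<epsilon>) (K \<epsilon>)"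
    "\<forall>\<epsilon>\<in>{0<..1}. continuous_on Z (a \<epsilon>) \<and> (\<forall>p\<in>Z. cmod (a \<epsilon> p) \<le> M \<epsilon>)"
    using assms by (auto simp: L2_bdd_def sup_bdd_def)
  have "negligible (\<lambda>\<epsilon>. (M \<epsilon> * M \<epsilon>) * K \<epsilon>)" by (intro negligible_mult moderate_mult KM)
  moreover have "slice_le t (\<lambda>p. a \<epsilon> p * u \<epsilon> p) ((M \<epsilon> * M \<epsilon>) * K \<epsilon>)" if "\<epsilon> \<in> {0<..1}" "t \<in> {0..T}" for \<epsilon> t
    unfolding power2_eq_square[symmetric] using KM(3,4) that by (intro slice_le_mult) auto
  ultimately show ?thesis unfolding L2_bdd_def by blast
qed

lemma L2_bdd_negligible_mult':
  assumes a: "sup_bdd negligible a" and u: "L2_bdd moderate u"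
  shows "L2_bdd negligible (\<lambda>\<epsilon> p. a \<epsilon> p * u \<epsilon> p)"
proof -
  obtain K M where KM: "moderate K" "negligible M" "\<forall>\<epsilon>\<in>{0<..1}. \<forall>t\<in>{0..T}. slice_le t (u \<epsilon>) (K \<epsilon>)"
    "\<forall>\<epsilon>\<in>{0<..1}. continuous_on Z (a \<epsilon>) \<and> (\<forall>p\<in>Z. cmod (a \<epsilon> p) \<le> M \<epsilon>)"
    using assms by (auto simp: L2_bdd_def sup_bdd_def)
  have "negligible (\<lambda>\<epsilon>. (K \<epsilon> * M \<epsilon>) * M \<epsilon>)" by (intro negligible_mult moderate_mult KM negligible_moderate[OF KM(2)])
  moreover have "slice_le t (\<lambda>p. a \<epsilon> p * u \<epsilon> p) ((K \<epsilon> * M \<epsilon>) * M \<epsilon>)" if "\<epsilon> \<in> {0<..1}" "t \<in> {0..T}" for \<epsilon> t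
  proof -
    have "slice_le t (\<lambda>p. a \<epsilon> p * u \<epsilon> p) ((M \<epsilon>)\<^sup>2 * K \<epsilon>)" using KM(3,4) that by (intro slice_le_mult) auto
    then show ?thesis by (simp add: power2_eq_square mult.commute mult.left_commute)
  qed
  ultimately show ?thesis unfolding L2_bdd_def by blast
qed

lemma L2_bdd_negligible_eventually:
  assumes "L2_bdd any_bound u" "negligible K" "\<forall>\<^sub>F \<epsilon> in at_right 0. \<forall>t\<in>{0..T}. slice_le t (u \<epsilon>) (K \<epsilon>)"
  shows "L2_bdd negligible u"
proof -
  obtain L where L: "\<forall>\<epsilon>\<in>{0<..1}. \<forall>t\<in>{0..T}. slice_le t (u \<epsilon>) (L \<epsilon>)" using assms(1) by (auto simp: L2_bdd_def)
  define K' where "K' = (\<lambda>\<epsilon>. if \<forall>t\<in>{0..T}. slice_le t (u \<epsilon>) (K \<epsilon>) then K \<epsilon> else L \<epsilon>)"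
  have "negligible K'" using assms(3) by (intro negligible_mono[OF assms(2)]) (auto simp: K'_def elim!: eventually_mono)
  moreover have "\<forall>\<epsilon>\<in>{0<..1}. \<forall>t\<in>{0..T}. slice_le t (u \<epsilon>) (K' \<epsilon>)" using L by (auto simp: K'_def)
  ultimately show ?thesis by (auto simp: L2_bdd_def)
qed

lemma eventually_unit: "(\<And>\<epsilon>. \<epsilon> \<in> {0<..1} \<Longrightarrow> Q \<epsilon>) \<Longrightarrow> \<forall>\<^sub>F \<epsilon> in at_right (0::real). Q \<epsilon>"
  using eventually_small[of 1] by (auto elim!: eventually_mono)

section \<open>Passage between Colombeau nets and uniform slice bounds\<close>

lemma L2_bdd_trace:
  assumes u: "\<And>\<epsilon>. \<epsilon> \<in> {0<..1} \<Longrightarrow> Hinf (Omega T) (u \<epsilon>)" and vs: "vs \<in> lists Basis"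
    and P: "P (\<lambda>\<epsilon>. (1 / T + 1) * (L2norm (Omega T) (ipd Z vs (u \<epsilon>)) * L2norm (Omega T) (ipd Z vs (u \<epsilon>)))
      + L2norm (Omega T) (ipd Z (dt # vs) (u \<epsilon>)) * L2norm (Omega T) (ipd Z (dt # vs) (u \<epsilon>)))"
  shows "L2_bdd P (\<lambda>\<epsilon>. ipd Z vs (u \<epsilon>))"
  unfolding L2_bdd_def
proof (intro exI conjI, rule P, intro ballI)
  fix \<epsilon> t :: real assume *: "\<epsilon> \<in> {0<..1}" "t \<in> {0..T}"
  have d: "dt # vs \<in> lists Basis" using vs by simp
  have "sm (ipd Z vs (u \<epsilon>))" using u[OF *(1)] vs by (intro sm_ipd) (auto simp: Hinf_def)
  moreover have "integrable (lebesgue_on (Omega T)) (\<lambda>p. (cmod (ipd Z vs (u \<epsilon>) p))\<^sup>2)"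
    using u[OF *(1)] vs unfolding Hinf_def by blast
  moreover have "integrable (lebesgue_on (Omega T)) (\<lambda>p. (cmod (ipd Z (dt # vs) (u \<epsilon>) p))\<^sup>2)"
    using u[OF *(1)] d unfolding Hinf_def by blast
  ultimately show "slice_le t (ipd Z vs (u \<epsilon>)) ((1 / T + 1) * (L2norm (Omega T) (ipd Z vs (u \<epsilon>)) * L2norm (Omega T) (ipd Z vs (u \<epsilon>)))
      + L2norm (Omega T) (ipd Z (dt # vs) (u \<epsilon>)) * L2norm (Omega T) (ipd Z (dt # vs) (u \<epsilon>)))"
    using trace_estimate[OF _ _ _ *(2), of "ipd Z vs (u \<epsilon>)"] by (simp only: power2_eq_square ipd.simps)
qed

lemma mod_L2_L2_smooth:
  assumes "mod_L2 (Omega T) u"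
  shows "L2_smooth moderate m u"
proof (rule L2_smoothI)
  fix vs :: "(real \<times> (real^'a)) list" assume vs: "vs \<in> lists Basis"
  have m: "moderate (\<lambda>\<epsilon>. L2norm (Omega T) (ipd Z vs (u \<epsilon>)))" if "vs \<in> lists Basis" for vs
    using assms that unfolding mod_L2_def by (metis bigo_moderate)
  have d: "dt # vs \<in> lists Basis" using vs by simp
  show "L2_bdd moderate (\<lambda>\<epsilon>. ipd Z vs (u \<epsilon>))"
    using assms by (intro L2_bdd_trace vs moderate_add moderate_mult moderate_const m d) (auto simp: mod_L2_def)
qed (use assms in \<open>auto simp: mod_L2_def Hinf_def\<close>)

lemma L2norm_nonneg: "0 \<le> L2norm S f"
  by (simp add: L2norm_def)

lemma L2_smooth_Hinf:
  assumes "\<And>m. L2_smooth P m u" "\<epsilon> \<in> {0<..1}"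
  shows "Hinf (Omega T) (u \<epsilon>)"
  unfolding Hinf_def
proof (intro conjI ballI)
  show "sm (u \<epsilon>)" using assms L2_smooth_sm by blast
  fix vs :: "(real \<times> (real^'a)) list" assume vs: "vs \<in> lists Basis"
  have "L2_bdd P (\<lambda>\<epsilon>. ipd Z vs (u \<epsilon>))" by (rule L2_smooth_L2_bdd[OF assms(1) vs order_refl])
  then obtain K where "\<And>t. t \<in> {0..T} \<Longrightarrow> slice_le t (ipd Z vs (u \<epsilon>)) K" using assms(2) unfolding L2_bdd_def by blast
  from slice_le_integrable[OF this] show "ipd Z vs (u \<epsilon>) \<in> borel_measurable (lebesgue_on (Omega T))"
    "integrable (lebesgue_on (Omega T)) (\<lambda>x. (cmod (ipd Z vs (u \<epsilon>) x))\<^sup>2)" by auto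
qed

lemma L2_smooth_mod_L2:
  assumes "\<And>m. L2_smooth moderate m u"
  shows "mod_L2 (Omega T) u"
  unfolding mod_L2_def
proof (intro conjI ballI)
  fix vs :: "(real \<times> (real^'a)) list" assume vs: "vs \<in> lists Basis"
  have "L2_bdd moderate (\<lambda>\<epsilon>. ipd Z vs (u \<epsilon>))" by (rule L2_smooth_L2_bdd[OF assms vs order_refl])
  then obtain K where K: "moderate K" "\<forall>\<epsilon>\<in>{0<..1}. \<forall>t\<in>{0..T}. slice_le t (ipd Z vs (u \<epsilon>)) (K \<epsilon>)" unfolding L2_bdd_def by blast
  have "moderate (\<lambda>\<epsilon>. 1 + T * K \<epsilon>)" by (intro moderate_add moderate_mult moderate_const K)
  moreover have "\<forall>\<^sub>F \<epsilon> in at_right 0. \<bar>L2norm (Omega T) (ipd Z vs (u \<epsilon>))\<bar> \<le> \<bar>1 + T * K \<epsilon>\<bar>"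
  proof (rule eventually_unit)
    fix \<epsilon> :: real assume "\<epsilon> \<in> {0<..1}"
    then have le: "(L2norm (Omega T) (ipd Z vs (u \<epsilon>)))\<^sup>2 \<le> T * K \<epsilon>" using K(2) by (intro slice_le_integrable) blast
    \<comment> \<open>\<open>2 * x \<le> 1 + x\<^sup>2\<close> bounds the norm by its square, so no
      root of a moderate net is needed.\<close>
    have "0 \<le> (L2norm (Omega T) (ipd Z vs (u \<epsilon>)) - 1)\<^sup>2" by simp
    then have "2 * L2norm (Omega T) (ipd Z vs (u \<epsilon>)) \<le> 1 + T * K \<epsilon>" using le by (simp add: power2_diff)
    then show "\<bar>L2norm (Omega T) (ipd Z vs (u \<epsilon>))\<bar> \<le> \<bar>1 + T * K \<epsilon>\<bar>"
      using L2norm_nonneg[of "Omega T" "ipd Z vs (u \<epsilon>)"] by linarith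
  qed
  ultimately have "moderate (\<lambda>\<epsilon>. L2norm (Omega T) (ipd Z vs (u \<epsilon>)))" by (rule moderate_mono)
  then show "\<exists>N::nat. (\<lambda>\<epsilon>. L2norm (Omega T) (ipd Z vs (u \<epsilon>))) \<in> O[at_right 0](\<lambda>\<epsilon>. \<epsilon> powr - real N)"
    by (rule moderate_bigo)
qed (rule L2_smooth_Hinf[OF assms])

lemma neg_L2_negligible: "neg_L2 S u \<Longrightarrow> vs \<in> lists Basis \<Longrightarrow> negligible (\<lambda>\<epsilon>. L2norm S (ipd (closure S) vs (u \<epsilon>)))"
  unfolding neg_L2_def by (intro bigo_negligible) blast

lemma neg_L2_L2_bdd:
  assumes "neg_L2 (Omega T) u"
  shows "L2_bdd negligible u"
proof -
  have n: "negligible (\<lambda>\<epsilon>. L2norm (Omega T) (ipd Z vs (u \<epsilon>)))" if "vs \<in> lists Basis" for vs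
    using neg_L2_negligible[OF assms that] .
  have "L2_bdd negligible (\<lambda>\<epsilon>. ipd Z [] (u \<epsilon>))"
  proof (rule L2_bdd_trace)
    have d: "[dt] \<in> lists Basis" "[] \<in> lists Basis" by auto
    show "negligible (\<lambda>\<epsilon>. (1 / T + 1) * (L2norm (Omega T) (ipd Z [] (u \<epsilon>)) * L2norm (Omega T) (ipd Z [] (u \<epsilon>)))
      + L2norm (Omega T) (ipd Z [dt] (u \<epsilon>)) * L2norm (Omega T) (ipd Z [dt] (u \<epsilon>)))"
      using n[OF d(1)] n[OF d(2)] by (intro negligible_add negligible_mult moderate_const negligible_moderate)
  qed (use assms in \<open>auto simp: neg_L2_def\<close>)
  then show ?thesis by simp
qed

text \<open>The interpolation step size is the fourth root of the null bound.\<close>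

lemma L2_bdd_negligible_pd:
  assumes X: "\<And>m. L2_smooth moderate m u" and u: "L2_bdd negligible u" and v: "v \<in> Basis"
  shows "L2_bdd negligible (\<lambda>\<epsilon>. pd Z v (u \<epsilon>))"
proof -
  have vv: "[v, v] \<in> lists Basis" "[v] \<in> lists Basis" using v by auto
  obtain K0 where K0: "negligible K0" "\<forall>\<epsilon>\<in>{0<..1}. \<forall>t\<in>{0..T}. slice_le t (u \<epsilon>) (K0 \<epsilon>)" using u by (auto simp: L2_bdd_def)
  have "L2_bdd moderate (\<lambda>\<epsilon>. ipd Z [v, v] (u \<epsilon>))" by (rule L2_smooth_L2_bdd[OF X vv(1) order_refl])
  then obtain K2 where K2: "moderate K2" "\<forall>\<epsilon>\<in>{0<..1}. \<forall>t\<in>{0..T}. slice_le t (pd Z v (pd Z v (u \<epsilon>))) (K2 \<epsilon>)" by (auto simp: L2_bdd_def)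
  \<comment> \<open>The exponential makes \<open>k\<close> strictly positive, so that one can divide
    by the step, and keeps it negligible. With \<open>h\<^sup>2 = sqrt (k \<epsilon>)\<close> both
    interpolation terms become a moderate factor times \<open>sqrt (k \<epsilon>)\<close>.\<close>
  define k where "k = (\<lambda>\<epsilon>. \<bar>K0 \<epsilon>\<bar> + exp (- 1 / \<epsilon>))"
  have kpos: "0 < k \<epsilon>" for \<epsilon> by (simp add: k_def add_nonneg_pos)
  have "negligible (\<lambda>\<epsilon>. \<bar>K0 \<epsilon>\<bar>)" by (rule negligible_mono[OF K0(1)]) simp
  then have nk: "negligible k" unfolding k_def by (intro negligible_add negligible_exp)
  then have ns: "negligible (\<lambda>\<epsilon>. sqrt (k \<epsilon>))" by (rule negligible_sqrt) (simp add: kpos less_imp_le)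
  then have nh: "negligible (\<lambda>\<epsilon>. sqrt (sqrt (k \<epsilon>)))" by (rule negligible_sqrt) (simp add: kpos less_imp_le)
  have "\<forall>\<^sub>F \<epsilon> in at_right 0. \<bar>sqrt (sqrt (k \<epsilon>))\<bar> \<le> \<epsilon> ^ 1" using nh unfolding negligible_def by blast
  moreover have "\<forall>\<^sub>F \<epsilon> in at_right 0. 0 < \<epsilon> \<and> \<epsilon> < T / 2" by (rule eventually_small) (use T_pos in simp)
  ultimately have small: "\<forall>\<^sub>F \<epsilon> in at_right 0. 2 * sqrt (sqrt (k \<epsilon>)) \<le> T"
    by eventually_elim (auto simp: abs_le_iff)
  have K: "negligible (\<lambda>\<epsilon>. 8 * sqrt (k \<epsilon>) + (2 * K2 \<epsilon>) * sqrt (k \<epsilon>))"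
    by (intro negligible_add negligible_mult moderate_mult moderate_const K2 ns)
  have "\<forall>\<^sub>F \<epsilon> in at_right 0. \<forall>t\<in>{0..T}. slice_le t (pd Z v (u \<epsilon>)) (8 * sqrt (k \<epsilon>) + (2 * K2 \<epsilon>) * sqrt (k \<epsilon>))"
    using small eventually_small[of 1, simplified]
  proof eventually_elim
    case (elim \<epsilon>)
    define h where "h = sqrt (sqrt (k \<epsilon>))"
    have h: "0 < h" "2 * h \<le> T" "h\<^sup>2 = sqrt (k \<epsilon>)" using elim kpos[of \<epsilon>] by (auto simp: h_def less_imp_le)
    have kk: "k \<epsilon> / sqrt (k \<epsilon>) = sqrt (k \<epsilon>)" using kpos[of \<epsilon>] by (simp add: real_div_sqrt)
    have e: "\<epsilon> \<in> {0<..1}" using elim by auto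
    have k0: "slice_le t (u \<epsilon>) (k \<epsilon>)" if "t \<in> {0..T}" for t
    proof -
      have "slice_le t (u \<epsilon>) (K0 \<epsilon>)" using K0(2) e that by blast
      moreover have "K0 \<epsilon> \<le> k \<epsilon>" using abs_ge_self[of "K0 \<epsilon>"] exp_ge_zero[of "- 1 / \<epsilon>"] unfolding k_def by linarith
      ultimately show ?thesis by (rule slice_le_mono)
    qed
    have smu: "sm (u \<epsilon>)" using X e L2_smooth_sm by blast
    show ?case
    proof
      fix t assume t: "t \<in> {0..T}"
      consider "v = dt" | j where "v = dx j" using v by (auto simp: Basis_slab)
      then show "slice_le t (pd Z v (u \<epsilon>)) (8 * sqrt (k \<epsilon>) + (2 * K2 \<epsilon>) * sqrt (k \<epsilon>))"
      proof cases
        case 1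
        have "slice_le t (pd Z dt (u \<epsilon>)) (8 * k \<epsilon> / h\<^sup>2 + 2 * h\<^sup>2 * K2 \<epsilon>)"
          by (rule slice_le_time_derivative[OF smu k0 _ h(1,2) t]) (use K2(2) e 1 in auto)
        moreover have "8 * k \<epsilon> / h\<^sup>2 + 2 * h\<^sup>2 * K2 \<epsilon> = 8 * sqrt (k \<epsilon>) + (2 * K2 \<epsilon>) * sqrt (k \<epsilon>)"
          unfolding h(3) times_divide_eq_right[symmetric] kk by simp
        ultimately show ?thesis by (simp only: 1)
      next
        case 2
        have "slice_le t (pd Z (dx j) (u \<epsilon>)) (2 * (k \<epsilon> / h\<^sup>2) + 2 * (h\<^sup>2 * K2 \<epsilon>))"
          by (rule slice_le_space_derivative[OF smu k0[OF t] _ h(1)]) (use K2(2) e 2 t in auto)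
        moreover have "2 * (k \<epsilon> / h\<^sup>2) + 2 * (h\<^sup>2 * K2 \<epsilon>) \<le> 8 * sqrt (k \<epsilon>) + (2 * K2 \<epsilon>) * sqrt (k \<epsilon>)"
          using kk kpos[of \<epsilon>] by (simp add: h(3) mult.commute less_imp_le)
        ultimately show ?thesis unfolding 2 by (rule slice_le_mono)
      qed
    qed
  qed
  moreover have "L2_bdd any_bound (\<lambda>\<epsilon>. pd Z v (u \<epsilon>))"
    using L2_bdd_weaken[OF L2_smooth_L2_bdd[OF X vv(2) order_refl]] by simp
  ultimately show ?thesis using K by (intro L2_bdd_negligible_eventually)
qed

lemma L2_smooth_pd_all:
  assumes "\<And>m. L2_smooth P m u" "v \<in> Basis"
  shows "L2_smooth P m (\<lambda>\<epsilon>. pd Z v (u \<epsilon>))"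
proof (rule L2_smoothI)
  fix vs :: "(real \<times> (real^'a)) list" assume vs: "vs \<in> lists Basis"
  then have "vs @ [v] \<in> lists Basis" using assms(2) by simp
  from L2_smooth_L2_bdd[OF assms(1) this order_refl] show "L2_bdd P (\<lambda>\<epsilon>. ipd Z vs (pd Z v (u \<epsilon>)))" by (simp add: ipd_append)
next
  fix \<epsilon> :: real assume "\<epsilon> \<in> {0<..1}" then show "sm (pd Z v (u \<epsilon>))" using sm_pd[OF L2_smooth_sm[OF assms(1)] assms(2)] by blast
qed

text \<open>Induction over the list of derivatives. Moderateness of all derivatives is carried along
  with negligibility, because the interpolation consumes second derivatives at every stage.\<close>

lemma neg_L2_I:
  assumes X: "\<And>m. L2_smooth moderate m u" and u: "L2_bdd negligible u"
  shows "neg_L2 (Omega T) u"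
  unfolding neg_L2_def
proof (intro conjI ballI allI)
  fix vs :: "(real \<times> (real^'a)) list" and q :: nat assume vs: "vs \<in> lists Basis"
  have "(\<forall>m. L2_smooth moderate m (\<lambda>\<epsilon>. ipd Z vs (u \<epsilon>))) \<and> L2_bdd negligible (\<lambda>\<epsilon>. ipd Z vs (u \<epsilon>))"
    using vs
  proof (induction vs)
    case (Cons v vs)
    then have IH: "\<And>m. L2_smooth moderate m (\<lambda>\<epsilon>. ipd Z vs (u \<epsilon>))" "L2_bdd negligible (\<lambda>\<epsilon>. ipd Z vs (u \<epsilon>))" "v \<in> Basis" by auto
    from L2_smooth_pd_all[OF IH(1,3)] L2_bdd_negligible_pd[OF IH] show ?case by simp
  qed (use assms in auto)
  then obtain K where K: "negligible K" "\<forall>\<epsilon>\<in>{0<..1}. \<forall>t\<in>{0..T}. slice_le t (ipd Z vs (u \<epsilon>)) (K \<epsilon>)" by (auto simp: L2_bdd_def)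
  have n: "negligible (\<lambda>\<epsilon>. sqrt \<bar>T * K \<epsilon>\<bar>)"
    by (rule negligible_sqrt, rule negligible_mono[OF negligible_mult[OF moderate_const[of T] K(1)]]) auto
  have "negligible (\<lambda>\<epsilon>. L2norm (Omega T) (ipd Z vs (u \<epsilon>)))"
  proof (rule negligible_mono[OF n], rule eventually_unit)
    fix \<epsilon> :: real assume "\<epsilon> \<in> {0<..1}"
    then have le: "(L2norm (Omega T) (ipd Z vs (u \<epsilon>)))\<^sup>2 \<le> T * K \<epsilon>" using K(2) by (intro slice_le_integrable) blast
    then have "L2norm (Omega T) (ipd Z vs (u \<epsilon>)) \<le> sqrt \<bar>T * K \<epsilon>\<bar>" by (intro real_le_rsqrt) linarith
    then show "\<bar>L2norm (Omega T) (ipd Z vs (u \<epsilon>))\<bar> \<le> \<bar>sqrt \<bar>T * K \<epsilon>\<bar>\<bar>"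
      using L2norm_nonneg[of "Omega T" "ipd Z vs (u \<epsilon>)"] by linarith
  qed
  then show "(\<lambda>\<epsilon>. L2norm (Omega T) (ipd Z vs (u \<epsilon>))) \<in> O[at_right 0](\<lambda>\<epsilon>. \<epsilon> ^ q)" by (rule negligible_bigo)
qed (rule L2_smooth_Hinf[OF X])

text \<open>\<open>supnorm\<close> runs over the open slab; continuity up to the boundary carries
  the bound to \<open>Z\<close>, in particular to the initial plane.\<close>

lemma Winf_bound:
  fixes a :: "real \<times> (real^'n::finite) \<Rightarrow> complex"
  assumes "Winf (Omega T) a" "vs \<in> lists Basis" "p \<in> Z"
  shows "cmod (ipd Z vs a p) \<le> supnorm (Omega T) (ipd Z vs a)"
proof -
  have "continuous_on Z (ipd Z vs a)" using assms by (intro sm_continuous sm_ipd) (auto simp: Winf_def)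
  then have c: "continuous_on (closure (Omega T)) (\<lambda>p. cmod (ipd Z vs a p))" by (intro continuous_intros)
  have "bounded (ipd Z vs a ` Omega T)" using assms unfolding Winf_def by blast
  then have bdd: "bdd_above ((\<lambda>x. cmod (ipd Z vs a x)) ` Omega T)" by (auto simp: bounded_iff bdd_above_def)
  have "(\<lambda>p. cmod (ipd Z vs a p)) ` closure (Omega T) \<subseteq> {.. supnorm (Omega T) (ipd Z vs a)}"
    by (rule image_closure_subset[OF c]) (auto simp: supnorm_def intro!: cSUP_upper bdd)
  then show ?thesis using assms(3) by blast
qed

lemma sup_bdd_supnorm:
  fixes a :: "real \<Rightarrow> real \<times> (real^'n::finite) \<Rightarrow> complex"
  assumes "\<And>\<epsilon>. \<epsilon> \<in> {0<..1} \<Longrightarrow> Winf (Omega T) (a \<epsilon>)" "vs \<in> lists Basis"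
    and "P (\<lambda>\<epsilon>. supnorm (Omega T) (ipd Z vs (a \<epsilon>)))"
  shows "sup_bdd P (\<lambda>\<epsilon>. ipd Z vs (a \<epsilon>))"
  unfolding sup_bdd_def
proof (intro exI conjI ballI, rule assms(3))
  fix \<epsilon> :: real assume e: "\<epsilon> \<in> {0<..1}"
  show "continuous_on Z (ipd Z vs (a \<epsilon>))" using assms(1)[OF e] assms(2) by (intro sm_continuous sm_ipd) (auto simp: Winf_def)
  fix p :: "real \<times> (real^'n)" assume "p \<in> Z"
  then show "cmod (ipd Z vs (a \<epsilon>) p) \<le> supnorm (Omega T) (ipd Z vs (a \<epsilon>))" by (rule Winf_bound[OF assms(1)[OF e] assms(2)])
qed

lemma mod_Linf_sup_smooth:
  assumes "mod_Linf (Omega T) a"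
  shows "sup_smooth moderate a"
  unfolding sup_smooth_def
proof (intro conjI ballI)
  fix vs :: "(real \<times> (real^'a)) list" assume vs: "vs \<in> lists Basis"
  then have "moderate (\<lambda>\<epsilon>. supnorm (Omega T) (ipd Z vs (a \<epsilon>)))"
    using assms unfolding mod_Linf_def by (metis bigo_moderate)
  then show "sup_bdd moderate (\<lambda>\<epsilon>. ipd Z vs (a \<epsilon>))"
    using assms by (intro sup_bdd_supnorm vs) (auto simp: mod_Linf_def)
qed (use assms in \<open>auto simp: mod_Linf_def Winf_def\<close>)

lemma neg_Linf_sup_bdd:
  assumes "neg_Linf (Omega T) a" "vs \<in> lists Basis"
  shows "sup_bdd negligible (\<lambda>\<epsilon>. ipd Z vs (a \<epsilon>))"
proof (rule sup_bdd_supnorm)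
  show "negligible (\<lambda>\<epsilon>. supnorm (Omega T) (ipd Z vs (a \<epsilon>)))"
    using assms unfolding neg_Linf_def by (intro bigo_negligible) blast
qed (use assms in \<open>auto simp: neg_Linf_def\<close>)

lemma L2_smooth_mono: "L2_smooth P m u \<Longrightarrow> m' \<le> m \<Longrightarrow> L2_smooth P m' u"
  unfolding L2_smooth_def by (meson order_trans)

lemma count_dt_space: "vs \<in> lists (range dx) \<Longrightarrow> count_list vs dt = 0"
proof -
  assume *: "vs \<in> lists (range dx)"
  have "(dx j :: real \<times> (real^'a)) \<noteq> dt" for j by (simp add: dx_def dt_def)
  then have "dt \<notin> range (dx :: 'a \<Rightarrow> real \<times> (real^'a))" by (metis rangeE)
  then have "dt \<notin> set vs" using * by (meson in_lists_conv_set)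
  then show ?thesis by simp
qed

lemma L2_bdd_J_space:
  assumes P: "bound_class P" and f: "L2_smooth P 0 f" and vs: "vs \<in> lists (range dx)"
  shows "L2_bdd P (\<lambda>\<epsilon>. ipd Z vs (J (f \<epsilon>)))"
proof -
  have "L2_bdd P (\<lambda>\<epsilon>. J (ipd Z vs (f \<epsilon>)))"
    by (intro L2_bdd_J[OF P] L2_smooth_L2_bdd[OF f] sm_ipd L2_smooth_sm[OF f]) (use vs in \<open>auto simp: count_dt_space simp del: in_lists_conv_set\<close>)
  then show ?thesis by (rule L2_bdd_cong) (use L2_smooth_sm[OF f] vs in \<open>simp add: ipd_J_space del: in_lists_conv_set\<close>)
qed

lemma L2_smooth_J_all:
  assumes P: "bound_class P" and f: "\<And>m. L2_smooth P m f"
  shows "L2_smooth P m (\<lambda>\<epsilon>. J (f \<epsilon>))"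
  by (rule L2_smooth_mono[OF L2_smooth_J[OF f[of m] L2_bdd_J_space[OF P f]]]) auto

section \<open>Picard iteration for the semi-discrete equation\<close>

primrec picard :: "real \<Rightarrow> ('n::finite \<Rightarrow> 'm::finite \<Rightarrow> 'm \<Rightarrow> real \<times> (real^'n) \<Rightarrow> complex) \<Rightarrow>
    ('m \<Rightarrow> 'm \<Rightarrow> real \<times> (real^'n) \<Rightarrow> complex) \<Rightarrow> ('m \<Rightarrow> real \<times> (real^'n) \<Rightarrow> complex) \<Rightarrow> nat \<Rightarrow> 'm \<Rightarrow> real \<times> (real^'n) \<Rightarrow> complex" where
  "picard h A B F 0 = (\<lambda>k p. 0)"
| "picard h A B F (Suc n) = (\<lambda>k. J (\<lambda>p. F k p - semi_op h A B (picard h A B F n) k p))"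

lemma L2_smooth_picard:
  assumes "bound_class P" "\<And>j k l. sup_smooth P (\<lambda>\<epsilon>. A j \<epsilon> k l)" "\<And>k l. sup_smooth P (\<lambda>\<epsilon>. B \<epsilon> k l)"
    "\<And>m l. L2_smooth P m (\<lambda>\<epsilon>. F \<epsilon> l)" "\<And>\<epsilon>. \<epsilon> \<in> {0<..1} \<Longrightarrow> 0 < h \<epsilon>"
  shows "L2_smooth P m (\<lambda>\<epsilon>. picard (h \<epsilon>) (\<lambda>j. A j \<epsilon>) (B \<epsilon>) (F \<epsilon>) n k)"
proof (induction n arbitrary: m k)
  case 0
  then show ?case by (simp add: L2_smooth_zero assms)
next
  case (Suc n)
  show ?case unfolding picard.simps
    by (intro L2_smooth_J_all L2_smooth_diff L2_smooth_semi_op assms Suc.IH)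
qed

text \<open>Under \<open>any_bound\<close> the requirements at different \<epsilon> are unrelated,
  so they can be checked for one \<epsilon> at a time on constant nets. This is what permits a free
  choice of the iteration index for each \<epsilon>.\<close>

lemma L2_smooth_any_bound_pointwise: "L2_smooth any_bound m u \<longleftrightarrow> (\<forall>\<epsilon>\<in>{0<..1}. L2_smooth any_bound m (\<lambda>_. u \<epsilon>))"
proof -
  have "(1::real) \<in> {0<..1}" by simp
  then show ?thesis unfolding L2_smooth_def L2_bdd_any_bound by blast
qed

lemma sup_smooth_any_bound_pointwise: "sup_smooth any_bound a \<Longrightarrow> \<epsilon> \<in> {0<..1} \<Longrightarrow> sup_smooth any_bound (\<lambda>_. a \<epsilon>)"
  unfolding sup_smooth_def sup_bdd_any_bound by blast

text \<open>The index \<open>\<nu> \<epsilon>\<close> of the iterate may depend arbitrarily on \<open>\<epsilon>\<close>.\<close>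

lemma L2_smooth_picard_select:
  assumes "\<And>j k l. sup_smooth any_bound (\<lambda>\<epsilon>. A j \<epsilon> k l)" "\<And>k l. sup_smooth any_bound (\<lambda>\<epsilon>. B \<epsilon> k l)"
    "\<And>m l. L2_smooth any_bound m (\<lambda>\<epsilon>. F \<epsilon> l)" "\<And>\<epsilon>. \<epsilon> \<in> {0<..1} \<Longrightarrow> 0 < h \<epsilon>"
  shows "L2_smooth any_bound m (\<lambda>\<epsilon>. picard (h \<epsilon>) (\<lambda>j. A j \<epsilon>) (B \<epsilon>) (F \<epsilon>) (\<nu> \<epsilon>) k)"
  unfolding L2_smooth_any_bound_pointwise[of m "\<lambda>\<epsilon>. picard (h \<epsilon>) (\<lambda>j. A j \<epsilon>) (B \<epsilon>) (F \<epsilon>) (\<nu> \<epsilon>) k"]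
proof
  fix \<epsilon> :: real assume e: "\<epsilon> \<in> {0<..1}"
  have F: "L2_smooth any_bound m (\<lambda>_. F \<epsilon> l)" for m l
    using assms(3)[of m l] e L2_smooth_any_bound_pointwise[of m "\<lambda>\<epsilon>. F \<epsilon> l"] by blast
  show "L2_smooth any_bound m (\<lambda>_. picard (h \<epsilon>) (\<lambda>j. A j \<epsilon>) (B \<epsilon>) (F \<epsilon>) (\<nu> \<epsilon>) k)"
    by (rule L2_smooth_picard[of any_bound "\<lambda>j _. A j \<epsilon>" "\<lambda>_. B \<epsilon>" "\<lambda>_. F \<epsilon>" "\<lambda>_. h \<epsilon>"])
      (use assms e F sup_smooth_any_bound_pointwise[OF assms(1) e] sup_smooth_any_bound_pointwise[OF assms(2) e] in auto)
qed

end

text \<open>Bounds the squared operator norm of \<open>semi_op\<close> on up to \<open>r\<close>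
  space derivatives, including the factors from repeated doubling in sums of slices. Its term
  \<open>1 / h\<^sup>2\<close> is far from moderate for the chosen step and influences only the
  number of iterations.\<close>

definition kop_const :: "nat \<Rightarrow> nat \<Rightarrow> nat \<Rightarrow> real \<Rightarrow> real \<Rightarrow> real" where
  "kop_const n m r M h = 16 * (2 ^ n * (real n * (2 ^ m * (real m * (4 ^ (2 ^ r) * (M\<^sup>2 * (1 / h\<^sup>2 + 1)))))))"

context slab begin

lemma finite_lists_le:
  "finite {vs :: (real \<times> (real^'n::finite)) list. vs \<in> lists Basis \<and> length vs \<le> r}"
  "finite {vs :: (real \<times> (real^'n::finite)) list. vs \<in> lists (range dx) \<and> length vs \<le> r}"
proof -
  have "finite {vs :: (real \<times> (real^'n)) list. set vs \<subseteq> Basis \<and> length vs \<le> r}"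
    by (rule finite_lists_length_le) simp
  then show f: "finite {vs :: (real \<times> (real^'n)) list. vs \<in> lists Basis \<and> length vs \<le> r}"
    by (rule rev_finite_subset) (auto simp: in_lists_conv_set)
  show "finite {vs :: (real \<times> (real^'n::finite)) list. vs \<in> lists (range dx) \<and> length vs \<le> r}"
    by (rule finite_subset[OF _ f]) (use space_lists in blast)
qed

lemma J_diff:
  assumes "sm f" "sm g" "p \<in> Z"
  shows "J f p - J g p = J (\<lambda>q. f q - g q) p"
proof -
  obtain t x where p: "p = (t, x)" by (cases p)
  have c: "continuous_on {0..1} (\<lambda>\<sigma>. complex_of_real t * u (t * \<sigma>, x))" if "sm u" for u :: "real \<times> (real^'a) \<Rightarrow> complex"
    using scale_continuous_slice[OF sm_continuous[OF that], of t x] assms(3) p by (auto intro!: continuous_intros)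
  show ?thesis unfolding J_def p prod.case right_diff_distrib
    by (rule Henstock_Kurzweil_Integration.integral_diff[symmetric]; intro integrable_continuous_interval c assms)
qed

lemma D_diff: "D h j (\<lambda>p. f p - g p) p = D h j f p - D h j g p"
  by (simp add: D_def algebra_simps)

lemma semi_op_diff: "semi_op h A B (\<lambda>l p. U l p - W l p) k p = semi_op h A B U k p - semi_op h A B W k p"
  by (simp add: semi_op_def D_diff right_diff_distrib sum_subtractf)

lemma slice_le_sum_const:
  assumes "finite S" "t \<in> {0..T}" "\<And>i. i \<in> S \<Longrightarrow> slice_le t (f i) x"
  shows "slice_le t (\<lambda>p. \<Sum>i\<in>S. f i p) (2 ^ card S * (real (card S) * x))"
  using slice_le_sum[OF assms(1,2), of f "\<lambda>_. x"] assms(3) by simp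

lemma semi_op_bound:
  fixes A :: "'n::finite \<Rightarrow> 'm::finite \<Rightarrow> 'm \<Rightarrow> real \<times> (real^'n) \<Rightarrow> complex"
  assumes smA: "\<And>j k l. sm (A j k l)" and smB: "\<And>k l. sm (B k l)" and smW: "\<And>l. sm (W l)" and h: "h > 0"
    and MA: "\<And>vs j k l p. vs \<in> lists (range dx) \<Longrightarrow> length vs \<le> r \<Longrightarrow> p \<in> Z \<Longrightarrow> cmod (ipd Z vs (A j k l) p) \<le> M"
    and MB: "\<And>vs k l p. vs \<in> lists (range dx) \<Longrightarrow> length vs \<le> r \<Longrightarrow> p \<in> Z \<Longrightarrow> cmod (ipd Z vs (B k l) p) \<le> M"
    and W: "\<And>vs l. vs \<in> lists (range dx) \<Longrightarrow> length vs \<le> r \<Longrightarrow> slice_le t (ipd Z vs (W l)) Q"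
    and vs: "vs \<in> lists (range dx)" "length vs \<le> r"
  shows "slice_le t (ipd Z vs (semi_op h A B W k)) (kop_const CARD('n) CARD('m) r M h * Q)"
proof -
  define x z m n where "x = M\<^sup>2 * ((1 / h\<^sup>2 + 1) * Q)" and "z = 4 ^ (2 ^ r) * x"
    and "m = 2 ^ CARD('m) * (real CARD('m) * z)" and "n = 2 ^ CARD('n) * (real CARD('n) * m)"
  have t: "t \<in> {0..T}" "0 \<le> Q" using W[OF vs] by (auto simp: slice_le_def)
  have x0: "0 \<le> x" using t by (simp add: x_def)
  have xz: "x \<le> z" unfolding z_def using x0 mult_right_mono[of 1 "4 ^ (2 ^ r)" x] by simp
  have mn: "m \<le> n"
  proof -
    have "1 * (1 * m) \<le> n" unfolding n_def
      using x0 xz by (intro mult_mono) (auto simp: m_def Suc_le_eq)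
    then show ?thesis by simp
  qed
  have tA: "slice_le t (\<lambda>p. ipd Z a (A j k l) p * D h j (ipd Z b (W l)) p) x"
    if "a \<in> lists (range dx)" "length a \<le> r" "b \<in> lists (range dx)" "length b \<le> r" for a b j l
  proof -
    have "continuous_on Z (ipd Z a (A j k l))" using that by (intro sm_continuous sm_ipd smA) auto
    then have "slice_le t (\<lambda>p. ipd Z a (A j k l) p * D h j (ipd Z b (W l)) p) (M\<^sup>2 * (Q / h\<^sup>2))"
      using that h by (intro slice_le_mult slice_le_D_const W MA)
    moreover have "M\<^sup>2 * (Q / h\<^sup>2) \<le> x" unfolding x_def using t by (intro mult_left_mono) (auto simp: field_simps)
    ultimately show ?thesis by (rule slice_le_mono)
  qed
  have tB: "slice_le t (\<lambda>p. ipd Z a (B k l) p * ipd Z b (W l) p) x"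
    if "a \<in> lists (range dx)" "length a \<le> r" "b \<in> lists (range dx)" "length b \<le> r" for a b l
  proof -
    have "continuous_on Z (ipd Z a (B k l))" using that by (intro sm_continuous sm_ipd smB) auto
    then have "slice_le t (\<lambda>p. ipd Z a (B k l) p * ipd Z b (W l) p) (M\<^sup>2 * Q)"
      using that by (intro slice_le_mult W MB)
    moreover have "M\<^sup>2 * Q \<le> x" unfolding x_def using t by (intro mult_left_mono) (auto simp: algebra_simps)
    ultimately show ?thesis by (rule slice_le_mono)
  qed
  have sp: "a \<in> lists (range dx) \<and> length a \<le> r \<and> b \<in> lists (range dx) \<and> length b \<le> r"
    if "(a, b) \<in> set (psplits vs)" for a b
    using psplits_Basis[OF vs(1) that] psplits_props[OF that, of dt] vs(2) by auto
  have lz: "4 ^ length (psplits vs) * x \<le> z"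
  proof -
    have "length (psplits vs) \<le> 2 ^ r"
      using length_psplits[of vs] power_increasing[OF vs(2), of "2::nat"] by linarith
    then have "(4::real) ^ length (psplits vs) \<le> 4 ^ (2 ^ r)" by (intro power_increasing) auto
    then show ?thesis unfolding z_def using x0 by (rule mult_right_mono)
  qed
  have lA: "slice_le t (\<lambda>p. \<Sum>(a, b)\<leftarrow>psplits vs. ipd Z a (A j k l) p * D h j (ipd Z b (W l)) p) z" for j l
  proof -
    have "slice_le t (\<lambda>p. \<Sum>f\<leftarrow>map (\<lambda>(a, b) p. ipd Z a (A j k l) p * D h j (ipd Z b (W l)) p) (psplits vs). f p) (4 ^ length (psplits vs) * x)"
      using slice_le_sum_list[OF t(1) x0, of "map (\<lambda>(a, b) p. ipd Z a (A j k l) p * D h j (ipd Z b (W l)) p) (psplits vs)"] sp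
      by (fastforce intro: tA)
    then show ?thesis using lz by (auto intro: slice_le_mono simp: o_def case_prod_unfold)
  qed
  have lB: "slice_le t (\<lambda>p. \<Sum>(a, b)\<leftarrow>psplits vs. ipd Z a (B k l) p * ipd Z b (W l) p) z" for l
  proof -
    have "slice_le t (\<lambda>p. \<Sum>f\<leftarrow>map (\<lambda>(a, b) p. ipd Z a (B k l) p * ipd Z b (W l) p) (psplits vs). f p) (4 ^ length (psplits vs) * x)"
      using slice_le_sum_list[OF t(1) x0, of "map (\<lambda>(a, b) p. ipd Z a (B k l) p * ipd Z b (W l) p) (psplits vs)"] sp
      by (fastforce intro: tB)
    then show ?thesis using lz by (auto intro: slice_le_mono simp: o_def case_prod_unfold)
  qed
  have A0: "slice_le t (\<lambda>p. A j k l p * D h j (ipd Z vs (W l)) p) z" for j l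
    using slice_le_mono[OF tA[of "[]" vs j l] xz] vs by simp
  have B0: "slice_le t (\<lambda>p. B k l p * ipd Z vs (W l) p) z" for l
    using slice_le_mono[OF tB[of "[]" vs l] xz] vs by simp
  have s1: "slice_le t (\<lambda>p. \<Sum>j\<in>UNIV. \<Sum>l\<in>UNIV. A j k l p * D h j (ipd Z vs (W l)) p) n"
    unfolding n_def m_def by (intro slice_le_sum_const A0 t) auto
  have s2: "slice_le t (\<lambda>p. \<Sum>j\<in>UNIV. \<Sum>l\<in>UNIV. \<Sum>(a, b)\<leftarrow>psplits vs. ipd Z a (A j k l) p * D h j (ipd Z b (W l)) p) n"
    unfolding n_def m_def by (intro slice_le_sum_const lA t) auto
  have s3: "slice_le t (\<lambda>p. \<Sum>l\<in>UNIV. B k l p * ipd Z vs (W l) p) n"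
    by (rule slice_le_mono[OF _ mn], unfold m_def, intro slice_le_sum_const B0 t) auto
  have s4: "slice_le t (\<lambda>p. \<Sum>l\<in>UNIV. \<Sum>(a, b)\<leftarrow>psplits vs. ipd Z a (B k l) p * ipd Z b (W l) p) n"
    by (rule slice_le_mono[OF _ mn], unfold m_def, intro slice_le_sum_const lB t) auto
  have "slice_le t (ipd Z vs (semi_op h A B W k)) (2 * (2 * n + 2 * n) + 2 * (2 * n + 2 * n))"
    by (rule slice_le_cong[OF slice_le_add[OF slice_le_add[OF s1 s2] slice_le_add[OF s3 s4]]])
      (simp add: ipd_semi_op[OF smA smB smW space_lists[OF vs(1)]])
  moreover have "2 * (2 * n + 2 * n) + 2 * (2 * n + 2 * n) = kop_const CARD('n) CARD('m) r M h * Q"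
    by (simp add: kop_const_def n_def m_def z_def x_def)
  ultimately show ?thesis by simp
qed

lemma sup_smooth_common_bound:
  fixes a :: "'i::finite \<Rightarrow> real \<Rightarrow> real \<times> (real^'n::finite) \<Rightarrow> complex"
  assumes P: "bound_class P" and a: "\<And>i. sup_smooth P (a i)"
  shows "\<exists>M. P M \<and> (\<forall>\<epsilon>\<in>{0<..1}. \<forall>i. \<forall>vs\<in>lists (range dx). length vs \<le> r \<longrightarrow> (\<forall>p\<in>Z. cmod (ipd Z vs (a i \<epsilon>) p) \<le> M \<epsilon>))"
proof -
  let ?S = "(UNIV :: 'i set) \<times> {vs :: (real \<times> (real^'n)) list. vs \<in> lists (range dx) \<and> length vs \<le> r}"
  let ?u = "\<lambda>(i, vs) \<epsilon>. ipd Z vs (a i \<epsilon>)"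
  have "\<exists>M. P M \<and> (\<forall>iv\<in>?S. \<forall>\<epsilon>\<in>{0<..1}. \<forall>p\<in>Z. cmod (?u iv \<epsilon> p) \<le> M \<epsilon>)"
  proof (rule sup_bdd_finite[OF P])
    show "finite ?S" using finite_lists_le(2)[of r] by (intro finite_cartesian_product) auto
    fix iv assume "iv \<in> ?S"
    then obtain i vs where iv: "iv = (i, vs)" "vs \<in> lists (range dx)" by blast
    show "sup_bdd P (?u iv)" unfolding iv prod.case by (rule sup_smooth_sup_bdd[OF a space_lists[OF iv(2)]])
  qed
  then obtain M where M: "P M" "\<forall>iv\<in>?S. \<forall>\<epsilon>\<in>{0<..1}. \<forall>p\<in>Z. cmod (?u iv \<epsilon> p) \<le> M \<epsilon>" by (elim exE conjE)
  have "cmod (ipd Z vs (a i \<epsilon>) p) \<le> M \<epsilon>" if "\<epsilon> \<in> {0<..1}" "vs \<in> lists (range dx)" "length vs \<le> r" "p \<in> Z" for \<epsilon> i vs p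
  proof -
    have "(i, vs) \<in> ?S" using that by blast
    from bspec[OF bspec[OF bspec[OF M(2) this] that(1)] that(4)] show ?thesis by simp
  qed
  with M(1) show ?thesis by blast
qed

lemma L2_smooth_common_bound:
  fixes u :: "'i::finite \<Rightarrow> real \<Rightarrow> real \<times> (real^'n::finite) \<Rightarrow> complex"
  assumes P: "bound_class P" and L: "finite L" and u: "\<And>i vs. vs \<in> L \<Longrightarrow> L2_bdd P (\<lambda>\<epsilon>. ipd Z vs (u i \<epsilon>))"
  shows "\<exists>K. P K \<and> (\<forall>\<epsilon>. 0 \<le> K \<epsilon>) \<and> (\<forall>\<epsilon>\<in>{0<..1}. \<forall>i. \<forall>vs\<in>L. \<forall>t\<in>{0..T}. slice_le t (ipd Z vs (u i \<epsilon>)) (K \<epsilon>))"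
proof -
  let ?u = "\<lambda>(i, vs) \<epsilon>. ipd Z vs (u i \<epsilon>)"
  obtain K where K: "P K" "\<And>\<epsilon>. 0 \<le> K \<epsilon>" "\<And>iv \<epsilon> t. iv \<in> UNIV \<times> L \<Longrightarrow> \<epsilon> \<in> {0<..1} \<Longrightarrow> t \<in> {0..T} \<Longrightarrow> slice_le t (?u iv \<epsilon>) (K \<epsilon>)"
  proof (rule L2_bdd_finite[OF P])
    show "finite ((UNIV :: 'i set) \<times> L)" using L by simp
    fix iv assume "iv \<in> (UNIV :: 'i set) \<times> L"
    then obtain i vs where iv: "iv = (i, vs)" "vs \<in> L" by blast
    show "L2_bdd P (?u iv)" unfolding iv prod.case by (rule u[OF iv(2)])
  qed (rule that)
  have "slice_le t (ipd Z vs (u i \<epsilon>)) (K \<epsilon>)" if "\<epsilon> \<in> {0<..1}" "vs \<in> L" "t \<in> {0..T}" for \<epsilon> i vs t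
    using K(3)[of "(i, vs)" \<epsilon> t] that by simp
  with K(1,2) show ?thesis by blast
qed

text \<open>The differences of consecutive iterates arise from one another by \<open>J\<close> after
  \<open>semi_op\<close>, a contraction in the exponentially weighted norm. The quantity bounded is
  the defect with which the iterate \<open>Suc n\<close> solves the semi-discrete equation; it
  becomes small in all space derivatives up to order \<open>r\<close> at once.\<close>

lemma picard_delta_small:
  fixes A :: "'n::finite \<Rightarrow> 'm::finite \<Rightarrow> 'm \<Rightarrow> real \<times> (real^'n) \<Rightarrow> complex"
  assumes A: "\<And>j k l. sup_smooth any_bound (\<lambda>_. A j k l)" and B: "\<And>k l. sup_smooth any_bound (\<lambda>_. B k l)"
    and F: "\<And>m l. L2_smooth any_bound m (\<lambda>_. F l)" and h: "0 < h" and \<eta>: "0 < \<eta>"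
  shows "\<exists>N0. \<forall>n\<ge>N0. \<forall>vs\<in>lists (range dx). length vs \<le> r \<longrightarrow> (\<forall>k. \<forall>t\<in>{0..T}.
    slice_le t (ipd Z vs (semi_op h A B (\<lambda>l p. picard h A B F (Suc n) l p - picard h A B F n l p) k)) \<eta>)"
proof -
  let ?V = "picard h A B F"
  define \<delta> where "\<delta> = (\<lambda>n l p. ?V (Suc n) l p - ?V n l p)"
  \<comment> \<open>The lemma concerns one fixed \<epsilon>, encoded by constant nets that are
    evaluated at 1.\<close>
  have one: "(1::real) \<in> {0<..1}" by simp
  have smA: "sm (A j k l)" and smB: "sm (B k l)" and smF: "sm (F l)" for j k l
    using sup_smooth_sm[OF A one] sup_smooth_sm[OF B one] L2_smooth_sm[OF F one] by auto
  have XV: "L2_smooth any_bound m (\<lambda>_. ?V n l)" for m n l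
    by (rule L2_smooth_picard[of any_bound "\<lambda>j _. A j" "\<lambda>_. B" "\<lambda>_. F" "\<lambda>_. h"]) (use A B F h in auto)
  then have smV: "sm (?V n l)" for n l using L2_smooth_sm one by blast
  have X\<delta>: "L2_smooth any_bound m (\<lambda>_. \<delta> n l)" for m n l unfolding \<delta>_def by (intro L2_smooth_diff XV) simp
  have sm\<delta>: "sm (\<delta> n l)" for n l unfolding \<delta>_def by (intro sm_diff smV)
  let ?S = "{vs :: (real \<times> (real^'n)) list. vs \<in> lists (range dx) \<and> length vs \<le> r}"
  have "\<exists>M. any_bound M \<and> (\<forall>\<epsilon>\<in>{0<..1}. \<forall>i. \<forall>vs\<in>lists (range dx). length vs \<le> r \<longrightarrow>
      (\<forall>p\<in>Z. cmod (ipd Z vs ((\<lambda>(j, k, l) _. A j k l) i \<epsilon>) p) \<le> M \<epsilon>))"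
    by (rule sup_smooth_common_bound) (auto simp: A)
  then obtain M1 :: "real \<Rightarrow> real" where "\<forall>i. \<forall>vs\<in>lists (range dx). length vs \<le> r \<longrightarrow>
      (\<forall>p\<in>Z. cmod (ipd Z vs ((\<lambda>(j, k, l) _. A j k l) i (1::real)) p) \<le> M1 1)" using one by blast
  note M1 = this[THEN spec, of "(j, k, l)" for j k l, rule_format, unfolded prod.case]
  have "\<exists>M. any_bound M \<and> (\<forall>\<epsilon>\<in>{0<..1}. \<forall>i. \<forall>vs\<in>lists (range dx). length vs \<le> r \<longrightarrow>
      (\<forall>p\<in>Z. cmod (ipd Z vs ((\<lambda>(k, l) _. B k l) i \<epsilon>) p) \<le> M \<epsilon>))"
    by (rule sup_smooth_common_bound) (auto simp: B)
  then obtain M2 :: "real \<Rightarrow> real" where "\<forall>i. \<forall>vs\<in>lists (range dx). length vs \<le> r \<longrightarrow>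
      (\<forall>p\<in>Z. cmod (ipd Z vs ((\<lambda>(k, l) _. B k l) i (1::real)) p) \<le> M2 1)" using one by blast
  note M2 = this[THEN spec, of "(k, l)" for k l, rule_format, unfolded prod.case]
  define M where "M = max (M1 1) (M2 1)"
  have MA: "cmod (ipd Z vs (A j k l) p) \<le> M" and MB: "cmod (ipd Z vs (B k l) p) \<le> M"
    if "vs \<in> lists (range dx)" "length vs \<le> r" "p \<in> Z" for vs p j k l
    using M1[OF that, of j k l] M2[OF that, of k l] by (simp_all add: M_def)
  have "\<exists>K. any_bound K \<and> (\<forall>\<epsilon>. 0 \<le> K \<epsilon>) \<and> (\<forall>\<epsilon>\<in>{0<..1}. \<forall>l. \<forall>vs\<in>?S. \<forall>t\<in>{0..T}. slice_le t (ipd Z vs ((\<lambda>l _. \<delta> 0 l) l \<epsilon>)) (K \<epsilon>))"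
    by (rule L2_smooth_common_bound[OF bound_class_any_bound finite_lists_le(2)]) (use L2_smooth_L2_bdd[OF X\<delta> space_lists order_refl] in blast)
  then obtain E :: "real \<Rightarrow> real" where E: "\<And>\<epsilon>. 0 \<le> E \<epsilon>" "\<forall>\<epsilon>\<in>{0<..1}. \<forall>l. \<forall>vs\<in>?S. \<forall>t\<in>{0..T}. slice_le t (ipd Z vs (\<delta> 0 l)) (E \<epsilon>)"
    by blast
  define CK where "CK = kop_const CARD('n) CARD('m) r M h"
  have CK: "0 \<le> CK" using h by (simp add: CK_def kop_const_def)
  \<comment> \<open>Chosen so that the factor \<open>T * CK / \<mu>\<close> of one iteration is at
    most 1/2; the \<open>+ 1\<close> keeps \<mu> positive.\<close>
  define \<mu> where "\<mu> = 2 * T * (CK + 1)"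
  have \<mu>: "0 < \<mu>" using CK T_pos by (simp add: \<mu>_def)
  have main: "\<forall>vs\<in>lists (range dx). length vs \<le> r \<longrightarrow> (\<forall>l. \<forall>t\<in>{0..T}. slice_le t (ipd Z vs (\<delta> n l)) (E 1 * (1 / 2) ^ n * exp (\<mu> * t)))" for n
  proof (induction n)
    case 0
    show ?case
    proof (intro ballI impI allI)
      fix vs :: "(real \<times> (real^'n)) list" and l and t :: real
      assume *: "vs \<in> lists (range dx)" "length vs \<le> r" "t \<in> {0..T}"
      have "slice_le t (ipd Z vs (\<delta> 0 l)) (E 1)"
 using E(2) one * by blast
      moreover have "E 1 * 1 \<le> E 1 * exp (\<mu> * t)" using E(1) \<mu> * by (intro mult_left_mono) auto
      ultimately show "slice_le t (ipd Z vs (\<delta> 0 l)) (E 1 * (1 / 2) ^ 0 * exp (\<mu> * t))" by (auto intro: slice_le_mono)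
    qed
  next
    case (Suc n)
    show ?case
    proof (intro ballI impI allI)
      fix vs :: "(real \<times> (real^'n)) list" and l and t :: real
      assume *: "vs \<in> lists (range dx)" "length vs \<le> r" "t \<in> {0..T}"
      let ?g = "\<lambda>p. - semi_op h A B (\<delta> n) l p"
      have smK: "sm (semi_op h A B (\<delta> n) l)" by (intro sm_semi_op smA smB sm\<delta>)
      then have smg: "sm ?g" by (rule sm_uminus)
      have "\<delta> (Suc n) l p = J ?g p" if "p \<in> Z" for p
      proof -
        have "\<delta> (Suc n) l p = J (\<lambda>p. (F l p - semi_op h A B (?V (Suc n)) l p) - (F l p - semi_op h A B (?V n) l p)) p"
          unfolding \<delta>_def picard.simps(2)[of h A B F "Suc n"] picard.simps(2)[of h A B F n]
          by (rule J_diff) (use that smF smV in \<open>auto intro!: sm_diff sm_semi_op smA smB simp del: picard.simps simp flip: picard.simps(2)\<close>)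
        also have "(\<lambda>p. (F l p - semi_op h A B (?V (Suc n)) l p) - (F l p - semi_op h A B (?V n) l p)) = ?g"
          unfolding \<delta>_def semi_op_diff by (simp del: picard.simps)
        finally show ?thesis .
      qed
      then have eqJ: "ipd Z vs (\<delta> (Suc n) l) p = J (ipd Z vs ?g) p" if "p \<in> Z" for p
        using that ipd_cong[of "\<delta> (Suc n) l" "J ?g" p vs] ipd_J_space[OF smg *(1) that] by simp
      have bJ: "slice_le t (J (ipd Z vs ?g)) (T * (CK * (E 1 * (1 / 2) ^ n)) / \<mu> * exp (\<mu> * t))"
      proof (rule slice_le_J[OF _ _ \<mu> *(3)])
        show "sm (ipd Z vs ?g)" using smg *(1) by (intro sm_ipd) auto
        fix s assume s: "s \<in> {0..T}"
        have "slice_le s (ipd Z vs (semi_op h A B (\<delta> n) l)) (CK * (E 1 * (1 / 2) ^ n * exp (\<mu> * s)))"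
          unfolding CK_def by (rule semi_op_bound[OF smA smB sm\<delta> h MA MB _ *(1,2)]) (use Suc s in auto)
        from slice_le_uminus[OF this] show "slice_le s (ipd Z vs ?g) (CK * (E 1 * (1 / 2) ^ n) * exp (\<mu> * s))"
          unfolding mult.assoc by (rule slice_le_cong) (use smK *(1) in \<open>simp add: ipd_uminus del: in_lists_conv_set\<close>)
      qed
      have le: "T * (CK * (E 1 * (1 / 2) ^ n)) / \<mu> * exp (\<mu> * t) \<le> E 1 * (1 / 2) ^ Suc n * exp (\<mu> * t)"
      proof (rule mult_right_mono)
        have "T * CK \<le> \<mu> / 2" using T_pos by (simp add: \<mu>_def)
        then have "T * CK / \<mu> \<le> 1 / 2" using \<mu> by (simp add: pos_divide_le_eq)
        from mult_right_mono[OF this, of "E 1 * (1 / 2) ^ n"] E(1)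
        show "T * (CK * (E 1 * (1 / 2) ^ n)) / \<mu> \<le> E 1 * (1 / 2) ^ Suc n" by (simp add: mult.assoc mult.left_commute mult.commute)
      qed simp
      show "slice_le t (ipd Z vs (\<delta> (Suc n) l)) (E 1 * (1 / 2) ^ Suc n * exp (\<mu> * t))"
        by (rule slice_le_mono[OF slice_le_cong[OF bJ] le]) (rule eqJ[symmetric])
    qed
  qed
  define Q where "Q = CK * (E 1 * exp (\<mu> * T))"
  have Q: "0 \<le> Q" using CK E(1) by (simp add: Q_def)
  obtain N0 where N0: "(1 / 2 :: real) ^ N0 < \<eta> / (Q + 1)"
    using real_arch_pow_inv[of "\<eta> / (Q + 1)" "1 / 2"] \<eta> Q by auto
  show ?thesis
  proof (intro exI[of _ N0] allI impI ballI)
    fix n k and vs :: "(real \<times> (real^'n)) list" and t :: real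
    assume *: "N0 \<le> n" "vs \<in> lists (range dx)" "length vs \<le> r" "t \<in> {0..T}"
    have "slice_le t (ipd Z vs (semi_op h A B (\<delta> n) k)) (CK * (E 1 * (1 / 2) ^ n * exp (\<mu> * t)))"
      unfolding CK_def by (rule semi_op_bound[OF smA smB sm\<delta> h MA MB _ *(2,3)]) (use main *(4) in auto)
    moreover have "CK * (E 1 * (1 / 2) ^ n * exp (\<mu> * t)) \<le> \<eta>"
    proof -
      have "CK * (E 1 * (1 / 2) ^ n * exp (\<mu> * t)) \<le> CK * (E 1 * (1 / 2) ^ N0 * exp (\<mu> * T))"
        using CK E(1) * \<mu> by (intro mult_left_mono mult_mono power_decreasing) auto
      also have "\<dots> = Q * (1 / 2) ^ N0" by (simp add: Q_def)
      also have "\<dots> \<le> (Q + 1) * (\<eta> / (Q + 1))" using N0 Q by (intro mult_mono) auto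
      also have "\<dots> = \<eta>" using Q by simp
      finally show ?thesis .
    qed
    ultimately show "slice_le t (ipd Z vs (semi_op h A B (\<lambda>l p. ?V (Suc n) l p - ?V n l p) k)) \<eta>"
      unfolding \<delta>_def by (rule slice_le_mono)
  qed
qed


section \<open>Existence and uniqueness for the reduced problem\<close>

text \<open>What the hypotheses on the coefficients amount to in the energy estimate: for small
  \<epsilon> a single continuous majorant in time with logarithmic integral. The summand 1 beside
  the logarithm leaves room for the constants that arise when representatives are exchanged.\<close>

definition log_coeffs :: "('n::finite \<Rightarrow> real \<Rightarrow> 'm::finite \<Rightarrow> 'm \<Rightarrow> real \<times> (real^'n) \<Rightarrow> complex) \<Rightarrow>
    (real \<Rightarrow> 'm \<Rightarrow> 'm \<Rightarrow> real \<times> (real^'n) \<Rightarrow> complex) \<Rightarrow> bool" where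
  "log_coeffs A B \<longleftrightarrow> (\<exists>c Q. \<forall>\<^sub>F \<epsilon> in at_right 0. continuous_on {0..T} (c \<epsilon>) \<and> (\<forall>s\<in>{0..T}. 0 \<le> c \<epsilon> s) \<and>
     integral {0..T} (c \<epsilon>) \<le> Q * (1 + ln (1 / \<epsilon>)) \<and>
     (\<forall>s\<in>{0<..<T}. \<forall>x j k l. A j \<epsilon> k l (s, x) = cnj (A j \<epsilon> l k (s, x))) \<and>
     (\<forall>s\<in>{0<..<T}. \<forall>x i j k l. cmod (pd Z (dx i) (A j \<epsilon> k l) (s, x)) \<le> c \<epsilon> s) \<and>
     (\<forall>s\<in>{0<..<T}. \<forall>x k l. cmod (B \<epsilon> k l (s, x) + cnj (B \<epsilon> l k (s, x))) \<le> c \<epsilon> s))"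

text \<open>The net \<open>R\<close> is built from the coefficients alone and the data enter
  linearly. The same estimate therefore yields moderate solutions for moderate data and negligible
  ones for negligible data.\<close>

lemma order_estimate_net:
  fixes A :: "'n::finite \<Rightarrow> real \<Rightarrow> 'm::finite \<Rightarrow> 'm \<Rightarrow> real \<times> (real^'n) \<Rightarrow> complex"
  assumes log_coeffs: "log_coeffs A B" and A: "\<And>j k l. sup_smooth moderate (\<lambda>\<epsilon>. A j \<epsilon> k l)" and B: "\<And>k l. sup_smooth moderate (\<lambda>\<epsilon>. B \<epsilon> k l)"
    and h: "\<And>\<epsilon>. \<epsilon> \<in> {0<..1} \<Longrightarrow> 0 < h \<epsilon>"
    and U: "\<And>m l. L2_smooth any_bound m (\<lambda>\<epsilon>. U \<epsilon> l)" and H: "\<And>\<epsilon> l. \<epsilon> \<in> {0<..1} \<Longrightarrow> sm (H \<epsilon> l)"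
    and eq: "\<And>\<epsilon> vs l p. \<epsilon> \<in> {0<..1} \<Longrightarrow> vs \<in> lists (range dx) \<Longrightarrow> length vs = N \<Longrightarrow> p \<in> Z \<Longrightarrow>
       pd Z dt (ipd Z vs (U \<epsilon> l)) p = ipd Z vs (H \<epsilon> l) p - ipd Z vs (semi_op (h \<epsilon>) (\<lambda>j. A j \<epsilon>) (B \<epsilon>) (U \<epsilon>) l) p"
    and init: "\<And>\<epsilon> vs l. \<epsilon> \<in> {0<..1} \<Longrightarrow> vs \<in> lists (range dx) \<Longrightarrow> length vs = N \<Longrightarrow> slice_le 0 (ipd Z vs (U \<epsilon> l)) (I0 \<epsilon>)"
    and hH: "\<And>\<epsilon> vs l t. \<epsilon> \<in> {0<..1} \<Longrightarrow> vs \<in> lists (range dx) \<Longrightarrow> length vs = N \<Longrightarrow> t \<in> {0..T} \<Longrightarrow> slice_le t (ipd Z vs (H \<epsilon> l)) (L \<epsilon>)"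
    and low: "\<And>\<epsilon> vs l t. \<epsilon> \<in> {0<..1} \<Longrightarrow> vs \<in> lists (range dx) \<Longrightarrow> length vs < N \<Longrightarrow> t \<in> {0..T} \<Longrightarrow> slice_le t (ipd Z vs (U \<epsilon> l)) (Y \<epsilon>)"
    and nonneg: "\<And>\<epsilon>. 0 \<le> I0 \<epsilon>" "\<And>\<epsilon>. 0 \<le> L \<epsilon>" "\<And>\<epsilon>. 0 \<le> Y \<epsilon>"
  shows "\<exists>R. moderate R \<and> (\<forall>\<^sub>F \<epsilon> in at_right 0. \<forall>vs\<in>lists (range dx). length vs = N \<longrightarrow>
     (\<forall>l. \<forall>t\<in>{0..T}. slice_le t (ipd Z vs (U \<epsilon> l)) (R \<epsilon> * (I0 \<epsilon> + L \<epsilon> + Y \<epsilon>))))"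
proof -
  obtain c Q where c: "\<forall>\<^sub>F \<epsilon> in at_right 0. continuous_on {0..T} (c \<epsilon>) \<and> (\<forall>s\<in>{0..T}. 0 \<le> c \<epsilon> s) \<and>
     integral {0..T} (c \<epsilon>) \<le> Q * (1 + ln (1 / \<epsilon>)) \<and>
     (\<forall>s\<in>{0<..<T}. \<forall>x j k l. A j \<epsilon> k l (s, x) = cnj (A j \<epsilon> l k (s, x))) \<and>
     (\<forall>s\<in>{0<..<T}. \<forall>x i j k l. cmod (pd Z (dx i) (A j \<epsilon> k l) (s, x)) \<le> c \<epsilon> s) \<and>
     (\<forall>s\<in>{0<..<T}. \<forall>x k l. cmod (B \<epsilon> k l (s, x) + cnj (B \<epsilon> l k (s, x))) \<le> c \<epsilon> s)"
    using log_coeffs unfolding log_coeffs_def by blast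
  have "\<exists>M. moderate M \<and> (\<forall>\<epsilon>\<in>{0<..1}. \<forall>i. \<forall>vs\<in>lists (range dx). length vs \<le> N \<longrightarrow>
      (\<forall>p\<in>Z. cmod (ipd Z vs ((\<lambda>(j, k, l) \<epsilon>. A j \<epsilon> k l) i \<epsilon>) p) \<le> M \<epsilon>))"
    by (rule sup_smooth_common_bound) (auto simp: A)
  then obtain M1 where M1: "moderate M1" "\<And>\<epsilon> j k l vs p. \<epsilon> \<in> {0<..1} \<Longrightarrow> vs \<in> lists (range dx) \<Longrightarrow> length vs \<le> N \<Longrightarrow> p \<in> Z \<Longrightarrow>
      cmod (ipd Z vs (A j \<epsilon> k l) p) \<le> M1 \<epsilon>" by (fastforce simp del: in_lists_conv_set)
  have "\<exists>M. moderate M \<and> (\<forall>\<epsilon>\<in>{0<..1}. \<forall>i. \<forall>vs\<in>lists (range dx). length vs \<le> N \<longrightarrow>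
      (\<forall>p\<in>Z. cmod (ipd Z vs ((\<lambda>(k, l) \<epsilon>. B \<epsilon> k l) i \<epsilon>) p) \<le> M \<epsilon>))"
    by (rule sup_smooth_common_bound) (auto simp: B)
  then obtain M2 where M2: "moderate M2" "\<And>\<epsilon> k l vs p. \<epsilon> \<in> {0<..1} \<Longrightarrow> vs \<in> lists (range dx) \<Longrightarrow> length vs \<le> N \<Longrightarrow> p \<in> Z \<Longrightarrow>
      cmod (ipd Z vs (B \<epsilon> k l) p) \<le> M2 \<epsilon>" by (fastforce simp del: in_lists_conv_set)
  define M where "M = (\<lambda>\<epsilon>. \<bar>M1 \<epsilon>\<bar> + \<bar>M2 \<epsilon>\<bar>)"
  have mM: "moderate M" unfolding M_def
    by (intro moderate_add moderate_mono[OF M1(1)] moderate_mono[OF M2(1)]) auto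
  let ?LL = "{vs :: (real \<times> (real^'n)) list. vs \<in> lists Basis \<and> length vs \<le> Suc N}"
  have "\<exists>K. any_bound K \<and> (\<forall>\<epsilon>. 0 \<le> K \<epsilon>) \<and> (\<forall>\<epsilon>\<in>{0<..1}. \<forall>l. \<forall>vs\<in>?LL. \<forall>t\<in>{0..T}. slice_le t (ipd Z vs ((\<lambda>l \<epsilon>. U \<epsilon> l) l \<epsilon>)) (K \<epsilon>))"
    by (rule L2_smooth_common_bound[OF bound_class_any_bound finite_lists_le(1)]) (blast intro: L2_smooth_L2_bdd[OF U _ order_refl])
  then obtain K where K: "\<And>\<epsilon> l vs t. \<epsilon> \<in> {0<..1} \<Longrightarrow> vs \<in> lists Basis \<Longrightarrow> length vs \<le> Suc N \<Longrightarrow> t \<in> {0..T} \<Longrightarrow> slice_le t (ipd Z vs (U \<epsilon> l)) (K \<epsilon>)"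
    by blast
  define C where "C = order_const CARD('n) CARD('m) N"
  have C0: "0 \<le> C" by (simp add: C_def order_const_def)
  \<comment> \<open>The exponent is \<open>C * (T + Q * (1 + ln (1 / \<epsilon>)))\<close>
    rearranged; the second factor adds up the coefficients of \<open>I0\<close>, \<open>L\<close>
    and \<open>Y\<close>.\<close>
  define R where "R = (\<lambda>\<epsilon>. exp ((C * (T + Q)) + (C * Q) * ln (1 / \<epsilon>)) * (C + T * C + (T * C) * (M \<epsilon> * M \<epsilon>)))"
  have "moderate R" unfolding R_def by (intro moderate_mult moderate_add moderate_const moderate_exp_ln mM)
  moreover have "\<forall>\<^sub>F \<epsilon> in at_right 0. \<forall>vs\<in>lists (range dx). length vs = N \<longrightarrow>
     (\<forall>l. \<forall>t\<in>{0..T}. slice_le t (ipd Z vs (U \<epsilon> l)) (R \<epsilon> * (I0 \<epsilon> + L \<epsilon> + Y \<epsilon>)))"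
    using c eventually_small[of 1, simplified]
  proof eventually_elim
    case (elim \<epsilon>)
    then have e: "\<epsilon> \<in> {0<..1}" by auto
    show ?case
    proof (intro ballI impI allI)
      fix vs :: "(real \<times> (real^'n)) list" and l and t :: real
      assume v: "vs \<in> lists (range dx)" "length vs = N" "t \<in> {0..T}"
      let ?c = "c \<epsilon>"
      have "slice_le t (ipd Z vs (U \<epsilon> l)) (exp (order_const CARD('n) CARD('m) N * (T + integral {0..T} ?c)) *
        (order_const CARD('n) CARD('m) N * I0 \<epsilon> + T * (order_const CARD('n) CARD('m) N * (L \<epsilon> + (M \<epsilon>)\<^sup>2 * Y \<epsilon>))))"
      proof (rule order_estimate[of "\<lambda>j. A j \<epsilon>" "B \<epsilon>" "U \<epsilon>" "h \<epsilon>" ?c N "M \<epsilon>" "H \<epsilon>" "K \<epsilon>" "I0 \<epsilon>" "L \<epsilon>" "Y \<epsilon>"])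
        show "sm (A j \<epsilon> k l)" for j k l by (rule sup_smooth_sm[OF A e])
        show "sm (B \<epsilon> k l)" for k l by (rule sup_smooth_sm[OF B e])
        show "sm (U \<epsilon> l)" for l by (rule L2_smooth_sm[OF U e])
        show "0 < h \<epsilon>" by (rule h[OF e])
        show "A j \<epsilon> k l (s, x) = cnj (A j \<epsilon> l k (s, x))" if "s \<in> {0<..<T}" for j k l s x using elim that by blast
        show "cmod (pd Z (dx i) (A j \<epsilon> k l) (s, x)) \<le> ?c s" if "s \<in> {0<..<T}" for i j k l s x using elim that by blast
        show "cmod (B \<epsilon> k l (s, x) + cnj (B \<epsilon> l k (s, x))) \<le> ?c s" if "s \<in> {0<..<T}" for k l s x using elim that by blast
        show "continuous_on {0..T} ?c" using elim by blast
        show "0 \<le> ?c s" if "s \<in> {0..T}" for s using elim that by blast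
        show "cmod (ipd Z vs (A j \<epsilon> k l) p) \<le> M \<epsilon>" if "vs \<in> lists (range dx)" "length vs \<le> N" "p \<in> Z" for vs j k l p
          using M1(2)[OF e that, of j k l] by (simp add: M_def)
        show "cmod (ipd Z vs (B \<epsilon> k l) p) \<le> M \<epsilon>" if "vs \<in> lists (range dx)" "length vs \<le> N" "p \<in> Z" for vs k l p
          using M2(2)[OF e that, of k l] by (simp add: M_def)
        show "pd Z dt (ipd Z vs (U \<epsilon> l)) p = ipd Z vs (H \<epsilon> l) p - ipd Z vs (semi_op (h \<epsilon>) (\<lambda>j. A j \<epsilon>) (B \<epsilon>) (U \<epsilon>) l) p"
          if "vs \<in> lists (range dx)" "length vs = N" "p \<in> Z" for vs l p by (rule eq[OF e that])
        show "slice_le t (ipd Z vs (U \<epsilon> l)) (K \<epsilon>)" if "vs \<in> lists Basis" "length vs \<le> Suc N" "t \<in> {0..T}" for vs l t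
          by (rule K[OF e that])
        show "slice_le 0 (ipd Z vs (U \<epsilon> l)) (I0 \<epsilon>)" if "vs \<in> lists (range dx)" "length vs = N" for vs l by (rule init[OF e that])
        show "slice_le t (ipd Z vs (H \<epsilon> l)) (L \<epsilon>)" if "vs \<in> lists (range dx)" "length vs = N" "t \<in> {0..T}" for vs l t by (rule hH[OF e that])
        show "slice_le t (ipd Z vs (U \<epsilon> l)) (Y \<epsilon>)" if "vs \<in> lists (range dx)" "length vs < N" "t \<in> {0..T}" for vs l t by (rule low[OF e that])
      qed (rule nonneg v)+
      then have "slice_le t (ipd Z vs (U \<epsilon> l)) (exp (C * (T + integral {0..T} ?c)) * (C * I0 \<epsilon> + T * (C * (L \<epsilon> + (M \<epsilon>)\<^sup>2 * Y \<epsilon>))))"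
        by (simp only: C_def)
      moreover have "exp (C * (T + integral {0..T} ?c)) * (C * I0 \<epsilon> + T * (C * (L \<epsilon> + (M \<epsilon>)\<^sup>2 * Y \<epsilon>))) \<le> R \<epsilon> * (I0 \<epsilon> + L \<epsilon> + Y \<epsilon>)"
      proof -
        have "C * (T + integral {0..T} ?c) \<le> C * (T + Q * (1 + ln (1 / \<epsilon>)))" using elim C0 by (intro mult_left_mono add_mono) auto
        also have "\<dots> = (C * (T + Q)) + (C * Q) * ln (1 / \<epsilon>)" by (simp add: algebra_simps)
        finally have 1: "exp (C * (T + integral {0..T} ?c)) \<le> exp ((C * (T + Q)) + (C * Q) * ln (1 / \<epsilon>))" by simp
        have "C * I0 \<epsilon> + T * (C * (L \<epsilon> + (M \<epsilon>)\<^sup>2 * Y \<epsilon>)) \<le> (C + T * C + (T * C) * (M \<epsilon> * M \<epsilon>)) * (I0 \<epsilon> + L \<epsilon> + Y \<epsilon>)"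
        proof -
          define a b d where "a = C" and "b = T * C" and "d = (T * C) * (M \<epsilon> * M \<epsilon>)"
          have abd: "0 \<le> a" "0 \<le> b" "0 \<le> d" using C0 T_pos by (auto simp: a_def b_def d_def)
          have "C * I0 \<epsilon> + T * (C * (L \<epsilon> + (M \<epsilon>)\<^sup>2 * Y \<epsilon>)) = a * I0 \<epsilon> + b * L \<epsilon> + d * Y \<epsilon>"
            by (simp add: a_def b_def d_def power2_eq_square algebra_simps)
          also have "\<dots> \<le> (a + b + d) * I0 \<epsilon> + (a + b + d) * L \<epsilon> + (a + b + d) * Y \<epsilon>"
            using abd nonneg by (intro add_mono mult_right_mono) auto
          also have "\<dots> = (a + b + d) * (I0 \<epsilon> + L \<epsilon> + Y \<epsilon>)" by (simp add: algebra_simps)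
          finally show ?thesis by (simp add: a_def b_def d_def)
        qed
        moreover have "0 \<le> C * I0 \<epsilon> + T * (C * (L \<epsilon> + (M \<epsilon>)\<^sup>2 * Y \<epsilon>))" using C0 T_pos nonneg by simp
        ultimately show ?thesis unfolding R_def mult.assoc[of "exp _"] using 1 by (intro mult_mono) auto
      qed
      ultimately show "slice_le t (ipd Z vs (U \<epsilon> l)) (R \<epsilon> * (I0 \<epsilon> + L \<epsilon> + Y \<epsilon>))" by (rule slice_le_mono)
    qed
  qed
  ultimately show ?thesis by blast
qed

text \<open>Strong induction on the order: the bounds for lower orders form \<open>Y\<close>, those
  for the source form \<open>L\<close>, and the initial values contribute nothing.\<close>

lemma spatial_moderate:
  fixes A :: "'n::finite \<Rightarrow> real \<Rightarrow> 'm::finite \<Rightarrow> 'm \<Rightarrow> real \<times> (real^'n) \<Rightarrow> complex"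
  assumes log_coeffs: "log_coeffs A B" and A: "\<And>j k l. sup_smooth moderate (\<lambda>\<epsilon>. A j \<epsilon> k l)" and B: "\<And>k l. sup_smooth moderate (\<lambda>\<epsilon>. B \<epsilon> k l)"
    and h: "\<And>\<epsilon>. \<epsilon> \<in> {0<..1} \<Longrightarrow> 0 < h \<epsilon>"
    and U: "\<And>m l. L2_smooth any_bound m (\<lambda>\<epsilon>. U \<epsilon> l)" and smH: "\<And>\<epsilon> l. \<epsilon> \<in> {0<..1} \<Longrightarrow> sm (H \<epsilon> l)"
    and eq: "\<And>\<epsilon> vs l p. \<epsilon> \<in> {0<..1} \<Longrightarrow> vs \<in> lists (range dx) \<Longrightarrow> p \<in> Z \<Longrightarrow>
       pd Z dt (ipd Z vs (U \<epsilon> l)) p = ipd Z vs (H \<epsilon> l) p - ipd Z vs (semi_op (h \<epsilon>) (\<lambda>j. A j \<epsilon>) (B \<epsilon>) (U \<epsilon>) l) p"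
    and init: "\<And>\<epsilon> vs l. \<epsilon> \<in> {0<..1} \<Longrightarrow> vs \<in> lists (range dx) \<Longrightarrow> slice_le 0 (ipd Z vs (U \<epsilon> l)) 0"
    and H: "\<And>vs l. vs \<in> lists (range dx) \<Longrightarrow> L2_bdd moderate (\<lambda>\<epsilon>. ipd Z vs (H \<epsilon> l))"
  shows "vs \<in> lists (range dx) \<Longrightarrow> L2_bdd moderate (\<lambda>\<epsilon>. ipd Z vs (U \<epsilon> l))"
proof (induction "length vs" arbitrary: vs l rule: less_induct)
  case less
  define N where "N = length vs"
  let ?L1 = "{vs :: (real \<times> (real^'n)) list. vs \<in> lists (range dx) \<and> length vs < N}"
  let ?L2 = "{vs :: (real \<times> (real^'n)) list. vs \<in> lists (range dx) \<and> length vs = N}"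
  have fin: "finite ?L1" "finite ?L2" by (rule finite_subset[OF _ finite_lists_le(2)[of N]], force)+
  have "\<exists>K. moderate K \<and> (\<forall>\<epsilon>. 0 \<le> K \<epsilon>) \<and> (\<forall>\<epsilon>\<in>{0<..1}. \<forall>l. \<forall>vs\<in>?L1. \<forall>t\<in>{0..T}. slice_le t (ipd Z vs ((\<lambda>l \<epsilon>. U \<epsilon> l) l \<epsilon>)) (K \<epsilon>))"
    by (rule L2_smooth_common_bound[OF bound_class_moderate fin(1)]) (use less.hyps N_def in blast)
  then obtain Y where Y: "moderate Y" "\<And>\<epsilon>. 0 \<le> Y \<epsilon>" "\<forall>\<epsilon>\<in>{0<..1}. \<forall>l. \<forall>vs\<in>?L1. \<forall>t\<in>{0..T}. slice_le t (ipd Z vs (U \<epsilon> l)) (Y \<epsilon>)"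
    by blast
  have "\<exists>K. moderate K \<and> (\<forall>\<epsilon>. 0 \<le> K \<epsilon>) \<and> (\<forall>\<epsilon>\<in>{0<..1}. \<forall>l. \<forall>vs\<in>?L2. \<forall>t\<in>{0..T}. slice_le t (ipd Z vs ((\<lambda>l \<epsilon>. H \<epsilon> l) l \<epsilon>)) (K \<epsilon>))"
    by (rule L2_smooth_common_bound[OF bound_class_moderate fin(2)]) (use H in blast)
  then obtain L where L: "moderate L" "\<And>\<epsilon>. 0 \<le> L \<epsilon>" "\<forall>\<epsilon>\<in>{0<..1}. \<forall>l. \<forall>vs\<in>?L2. \<forall>t\<in>{0..T}. slice_le t (ipd Z vs (H \<epsilon> l)) (L \<epsilon>)"
    by blast
  have "\<exists>R. moderate R \<and> (\<forall>\<^sub>F \<epsilon> in at_right 0. \<forall>vs\<in>lists (range dx). length vs = N \<longrightarrow>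
     (\<forall>l. \<forall>t\<in>{0..T}. slice_le t (ipd Z vs (U \<epsilon> l)) (R \<epsilon> * ((\<lambda>_. 0) \<epsilon> + L \<epsilon> + Y \<epsilon>))))"
    by (rule order_estimate_net[OF log_coeffs A B h U smH eq init])
      (use L Y in \<open>auto simp del: in_lists_conv_set\<close>)
  then obtain R where R: "moderate R" "\<forall>\<^sub>F \<epsilon> in at_right 0. \<forall>vs\<in>lists (range dx). length vs = N \<longrightarrow>
     (\<forall>l. \<forall>t\<in>{0..T}. slice_le t (ipd Z vs (U \<epsilon> l)) (R \<epsilon> * (L \<epsilon> + Y \<epsilon>)))" by auto
  show ?case
  proof (rule L2_bdd_moderate_eventually)
    show "L2_bdd any_bound (\<lambda>\<epsilon>. ipd Z vs (U \<epsilon> l))" by (rule L2_smooth_L2_bdd[OF U space_lists[OF less.prems] order_refl])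
    show "moderate (\<lambda>\<epsilon>. R \<epsilon> * (L \<epsilon> + Y \<epsilon>))" by (intro moderate_mult moderate_add R L Y)
    show "\<forall>\<^sub>F \<epsilon> in at_right 0. \<forall>t\<in>{0..T}. slice_le t (ipd Z vs (U \<epsilon> l)) (R \<epsilon> * (L \<epsilon> + Y \<epsilon>))"
      using R(2) by eventually_elim (use less.prems N_def in blast)
  qed
qed


lemma L2_smooth_eventually:
  assumes "L2_smooth any_bound m u" "L2_smooth moderate m v" "\<forall>\<^sub>F \<epsilon> in at_right 0. u \<epsilon> = v \<epsilon>"
  shows "L2_smooth moderate m u"
proof (rule L2_smoothI)
  fix vs :: "(real \<times> (real^'a)) list" assume vs: "vs \<in> lists Basis" "count_list vs dt \<le> m"
  have "L2_bdd moderate (\<lambda>\<epsilon>. ipd Z vs (v \<epsilon>))" by (rule L2_smooth_L2_bdd[OF assms(2) vs])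
  then obtain K where K: "moderate K" "\<forall>\<epsilon>\<in>{0<..1}. \<forall>t\<in>{0..T}. slice_le t (ipd Z vs (v \<epsilon>)) (K \<epsilon>)" unfolding L2_bdd_def by blast
  have "\<forall>\<^sub>F \<epsilon> in at_right 0. \<forall>t\<in>{0..T}. slice_le t (ipd Z vs (u \<epsilon>)) (K \<epsilon>)"
    using assms(3) eventually_small[of 1, simplified] by eventually_elim (use K(2) in auto)
  with L2_smooth_L2_bdd[OF assms(1) vs] K(1) show "L2_bdd moderate (\<lambda>\<epsilon>. ipd Z vs (u \<epsilon>))" by (rule L2_bdd_moderate_eventually)
qed (rule L2_smooth_sm[OF assms(1)])

text \<open>Exponential smallness of the step enters here: the error is \<open>h\<^sup>2\<close>
  times a bound for second derivatives that is only known to be moderate.\<close>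

lemma L2_bdd_D_diff:
  assumes "L2_smooth moderate m u"
  shows "L2_bdd negligible (\<lambda>\<epsilon> p. D (exp (- 1 / \<epsilon>)) j (u \<epsilon>) p - pd Z (dx j) (u \<epsilon>) p)"
proof -
  have "[dx j, dx j] \<in> lists (range dx)" by simp
  from L2_smooth_L2_bdd[OF assms space_lists[OF this]] count_dt_space[OF this]
  have "L2_bdd moderate (\<lambda>\<epsilon>. ipd Z [dx j, dx j] (u \<epsilon>))" by simp
  then obtain K where K: "moderate K" "\<forall>\<epsilon>\<in>{0<..1}. \<forall>t\<in>{0..T}. slice_le t (pd Z (dx j) (pd Z (dx j) (u \<epsilon>))) (K \<epsilon>)" unfolding L2_bdd_def by auto
  have "negligible (\<lambda>\<epsilon>. (K \<epsilon> * exp (- 1 / \<epsilon>)) * exp (- 1 / \<epsilon>))" by (intro negligible_mult moderate_mult negligible_exp negligible_moderate[OF negligible_exp] K)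
  moreover have "slice_le t (\<lambda>p. D (exp (- 1 / \<epsilon>)) j (u \<epsilon>) p - pd Z (dx j) (u \<epsilon>) p) ((K \<epsilon> * exp (- 1 / \<epsilon>)) * exp (- 1 / \<epsilon>))"
    if "\<epsilon> \<in> {0<..1}" "t \<in> {0..T}" for \<epsilon> t
  proof -
    have "slice_le t (\<lambda>p. D (exp (- 1 / \<epsilon>)) j (u \<epsilon>) p - pd Z (dx j) (u \<epsilon>) p) ((exp (- 1 / \<epsilon>))\<^sup>2 * K \<epsilon>)"
      using K(2) that by (intro slice_le_D_diff L2_smooth_sm[OF assms]) auto
    then show ?thesis by (simp add: power2_eq_square mult.commute mult.left_commute)
  qed
  ultimately show ?thesis unfolding L2_bdd_def by blast
qed

lemma space_of_count_dt: "vs \<in> lists Basis \<Longrightarrow> count_list vs dt = 0 \<Longrightarrow> vs \<in> lists (range (dx :: 'n::finite \<Rightarrow> _))"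
proof -
  assume vs: "vs \<in> lists Basis" "count_list vs dt = 0"
  have "v \<in> range dx" if "v \<in> set vs" for v
  proof -
    have "v \<in> Basis" "v \<noteq> dt" using vs that by (auto simp: count_list_0_iff)
    then show ?thesis by (simp add: Basis_slab)
  qed
  then show ?thesis by (simp only: in_lists_conv_set) blast
qed

text \<open>The iterate \<open>Suc n\<close> solves the semi-discrete equation exactly once the
  source \<open>F\<close> is replaced by \<open>F\<close> plus \<Delta>, the change of
  \<open>KV\<close> between consecutive iterates. Hence the energy estimate applies to it directly,
  and its residual in the differential equation is \<Delta> minus the consistency error.\<close>

lemma existence_zero:
  fixes A :: "'n::finite \<Rightarrow> real \<Rightarrow> 'm::finite \<Rightarrow> 'm \<Rightarrow> real \<times> (real^'n) \<Rightarrow> complex"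
  assumes log_coeffs: "log_coeffs A B" and A: "\<And>j k l. sup_smooth moderate (\<lambda>\<epsilon>. A j \<epsilon> k l)" and B: "\<And>k l. sup_smooth moderate (\<lambda>\<epsilon>. B \<epsilon> k l)"
    and F: "\<And>m l. L2_smooth moderate m (\<lambda>\<epsilon>. F \<epsilon> l)"
  shows "\<exists>U. (\<forall>m l. L2_smooth moderate m (\<lambda>\<epsilon>. U \<epsilon> l)) \<and> (\<forall>\<epsilon> l y. U \<epsilon> l (0, y) = 0) \<and>
    (\<forall>k. L2_bdd negligible (\<lambda>\<epsilon> p. pd Z dt (U \<epsilon> k) p + (\<Sum>j\<in>UNIV. \<Sum>l\<in>UNIV. A j \<epsilon> k l p * pd Z (dx j) (U \<epsilon> l) p)
       + (\<Sum>l\<in>UNIV. B \<epsilon> k l p * U \<epsilon> l p) - F \<epsilon> k p))"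
proof -
  define h where "h = (\<lambda>\<epsilon>::real. exp (- 1 / \<epsilon>))"
  have h: "0 < h \<epsilon>" for \<epsilon> by (simp add: h_def)
  define V where "V = (\<lambda>\<epsilon>. picard (h \<epsilon>) (\<lambda>j. A j \<epsilon>) (B \<epsilon>) (F \<epsilon>))"
  define KV where "KV = (\<lambda>\<epsilon> n. semi_op (h \<epsilon>) (\<lambda>j. A j \<epsilon>) (B \<epsilon>) (V \<epsilon> n))"
  define \<Delta> where "\<Delta> = (\<lambda>\<epsilon> n k. semi_op (h \<epsilon>) (\<lambda>j. A j \<epsilon>) (B \<epsilon>) (\<lambda>l p. V \<epsilon> (Suc n) l p - V \<epsilon> n l p) k)"
  have \<Delta>: "\<Delta> \<epsilon> n k p = KV \<epsilon> (Suc n) k p - KV \<epsilon> n k p" for \<epsilon> n k p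
    unfolding \<Delta>_def KV_def by (rule semi_op_diff)
  have VS: "V \<epsilon> (Suc n) k = J (\<lambda>p. F \<epsilon> k p - KV \<epsilon> n k p)" for \<epsilon> n k
    by (simp add: V_def KV_def)
  note Aa = sup_smooth_weaken[OF A] and Ba = sup_smooth_weaken[OF B] and Fa = L2_smooth_weaken[OF F]
  have XV: "L2_smooth any_bound m (\<lambda>\<epsilon>. V \<epsilon> (\<nu> \<epsilon>) l)" for m l \<nu>
    unfolding V_def by (rule L2_smooth_picard_select[OF Aa Ba Fa h])
  have XKV: "L2_smooth any_bound m (\<lambda>\<epsilon>. KV \<epsilon> (\<nu> \<epsilon>) l)" for m l \<nu>
    unfolding KV_def by (intro L2_smooth_semi_op Aa Ba XV h) simp
  have X\<Delta>: "L2_smooth any_bound m (\<lambda>\<epsilon>. \<Delta> \<epsilon> (\<mu> \<epsilon>) l)" for m l \<mu>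
    unfolding \<Delta>_def by (intro L2_smooth_semi_op Aa Ba L2_smooth_diff XV h) simp_all
  \<comment> \<open>The controlled order grows with \<open>1 / \<epsilon>\<close>, so every fixed
    \<open>vs\<close> is covered once \<epsilon> is small, while for each \<epsilon> only finitely
    many lists are involved and a common index exists.\<close>
  have "\<forall>\<epsilon>. \<exists>N0. \<epsilon> \<in> {0<..1} \<longrightarrow> (\<forall>n\<ge>N0. \<forall>vs\<in>lists (range dx). length vs \<le> nat \<lceil>1 / \<epsilon>\<rceil> \<longrightarrow>
     (\<forall>k. \<forall>t\<in>{0..T}. slice_le t (ipd Z vs (\<Delta> \<epsilon> n k)) (exp (- 1 / \<epsilon>))))"
  proof
    fix \<epsilon> :: real
    show "\<exists>N0. \<epsilon> \<in> {0<..1} \<longrightarrow> (\<forall>n\<ge>N0. \<forall>vs\<in>lists (range dx). length vs \<le> nat \<lceil>1 / \<epsilon>\<rceil> \<longrightarrow>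
     (\<forall>k. \<forall>t\<in>{0..T}. slice_le t (ipd Z vs (\<Delta> \<epsilon> n k)) (exp (- 1 / \<epsilon>))))"
    proof (cases "\<epsilon> \<in> {0<..1}")
      case True
      have Fe: "L2_smooth any_bound m (\<lambda>_. F \<epsilon> l)" for m l
        using Fa[of m l] True L2_smooth_any_bound_pointwise[of m "\<lambda>\<epsilon>. F \<epsilon> l"] by blast
      have "\<exists>N0. \<forall>n\<ge>N0. \<forall>vs\<in>lists (range dx). length vs \<le> nat \<lceil>1 / \<epsilon>\<rceil> \<longrightarrow>
         (\<forall>k. \<forall>t\<in>{0..T}. slice_le t (ipd Z vs (\<Delta> \<epsilon> n k)) (exp (- 1 / \<epsilon>)))"
        unfolding \<Delta>_def V_def
        by (rule picard_delta_small[where A="\<lambda>j. A j \<epsilon>" and B="B \<epsilon>" and F="F \<epsilon>"])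
          (rule sup_smooth_any_bound_pointwise[OF Aa True] sup_smooth_any_bound_pointwise[OF Ba True] Fe h exp_gt_zero)+
      then show ?thesis by blast
    qed auto
  qed
  then obtain N0 where N0: "\<And>\<epsilon> n vs k t. \<epsilon> \<in> {0<..1} \<Longrightarrow> N0 \<epsilon> \<le> n \<Longrightarrow> vs \<in> lists (range dx) \<Longrightarrow> length vs \<le> nat \<lceil>1 / \<epsilon>\<rceil> \<Longrightarrow>
      t \<in> {0..T} \<Longrightarrow> slice_le t (ipd Z vs (\<Delta> \<epsilon> n k)) (exp (- 1 / \<epsilon>))"
    by metis
  \<comment> \<open>Any index net beyond \<open>N0\<close> is allowed, because the induction on time
    derivatives below goes back from an iterate to its predecessor.\<close>
  have spatial: "L2_bdd moderate (\<lambda>\<epsilon>. ipd Z vs (V \<epsilon> (Suc (\<mu> \<epsilon>)) l))"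
    if \<mu>: "\<And>\<epsilon>. \<epsilon> \<in> {0<..1} \<Longrightarrow> N0 \<epsilon> \<le> \<mu> \<epsilon>" and vs: "vs \<in> lists (range dx)" for \<mu> vs l
  proof (rule spatial_moderate[OF log_coeffs A B h, where U="\<lambda>\<epsilon>. V \<epsilon> (Suc (\<mu> \<epsilon>))" and H="\<lambda>\<epsilon> l p. F \<epsilon> l p + \<Delta> \<epsilon> (\<mu> \<epsilon>) l p"])
    show "L2_smooth any_bound m (\<lambda>\<epsilon>. V \<epsilon> (Suc (\<mu> \<epsilon>)) l)" for m l by (rule XV)
    show smH: "sm (\<lambda>p. F \<epsilon> l p + \<Delta> \<epsilon> (\<mu> \<epsilon>) l p)" if "\<epsilon> \<in> {0<..1}" for \<epsilon> l
      by (intro sm_add L2_smooth_sm[OF F that] L2_smooth_sm[OF X\<Delta> that])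
    show "vs \<in> lists (range dx)" by (rule vs)
    have smf: "sm (\<lambda>p. F \<epsilon> l p - KV \<epsilon> (\<mu> \<epsilon>) l p)" if "\<epsilon> \<in> {0<..1}" for \<epsilon> l
      by (intro sm_diff L2_smooth_sm[OF F that] L2_smooth_sm[OF XKV that])
    {
      fix \<epsilon> :: real and vs :: "(real \<times> (real^'n)) list" and l and p :: "real \<times> (real^'n)"
      assume *: "\<epsilon> \<in> {0<..1}" "vs \<in> lists (range dx)" "p \<in> Z"
      have "pd Z dt (ipd Z vs (V \<epsilon> (Suc (\<mu> \<epsilon>)) l)) p = pd Z dt (J (ipd Z vs (\<lambda>p. F \<epsilon> l p - KV \<epsilon> (\<mu> \<epsilon>) l p))) p"
        unfolding VS by (rule pd_cong) (use * smf in \<open>auto simp: ipd_J_space simp del: in_lists_conv_set\<close>)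
      also have "\<dots> = ipd Z vs (\<lambda>p. F \<epsilon> l p - KV \<epsilon> (\<mu> \<epsilon>) l p) p"
        by (rule pd_J_dt[OF sm_ipd[OF smf[OF *(1)] space_lists[OF *(2)]] *(3)])
      also have "(\<lambda>p. F \<epsilon> l p - KV \<epsilon> (\<mu> \<epsilon>) l p) = (\<lambda>p. (F \<epsilon> l p + \<Delta> \<epsilon> (\<mu> \<epsilon>) l p) - KV \<epsilon> (Suc (\<mu> \<epsilon>)) l p)"
        by (simp add: \<Delta>)
      also have "ipd Z vs \<dots> p = ipd Z vs (\<lambda>p. F \<epsilon> l p + \<Delta> \<epsilon> (\<mu> \<epsilon>) l p) p - ipd Z vs (KV \<epsilon> (Suc (\<mu> \<epsilon>)) l) p"
        by (rule ipd_diff[OF smH[OF *(1)] L2_smooth_sm[OF XKV *(1)] space_lists[OF *(2)] *(3)])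
      finally show "pd Z dt (ipd Z vs (V \<epsilon> (Suc (\<mu> \<epsilon>)) l)) p = ipd Z vs (\<lambda>p. F \<epsilon> l p + \<Delta> \<epsilon> (\<mu> \<epsilon>) l p) p
         - ipd Z vs (semi_op (h \<epsilon>) (\<lambda>j. A j \<epsilon>) (B \<epsilon>) (V \<epsilon> (Suc (\<mu> \<epsilon>))) l) p"
        by (simp only: KV_def)
    }
    {
      fix \<epsilon> :: real and vs :: "(real \<times> (real^'n)) list" and l
      assume *: "\<epsilon> \<in> {0<..1}" "vs \<in> lists (range dx)"
      have "ipd Z vs (V \<epsilon> (Suc (\<mu> \<epsilon>)) l) (0, x) = 0" for x
      proof -
        have "(0, x) \<in> Z" using T_pos by (simp add: Z_eq)
        then show ?thesis unfolding VS ipd_J_space[OF smf[OF *(1)] *(2) \<open>(0, x) \<in> Z\<close>] by (simp add: J_def)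
      qed
      moreover have "continuous_on Z (ipd Z vs (V \<epsilon> (Suc (\<mu> \<epsilon>)) l))"
        by (rule sm_continuous[OF sm_ipd[OF L2_smooth_sm[OF XV *(1)] space_lists[OF *(2)]]])
      ultimately show "slice_le 0 (ipd Z vs (V \<epsilon> (Suc (\<mu> \<epsilon>)) l)) 0"
        using T_pos by (simp add: slice_le_def nsq_def)
    }
    {
      fix vs :: "(real \<times> (real^'n)) list" and l
      assume vs: "vs \<in> lists (range dx)"
      have "\<forall>\<^sub>F \<epsilon> in at_right 0. 0 < \<epsilon> \<and> \<epsilon> < 1 / (real (length vs) + 1)" by (rule eventually_small) simp
      then have "\<forall>\<^sub>F \<epsilon> in at_right 0. \<forall>t\<in>{0..T}. slice_le t (ipd Z vs (\<Delta> \<epsilon> (\<mu> \<epsilon>) l)) (exp (- 1 / \<epsilon>))"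
        using eventually_small[of 1, simplified]
      proof eventually_elim
        case (elim \<epsilon>)
        then have e: "\<epsilon> \<in> {0<..1}" by simp
        have "\<epsilon> * (real (length vs) + 1) < 1" using elim by (simp add: pos_less_divide_eq)
        then have "real (length vs) * \<epsilon> \<le> 1" using elim by (simp add: algebra_simps)
        then have "real (length vs) \<le> 1 / \<epsilon>" using elim by (simp add: pos_le_divide_eq)
        then have "length vs \<le> nat \<lceil>1 / \<epsilon>\<rceil>" by linarith
        then show ?case using N0[OF e \<mu>[OF e] vs] by blast
      qed
      then have "L2_bdd moderate (\<lambda>\<epsilon>. ipd Z vs (\<Delta> \<epsilon> (\<mu> \<epsilon>) l))"
        by (rule L2_bdd_moderate_eventually[OF L2_smooth_L2_bdd[OF X\<Delta> space_lists[OF vs] order_refl] negligible_moderate[OF negligible_exp]])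
      then have "L2_bdd moderate (\<lambda>\<epsilon> p. ipd Z vs (F \<epsilon> l) p + ipd Z vs (\<Delta> \<epsilon> (\<mu> \<epsilon>) l) p)"
        by (rule L2_bdd_add[OF bound_class_moderate L2_smooth_L2_bdd[OF F space_lists[OF vs] order_refl]])
      then show "L2_bdd moderate (\<lambda>\<epsilon>. ipd Z vs (\<lambda>p. F \<epsilon> l p + \<Delta> \<epsilon> (\<mu> \<epsilon>) l p))"
        by (rule L2_bdd_cong) (rule ipd_add[symmetric, OF L2_smooth_sm[OF F] L2_smooth_sm[OF X\<Delta>] space_lists[OF vs]])
    }
  qed
  \<comment> \<open>A time derivative of an iterate is expressed by the preceding iterate, so
    \<open>m\<close> of them need a reserve of \<open>m\<close> indices beyond \<open>N0\<close>;
    the additional \<open>Suc\<close> provides a predecessor that is still at least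
    \<open>N0\<close>, as \<open>spatial\<close> demands.\<close>
  have all: "L2_smooth moderate m (\<lambda>\<epsilon>. V \<epsilon> (\<nu> \<epsilon>) l)" if "\<And>\<epsilon>. \<epsilon> \<in> {0<..1} \<Longrightarrow> N0 \<epsilon> + Suc m \<le> \<nu> \<epsilon>" for m \<nu> l
    using that
  proof (induction m arbitrary: \<nu> l)
    case 0
    have sp: "L2_bdd moderate (\<lambda>\<epsilon>. ipd Z vs (V \<epsilon> (\<nu> \<epsilon>) l))" if "vs \<in> lists (range dx)" for vs
    proof (rule L2_bdd_cong)
      show "L2_bdd moderate (\<lambda>\<epsilon>. ipd Z vs (V \<epsilon> (Suc (\<nu> \<epsilon> - 1)) l))"
        by (rule spatial[OF _ that]) (use 0 in force)
      show "ipd Z vs (V \<epsilon> (Suc (\<nu> \<epsilon> - 1)) l) p = ipd Z vs (V \<epsilon> (\<nu> \<epsilon>) l) p" if "\<epsilon> \<in> {0<..1}" for \<epsilon> p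
        using 0[OF that] by simp
    qed
    show ?case
      by (rule L2_smoothI[OF L2_smooth_sm[OF XV]]) (use sp space_of_count_dt in auto)
  next
    case (Suc m)
    have "L2_smooth moderate (Suc m) (\<lambda>\<epsilon>. J (\<lambda>p. F \<epsilon> l p - KV \<epsilon> (\<nu> \<epsilon> - 1) l p))"
    proof (rule L2_smooth_J)
      have "L2_smooth moderate m (\<lambda>\<epsilon>. V \<epsilon> (\<nu> \<epsilon> - 1) k)" for k
        by (rule Suc.IH) (use Suc.prems in force)
      then show "L2_smooth moderate m (\<lambda>\<epsilon> p. F \<epsilon> l p - KV \<epsilon> (\<nu> \<epsilon> - 1) l p)"
        unfolding KV_def by (intro L2_smooth_diff L2_smooth_semi_op F A B h) simp_all
      fix vs :: "(real \<times> (real^'n)) list" assume vs: "vs \<in> lists (range dx)"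
      have "L2_bdd moderate (\<lambda>\<epsilon>. ipd Z vs (V \<epsilon> (Suc (\<nu> \<epsilon> - 1)) l))"
        by (rule spatial[OF _ vs]) (use Suc.prems in force)
      then show "L2_bdd moderate (\<lambda>\<epsilon>. ipd Z vs (J (\<lambda>p. F \<epsilon> l p - KV \<epsilon> (\<nu> \<epsilon> - 1) l p)))"
        by (simp only: VS)
    qed
    then show ?case
    proof (rule L2_smooth_cong)
      fix \<epsilon> :: real and p :: "real \<times> (real^'n)" assume "\<epsilon> \<in> {0<..1}"
      then have "\<nu> \<epsilon> = Suc (\<nu> \<epsilon> - 1)" using Suc.prems[of \<epsilon>] by simp
      then show "J (\<lambda>p. F \<epsilon> l p - KV \<epsilon> (\<nu> \<epsilon> - 1) l p) p = V \<epsilon> (\<nu> \<epsilon>) l p" using VS by metis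
    qed
  qed
  \<comment> \<open>\<open>m\<close> time derivatives use up \<open>m\<close> iterates beyond \<open>N0 \<epsilon>\<close>; letting the reserve grow with \<open>1 / \<epsilon>\<close> serves all \<open>m\<close>.\<close>
  define \<mu> where "\<mu> = (\<lambda>\<epsilon>. N0 \<epsilon> + nat \<lceil>1 / \<epsilon>\<rceil>)"
  define U where "U = (\<lambda>\<epsilon>. V \<epsilon> (Suc (\<mu> \<epsilon>)))"
  have XU: "L2_smooth moderate m (\<lambda>\<epsilon>. U \<epsilon> l)" for m l
  proof (rule L2_smooth_eventually)
    show "L2_smooth any_bound m (\<lambda>\<epsilon>. U \<epsilon> l)" unfolding U_def by (rule XV)
    \<comment> \<open>The maximum meets the requirement of \<open>all\<close> for every \<epsilon>
      and equals the chosen index for small \<epsilon>.\<close>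
    show "L2_smooth moderate m (\<lambda>\<epsilon>. V \<epsilon> (max (Suc (\<mu> \<epsilon>)) (N0 \<epsilon> + Suc m)) l)" by (rule all) simp
    have "\<forall>\<^sub>F \<epsilon> in at_right 0. 0 < \<epsilon> \<and> \<epsilon> < 1 / (real m + 1)" by (rule eventually_small) simp
    then show "\<forall>\<^sub>F \<epsilon> in at_right 0. U \<epsilon> l = V \<epsilon> (max (Suc (\<mu> \<epsilon>)) (N0 \<epsilon> + Suc m)) l"
    proof eventually_elim
      case (elim \<epsilon>)
      then have "\<epsilon> * (real m + 1) < 1" by (simp add: pos_less_divide_eq)
      then have "real m * \<epsilon> \<le> 1" using elim by (simp add: algebra_simps)
      then have "real m \<le> 1 / \<epsilon>" using elim by (simp add: pos_le_divide_eq)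
      then have "m \<le> nat \<lceil>1 / \<epsilon>\<rceil>" by linarith
      then have "max (Suc (\<mu> \<epsilon>)) (N0 \<epsilon> + Suc m) = Suc (\<mu> \<epsilon>)" unfolding \<mu>_def by linarith
      then show ?case by (simp only: U_def)
    qed
  qed
  have n\<Delta>: "L2_bdd negligible (\<lambda>\<epsilon>. \<Delta> \<epsilon> (\<mu> \<epsilon>) k)" for k
    unfolding L2_bdd_def
  proof (intro exI conjI ballI, rule negligible_exp)
    fix \<epsilon> t :: real assume *: "\<epsilon> \<in> {0<..1}" "t \<in> {0..T}"
    show "slice_le t (\<Delta> \<epsilon> (\<mu> \<epsilon>) k) (exp (- 1 / \<epsilon>))"
      using N0[OF *(1), of "\<mu> \<epsilon>" "[]" t k] *(2) by (simp add: \<mu>_def)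
  qed
  have "L2_bdd negligible (\<lambda>\<epsilon> p. \<Delta> \<epsilon> (\<mu> \<epsilon>) k p - (\<Sum>j\<in>UNIV. \<Sum>l\<in>UNIV. A j \<epsilon> k l p * (D (exp (- 1 / \<epsilon>)) j (U \<epsilon> l) p - pd Z (dx j) (U \<epsilon> l) p)))" for k
  proof (rule L2_bdd_negligible_diff[OF n\<Delta>], intro L2_bdd_negligible_sum L2_bdd_negligible_mult L2_bdd_D_diff[OF XU])
    show "sup_bdd moderate (\<lambda>\<epsilon>. A j \<epsilon> k l)" for j l using sup_smooth_sup_bdd[OF A, of "[]"] by simp
  qed
  then have "L2_bdd negligible (\<lambda>\<epsilon> p. pd Z dt (U \<epsilon> k) p + (\<Sum>j\<in>UNIV. \<Sum>l\<in>UNIV. A j \<epsilon> k l p * pd Z (dx j) (U \<epsilon> l) p)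
       + (\<Sum>l\<in>UNIV. B \<epsilon> k l p * U \<epsilon> l p) - F \<epsilon> k p)" for k
  proof (rule L2_bdd_cong)
    fix \<epsilon> :: real and p :: "real \<times> (real^'n)" assume *: "\<epsilon> \<in> {0<..1}" "p \<in> Z"
    have "pd Z dt (U \<epsilon> k) p = F \<epsilon> k p - KV \<epsilon> (\<mu> \<epsilon>) k p"
      unfolding U_def VS by (rule pd_J_dt[OF sm_diff[OF L2_smooth_sm[OF F *(1)] L2_smooth_sm[OF XKV *(1)]] *(2)])
    moreover have "KV \<epsilon> (\<mu> \<epsilon>) k p = KV \<epsilon> (Suc (\<mu> \<epsilon>)) k p - \<Delta> \<epsilon> (\<mu> \<epsilon>) k p" by (simp add: \<Delta>)
    moreover have "KV \<epsilon> (Suc (\<mu> \<epsilon>)) k p = (\<Sum>j\<in>UNIV. \<Sum>l\<in>UNIV. A j \<epsilon> k l p * D (exp (- 1 / \<epsilon>)) j (U \<epsilon> l) p) + (\<Sum>l\<in>UNIV. B \<epsilon> k l p * U \<epsilon> l p)"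
      by (simp add: KV_def semi_op_def U_def h_def)
    ultimately show "\<Delta> \<epsilon> (\<mu> \<epsilon>) k p - (\<Sum>j\<in>UNIV. \<Sum>l\<in>UNIV. A j \<epsilon> k l p * (D (exp (- 1 / \<epsilon>)) j (U \<epsilon> l) p - pd Z (dx j) (U \<epsilon> l) p))
      = pd Z dt (U \<epsilon> k) p + (\<Sum>j\<in>UNIV. \<Sum>l\<in>UNIV. A j \<epsilon> k l p * pd Z (dx j) (U \<epsilon> l) p)
       + (\<Sum>l\<in>UNIV. B \<epsilon> k l p * U \<epsilon> l p) - F \<epsilon> k p"
      by (simp add: right_diff_distrib sum_subtractf)
  qed
  moreover have "U \<epsilon> l (0, y) = 0" for \<epsilon> l y by (simp add: U_def VS J_def)
  ultimately show ?thesis using XU by blast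
qed

text \<open>\<open>W\<close> is regarded as an exact solution of the semi-discrete equation with its
  own residual \<open>H\<close> as source. \<open>H\<close> is negligible, being the residual of the
  differential equation plus the consistency error. The energy estimate is needed at order zero
  only, where no commutators occur.\<close>

lemma uniqueness_zero:
  fixes A :: "'n::finite \<Rightarrow> real \<Rightarrow> 'm::finite \<Rightarrow> 'm \<Rightarrow> real \<times> (real^'n) \<Rightarrow> complex"
  assumes log_coeffs: "log_coeffs A B" and A: "\<And>j k l. sup_smooth moderate (\<lambda>\<epsilon>. A j \<epsilon> k l)" and B: "\<And>k l. sup_smooth moderate (\<lambda>\<epsilon>. B \<epsilon> k l)"
    and W: "\<And>m l. L2_smooth moderate m (\<lambda>\<epsilon>. W \<epsilon> l)"
    and eq: "\<And>k. L2_bdd negligible (\<lambda>\<epsilon> p. pd Z dt (W \<epsilon> k) p + (\<Sum>j\<in>UNIV. \<Sum>l\<in>UNIV. A j \<epsilon> k l p * pd Z (dx j) (W \<epsilon> l) p)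
       + (\<Sum>l\<in>UNIV. B \<epsilon> k l p * W \<epsilon> l p))"
    and init: "negligible I0" "\<And>\<epsilon>. 0 \<le> I0 \<epsilon>" "\<And>\<epsilon> l. \<epsilon> \<in> {0<..1} \<Longrightarrow> slice_le 0 (W \<epsilon> l) (I0 \<epsilon>)"
  shows "L2_bdd negligible (\<lambda>\<epsilon>. W \<epsilon> k)"
proof -
  define h where "h = (\<lambda>\<epsilon>::real. exp (- 1 / \<epsilon>))"
  have h: "0 < h \<epsilon>" for \<epsilon> by (simp add: h_def)
  define H where "H = (\<lambda>\<epsilon> k p. pd Z dt (W \<epsilon> k) p + semi_op (h \<epsilon>) (\<lambda>j. A j \<epsilon>) (B \<epsilon>) (W \<epsilon>) k p)"
  have smH: "sm (H \<epsilon> l)" if "\<epsilon> \<in> {0<..1}" for \<epsilon> l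
    unfolding H_def by (intro sm_add sm_pd sm_semi_op dt_Basis L2_smooth_sm[OF W that] sup_smooth_sm[OF A that] sup_smooth_sm[OF B that])
  have nH: "L2_bdd negligible (\<lambda>\<epsilon>. H \<epsilon> k)" for k
  proof (rule L2_bdd_cong)
    show "L2_bdd negligible (\<lambda>\<epsilon> p. (pd Z dt (W \<epsilon> k) p + (\<Sum>j\<in>UNIV. \<Sum>l\<in>UNIV. A j \<epsilon> k l p * pd Z (dx j) (W \<epsilon> l) p)
       + (\<Sum>l\<in>UNIV. B \<epsilon> k l p * W \<epsilon> l p)) + (\<Sum>j\<in>UNIV. \<Sum>l\<in>UNIV. A j \<epsilon> k l p * (D (exp (- 1 / \<epsilon>)) j (W \<epsilon> l) p - pd Z (dx j) (W \<epsilon> l) p)))"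
    proof (rule L2_bdd_negligible_add[OF eq], intro L2_bdd_negligible_sum L2_bdd_negligible_mult L2_bdd_D_diff[OF W])
      show "sup_bdd moderate (\<lambda>\<epsilon>. A j \<epsilon> k l)" for j l using sup_smooth_sup_bdd[OF A, of "[]"] by simp
    qed
  qed (simp add: H_def semi_op_def h_def right_diff_distrib sum_subtractf)
  have "\<exists>K. negligible K \<and> (\<forall>\<epsilon>. 0 \<le> K \<epsilon>) \<and> (\<forall>\<epsilon>\<in>{0<..1}. \<forall>l. \<forall>t\<in>{0..T}. slice_le t (H \<epsilon> l) (K \<epsilon>))"
  proof -
    have "\<forall>k. \<exists>K. negligible K \<and> (\<forall>\<epsilon>\<in>{0<..1}. \<forall>t\<in>{0..T}. slice_le t (H \<epsilon> k) (K \<epsilon>))" using nH unfolding L2_bdd_def by blast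
    then obtain K where K: "\<And>k. negligible (K k)" "\<And>k \<epsilon> t. \<epsilon> \<in> {0<..1} \<Longrightarrow> t \<in> {0..T} \<Longrightarrow> slice_le t (H \<epsilon> k) (K k \<epsilon>)" by metis
    have "negligible (\<lambda>\<epsilon>. \<Sum>k\<in>S. \<bar>K k \<epsilon>\<bar>)" if "finite S" for S
      using that
    proof (induction S rule: finite_induct)
      case (insert k S)
      have "negligible (\<lambda>\<epsilon>. \<bar>K k \<epsilon>\<bar>)" by (rule negligible_mono[OF K(1)[of k]]) simp
      then show ?case using insert by (simp add: negligible_add)
    qed (simp add: negligible_const_0)
    moreover have "slice_le t (H \<epsilon> l) (\<Sum>k\<in>UNIV. \<bar>K k \<epsilon>\<bar>)" if "\<epsilon> \<in> {0<..1}" "t \<in> {0..T}" for \<epsilon> l t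
    proof (rule slice_le_mono[OF K(2)[OF that]])
      have "\<bar>K l \<epsilon>\<bar> \<le> (\<Sum>k\<in>UNIV. \<bar>K k \<epsilon>\<bar>)" by (rule member_le_sum) auto
      then show "K l \<epsilon> \<le> (\<Sum>k\<in>UNIV. \<bar>K k \<epsilon>\<bar>)" by linarith
    qed
    ultimately show ?thesis by (intro exI[of _ "\<lambda>\<epsilon>. \<Sum>k\<in>UNIV. \<bar>K k \<epsilon>\<bar>"]) (auto intro: sum_nonneg)
  qed
  then obtain L where L: "negligible L" "\<And>\<epsilon>. 0 \<le> L \<epsilon>" "\<And>\<epsilon> l t. \<epsilon> \<in> {0<..1} \<Longrightarrow> t \<in> {0..T} \<Longrightarrow> slice_le t (H \<epsilon> l) (L \<epsilon>)" by blast
  have "\<exists>R. moderate R \<and> (\<forall>\<^sub>F \<epsilon> in at_right 0. \<forall>vs\<in>lists (range dx). length vs = 0 \<longrightarrow>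
     (\<forall>l. \<forall>t\<in>{0..T}. slice_le t (ipd Z vs (W \<epsilon> l)) (R \<epsilon> * (I0 \<epsilon> + L \<epsilon> + (\<lambda>_. 0) \<epsilon>))))"
  proof (rule order_estimate_net[OF log_coeffs A B h L2_smooth_weaken[OF W] smH])
    fix \<epsilon> :: real and vs :: "(real \<times> (real^'n)) list" and l and p :: "real \<times> (real^'n)"
    assume "\<epsilon> \<in> {0<..1}" "length vs = 0" "p \<in> Z"
    then show "pd Z dt (ipd Z vs (W \<epsilon> l)) p = ipd Z vs (H \<epsilon> l) p - ipd Z vs (semi_op (h \<epsilon>) (\<lambda>j. A j \<epsilon>) (B \<epsilon>) (W \<epsilon>) l) p"
      by (simp add: H_def)
  qed (use init L in auto)
  then obtain R where R: "moderate R" "\<forall>\<^sub>F \<epsilon> in at_right 0. \<forall>vs\<in>lists (range dx). length vs = 0 \<longrightarrow>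
     (\<forall>l. \<forall>t\<in>{0..T}. slice_le t (ipd Z vs (W \<epsilon> l)) (R \<epsilon> * (I0 \<epsilon> + L \<epsilon>)))" by auto
  show ?thesis
  proof (rule L2_bdd_negligible_eventually)
    show "L2_bdd any_bound (\<lambda>\<epsilon>. W \<epsilon> k)" using L2_bdd_weaken[OF L2_smooth_L2_bdd[OF W, of "[]"]] by simp
    show "negligible (\<lambda>\<epsilon>. R \<epsilon> * (I0 \<epsilon> + L \<epsilon>))" by (intro negligible_mult negligible_add R init L)
    show "\<forall>\<^sub>F \<epsilon> in at_right 0. \<forall>t\<in>{0..T}. slice_le t (W \<epsilon> k) (R \<epsilon> * (I0 \<epsilon> + L \<epsilon>))"
      using R(2) by eventually_elim (auto dest!: bspec[of _ _ "[]"])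
  qed
qed

end

section \<open>Coefficients of log-type\<close>

lemma matrix_apply_norm_le:
  fixes M :: "'m::finite \<Rightarrow> 'm \<Rightarrow> complex"
  shows "norm (\<chi> k. \<Sum>l\<in>UNIV. M k l * v $ l :: complex^'m) \<le> (\<Sum>k\<in>UNIV. \<Sum>l\<in>UNIV. cmod (M k l)) * norm v"
proof -
  have "norm (\<chi> k. \<Sum>l\<in>UNIV. M k l * v $ l :: complex^'m) \<le> (\<Sum>k\<in>UNIV. cmod (\<Sum>l\<in>UNIV. M k l * v $ l))"
    unfolding norm_vec_def by (intro order_trans[OF L2_set_le_sum]) auto
  also have "\<dots> \<le> (\<Sum>k\<in>UNIV. \<Sum>l\<in>UNIV. cmod (M k l) * norm v)"
    by (intro sum_mono order_trans[OF norm_sum]) (auto simp: norm_mult intro!: mult_left_mono Finite_Cartesian_Product.norm_nth_le)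
  also have "\<dots> = (\<Sum>k\<in>UNIV. \<Sum>l\<in>UNIV. cmod (M k l)) * norm v" by (simp add: sum_distrib_right)
  finally show ?thesis .
qed

lemma matrix_apply_bounded_linear:
  fixes M :: "'m::finite \<Rightarrow> 'm \<Rightarrow> complex"
  shows "bounded_linear (\<lambda>v::complex^'m. \<chi> k. \<Sum>l\<in>UNIV. M k l * v $ l)"
  using matrix_apply_norm_le[of M]
  by (intro bounded_linear_intro[of _ "\<Sum>k\<in>UNIV. \<Sum>l\<in>UNIV. cmod (M k l)"])
    (auto simp: vec_eq_iff algebra_simps sum.distrib scaleR_sum_right mult.commute)

lemma mat_opnorm_le: "mat_opnorm M \<le> (\<Sum>k\<in>UNIV. \<Sum>l\<in>UNIV. cmod (M k l))"
  unfolding mat_opnorm_def by (rule onorm_bound) (auto intro!: sum_nonneg matrix_apply_norm_le)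

lemma mat_opnorm_entry: "cmod (M k l) \<le> mat_opnorm M"
proof -
  let ?f = "\<lambda>v::complex^'a. \<chi> k. \<Sum>l\<in>UNIV. M k l * v $ l"
  have "?f (axis l 1) $ k = M k l"
    by (simp add: axis_def if_distrib cong: if_cong)
  then have "cmod (M k l) \<le> norm (?f (axis l 1))" using Finite_Cartesian_Product.norm_nth_le[of "?f (axis l 1)" k] by simp
  also have "\<dots> \<le> onorm ?f * norm (axis l 1 :: complex^'a)" by (rule onorm[OF matrix_apply_bounded_linear])
  also have "\<dots> \<le> onorm ?f * 1"
  proof (rule mult_left_mono[OF _ onorm_pos_le[OF matrix_apply_bounded_linear]])
    have "norm (axis l 1 :: complex^'a) \<le> (\<Sum>i\<in>UNIV. cmod (axis l 1 $ i))"
      unfolding norm_vec_def by (rule L2_set_le_sum) auto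
    also have "\<dots> = 1" by (simp add: axis_def if_distrib cong: if_cong)
    finally show "norm (axis l 1 :: complex^'a) \<le> 1" .
  qed
  finally show ?thesis by (simp add: mat_opnorm_def)
qed

lemma mat_opnorm_diff: "mat_opnorm M \<le> mat_opnorm M' + (\<Sum>k\<in>UNIV. \<Sum>l\<in>UNIV. cmod (M k l - M' k l))"
proof -
  have eq: "(\<lambda>v::complex^'a. \<chi> k. \<Sum>l\<in>UNIV. M k l * v $ l) = (\<lambda>v. (\<chi> k. \<Sum>l\<in>UNIV. M' k l * v $ l) + (\<chi> k. \<Sum>l\<in>UNIV. (M k l - M' k l) * v $ l))"
    by (simp add: fun_eq_iff vec_eq_iff left_diff_distrib sum_subtractf)
  have "mat_opnorm M \<le> mat_opnorm M' + mat_opnorm (\<lambda>k l. M k l - M' k l)"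
    unfolding mat_opnorm_def eq by (rule onorm_triangle[OF matrix_apply_bounded_linear matrix_apply_bounded_linear])
  with mat_opnorm_le[of "\<lambda>k l. M k l - M' k l"] show ?thesis by linarith
qed

context slab begin

definition supop :: "('m::finite \<Rightarrow> 'm \<Rightarrow> real \<times> (real^'n::finite) \<Rightarrow> complex) \<Rightarrow> real \<Rightarrow> real" where
  "supop M s = (SUP x\<in>UNIV. mat_opnorm (\<lambda>k l. M k l (s, x)))"

lemma time_increment_le:
  assumes f: "sm f" and b: "\<And>p. p \<in> Z \<Longrightarrow> cmod (pd Z dt f p) \<le> L" and st: "s \<in> {0..T}" "t \<in> {0..T}" "s \<le> t"
  shows "cmod (f (t, x) - f (s, x)) \<le> L * (t - s)"
proof (rule vector_increment_le[OF st(3)])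
  have d: "((\<lambda>u. f (u, x)) has_vector_derivative pd Z dt f (u, x)) (at u within {0..T})" if "u \<in> {0..T}" for u
    by (rule dt_slice[OF f that])
  have "continuous_on {0..T} (\<lambda>u. f (u, x))"
    unfolding continuous_on_eq_continuous_within using has_vector_derivative_continuous[OF d] by blast
  then show "continuous_on {s..t} (\<lambda>u. f (u, x))" by (rule continuous_on_subset) (use st in auto)
  fix u assume u: "u \<in> {s<..<t}"
  then have "u \<in> interior {0..T}" using st by auto
  then have "at u within {0..T} = at u" by (rule at_within_interior)
  moreover have "u \<in> {0..T}" using u st by auto
  ultimately show "((\<lambda>u. f (u, x)) has_vector_derivative pd Z dt f (u, x)) (at u)"
    using d[of u] by simp
  show "cmod (pd Z dt f (u, x)) \<le> L" using u st by (intro b) (auto simp: Z_eq)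
qed

text \<open>A supremum over \<open>x\<close> of continuous functions need not be continuous in time;
  here the time derivatives are bounded uniformly in \<open>x\<close>, so \<open>supop M\<close> is
  Lipschitz. Continuity makes it an admissible majorant and turns \<open>L1inf_norm\<close> into an
  ordinary integral.\<close>

lemma supop_props:
  fixes M :: "'m::finite \<Rightarrow> 'm \<Rightarrow> real \<times> (real^'n::finite) \<Rightarrow> complex"
  assumes M: "\<And>k l. Winf (Omega T) (M k l)"
  shows "\<And>s x k l. s \<in> {0..T} \<Longrightarrow> cmod (M k l (s, x)) \<le> supop M s"
    and "continuous_on {0..T} (supop M)"
    and "L1inf_norm T M = integral {0..T} (supop M)"
proof -
  define C where "C = (\<Sum>k\<in>UNIV. \<Sum>l\<in>UNIV. supnorm (Omega T) (M k l))"
  define L where "L = (\<Sum>k\<in>UNIV. \<Sum>l\<in>UNIV. supnorm (Omega T) (pd Z dt (M k l)))"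
  have smM: "sm (M k l)" for k l using M by (simp add: Winf_def)
  have b0: "cmod (M k l p) \<le> supnorm (Omega T) (M k l)" if "p \<in> Z" for k l p
    using Winf_bound[OF M _ that, of "[]"] by simp
  have b1: "cmod (pd Z dt (M k l) p) \<le> supnorm (Omega T) (pd Z dt (M k l))" if "p \<in> Z" for k l p
    using Winf_bound[OF M _ that, of "[dt]"] by simp
  have bdd: "bdd_above (range (\<lambda>x. mat_opnorm (\<lambda>k l. M k l (s, x))))" if "s \<in> {0..T}" for s
  proof (rule bdd_aboveI2)
    fix x :: "real^'n"
    have "mat_opnorm (\<lambda>k l. M k l (s, x)) \<le> (\<Sum>k\<in>UNIV. \<Sum>l\<in>UNIV. cmod (M k l (s, x)))" by (rule mat_opnorm_le)
    also have "\<dots> \<le> C" unfolding C_def using that by (intro sum_mono b0) (auto simp: Z_eq)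
    finally show "mat_opnorm (\<lambda>k l. M k l (s, x)) \<le> C" .
  qed
  show "cmod (M k l (s, x)) \<le> supop M s" if "s \<in> {0..T}" for s x k l
    unfolding supop_def using mat_opnorm_entry[of "\<lambda>k l. M k l (s, x)" k l]
    by (rule order_trans) (rule cSUP_upper[OF UNIV_I bdd[OF that]])
  have lip: "supop M s \<le> supop M t + L * \<bar>t - s\<bar>" if st: "s \<in> {0..T}" "t \<in> {0..T}" for s t
    unfolding supop_def[of M s]
  proof (rule cSUP_least)
    fix x :: "real^'n"
    have "mat_opnorm (\<lambda>k l. M k l (s, x)) \<le> mat_opnorm (\<lambda>k l. M k l (t, x)) + (\<Sum>k\<in>UNIV. \<Sum>l\<in>UNIV. cmod (M k l (s, x) - M k l (t, x)))"
      by (rule mat_opnorm_diff)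
    also have "\<dots> \<le> supop M t + (\<Sum>k\<in>UNIV. \<Sum>l\<in>UNIV. supnorm (Omega T) (pd Z dt (M k l)) * \<bar>t - s\<bar>)"
    proof (intro add_mono sum_mono)
      show "mat_opnorm (\<lambda>k l. M k l (t, x)) \<le> supop M t" unfolding supop_def by (rule cSUP_upper[OF UNIV_I bdd[OF st(2)]])
      fix k l
      show "cmod (M k l (s, x) - M k l (t, x)) \<le> supnorm (Omega T) (pd Z dt (M k l)) * \<bar>t - s\<bar>"
      proof (cases "s \<le> t")
        case True
        then show ?thesis using time_increment_le[OF smM b1 st True, of k l x] by (simp add: norm_minus_commute)
      next
        case False
        then show ?thesis using time_increment_le[OF smM b1 st(2,1), of k l x] by simp
      qed
    qed
    also have "\<dots> = supop M t + L * \<bar>t - s\<bar>" by (simp add: L_def sum_distrib_right)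
    finally show "mat_opnorm (\<lambda>k l. M k l (s, x)) \<le> supop M t + L * \<bar>t - s\<bar>" .
  qed simp
  show cont: "continuous_on {0..T} (supop M)"
    unfolding continuous_on_iff
  proof (intro ballI allI impI)
    fix s e :: real assume s: "s \<in> {0..T}" and e: "0 < e"
    show "\<exists>d>0. \<forall>t\<in>{0..T}. dist t s < d \<longrightarrow> dist (supop M t) (supop M s) < e"
    proof (intro exI[of _ "e / (\<bar>L\<bar> + 1)"] conjI ballI impI)
      show "0 < e / (\<bar>L\<bar> + 1)" using e by simp
      fix t assume t: "t \<in> {0..T}" "dist t s < e / (\<bar>L\<bar> + 1)"
      have "\<bar>supop M t - supop M s\<bar> \<le> L * \<bar>t - s\<bar>"
        using lip[OF s t(1)] lip[OF t(1) s] by (simp add: abs_minus_commute abs_le_iff)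
      also have "\<dots> \<le> (\<bar>L\<bar> + 1) * \<bar>t - s\<bar>" by (intro mult_right_mono) auto
      also have "\<dots> < e" using t(2) by (simp add: dist_real_def pos_less_divide_eq mult.commute)
      finally show "dist (supop M t) (supop M s) < e" by (simp add: dist_real_def)
    qed
  qed
  have "supop M integrable_on {0..T}" by (rule integrable_continuous_interval[OF cont])
  moreover have "supop M absolutely_integrable_on {0..T}"
    using absolutely_integrable_continuous[of 0 T "supop M"] cont by simp
  then have "supop M absolutely_integrable_on {0<..<T}"
    by (rule set_integrable_subset) auto
  then have "integrable (lebesgue_on {0<..<T}) (supop M)" by (simp add: integrable_restrict_space set_integrable_def)
  then have "integral\<^sup>L (lebesgue_on {0<..<T}) (supop M) = integral {0<..<T} (supop M)"
    by (intro lebesgue_integral_eq_integral) auto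
  then show "L1inf_norm T M = integral {0..T} (supop M)"
    by (simp add: L1inf_norm_def supop_def[abs_def] integral_open_interval_real)
qed

text \<open>The logarithmic bound belongs to some representative \<open>M\<close>, whose entries
  differ from those of \<open>N\<close> by at most 1 for small \<epsilon>; hence the majorant
  \<open>1 + supop (M \<epsilon>)\<close>.\<close>

lemma log_type_bound:
  fixes N :: "real \<Rightarrow> 'm::finite \<Rightarrow> 'm \<Rightarrow> real \<times> (real^'n::finite) \<Rightarrow> complex"
  assumes "log_type T N"
  shows "\<exists>c Q. \<forall>\<^sub>F \<epsilon> in at_right 0. continuous_on {0..T} (c \<epsilon>) \<and> (\<forall>s\<in>{0..T}. 0 \<le> c \<epsilon> s) \<and>
     integral {0..T} (c \<epsilon>) \<le> Q * (1 + ln (1 / \<epsilon>)) \<and> (\<forall>s\<in>{0..T}. \<forall>x k l. cmod (N \<epsilon> k l (s, x)) \<le> c \<epsilon> s)"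
proof -
  obtain M where M: "mat_same_class (Omega T) N M" "(\<lambda>\<epsilon>. L1inf_norm T (M \<epsilon>)) \<in> O[at_right 0](\<lambda>\<epsilon>. ln (1 / \<epsilon>))"
    using assms unfolding log_type_def by blast
  have W: "Winf (Omega T) (M \<epsilon> k l)" if "\<epsilon> \<in> {0<..1}" for \<epsilon> k l
    using M(1) that unfolding mat_same_class_def mat_mod_Linf_def mod_Linf_def by blast
  obtain C where C: "C > 0" "\<forall>\<^sub>F \<epsilon> in at_right 0. norm (L1inf_norm T (M \<epsilon>)) \<le> C * norm (ln (1 / \<epsilon>))"
    using M(2) by (elim landau_o.bigE)
  have small: "\<forall>\<^sub>F \<epsilon> in at_right 0. \<forall>p\<in>Z. cmod (M \<epsilon> k l p - N \<epsilon> k l p) \<le> 1" for k l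
  proof -
    have "neg_Linf (Omega T) (\<lambda>\<epsilon> x. M \<epsilon> k l x - N \<epsilon> k l x)" using M(1) by (simp add: mat_same_class_def)
    from neg_Linf_sup_bdd[OF this, of "[]"] obtain m where m: "negligible m" "\<forall>\<epsilon>\<in>{0<..1}. \<forall>p\<in>Z. cmod (M \<epsilon> k l p - N \<epsilon> k l p) \<le> m \<epsilon>"
      by (auto simp: sup_bdd_def)
    have "\<forall>\<^sub>F \<epsilon> in at_right 0. \<bar>m \<epsilon>\<bar> \<le> \<epsilon> ^ 0" using m(1) unfolding negligible_def by blast
    then show ?thesis using eventually_small[of 1, simplified]
    proof eventually_elim
      case (elim \<epsilon>)
      then have "\<epsilon> \<in> {0<..1}" "m \<epsilon> \<le> 1" by auto
      then show ?case using m(2) order_trans by blast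
    qed
  qed
  have small': "\<forall>\<^sub>F \<epsilon> in at_right 0. \<forall>k l. \<forall>p\<in>Z. cmod (M \<epsilon> k l p - N \<epsilon> k l p) \<le> 1"
    using small by (simp add: eventually_all_finite)
  have "\<forall>\<^sub>F \<epsilon> in at_right 0. continuous_on {0..T} (\<lambda>s. 1 + supop (M \<epsilon>) s) \<and> (\<forall>s\<in>{0..T}. 0 \<le> 1 + supop (M \<epsilon>) s) \<and>
     integral {0..T} (\<lambda>s. 1 + supop (M \<epsilon>) s) \<le> (T + C) * (1 + ln (1 / \<epsilon>)) \<and> (\<forall>s\<in>{0..T}. \<forall>x k l. cmod (N \<epsilon> k l (s, x)) \<le> 1 + supop (M \<epsilon>) s)"
    using small' C(2) eventually_small[of 1, simplified]
  proof eventually_elim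
    case (elim \<epsilon>)
    then have e: "\<epsilon> \<in> {0<..1}" by auto
    note P = supop_props[of "M \<epsilon>", OF W[OF e]]
    have c: "continuous_on {0..T} (\<lambda>s. 1 + supop (M \<epsilon>) s)" by (intro continuous_intros P(2))
    have n: "0 \<le> 1 + supop (M \<epsilon>) s" if "s \<in> {0..T}" for s
      using order_trans[OF norm_ge_zero P(1)[OF that]] by (metis add_nonneg_nonneg zero_le_one)
    have ln0: "0 \<le> ln (1 / \<epsilon>)" using e by (intro ln_ge_zero) (auto simp: field_simps)
    have "((\<lambda>s. 1 + supop (M \<epsilon>) s) has_integral T + L1inf_norm T (M \<epsilon>)) {0..T}"
      unfolding P(3) using T_pos has_integral_const_real[of "1::real" 0 T]
      by (intro has_integral_add integrable_integral integrable_continuous_interval P(2)) auto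
    then have "integral {0..T} (\<lambda>s. 1 + supop (M \<epsilon>) s) = T + L1inf_norm T (M \<epsilon>)" by (rule integral_unique)
    also have "\<dots> \<le> T + C * ln (1 / \<epsilon>)" using elim ln0 by simp
    also have "\<dots> \<le> (T + C) * (1 + ln (1 / \<epsilon>))" using ln0 C(1) T_pos by (simp add: algebra_simps)
    finally have i: "integral {0..T} (\<lambda>s. 1 + supop (M \<epsilon>) s) \<le> (T + C) * (1 + ln (1 / \<epsilon>))" .
    have "cmod (N \<epsilon> k l (s, x)) \<le> 1 + supop (M \<epsilon>) s" if "s \<in> {0..T}" for s x k l
    proof -
      have "(s, x) \<in> Z" using that by (simp add: Z_eq)
      then have "cmod (M \<epsilon> k l (s, x) - N \<epsilon> k l (s, x)) \<le> 1" using elim by blast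
      moreover have "cmod (N \<epsilon> k l (s, x)) \<le> cmod (M \<epsilon> k l (s, x)) + cmod (M \<epsilon> k l (s, x) - N \<epsilon> k l (s, x))"
        using norm_triangle_ineq4[of "M \<epsilon> k l (s, x)" "M \<epsilon> k l (s, x) - N \<epsilon> k l (s, x)"] by simp
      ultimately show ?thesis using P(1)[OF that, where x=x and k=k and l=l] by linarith
    qed
    with c n i show ?case by blast
  qed
  then show ?thesis by (intro exI[of _ "\<lambda>\<epsilon> s. 1 + supop (M \<epsilon>) s"] exI[of _ "T + C"])
qed

text \<open>Symmetry is known for \<open>A'\<close>, the logarithmic bound for the derivatives of
  \<open>A\<close>. For small \<epsilon> the derivatives of the two differ by at most 1, so the
  majorant survives the exchange.\<close>

lemma log_coeffs_I:
  fixes A :: "'n::finite \<Rightarrow> real \<Rightarrow> 'm::finite \<Rightarrow> 'm \<Rightarrow> real \<times> (real^'n) \<Rightarrow> complex"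
  assumes A: "\<And>j. mat_same_class (Omega T) (A j) (A' j)"
    and herm: "\<And>j. \<forall>\<^sub>F \<epsilon> in at_right 0. \<forall>x\<in>Omega T. \<forall>k l. A' j \<epsilon> k l x = cnj (A' j \<epsilon> l k x)"
    and dA: "\<And>i j. log_type T (\<lambda>\<epsilon> k l. pd Z (dx i) (A j \<epsilon> k l))"
    and B: "log_type T (\<lambda>\<epsilon> k l x. (B \<epsilon> k l x + cnj (B \<epsilon> l k x)) / 2)"
  shows "log_coeffs A' B"
proof -
  define R where "R = (\<lambda>i j c Q. \<forall>\<^sub>F \<epsilon> in at_right 0. continuous_on {0..T} (c \<epsilon>) \<and> (\<forall>s\<in>{0..T}. 0 \<le> c \<epsilon> s) \<and>
     integral {0..T} (c \<epsilon>) \<le> Q * (1 + ln (1 / \<epsilon>)) \<and> (\<forall>s\<in>{0..T}. \<forall>x k l. cmod (pd Z (dx i) (A j \<epsilon> k l) (s, x)) \<le> c \<epsilon> s))"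
  have "\<exists>c Q. R i j c Q" for i j unfolding R_def by (rule log_type_bound[OF dA])
  then obtain cA QA where "\<And>i j. R i j (cA i j) (QA i j)" by metis
  note cA = this[unfolded R_def]
  obtain cB QB where cB: "\<forall>\<^sub>F \<epsilon> in at_right 0. continuous_on {0..T} (cB \<epsilon>) \<and> (\<forall>s\<in>{0..T}. 0 \<le> cB \<epsilon> s) \<and>
     integral {0..T} (cB \<epsilon>) \<le> QB * (1 + ln (1 / \<epsilon>)) \<and> (\<forall>s\<in>{0..T}. \<forall>x k l. cmod ((B \<epsilon> k l (s, x) + cnj (B \<epsilon> l k (s, x))) / 2) \<le> cB \<epsilon> s)"
    using log_type_bound[OF B] by blast
  have small: "\<forall>\<^sub>F \<epsilon> in at_right 0. \<forall>p\<in>Z. cmod (pd Z (dx i) (A' j \<epsilon> k l) p - pd Z (dx i) (A j \<epsilon> k l) p) \<le> 1" for i j k l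
  proof -
    have n: "neg_Linf (Omega T) (\<lambda>\<epsilon> x. A' j \<epsilon> k l x - A j \<epsilon> k l x)" using A[of j] by (simp add: mat_same_class_def)
    have smA: "sm (A j \<epsilon> k l)" "sm (A' j \<epsilon> k l)" if "\<epsilon> \<in> {0<..1}" for \<epsilon>
      using A[of j] that unfolding mat_same_class_def mat_mod_Linf_def mod_Linf_def Winf_def by blast+
    have "[dx i] \<in> lists Basis" by simp
    from neg_Linf_sup_bdd[OF n this] obtain m where m: "negligible m"
      "\<forall>\<epsilon>\<in>{0<..1}. \<forall>p\<in>Z. cmod (ipd Z [dx i] (\<lambda>x. A' j \<epsilon> k l x - A j \<epsilon> k l x) p) \<le> m \<epsilon>"
      unfolding sup_bdd_def by blast
    have "\<forall>\<^sub>F \<epsilon> in at_right 0. \<bar>m \<epsilon>\<bar> \<le> \<epsilon> ^ 0" using m(1) unfolding negligible_def by blast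
    then show ?thesis using eventually_small[of 1, simplified]
    proof eventually_elim
      case (elim \<epsilon>)
      then have e: "\<epsilon> \<in> {0<..1}" "m \<epsilon> \<le> 1" by auto
      have "pd Z (dx i) (A' j \<epsilon> k l) p - pd Z (dx i) (A j \<epsilon> k l) p = ipd Z [dx i] (\<lambda>x. A' j \<epsilon> k l x - A j \<epsilon> k l x) p" if "p \<in> Z" for p
        using ipd_diff[OF smA(2)[OF e(1)] smA(1)[OF e(1)] _ that, of "[dx i]"] by simp
      moreover have "cmod (ipd Z [dx i] (\<lambda>x. A' j \<epsilon> k l x - A j \<epsilon> k l x) p) \<le> 1" if "p \<in> Z" for p
        using bspec[OF bspec[OF m(2) e(1)] that] e(2) by linarith
      ultimately show ?case by simp
    qed
  qed
  \<comment> \<open>The sums over \<open>i\<close> and \<open>j\<close> form a common majorant for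
    all derivatives; 1 pays for replacing \<open>A\<close> by \<open>A'\<close>, and 2 undoes the
    division in the Hermitian part.\<close>
  define c where "c = (\<lambda>\<epsilon> s. 1 + (\<Sum>i\<in>UNIV. \<Sum>j\<in>UNIV. cA i j \<epsilon> s) + 2 * cB \<epsilon> s)"
  define Q where "Q = T + (\<Sum>i\<in>UNIV. \<Sum>j\<in>UNIV. QA i j) + 2 * QB"
  have cA': "\<forall>\<^sub>F \<epsilon> in at_right 0. \<forall>i j. continuous_on {0..T} (cA i j \<epsilon>) \<and> (\<forall>s\<in>{0..T}. 0 \<le> cA i j \<epsilon> s) \<and>
     integral {0..T} (cA i j \<epsilon>) \<le> QA i j * (1 + ln (1 / \<epsilon>)) \<and> (\<forall>s\<in>{0..T}. \<forall>x k l. cmod (pd Z (dx i) (A j \<epsilon> k l) (s, x)) \<le> cA i j \<epsilon> s)"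
    using cA by (simp add: eventually_all_finite)
  have small': "\<forall>\<^sub>F \<epsilon> in at_right 0. \<forall>i j k l. \<forall>p\<in>Z. cmod (pd Z (dx i) (A' j \<epsilon> k l) p - pd Z (dx i) (A j \<epsilon> k l) p) \<le> 1"
    using small by (simp add: eventually_all_finite)
  have herm': "\<forall>\<^sub>F \<epsilon> in at_right 0. \<forall>j. \<forall>x\<in>Omega T. \<forall>k l. A' j \<epsilon> k l x = cnj (A' j \<epsilon> l k x)"
    using herm by (simp add: eventually_all_finite)
  have "\<forall>\<^sub>F \<epsilon> in at_right 0. continuous_on {0..T} (c \<epsilon>) \<and> (\<forall>s\<in>{0..T}. 0 \<le> c \<epsilon> s) \<and>
     integral {0..T} (c \<epsilon>) \<le> Q * (1 + ln (1 / \<epsilon>)) \<and>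
     (\<forall>s\<in>{0<..<T}. \<forall>x j k l. A' j \<epsilon> k l (s, x) = cnj (A' j \<epsilon> l k (s, x))) \<and>
     (\<forall>s\<in>{0<..<T}. \<forall>x i j k l. cmod (pd Z (dx i) (A' j \<epsilon> k l) (s, x)) \<le> c \<epsilon> s) \<and>
     (\<forall>s\<in>{0<..<T}. \<forall>x k l. cmod (B \<epsilon> k l (s, x) + cnj (B \<epsilon> l k (s, x))) \<le> c \<epsilon> s)"
    using cA' cB small' herm' eventually_small[of 1, simplified]
  proof eventually_elim
    case (elim \<epsilon>)
    have ln0: "0 \<le> ln (1 / \<epsilon>)" using elim by (intro ln_ge_zero) (auto simp: field_simps)
    have cc: "continuous_on {0..T} (cA i j \<epsilon>)" "continuous_on {0..T} (cB \<epsilon>)" for i j using elim by auto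
    have nn: "0 \<le> cA i j \<epsilon> s" "0 \<le> cB \<epsilon> s" if "s \<in> {0..T}" for i j s using elim that by auto
    have 1: "continuous_on {0..T} (c \<epsilon>)" unfolding c_def by (intro continuous_intros cc)
    have 2: "0 \<le> c \<epsilon> s" if "s \<in> {0..T}" for s unfolding c_def using nn[OF that] by (intro add_nonneg_nonneg sum_nonneg mult_nonneg_nonneg) auto
    have "(c \<epsilon> has_integral T + (\<Sum>i\<in>UNIV. \<Sum>j\<in>UNIV. integral {0..T} (cA i j \<epsilon>)) + 2 * integral {0..T} (cB \<epsilon>)) {0..T}"
      unfolding c_def using T_pos has_integral_const_real[of "1::real" 0 T]
      by (intro has_integral_add has_integral_sum has_integral_mult_right integrable_integral integrable_continuous_interval cc) auto
    then have "integral {0..T} (c \<epsilon>) = T + (\<Sum>i\<in>UNIV. \<Sum>j\<in>UNIV. integral {0..T} (cA i j \<epsilon>)) + 2 * integral {0..T} (cB \<epsilon>)" by (rule integral_unique)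
    also have "\<dots> \<le> T * (1 + ln (1 / \<epsilon>)) + (\<Sum>i\<in>UNIV. \<Sum>j\<in>UNIV. QA i j * (1 + ln (1 / \<epsilon>))) + 2 * (QB * (1 + ln (1 / \<epsilon>)))"
      using elim ln0 T_pos by (intro add_mono sum_mono mult_left_mono) auto
    also have "\<dots> = Q * (1 + ln (1 / \<epsilon>))" by (simp add: Q_def sum_distrib_right distrib_right)
    finally have 3: "integral {0..T} (c \<epsilon>) \<le> Q * (1 + ln (1 / \<epsilon>))" .
    have 4: "A' j \<epsilon> k l (s, x) = cnj (A' j \<epsilon> l k (s, x))" if "s \<in> {0<..<T}" for s x j k l
    proof -
      have "(s, x) \<in> Omega T" using that by (simp add: Omega_def)
      then show ?thesis by (rule elim(4)[rule_format])
    qed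
    have 5: "cmod (pd Z (dx i) (A' j \<epsilon> k l) (s, x)) \<le> c \<epsilon> s" if "s \<in> {0<..<T}" for s x i j k l
    proof -
      have s: "s \<in> {0..T}" "(s, x) \<in> Z" using that by (auto simp: Z_eq)
      have "cmod (pd Z (dx i) (A' j \<epsilon> k l) (s, x)) \<le> cmod (pd Z (dx i) (A j \<epsilon> k l) (s, x)) + cmod (pd Z (dx i) (A' j \<epsilon> k l) (s, x) - pd Z (dx i) (A j \<epsilon> k l) (s, x))"
        by (rule norm_triangle_sub)
      also have "\<dots> \<le> cA i j \<epsilon> s + 1" using elim s by (intro add_mono) blast+
      also have "cA i j \<epsilon> s \<le> (\<Sum>j\<in>UNIV. cA i j \<epsilon> s)" using nn[OF s(1)] by (intro member_le_sum) auto
      also have "(\<Sum>j\<in>UNIV. cA i j \<epsilon> s) \<le> (\<Sum>i\<in>UNIV. \<Sum>j\<in>UNIV. cA i j \<epsilon> s)"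
        using nn[OF s(1)] by (intro member_le_sum[of i UNIV "\<lambda>i. \<Sum>j\<in>UNIV. cA i j \<epsilon> s"] sum_nonneg) auto
      finally show ?thesis unfolding c_def using nn(2)[OF s(1)] by linarith
    qed
    have 6: "cmod (B \<epsilon> k l (s, x) + cnj (B \<epsilon> l k (s, x))) \<le> c \<epsilon> s" if "s \<in> {0<..<T}" for s x k l
    proof -
      have s: "s \<in> {0..T}" using that by auto
      have "cmod ((B \<epsilon> k l (s, x) + cnj (B \<epsilon> l k (s, x))) / 2) \<le> cB \<epsilon> s" using elim s by blast
      then have "cmod (B \<epsilon> k l (s, x) + cnj (B \<epsilon> l k (s, x))) \<le> 2 * cB \<epsilon> s" by (simp add: norm_divide)
      moreover have "0 \<le> (\<Sum>i\<in>UNIV. \<Sum>j\<in>UNIV. cA i j \<epsilon> s)" using nn[OF s] by (intro sum_nonneg) auto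
      ultimately show ?thesis unfolding c_def by linarith
    qed
    from 1 2 3 4 5 6 show ?case by blast
  qed
  then show ?thesis unfolding log_coeffs_def by blast
qed


section \<open>Reduction to Hermitian coefficients and zero initial data\<close>

definition pde_op :: "('n::finite \<Rightarrow> real \<Rightarrow> 'm::finite \<Rightarrow> 'm \<Rightarrow> real \<times> (real^'n) \<Rightarrow> complex) \<Rightarrow>
    (real \<Rightarrow> 'm \<Rightarrow> 'm \<Rightarrow> real \<times> (real^'n) \<Rightarrow> complex) \<Rightarrow> (real \<Rightarrow> 'm \<Rightarrow> real \<times> (real^'n) \<Rightarrow> complex) \<Rightarrow>
    'm \<Rightarrow> real \<Rightarrow> real \<times> (real^'n) \<Rightarrow> complex" where
  "pde_op A B U k = (\<lambda>\<epsilon> p. pd Z dt (U \<epsilon> k) p + (\<Sum>j\<in>UNIV. \<Sum>l\<in>UNIV. A j \<epsilon> k l p * pd Z (dx j) (U \<epsilon> l) p)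
       + (\<Sum>l\<in>UNIV. B \<epsilon> k l p * U \<epsilon> l p))"

lemma pde_op_add:
  assumes "\<And>l. sm (U \<epsilon> l)" "\<And>l. sm (V \<epsilon> l)" "p \<in> Z"
  shows "pde_op A B (\<lambda>\<epsilon> l p. U \<epsilon> l p + V \<epsilon> l p) k \<epsilon> p = pde_op A B U k \<epsilon> p + pde_op A B V k \<epsilon> p"
  using assms by (simp add: pde_op_def pd_add sm_differentiable distrib_left sum.distrib)

lemma L2_smooth_pde_op:
  assumes "\<And>j k l. sup_smooth moderate (\<lambda>\<epsilon>. A j \<epsilon> k l)" "\<And>k l. sup_smooth moderate (\<lambda>\<epsilon>. B \<epsilon> k l)" "\<And>m l. L2_smooth moderate m (\<lambda>\<epsilon>. U \<epsilon> l)"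
  shows "L2_smooth moderate m (pde_op A B U k)"
  unfolding pde_op_def by (intro L2_smooth_add L2_smooth_sum L2_smooth_mult L2_smooth_pd_all assms bound_class_moderate dt_Basis dx_Basis)

text \<open>Negligible coefficients times moderate derivatives are negligible, so being a solution
  does not depend on the representative of \<open>A\<close>. This allows the energy estimate to work
  with the Hermitian one.\<close>

lemma pde_op_change:
  fixes A :: "'n::finite \<Rightarrow> real \<Rightarrow> 'm::finite \<Rightarrow> 'm \<Rightarrow> real \<times> (real^'n) \<Rightarrow> complex"
  assumes A: "\<And>j k l. sup_bdd negligible (\<lambda>\<epsilon> p. A' j \<epsilon> k l p - A j \<epsilon> k l p)" and U: "\<And>m l. L2_smooth moderate m (\<lambda>\<epsilon>. U \<epsilon> l)"
  shows "L2_bdd negligible (\<lambda>\<epsilon> p. pde_op A' B U k \<epsilon> p - pde_op A B U k \<epsilon> p)"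
proof (rule L2_bdd_cong)
  show "L2_bdd negligible (\<lambda>\<epsilon> p. \<Sum>j\<in>UNIV. \<Sum>l\<in>UNIV. (A' j \<epsilon> k l p - A j \<epsilon> k l p) * pd Z (dx j) (U \<epsilon> l) p)"
  proof (intro L2_bdd_negligible_sum L2_bdd_negligible_mult' A)
    fix j :: 'n and l :: 'm
    have "[dx j] \<in> lists Basis" by simp
    from L2_smooth_L2_bdd[OF U this order_refl] show "L2_bdd moderate (\<lambda>\<epsilon>. pd Z (dx j) (U \<epsilon> l))" by simp
  qed
qed (simp add: pde_op_def left_diff_distrib sum_subtractf)

lemma Hinf_UNIV_measurable:
  fixes g :: "'a::euclidean_space \<Rightarrow> complex"
  assumes "Hinf UNIV g"
  shows "g \<in> borel_measurable borel" "nsq g = ennreal ((L2norm UNIV g)\<^sup>2)"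
proof -
  have nil: "[] \<in> lists (Basis :: 'a set)" by simp
  have s: "smooth_upto UNIV g" and i: "integrable (lebesgue_on UNIV) (\<lambda>x. (cmod (ipd (closure UNIV) [] g x))\<^sup>2)"
    using assms nil unfolding Hinf_def by blast+
  have "isCont g x" for x
    using has_derivative_continuous[OF smooth_UNIV_differentiable[OF s nil]] by simp
  then have "continuous_on UNIV g" by (simp add: continuous_at_imp_continuous_on)
  then show "g \<in> borel_measurable borel" by (rule borel_measurable_continuous_onI)
  show "nsq g = ennreal ((L2norm UNIV g)\<^sup>2)" using nsq_UNIV[of g] i by simp
qed

text \<open>Every slice of a space derivative of the extension is the corresponding derivative of
  \<open>G\<close>, and derivatives involving time vanish; so the bounds for \<open>G\<close> carry
  over without any trace inequality.\<close>

lemma L2_smooth_ext: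
  assumes G: "mod_L2 (UNIV :: (real^'n::finite) set) G"
  shows "L2_smooth moderate m (\<lambda>\<epsilon>. ext (G \<epsilon>))"
proof (rule L2_smoothI)
  have sG: "smooth_upto UNIV (G \<epsilon>)" if "\<epsilon> \<in> {0<..1}" for \<epsilon>
    using G that unfolding mod_L2_def Hinf_def by blast
  show "sm (ext (G \<epsilon>))" if "\<epsilon> \<in> {0<..1}" for \<epsilon> by (rule sm_ext[OF sG[OF that]])
  fix vs :: "(real \<times> (real^'n)) list" assume vs: "vs \<in> lists Basis"
  show "L2_bdd moderate (\<lambda>\<epsilon>. ipd Z vs (ext (G \<epsilon>)))"
  proof (cases "vs \<in> lists (range dx)")
    case False
    show ?thesis by (rule L2_bdd_cong[OF L2_bdd_zero[OF bound_class_moderate]]) (use False ipd_ext[OF sG vs] in simp)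
  next
    case True
    let ?ws = "map snd vs"
    have ws: "?ws \<in> lists Basis"
    proof -
      have "snd u \<in> Basis" if "u \<in> range dx" for u :: "real \<times> (real^'n)"
        using that by (auto simp: dx_def axis_in_Basis_iff)
      then show ?thesis using True unfolding in_lists_conv_set by simp
    qed
    have "moderate (\<lambda>\<epsilon>. L2norm UNIV (ipd (closure UNIV) ?ws (G \<epsilon>)))"
      using G ws bigo_moderate unfolding mod_L2_def by blast
    then have "moderate (\<lambda>\<epsilon>. (L2norm UNIV (ipd UNIV ?ws (G \<epsilon>)))\<^sup>2)"
      unfolding power2_eq_square closure_UNIV by (intro moderate_mult)
    moreover have "slice_le t (ipd Z vs (ext (G \<epsilon>))) ((L2norm UNIV (ipd UNIV ?ws (G \<epsilon>)))\<^sup>2)" if "\<epsilon> \<in> {0<..1}" "t \<in> {0..T}" for \<epsilon> t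
    proof -
      have "integrable (lebesgue_on UNIV) (\<lambda>x. (cmod (ipd (closure UNIV) ?ws (G \<epsilon>) x))\<^sup>2)"
        using G that(1) ws unfolding mod_L2_def Hinf_def by blast
      then have n: "nsq (ipd UNIV ?ws (G \<epsilon>)) = ennreal ((L2norm UNIV (ipd UNIV ?ws (G \<epsilon>)))\<^sup>2)"
        by (intro nsq_UNIV) simp
      have "ipd Z vs (ext (G \<epsilon>)) (t, x) = ipd UNIV ?ws (G \<epsilon>) x" for x
        using ipd_ext[OF sG[OF that(1)] vs, of "(t, x)"] True that(2) by (simp add: Z_eq ext_def del: in_lists_conv_set)
      moreover have "continuous_on Z (ipd Z vs (ext (G \<epsilon>)))"
        by (rule sm_continuous[OF sm_ipd[OF sm_ext[OF sG[OF that(1)]] vs]])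
      ultimately show ?thesis using that n by (simp add: slice_le_def)
    qed
    ultimately show ?thesis unfolding L2_bdd_def by blast
  qed
qed

lemma neg_L2_zero: "neg_L2 (UNIV :: 'a::euclidean_space set) (\<lambda>_ _. 0)"
proof -
  have "ipd UNIV vs (\<lambda>_. 0) = (\<lambda>_::'a. 0 :: complex)" for vs
    by (induction vs) (auto simp: pd_def frechet_derivative_const)
  then show ?thesis
    by (auto simp: neg_L2_def Hinf_def smooth_upto_def L2norm_def)
qed

lemma slice_le_initial:
  assumes U: "neg_L2 (UNIV :: (real^'n::finite) set) (\<lambda>\<epsilon> y. U \<epsilon> (0, y) - G \<epsilon> y)"
    and V: "neg_L2 (UNIV :: (real^'n) set) (\<lambda>\<epsilon> y. V \<epsilon> (0, y) - G \<epsilon> y)"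
    and sm: "\<And>\<epsilon>. \<epsilon> \<in> {0<..1} \<Longrightarrow> sm (U \<epsilon>)" "\<And>\<epsilon>. \<epsilon> \<in> {0<..1} \<Longrightarrow> sm (V \<epsilon>)"
  shows "\<exists>I0. negligible I0 \<and> (\<forall>\<epsilon>. 0 \<le> I0 \<epsilon>) \<and> (\<forall>\<epsilon>\<in>{0<..1}. slice_le 0 (\<lambda>p. U \<epsilon> p - V \<epsilon> p) (I0 \<epsilon>))"
proof -
  let ?N = "\<lambda>W \<epsilon>. L2norm UNIV (\<lambda>y. W \<epsilon> (0, y) - G \<epsilon> y)"
  have n: "negligible (?N U)" "negligible (?N V)" using neg_L2_negligible[OF U, of "[]"] neg_L2_negligible[OF V, of "[]"] by simp_all
  have "negligible (\<lambda>\<epsilon>. 2 * (?N U \<epsilon> * ?N U \<epsilon>) + 2 * (?N V \<epsilon> * ?N V \<epsilon>))"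
    by (intro negligible_add negligible_mult moderate_const n negligible_moderate[OF n(1)] negligible_moderate[OF n(2)])
  moreover have "slice_le 0 (\<lambda>p. U \<epsilon> p - V \<epsilon> p) (2 * (?N U \<epsilon> * ?N U \<epsilon>) + 2 * (?N V \<epsilon> * ?N V \<epsilon>))" if e: "\<epsilon> \<in> {0<..1}" for \<epsilon>
  proof -
    have HU: "Hinf UNIV (\<lambda>y. U \<epsilon> (0, y) - G \<epsilon> y)" and HV: "Hinf UNIV (\<lambda>y. V \<epsilon> (0, y) - G \<epsilon> y)"
      using U V e unfolding neg_L2_def by blast+
    note mU = Hinf_UNIV_measurable[OF HU] and mV = Hinf_UNIV_measurable[OF HV]
    have mm: "(\<lambda>y. (- 1) * (V \<epsilon> (0, y) - G \<epsilon> y)) \<in> borel_measurable borel" using mV(1) by measurable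
    have "nsq (\<lambda>y. U \<epsilon> (0, y) - V \<epsilon> (0, y)) = nsq (\<lambda>y. (U \<epsilon> (0, y) - G \<epsilon> y) + (- 1) * (V \<epsilon> (0, y) - G \<epsilon> y))"
      by (simp add: algebra_simps)
    also have "\<dots> \<le> 2 * nsq (\<lambda>y. U \<epsilon> (0, y) - G \<epsilon> y) + 2 * nsq (\<lambda>y. (- 1) * (V \<epsilon> (0, y) - G \<epsilon> y))"
      by (rule nsq_add[OF mU(1) mm])
    also have "nsq (\<lambda>y. (- 1) * (V \<epsilon> (0, y) - G \<epsilon> y)) = nsq (\<lambda>y. V \<epsilon> (0, y) - G \<epsilon> y)"
      by (simp add: nsq_def norm_minus_commute)
    also have "2 * nsq (\<lambda>y. U \<epsilon> (0, y) - G \<epsilon> y) + 2 * nsq (\<lambda>y. V \<epsilon> (0, y) - G \<epsilon> y) = ennreal (2 * (?N U \<epsilon> * ?N U \<epsilon>) + 2 * (?N V \<epsilon> * ?N V \<epsilon>))"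
      unfolding mU(2) mV(2) power2_eq_square by (subst ennreal_plus) (auto simp: ennreal_mult L2norm_nonneg)
    finally show ?thesis
      using T_pos e by (auto simp: slice_le_def L2norm_nonneg intro!: sm_continuous sm_diff sm)
  qed
  moreover have "0 \<le> 2 * (?N U \<epsilon> * ?N U \<epsilon>) + 2 * (?N V \<epsilon> * ?N V \<epsilon>)" for \<epsilon> by simp
  ultimately show ?thesis by blast
qed

end

theorem theorem3p4:
  fixes T :: real
    and A :: "'n::finite \<Rightarrow> real \<Rightarrow> 'm::finite \<Rightarrow> 'm \<Rightarrow> real \<times> (real^'n) \<Rightarrow> complex"
    and B :: "real \<Rightarrow> 'm \<Rightarrow> 'm \<Rightarrow> real \<times> (real^'n) \<Rightarrow> complex"
    and F :: "real \<Rightarrow> 'm \<Rightarrow> real \<times> (real^'n) \<Rightarrow> complex"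
    and G :: "real \<Rightarrow> 'm \<Rightarrow> real^'n \<Rightarrow> complex"
  assumes "T > 0"
    and "\<And>j. mat_mod_Linf (Omega T) (A j)"
    and "mat_mod_Linf (Omega T) B"
    and "\<And>j. gen_hermitian (Omega T) (A j)"
    and "\<And>k. mod_L2 (UNIV :: (real^'n) set) (\<lambda>\<epsilon>. G \<epsilon> k)"
    and "\<And>k. mod_L2 (Omega T) (\<lambda>\<epsilon>. F \<epsilon> k)"
    and "\<And>i j. log_type T (\<lambda>\<epsilon> k l. pd (closure (Omega T)) (dx i) (A j \<epsilon> k l))"
    and "log_type T (\<lambda>\<epsilon> k l x. (B \<epsilon> k l x + cnj (B \<epsilon> l k x)) / 2)"
  shows "(\<exists>U. (\<forall>k. mod_L2 (Omega T) (\<lambda>\<epsilon>. U \<epsilon> k)) \<and> solves_ivp T A B F G U) \<and>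
         (\<forall>U V. (\<forall>k. mod_L2 (Omega T) (\<lambda>\<epsilon>. U \<epsilon> k)) \<and> solves_ivp T A B F G U \<and>
                (\<forall>k. mod_L2 (Omega T) (\<lambda>\<epsilon>. V \<epsilon> k)) \<and> solves_ivp T A B F G V
                \<longrightarrow> (\<forall>k. neg_L2 (Omega T) (\<lambda>\<epsilon> x. U \<epsilon> k x - V \<epsilon> k x)))"
proof -
  interpret slab T by unfold_locales (rule assms(1))
  have "\<forall>j. \<exists>A'. mat_same_class (Omega T) (A j) A' \<and>
     (\<forall>\<^sub>F \<epsilon> in at_right 0. \<forall>x\<in>Omega T. \<forall>k l. A' \<epsilon> k l x = cnj (A' \<epsilon> l k x))"
    using assms(4) unfolding gen_hermitian_def by blast
  from choice[OF this] obtain A' where A'0: "\<forall>j. mat_same_class (Omega T) (A j) (A' j) \<and>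
     (\<forall>\<^sub>F \<epsilon> in at_right 0. \<forall>x\<in>Omega T. \<forall>k l. A' j \<epsilon> k l x = cnj (A' j \<epsilon> l k x))"
    by (elim exE)
  have A': "mat_same_class (Omega T) (A j) (A' j)"
     "\<forall>\<^sub>F \<epsilon> in at_right 0. \<forall>x\<in>Omega T. \<forall>k l. A' j \<epsilon> k l x = cnj (A' j \<epsilon> l k x)" for j
    using spec[OF A'0, of j] by simp_all
  have log_coeffs: "log_coeffs A' B" by (rule log_coeffs_I[OF A' assms(7,8)])
  have WA: "sup_smooth moderate (\<lambda>\<epsilon>. A j \<epsilon> k l)" for j k l
    by (rule mod_Linf_sup_smooth) (use assms(2)[of j] in \<open>simp add: mat_mod_Linf_def\<close>)
  have WA': "sup_smooth moderate (\<lambda>\<epsilon>. A' j \<epsilon> k l)" for j k l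
    by (rule mod_Linf_sup_smooth) (use A'(1)[of j] in \<open>simp add: mat_same_class_def mat_mod_Linf_def\<close>)
  have WB: "sup_smooth moderate (\<lambda>\<epsilon>. B \<epsilon> k l)" for k l
    by (rule mod_Linf_sup_smooth) (use assms(3) in \<open>simp add: mat_mod_Linf_def\<close>)
  have d: "sup_bdd negligible (\<lambda>\<epsilon> p. A' j \<epsilon> k l p - A j \<epsilon> k l p)" for j k l
    using neg_Linf_sup_bdd[of "\<lambda>\<epsilon> p. A' j \<epsilon> k l p - A j \<epsilon> k l p" "[]"] A'(1)[of j] by (simp add: mat_same_class_def)
  have d': "sup_bdd negligible (\<lambda>\<epsilon> p. A j \<epsilon> k l p - A' j \<epsilon> k l p)" for j k l
    using d[of j k l] unfolding sup_bdd_def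
    by (metis (no_types, lifting) continuous_on_cong continuous_on_minus minus_diff_eq norm_minus_commute)
  note XF = mod_L2_L2_smooth[OF assms(6)]
  have XG: "L2_smooth moderate m (\<lambda>\<epsilon>. ext (G \<epsilon> l))" for m l by (rule L2_smooth_ext[OF assms(5)])
  show ?thesis
  proof (intro conjI allI impI)
    let ?G = "\<lambda>\<epsilon> l. ext (G \<epsilon> l)"
    \<comment> \<open>The modified source compensates the action of the operator on the extended
      initial data, so that a solution with zero initial data plus the extension solves the original
      problem.\<close>
    let ?F = "\<lambda>\<epsilon> k p. F \<epsilon> k p - pde_op A' B ?G k \<epsilon> p"
    have "L2_smooth moderate m (\<lambda>\<epsilon>. ?F \<epsilon> k)" for m k
      using L2_smooth_diff[OF bound_class_moderate XF L2_smooth_pde_op[OF WA' WB XG]] .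
    from existence_zero[where F="?F", OF log_coeffs WA' WB this]
    obtain U0 where U0: "\<And>m l. L2_smooth moderate m (\<lambda>\<epsilon>. U0 \<epsilon> l)" "\<And>\<epsilon> l y. U0 \<epsilon> l (0, y) = 0"
      "\<And>k. L2_bdd negligible (\<lambda>\<epsilon> p. pde_op A' B U0 k \<epsilon> p - ?F \<epsilon> k p)" unfolding pde_op_def by blast
    define U where "U = (\<lambda>\<epsilon> l p. U0 \<epsilon> l p + ext (G \<epsilon> l) p)"
    have XU: "L2_smooth moderate m (\<lambda>\<epsilon>. U \<epsilon> l)" for m l unfolding U_def by (intro L2_smooth_add bound_class_moderate U0 XG)
    have "neg_L2 (Omega T) (\<lambda>\<epsilon> p. pde_op A B U k \<epsilon> p - F \<epsilon> k p)" for k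
    proof (rule neg_L2_I)
      show "L2_smooth moderate m (\<lambda>\<epsilon> p. pde_op A B U k \<epsilon> p - F \<epsilon> k p)" for m
        by (rule L2_smooth_diff[OF bound_class_moderate L2_smooth_pde_op[OF WA WB XU] XF])
      \<comment> \<open>The residual for the given \<open>A\<close> splits into the error of
        exchanging representatives and the residual of the reduced problem.\<close>
      have "L2_bdd negligible (\<lambda>\<epsilon> p. (pde_op A B U k \<epsilon> p - pde_op A' B U k \<epsilon> p) + (pde_op A' B U0 k \<epsilon> p - ?F \<epsilon> k p))"
        by (rule L2_bdd_negligible_add[OF pde_op_change[OF d' XU] U0(3)])
      then show "L2_bdd negligible (\<lambda>\<epsilon> p. pde_op A B U k \<epsilon> p - F \<epsilon> k p)"
      proof (rule L2_bdd_cong)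
        fix \<epsilon> :: real and p :: "real \<times> (real^'n)" assume *: "\<epsilon> \<in> {0<..1}" "p \<in> Z"
        have "pde_op A' B U k \<epsilon> p = pde_op A' B U0 k \<epsilon> p + pde_op A' B ?G k \<epsilon> p"
          unfolding U_def by (rule pde_op_add) (rule L2_smooth_sm[OF U0(1) *(1)] L2_smooth_sm[OF XG *(1)] *(2))+
        then show "(pde_op A B U k \<epsilon> p - pde_op A' B U k \<epsilon> p) + (pde_op A' B U0 k \<epsilon> p - ?F \<epsilon> k p) = pde_op A B U k \<epsilon> p - F \<epsilon> k p"
          by simp
      qed
    qed
    moreover have "neg_L2 (UNIV :: (real^'n) set) (\<lambda>\<epsilon> y. U \<epsilon> k (0, y) - G \<epsilon> k y)" for k
      using neg_L2_zero by (simp add: U_def U0(2) ext_def)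
    ultimately have "solves_ivp T A B F G U" by (simp add: solves_ivp_def pde_op_def)
    moreover have "mod_L2 (Omega T) (\<lambda>\<epsilon>. U \<epsilon> k)" for k by (rule L2_smooth_mod_L2[OF XU])
    ultimately show "\<exists>U. (\<forall>k. mod_L2 (Omega T) (\<lambda>\<epsilon>. U \<epsilon> k)) \<and> solves_ivp T A B F G U" by blast
  next
    fix U V k
    assume *: "(\<forall>k. mod_L2 (Omega T) (\<lambda>\<epsilon>. U \<epsilon> k)) \<and> solves_ivp T A B F G U \<and>
                (\<forall>k. mod_L2 (Omega T) (\<lambda>\<epsilon>. V \<epsilon> k)) \<and> solves_ivp T A B F G V"
    have XU: "L2_smooth moderate m (\<lambda>\<epsilon>. U \<epsilon> l)" and XV: "L2_smooth moderate m (\<lambda>\<epsilon>. V \<epsilon> l)" for m l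
      using * mod_L2_L2_smooth by blast+
    define W where "W = (\<lambda>\<epsilon> l p. U \<epsilon> l p - V \<epsilon> l p)"
    have XW: "L2_smooth moderate m (\<lambda>\<epsilon>. W \<epsilon> l)" for m l unfolding W_def by (intro L2_smooth_diff bound_class_moderate XU XV)
    have sol: "L2_bdd negligible (\<lambda>\<epsilon> p. pde_op A B U k \<epsilon> p - F \<epsilon> k p)" "L2_bdd negligible (\<lambda>\<epsilon> p. pde_op A B V k \<epsilon> p - F \<epsilon> k p)" for k
      using * unfolding solves_ivp_def pde_op_def by (blast intro: neg_L2_L2_bdd)+
    \<comment> \<open>By linearity with \<open>U = W + V\<close> the source \<open>F\<close> cancels
      between the two residuals; the first summand then exchanges \<open>A\<close> for
      \<open>A'\<close>.\<close>
    have eq: "L2_bdd negligible (pde_op A' B W k)" for k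
    proof -
      have "L2_bdd negligible (\<lambda>\<epsilon> p. (pde_op A' B W k \<epsilon> p - pde_op A B W k \<epsilon> p) + ((pde_op A B U k \<epsilon> p - F \<epsilon> k p) - (pde_op A B V k \<epsilon> p - F \<epsilon> k p)))"
        by (rule L2_bdd_negligible_add[OF pde_op_change[OF d XW] L2_bdd_negligible_diff[OF sol]])
      then show ?thesis
      proof (rule L2_bdd_cong)
        fix \<epsilon> :: real and p :: "real \<times> (real^'n)" assume **: "\<epsilon> \<in> {0<..1}" "p \<in> Z"
        have "pde_op A B (\<lambda>\<epsilon> l p. W \<epsilon> l p + V \<epsilon> l p) k \<epsilon> p = pde_op A B W k \<epsilon> p + pde_op A B V k \<epsilon> p"
          by (rule pde_op_add) (rule L2_smooth_sm[OF XW **(1)] L2_smooth_sm[OF XV **(1)] **(2))+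
        then have "pde_op A B U k \<epsilon> p = pde_op A B W k \<epsilon> p + pde_op A B V k \<epsilon> p" by (simp add: W_def)
        then show "(pde_op A' B W k \<epsilon> p - pde_op A B W k \<epsilon> p) + ((pde_op A B U k \<epsilon> p - F \<epsilon> k p) - (pde_op A B V k \<epsilon> p - F \<epsilon> k p)) = pde_op A' B W k \<epsilon> p"
          by simp
      qed
    qed
    have "\<forall>l. \<exists>I0. negligible I0 \<and> (\<forall>\<epsilon>. 0 \<le> I0 \<epsilon>) \<and> (\<forall>\<epsilon>\<in>{0<..1}. slice_le 0 (W \<epsilon> l) (I0 \<epsilon>))"
    proof
      fix l
      show "\<exists>I0. negligible I0 \<and> (\<forall>\<epsilon>. 0 \<le> I0 \<epsilon>) \<and> (\<forall>\<epsilon>\<in>{0<..1}. slice_le 0 (W \<epsilon> l) (I0 \<epsilon>))"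
        unfolding W_def
        by (rule slice_le_initial[where G="\<lambda>\<epsilon>. G \<epsilon> l"]) (use * L2_smooth_sm[OF XU] L2_smooth_sm[OF XV] in \<open>auto simp: solves_ivp_def\<close>)
    qed
    then obtain J0 where J0: "\<And>l. negligible (J0 l)" "\<And>l \<epsilon>. 0 \<le> J0 l \<epsilon>" "\<And>l \<epsilon>. \<epsilon> \<in> {0<..1} \<Longrightarrow> slice_le 0 (W \<epsilon> l) (J0 l \<epsilon>)"
      by metis
    define I0 where "I0 = (\<lambda>\<epsilon>. \<Sum>l\<in>UNIV. J0 l \<epsilon>)"
    have nI: "negligible (\<lambda>\<epsilon>. \<Sum>l\<in>S. J0 l \<epsilon>)" if "finite S" for S
      using that by (induction S rule: finite_induct) (simp_all add: negligible_const_0 negligible_add J0(1))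
    have "L2_bdd negligible (\<lambda>\<epsilon>. W \<epsilon> l)" for l
    proof (rule uniqueness_zero[OF log_coeffs WA' WB XW])
      show "negligible I0" "0 \<le> I0 \<epsilon>" for \<epsilon> unfolding I0_def by (auto intro!: nI sum_nonneg J0(2))
      show "slice_le 0 (W \<epsilon> l) (I0 \<epsilon>)" if "\<epsilon> \<in> {0<..1}" for \<epsilon> l
        unfolding I0_def by (rule slice_le_mono[OF J0(3)[OF that, of l]], rule member_le_sum) (auto simp: J0(2))
    qed (use eq in \<open>simp add: pde_op_def\<close>)
    from neg_L2_I[OF XW this] show "neg_L2 (Omega T) (\<lambda>\<epsilon> x. U \<epsilon> k x - V \<epsilon> k x)" by (simp add: W_def)
  qed
qed

end
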